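(* Let $n\in\mathbb{N}$, $0<r<\infty$, $0<B<\infty$, $2<p<n$, $C\in\mathbb{R}$, and $\Omega=B(0,r)\subseteq\mathbb{R}^n$ (the open ball with center $0$ and radius $r$). Let $h:(0,B)\to(0,\infty)$ be continuous and integrable on $(0,\lambda)$ for every $\lambda<B$, and let $H_C$ and $\mathcal{T}_{h,C}$ be the functions associated with $h$ and $C$ (defined in the context). Assume that: (a) $H_C(0)\ge 0$; (b) the function $G_{h,C,p}(\lambda):=\mathcal{T}_{h,C}(\lambda)\,h^{\frac1p}(\lambda)$, $G_{h,C,p}:(0,B)\to(0,\infty)$, extends to a locally absolutely continuous function on $[0,B)$ with $G_{h,C,p}(0)=0$, and $$C_{h,C,p}:=\sup\left\{\frac{|G_{h,C,p}'(\lambda)|}{h^{\frac1p}(\lambda)}:\ \lambda\in(0,B)\right\}<\infty,\qquad D:=(p-2)\,\frac{(n-1)p}{n-p}\,C_{h,C,p}<1$$ (the supremum being taken over those $\lambda$ at which the derivative exists). Let $u\in W^{2,p/2}(\Omega)\cap C(\bar\Omega)$ be a radially symmetric function such that $0<u<B$ in $\Omega$, $u\equiv 0$ on $\partial\Omega$, and $$\int_{\Omega}\frac{(\mathcal{T}_{h,C}(u(x)))^p(h(u(x)))^2}{|x|^p}\,dx<\infty .$$ Then $$\int_{\Omega}|\nabla u(x)|^p h(u(x))\,dx\le A\int_{\Omega}\left(\sqrt{|\Delta u(x)\,\mathcal{T}_{h,C}(u(x))|}\right)^{p}h(u(x))\,dx,\qquad\text{where } A=\left(\frac{2(p-1)}{1-D^2}\right)^{\frac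 p2}.$$
   Context: For a continuous function $h:(0,B)\to(0,\infty)$ integrable on $(0,\lambda)$ for every $\lambda<B$, and $C\in\mathbb{R}$, define $H_C:[0,B)\to\mathbb{R}$ by $H_C(\lambda):=\int_0^\lambda h(s)\,ds-C$, and $\mathcal{T}_{h,C}(\lambda):=\dfrac{H_C(\lambda)}{h(\lambda)}$ for $\lambda\in(0,B)$. $W^{2,q}(\Omega)$ is the usual Sobolev space, $\Delta$ is the Laplace operator. Radially symmetric means $u(x)=w(|x|)$ for some function $w$. Integrals of nonnegative functions may take the value $+\infty$. *)

theory Defs
  imports "HOL-Analysis.Analysis"
begin

text \<open>A multi-index is represented by the list of the coordinate directions, so that
  \<^term>\<open>length is\<close> is the order of the derivative.\<close>

definition partial :: "'n::finite \<Rightarrow> (real^'n \<Rightarrow> real) \<Rightarrow> real^'n \<Rightarrow> real" where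
  "partial i f x = deriv (\<lambda>t. f (x + t *\<^sub>R axis i 1)) 0"

definition partials :: "'n::finite list \<Rightarrow> (real^'n \<Rightarrow> real) \<Rightarrow> real^'n \<Rightarrow> real" where
  "partials is f = foldr partial is f"

definition smooth :: "(real^'n::finite \<Rightarrow> real) \<Rightarrow> bool" where
  "smooth f \<longleftrightarrow> (\<forall>is x. partials is f differentiable at x)"

definition test_function :: "(real^'n::finite) set \<Rightarrow> (real^'n \<Rightarrow> real) \<Rightarrow> bool" where
  "test_function \<Omega> \<phi> \<longleftrightarrow>
     smooth \<phi> \<and> compact (closure {x. \<phi> x \<noteq> 0}) \<and> closure {x. \<phi> x \<noteq> 0} \<subseteq> \<Omega>"

definition locally_integrable :: "(real^'n::finite) set \<Rightarrow> (real^'n \<Rightarrow> real) \<Rightarrow> bool" where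
  "locally_integrable \<Omega> f \<longleftrightarrow> (\<forall>K. compact K \<and> K \<subseteq> \<Omega> \<longrightarrow> set_integrable lebesgue K f)"

definition has_weak_deriv ::
  "(real^'n::finite) set \<Rightarrow> 'n list \<Rightarrow> (real^'n \<Rightarrow> real) \<Rightarrow> (real^'n \<Rightarrow> real) \<Rightarrow> bool" where
  "has_weak_deriv \<Omega> is u g \<longleftrightarrow>
     locally_integrable \<Omega> u \<and> locally_integrable \<Omega> g \<and>
     (\<forall>\<phi>. test_function \<Omega> \<phi> \<longrightarrow>
        (LINT x:\<Omega>|lebesgue. u x * partials is \<phi> x) =
        (-1) ^ length is * (LINT x:\<Omega>|lebesgue. g x * \<phi> x))"

definition Lq_space :: "real \<Rightarrow> (real^'n::finite) set \<Rightarrow> (real^'n \<Rightarrow> real) set" where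
  "Lq_space q \<Omega> = {f. f \<in> borel_measurable (lebesgue_on \<Omega>) \<and>
     integrable (lebesgue_on \<Omega>) (\<lambda>x. \<bar>f x\<bar> powr q)}"

text \<open>The empty list of directions forces \<^term>\<open>u\<close> itself to be in \<^term>\<open>Lq_space q \<Omega>\<close>.\<close>

definition sobolev_space :: "nat \<Rightarrow> real \<Rightarrow> (real^'n::finite) set \<Rightarrow> (real^'n \<Rightarrow> real) set" where
  "sobolev_space k q \<Omega> =
     {u. \<forall>is. length is \<le> k \<longrightarrow> (\<exists>g \<in> Lq_space q \<Omega>. has_weak_deriv \<Omega> is u g)}"

text \<open>Weak derivatives on an open set are unique up to null sets; the following picks a
  representative.  It is meaningful only if a weak derivative exists.\<close>

definition weak_deriv ::
  "(real^'n::finite) set \<Rightarrow> 'n list \<Rightarrow> (real^'n \<Rightarrow> real) \<Rightarrow> real^'n \<Rightarrow> real" where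
  "weak_deriv \<Omega> is u = (SOME g. has_weak_deriv \<Omega> is u g)"

definition weak_gradient ::
  "(real^'n::finite) set \<Rightarrow> (real^'n \<Rightarrow> real) \<Rightarrow> real^'n \<Rightarrow> real^'n" where
  "weak_gradient \<Omega> u x = (\<chi> i. weak_deriv \<Omega> [i] u x)"

definition weak_laplacian ::
  "(real^'n::finite) set \<Rightarrow> (real^'n \<Rightarrow> real) \<Rightarrow> real^'n \<Rightarrow> real" where
  "weak_laplacian \<Omega> u x = (\<Sum>i\<in>UNIV. weak_deriv \<Omega> [i, i] u x)"

definition radially_symmetric_on :: "(real^'n::finite) set \<Rightarrow> (real^'n \<Rightarrow> real) \<Rightarrow> bool" where
  "radially_symmetric_on \<Omega> u \<longleftrightarrow> (\<exists>w::real \<Rightarrow> real. \<forall>x\<in>\<Omega>. u x = w (norm x))"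

text \<open>A finite family of non-overlapping subintervals is a finite set of pairs of end points.\<close>

definition absolutely_continuous_on_interval :: "real \<Rightarrow> real \<Rightarrow> (real \<Rightarrow> real) \<Rightarrow> bool" where
  "absolutely_continuous_on_interval a b f \<longleftrightarrow>
     (\<forall>\<epsilon>>0. \<exists>\<delta>>0. \<forall>S::(real \<times> real) set.
        finite S \<and> (\<forall>(s, t)\<in>S. a \<le> s \<and> s \<le> t \<and> t \<le> b) \<and>
        pairwise (\<lambda>(s, t) (s', t'). disjnt {s<..<t} {s'<..<t'}) S \<and>
        (\<Sum>(s, t)\<in>S. t - s) < \<delta>
        \<longrightarrow> (\<Sum>(s, t)\<in>S. \<bar>f t - f s\<bar>) < \<epsilon>)"

definition locally_absolutely_continuous :: "real \<Rightarrow> (real \<Rightarrow> real) \<Rightarrow> bool" where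
  "locally_absolutely_continuous B f \<longleftrightarrow>
     (\<forall>a b. 0 \<le> a \<and> a \<le> b \<and> b < B \<longrightarrow> absolutely_continuous_on_interval a b f)"

definition H_fun :: "(real \<Rightarrow> real) \<Rightarrow> real \<Rightarrow> real \<Rightarrow> real" where
  "H_fun h C l = (LINT s:{0<..<l}|lborel. h s) - C"

definition T_fun :: "(real \<Rightarrow> real) \<Rightarrow> real \<Rightarrow> real \<Rightarrow> real" where
  "T_fun h C l = H_fun h C l / h l"

definition G_fun :: "(real \<Rightarrow> real) \<Rightarrow> real \<Rightarrow> real \<Rightarrow> real \<Rightarrow> real" where
  "G_fun h C p l = T_fun h C l * h l powr (1 / p)"

definition C_const :: "(real \<Rightarrow> real) \<Rightarrow> real \<Rightarrow> real \<Rightarrow> real \<Rightarrow> ennreal" where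
  "C_const h C p B =
     (SUP l \<in> {l \<in> {0<..<B}. G_fun h C p differentiable at l}.
        ennreal (\<bar>deriv (G_fun h C p) l\<bar> / h l powr (1 / p)))"

end

theory Submission
  imports Defs
begin

text \<open>Write \<open>u(x) = w(|x|)\<close>. Testing the weak Laplacian against radial functions of the
  fundamental solution shows that \<open>w\<close> is continuously differentiable on \<open>(0, r)\<close> and that the flux
  \<open>\<sigma> \<rho>\<^sup>n\<^sup>-\<^sup>1 w'(\<rho>)\<close> changes by the integral of the Laplacian over the shell between two radii.
  Integrating the flux by parts against \<open>|w'|\<^sup>p\<^sup>-\<^sup>2 H(w)\<close> on an annulus bounds the
  gradient term by the Laplacian term, boundary terms, and the cross term
  \<open>(n - 1)(p - 2) \<integral>|w'|\<^sup>p\<^sup>-\<^sup>1 H(w) / |x|\<close>. The cross term is controlled by a one-dimensional Hardy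
  inequality for \<open>G(w)\<close>, whose derivative is at most \<open>C_const h(w)\<^sup>1\<^sup>/\<^sup>p |w'|\<close>; it is absorbed because
  \<open>D < 1\<close>. On the outer sphere the flux is nonpositive along radii supplied by the mean value theorem
  and \<open>G(w)\<close> tends to 0; on the inner sphere the flux term cannot stay bounded away from 0, for
  otherwise \<open>w\<close> would be logarithmically unbounded at the centre.\<close>

section \<open>Absolutely continuous functions on an interval\<close>

text \<open>Two losses of regularity shape the argument. The flux of \<open>w\<close> is only known
  through integrals of an integrable Laplacian, so \<open>w'\<close> need have no derivative to put
  into a product rule; and \<open>G\<close> is differentiable only almost everywhere, with
  \<open>C_const\<close> a supremum over just those points. Hence the product rule and the Hardy
  inequality are obtained from increments over short intervals, added up by a gauge argument, and
  the bound on \<open>G'\<close> becomes a bound on increments only once absolutely continuous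
  functions are known to be differentiable almost everywhere. All absorptions take place on closed
  annuli away from the origin, where the gradient and Hardy terms are finite numbers that may be
  subtracted. The constant: integration by parts leaves \<open>(p - 1) |w'|^(p-2) H(w)\<close>
  against the Laplacian; once the cross term is absorbed, Young's inequality with exponents
  \<open>p / (p - 2)\<close> and \<open>p / 2\<close> gives, for positive \<open>C_const\<close>,
  the factor \<open>((p - 1) / (1 - D)) powr (p / 2)\<close>, which is at most \<open>A\<close>
  because \<open>1 + D\<close> is below 2.\<close>

lemma sum_increments_tagged_division:
  fixes f :: "real \<Rightarrow> real"
  assumes "p tagged_division_of {a..b}" "a \<le> b"
  shows "(\<Sum>(x,K)\<in>p. f (Sup K) - f (Inf K)) = f b - f a"
  using additive_tagged_division_1 assms by blast

lemma tagged_division_of_realE: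
  assumes "p tagged_division_of {a..b::real}" "(x, K) \<in> p"
  obtains s t where "K = {s..t}" "a \<le> s" "s \<le> x" "x \<le> t" "t \<le> b" "Inf K = s" "Sup K = t"
proof -
  obtain s t where st: "K = cbox s t" using tagged_division_ofD(4)[OF assms] by blast
  have x: "x \<in> K" and sub: "K \<subseteq> {a..b}" using tagged_division_ofD(2,3)[OF assms] by auto
  have "s \<le> t" using x st by auto
  then show ?thesis using that[of s t] x sub st by auto
qed

text \<open>Cousin's lemma: some tagged division is fine for the gauge, and the local inequalities
  telescope along it. It replaces a comparison of derivatives for functions that need not be
  differentiable; in the applications \<open>g\<close> is a small multiple of an increasing
  function.\<close>

lemma increment_le_of_local:
  fixes f g :: "real \<Rightarrow> real"
  assumes ab: "a \<le> b"
    and loc: "\<And>x. x \<in> {a..b} \<Longrightarrow> \<exists>d>0. \<forall>s t. a \<le> s \<longrightarrow> s \<le> x \<longrightarrow> x \<le> t \<longrightarrow> t \<le> b \<longrightarrow> s < t \<longrightarrow> t - s < d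
                 \<longrightarrow> f t - f s \<le> g t - g s"
  shows "f b - f a \<le> g b - g a"
proof -
  have "\<forall>x. \<exists>d>0. x \<in> {a..b} \<longrightarrow> (\<forall>s t. a \<le> s \<longrightarrow> s \<le> x \<longrightarrow> x \<le> t \<longrightarrow> t \<le> b \<longrightarrow> s < t \<longrightarrow> t - s < d
                 \<longrightarrow> f t - f s \<le> g t - g s)"
    using loc zero_less_one by blast
  then obtain d where d0: "\<And>x. d x > 0" and d: "\<And>x s t. x \<in> {a..b} \<Longrightarrow> a \<le> s \<Longrightarrow> s \<le> x \<Longrightarrow> x \<le> t \<Longrightarrow> t \<le> b
        \<Longrightarrow> s < t \<Longrightarrow> t - s < d x \<Longrightarrow> f t - f s \<le> g t - g s"
    by metis
  have "gauge (\<lambda>x. ball x (d x / 2))" using d0 by (intro gauge_ball_dependent) auto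
  then obtain p where p: "p tagged_division_of {a..b}" "(\<lambda>x. ball x (d x / 2)) fine p"
    using fine_division_exists_real by blast
  have "(\<Sum>(x,K)\<in>p. f (Sup K) - f (Inf K)) \<le> (\<Sum>(x,K)\<in>p. g (Sup K) - g (Inf K))"
  proof (rule sum_mono, clarify)
    fix x K assume xK: "(x, K) \<in> p"
    obtain s t where st: "K = {s..t}" "a \<le> s" "s \<le> x" "x \<le> t" "t \<le> b" "Inf K = s" "Sup K = t"
      using tagged_division_of_realE[OF p(1) xK] by blast
    have "K \<subseteq> ball x (d x / 2)" using p(2) xK by (auto simp: fine_def)
    moreover have "s \<in> K" "t \<in> K" using st by auto
    ultimately have "s \<in> ball x (d x / 2)" "t \<in> ball x (d x / 2)" by blast+
    then have "t - s < d x" by (auto simp: dist_real_def abs_if split: if_splits)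
    then show "f (Sup K) - f (Inf K) \<le> g (Sup K) - g (Inf K)"
      using d[of x s t] st by (cases "s = t") auto
  qed
  then show ?thesis using sum_increments_tagged_division[OF p(1) ab] by metis
qed

lemma sum_lengths_eq_measure:
  fixes S :: "(real \<times> real) set"
  assumes "finite S" "\<forall>(s, t)\<in>S. s \<le> t"
    "pairwise (\<lambda>(s, t) (s', t'). disjnt {s<..<t} {s'<..<t'}) S"
  shows "(\<Sum>(s, t)\<in>S. t - s) = measure lebesgue (\<Union>(s,t)\<in>S. {s<..<t})"
proof -
  have "measure lebesgue (\<Union>i\<in>S. (\<lambda>(s,t). {s<..<t}) i) = (\<Sum>i\<in>S. measure lebesgue ((\<lambda>(s,t). {s<..<t}) i))"
  proof (rule measure_finite_Union)
    show "disjoint_family_on (\<lambda>(s, t). {s<..<t}) S"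
      using assms(3) unfolding disjoint_family_on_def pairwise_def disjnt_def
      by (simp add: case_prod_beta)
    show "(\<lambda>(s, t). {s<..<t}) ` S \<subseteq> sets lebesgue" by auto
    show "emeasure lebesgue ((\<lambda>(s, t). {s<..<t}) i) \<noteq> \<infinity>" if "i \<in> S" for i
      using that assms(2) by (auto simp: split_beta)
  qed fact
  also have "\<dots> = (\<Sum>(s,t)\<in>S. t - s)"
    using assms(2) by (intro sum.cong) auto
  finally show ?thesis by simp
qed

text \<open>Intervals tagged outside \<open>N\<close> are controlled by the derivatives. Those
  tagged in \<open>N\<close> lie in an open set of tiny measure, so absolute continuity makes their
  increments of \<open>F\<close> small in total; since \<open>P\<close> is monotone, its increments
  over them only help.\<close>

lemma AC_increment_le:
  fixes F P :: "real \<Rightarrow> real"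
  assumes ac: "absolutely_continuous_on_interval a b F" and ab: "a \<le> b" and N: "negligible N"
    and P: "mono_on {a..b} P"
    and der: "\<And>x. x \<in> {a..b} - N \<Longrightarrow> \<exists>D E. (F has_real_derivative D) (at x within {a..b}) \<and>
        (P has_real_derivative E) (at x within {a..b}) \<and> D \<le> E"
  shows "F b - F a \<le> P b - P a"
proof -
  have key: "F b - F a \<le> P b - P a + e * (b - a) + e" if e: "e > 0" for e
  proof -
    obtain d where d0: "d > 0" and d: "\<forall>S. finite S \<and> (\<forall>(s, t)\<in>S. a \<le> s \<and> s \<le> t \<and> t \<le> b) \<and>
        pairwise (\<lambda>(s, t) (s', t'). disjnt {s<..<t} {s'<..<t'}) S \<and>
        (\<Sum>(s, t)\<in>S. t - s) < d \<longrightarrow> (\<Sum>(s, t)\<in>S. \<bar>F t - F s\<bar>) < e"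
      using ac e unfolding absolutely_continuous_on_interval_def by blast
    have Ns: "N \<in> sets lebesgue" "emeasure lebesgue N = 0"
      using N by (auto simp: negligible_iff_null_sets)
    obtain V where V: "open V" "N \<subseteq> V" "V - N \<in> lmeasurable" "emeasure lebesgue (V - N) < ennreal d"
      using sets_lebesgue_outer_open[OF Ns(1) d0] by blast
    have emV: "emeasure lebesgue V < ennreal d"
    proof -
      have "emeasure lebesgue V \<le> emeasure lebesgue ((V - N) \<union> N)"
        using V Ns by (intro emeasure_mono) (auto simp: fmeasurable_def)
      also have "\<dots> \<le> emeasure lebesgue (V - N) + emeasure lebesgue N"
        using V Ns by (intro emeasure_subadditive) (auto simp: fmeasurable_def)
      finally show ?thesis using V(4) Ns(2) by simp
    qed
    have "\<exists>r>0. (x \<in> {a..b} - N \<longrightarrow> (\<forall>s t. a \<le> s \<longrightarrow> s \<le> x \<longrightarrow> x \<le> t \<longrightarrow> t \<le> b \<longrightarrow> x - s < r \<longrightarrow> t - x < r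
             \<longrightarrow> F t - F s \<le> P t - P s + e * (t - s))) \<and> (x \<in> N \<longrightarrow> ball x r \<subseteq> V)" for x
    proof (cases "x \<in> N")
      case True
      then show ?thesis using V by (metis Diff_iff open_contains_ball subsetD)
    next
      case False
      show ?thesis
      proof (cases "x \<in> {a..b}")
        case True
        then obtain D E where D: "(F has_real_derivative D) (at x within {a..b})"
          "(P has_real_derivative E) (at x within {a..b})" "D \<le> E" using der False by blast
        have "((\<lambda>x. F x - P x) has_real_derivative D - E) (at x within {a..b})"
          by (intro derivative_intros D)
        then have "((\<lambda>x. F x - P x) has_derivative (\<lambda>h. (D - E) * h)) (at x within {a..b})"
          by (simp add: has_field_derivative_def)
        then obtain r where r: "r > 0" "\<And>y. y \<in> {a..b} \<Longrightarrow> norm (y - x) < r \<Longrightarrow>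
            norm ((F y - P y) - (F x - P x) - (D - E) * (y - x)) \<le> e * norm (y - x)"
          using e unfolding has_derivative_within_alt by metis
        have "F t - F s \<le> P t - P s + e * (t - s)"
          if "a \<le> s" "s \<le> x" "x \<le> t" "t \<le> b" "x - s < r" "t - x < r" for s t
        proof -
          have 1: "\<bar>(F t - P t) - (F x - P x) - (D - E) * (t - x)\<bar> \<le> e * (t - x)"
            using r(2)[of t] that True by auto
          have 2: "\<bar>(F s - P s) - (F x - P x) - (D - E) * (s - x)\<bar> \<le> e * (x - s)"
            using r(2)[of s] that True by auto
          have 3: "(D - E) * (t - x) \<le> 0" "(D - E) * (s - x) \<ge> 0"
            using that D by (auto simp: mult_nonpos_nonneg mult_nonpos_nonpos)
          show ?thesis using 1 2 3 by (simp add: abs_le_iff algebra_simps)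
        qed
        then show ?thesis using r False by blast
      qed (use False in \<open>auto intro: exI[of _ 1]\<close>)
    qed
    then obtain r where r0: "\<And>x. r x > 0" and r: "\<And>x s t. x \<in> {a..b} - N \<Longrightarrow> a \<le> s \<Longrightarrow> s \<le> x \<Longrightarrow> x \<le> t \<Longrightarrow> t \<le> b
        \<Longrightarrow> x - s < r x \<Longrightarrow> t - x < r x \<Longrightarrow> F t - F s \<le> P t - P s + e * (t - s)"
        and rN: "\<And>x. x \<in> N \<Longrightarrow> ball x (r x) \<subseteq> V"
      by metis
    have "gauge (\<lambda>x. ball x (r x))" using r0 by (intro gauge_ball_dependent) auto
    then obtain p where p: "p tagged_division_of {a..b}" "(\<lambda>x. ball x (r x)) fine p"
      using fine_division_exists_real by blast
    have finp: "finite p" using p(1) by (rule tagged_division_of_finite)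
    \<comment> \<open>Only nondegenerate intervals are kept: two distinct members then have distinct
      end points, so that passing to the set \<open>S\<close> of pairs loses nothing.\<close>
    define q where "q = {xK \<in> p. fst xK \<in> N \<and> Inf (snd xK) < Sup (snd xK)}"
    define S where "S = (\<lambda>xK. (Inf (snd xK), Sup (snd xK))) ` q"
    have qE: "\<exists>s t. xK = (fst xK, {s..t}) \<and> a \<le> s \<and> s < t \<and> t \<le> b \<and> Inf (snd xK) = s \<and> Sup (snd xK) = t
        \<and> {s..t} \<subseteq> V" if "xK \<in> q" for xK
    proof -
      obtain x K where xK: "xK = (x, K)" by fastforce
      have xp: "(x, K) \<in> p" "x \<in> N" "Inf K < Sup K" using that xK by (auto simp: q_def)
      obtain s t where st: "K = {s..t}" "a \<le> s" "s \<le> x" "x \<le> t" "t \<le> b" "Inf K = s" "Sup K = t"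
        using tagged_division_of_realE[OF p(1) xp(1)] by blast
      moreover have "K \<subseteq> V" using p(2) xp rN[of x] by (fastforce simp: fine_def)
      ultimately show ?thesis using xp xK by auto
    qed
    have disj: "disjnt {Inf (snd xK)<..<Sup (snd xK)} {Inf (snd yL)<..<Sup (snd yL)}"
      if xy: "xK \<in> q" "yL \<in> q" "xK \<noteq> yL" for xK yL
    proof -
      have "interior (snd xK) \<inter> interior (snd yL) = {}"
        using tagged_division_ofD(5)[OF p(1), of "fst xK" "snd xK" "fst yL" "snd yL"] xy
        by (auto simp: q_def)
      moreover have "interior (snd xK) = {Inf (snd xK)<..<Sup (snd xK)}" if "xK \<in> q" for xK
        using qE[OF that] by (metis interior_atLeastAtMost_real snd_conv)
      ultimately show ?thesis using xy by (simp add: disjnt_def)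
    qed
    have inj: "inj_on (\<lambda>xK. (Inf (snd xK), Sup (snd xK))) q"
    proof (rule inj_onI, rule ccontr)
      fix xK yL assume *: "xK \<in> q" "yL \<in> q" "(Inf (snd xK), Sup (snd xK)) = (Inf (snd yL), Sup (snd yL))" "xK \<noteq> yL"
      then have "{Inf (snd xK)<..<Sup (snd xK)} = {}" using disj[of xK yL] by (auto simp: disjnt_def)
      then show False using *(1) by (auto simp: q_def)
    qed
    have finS: "finite S" using finp by (auto simp: S_def q_def)
    have S1: "\<forall>(s, t)\<in>S. a \<le> s \<and> s \<le> t \<and> t \<le> b"
      unfolding S_def using qE by fastforce
    have S2: "pairwise (\<lambda>(s, t) (s', t'). disjnt {s<..<t} {s'<..<t'}) S"
      unfolding S_def pairwise_def using disj by (auto simp: inj_on_eq_iff[OF inj])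
    have "(\<Sum>(s, t)\<in>S. t - s) = measure lebesgue (\<Union>(s,t)\<in>S. {s<..<t})"
      using finS S1 S2 by (intro sum_lengths_eq_measure) auto
    also have "\<dots> < d"
    proof -
      have sub: "(\<Union>(s,t)\<in>S. {s<..<t}) \<subseteq> V" unfolding S_def using qE by fastforce
      have "emeasure lebesgue (\<Union>(s,t)\<in>S. {s<..<t}) \<le> emeasure lebesgue V"
        using sub V(1) by (intro emeasure_mono) auto
      then have "emeasure lebesgue (\<Union>(s,t)\<in>S. {s<..<t}) < ennreal d" using emV by simp
      then show ?thesis
        by (metis d0 emeasure_eq_ennreal_measure ennreal_less_iff less_top measure_nonneg order_less_le_trans top_greatest)
    qed
    finally have "(\<Sum>(s, t)\<in>S. \<bar>F t - F s\<bar>) < e" using d finS S1 S2 by blast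
    then have Sq: "(\<Sum>xK\<in>q. \<bar>F (Sup (snd xK)) - F (Inf (snd xK))\<bar>) < e"
      unfolding S_def by (subst (asm) sum.reindex[OF inj]) (simp add: o_def)
    have "F b - F a = (\<Sum>(x,K)\<in>p. F (Sup K) - F (Inf K))"
      using sum_increments_tagged_division[OF p(1) ab] by simp
    also have "\<dots> \<le> (\<Sum>(x,K)\<in>p. ((P (Sup K) - P (Inf K)) + e * (Sup K - Inf K)) +
         (if (x,K) \<in> q then \<bar>F (Sup K) - F (Inf K)\<bar> else 0))"
    proof (rule sum_mono, clarify)
      fix x K assume xK: "(x, K) \<in> p"
      obtain s t where st: "K = {s..t}" "a \<le> s" "s \<le> x" "x \<le> t" "t \<le> b" "Inf K = s" "Sup K = t"
        using tagged_division_of_realE[OF p(1) xK] by blast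
      have "P s \<le> P t" using P st by (auto simp: mono_on_def)
      have "e * (t - s) \<ge> 0" using e st by simp
      have "K \<subseteq> ball x (r x)" using p(2) xK by (auto simp: fine_def)
      moreover have "s \<in> K" "t \<in> K" using st by auto
      ultimately have "s \<in> ball x (r x)" "t \<in> ball x (r x)" by blast+
      then have "x - s < r x" "t - x < r x" by (auto simp: dist_real_def)
      then show "F (Sup K) - F (Inf K) \<le> ((P (Sup K) - P (Inf K)) + e * (Sup K - Inf K)) +
         (if (x,K) \<in> q then \<bar>F (Sup K) - F (Inf K)\<bar> else 0)"
        using r[of x s t] st \<open>P s \<le> P t\<close> \<open>e * (t - s) \<ge> 0\<close> xK
        by (cases "x \<in> N"; cases "s = t") (auto simp: q_def)
    qed
    also have "\<dots> = (\<Sum>(x,K)\<in>p. (P (Sup K) - P (Inf K))) + (\<Sum>(x,K)\<in>p. e * (Sup K - Inf K)) +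
         (\<Sum>xK\<in>p. (if xK \<in> q then \<bar>F (Sup (snd xK)) - F (Inf (snd xK))\<bar> else 0))"
      by (simp add: sum.distrib case_prod_beta)
    also have "(\<Sum>(x,K)\<in>p. (P (Sup K) - P (Inf K))) = P b - P a"
      using sum_increments_tagged_division[OF p(1) ab] .
    also have "(\<Sum>(x,K)\<in>p. e * (Sup K - Inf K)) = e * (b - a)"
      using sum_increments_tagged_division[OF p(1) ab, of "\<lambda>x. e * x"] by (simp add: algebra_simps)
    also have "(\<Sum>xK\<in>p. (if xK \<in> q then \<bar>F (Sup (snd xK)) - F (Inf (snd xK))\<bar> else 0)) =
        (\<Sum>xK\<in>q. \<bar>F (Sup (snd xK)) - F (Inf (snd xK))\<bar>)"
      using finp by (subst sum.inter_restrict[symmetric]) (auto simp: q_def intro!: sum.cong)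
    finally show ?thesis using Sq by simp
  qed
  show ?thesis
  proof (rule field_le_epsilon)
    fix e :: real assume "e > 0"
    then have "F b - F a \<le> P b - P a + e / (b - a + 1) * (b - a) + e / (b - a + 1)"
      using ab by (intro key) simp
    also have "\<dots> = P b - P a + e / (b - a + 1) * (b - a + 1)" by (simp only: distrib_left)
    also have "\<dots> = P b - P a + e" using ab by simp
    finally show "F b - F a \<le> P b - P a + e" .
  qed
qed

section \<open>Vitali coverings and differentiability almost everywhere\<close>

lemma pairwise_prodI:
  "(\<And>s t s' t'. (s, t) \<in> S \<Longrightarrow> (s', t') \<in> S \<Longrightarrow> (s, t) \<noteq> (s', t') \<Longrightarrow> R s t s' t')
    \<Longrightarrow> pairwise (\<lambda>(s, t) (s', t'). R s t s' t') S"
  unfolding pairwise_def by auto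

text \<open>Vitali's theorem gives a countable disjoint subfamily covering \<open>E\<close> up to a
  null set, and finitely many members already capture all but \<open>e\<close> of the measure.
  Intervals are coded as pairs of end points to match
  \<open>absolutely_continuous_on_interval\<close>.\<close>

lemma Vitali_finite_cover:
  fixes E :: "real set" and P :: "(real \<times> real) set"
  assumes E: "E \<in> lmeasurable" and e: "e > 0"
    and P: "\<And>x d. x \<in> E \<Longrightarrow> d > 0 \<Longrightarrow> \<exists>s t. (s, t) \<in> P \<and> s < x \<and> x < t \<and> t - s < d"
  obtains C where "finite C" "C \<subseteq> P" "\<forall>(s, t)\<in>C. s < t"
    "pairwise (\<lambda>(s, t) (s', t'). disjnt {s<..<t} {s'<..<t'}) C"
    "measure lebesgue (E - (\<Union>(s,t)\<in>C. {s<..<t})) < e"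
proof -
  define K where "K = {p \<in> P. fst p < snd p}"
  define c where "c = (\<lambda>p::real \<times> real. (fst p + snd p) / 2)"
  define r where "r = (\<lambda>p::real \<times> real. (snd p - fst p) / 2)"
  have ball: "ball (c p) (r p) = {fst p<..<snd p}" for p
    by (auto simp: c_def r_def dist_real_def abs_if field_simps split: if_splits)
  have fine: "\<exists>i. i \<in> K \<and> x \<in> ball (c i) (r i) \<and> r i < d" if xd: "x \<in> E" "0 < d" for x d
  proof -
    obtain s t where st: "(s, t) \<in> P" "s < x" "x < t" "t - s < d" using P xd by blast
    moreover have "x \<in> ball (c (s, t)) (r (s, t))" unfolding ball using st by simp
    ultimately show ?thesis by (intro exI[of _ "(s,t)"]) (auto simp: K_def r_def)
  qed
  obtain C where C: "countable C" "C \<subseteq> K"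
     "pairwise (\<lambda>i j. disjnt (ball (c i) (r i)) (ball (c j) (r j))) C"
     "negligible (E - (\<Union>i \<in> C. ball (c i) (r i)))"
    by (rule Vitali_covering_theorem_balls[of E K c r]) (use fine in auto)
  define I where "I = (\<lambda>p::real \<times> real. {fst p<..<snd p})"
  have Im: "I p \<in> sets lebesgue" for p by (simp add: I_def)
  have EI: "E \<inter> I p \<in> lmeasurable" for p by (intro fmeasurable_Int_fmeasurable E Im)
  let ?D = "(\<lambda>p. E \<inter> I p) ` C"
  obtain D' where D': "D' \<subseteq> ?D" "finite D'" "measure lebesgue (\<Union>?D) - e < measure lebesgue (\<Union>D')"
  proof (rule measure_countable_Union_approachable[of ?D e "measure lebesgue E"])
    show "measure lebesgue (\<Union>D') \<le> measure lebesgue E" if "D' \<subseteq> ?D" "finite D'" for D'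
    proof (rule measure_mono_fmeasurable)
      show "\<Union>D' \<in> sets lebesgue" using that EI by (intro sets.finite_Union) auto
    qed (use that E in auto)
  qed (use C e EI in auto)
  obtain C' where C': "C' \<subseteq> C" "finite C'" "D' = (\<lambda>p. E \<inter> I p) ` C'"
    using finite_subset_image[OF D'(2,1)] by blast
  have UC: "(\<Union>p\<in>C. E \<inter> I p) \<in> lmeasurable"
    using E C(1) Im by (intro fmeasurableI2[OF E]) (auto intro!: sets.countable_UN'' simp: fmeasurableD)
  have UC': "(\<Union>p\<in>C'. E \<inter> I p) \<in> lmeasurable"
    using EI C' by (intro fmeasurable.finite_UN) auto
  have "measure lebesgue E = measure lebesgue (\<Union>p\<in>C. E \<inter> I p)"
  proof (rule measure_negligible_symdiff)
    have "(E - (\<Union>p\<in>C. E \<inter> I p)) \<union> ((\<Union>p\<in>C. E \<inter> I p) - E) = E - (\<Union>i \<in> C. ball (c i) (r i))"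
      by (auto simp: ball I_def)
    then show "negligible ((\<Union>p\<in>C. E \<inter> I p) - E \<union> (E - (\<Union>p\<in>C. E \<inter> I p)))" 
      using C(4) by (simp add: Un_commute)
  qed (use UC in auto)
  then have "measure lebesgue E - e < measure lebesgue (\<Union>p\<in>C'. E \<inter> I p)"
    using D'(3) C'(3) by simp
  moreover have "measure lebesgue (E - (\<Union>p\<in>C'. E \<inter> I p)) = measure lebesgue E - measure lebesgue (\<Union>p\<in>C'. E \<inter> I p)"
    by (rule measurable_measure_Diff) (use E UC' in auto)
  moreover have "E - (\<Union>p\<in>C'. E \<inter> I p) = E - (\<Union>(s,t)\<in>C'. {s<..<t})" by (auto simp: I_def)
  ultimately have "measure lebesgue (E - (\<Union>(s,t)\<in>C'. {s<..<t})) < e" by simp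
  moreover have "pairwise (\<lambda>(s, t) (s', t'). disjnt {s<..<t} {s'<..<t'}) C'"
  proof (rule pairwise_prodI)
    fix s t s' t' assume "(s, t) \<in> C'" "(s', t') \<in> C'" "(s, t) \<noteq> (s', t')"
    then have "disjnt (ball (c (s, t)) (r (s, t))) (ball (c (s', t')) (r (s', t')))"
      using pairwiseD[OF C(3), of "(s, t)" "(s', t')"] C'(1) by blast
    then show "disjnt {s<..<t} {s'<..<t'}" unfolding ball by simp
  qed
  moreover have "finite C'" "C' \<subseteq> P" "\<forall>(s, t)\<in>C'. s < t" using C(2) C'(1,2) by (auto simp: K_def)
  ultimately show ?thesis using that by blast
qed

text \<open>Each interval of \<open>C'\<close> cuts the interval containing it into at most two
  pieces, so what remains of \<open>C\<close> is again a family of non-overlapping intervals. The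
  sum formula is stated for every \<open>f\<close> at once because it is applied both to the
  function at hand and to the identity, which gives the lengths.\<close>

lemma remove_subintervals:
  fixes C C' :: "(real \<times> real) set"
  assumes "finite C'" "finite C" "\<forall>(s, t)\<in>C. a \<le> s \<and> s < t \<and> t \<le> b" "\<forall>(s, t)\<in>C'. s < t"
    "pairwise (\<lambda>(s, t) (s', t'). disjnt {s<..<t} {s'<..<t'}) C"
    "pairwise (\<lambda>(s, t) (s', t'). disjnt {s<..<t} {s'<..<t'}) C'"
    "\<forall>(s', t')\<in>C'. \<exists>(s, t)\<in>C. s \<le> s' \<and> t' \<le> t"
  shows "\<exists>S. finite S \<and> (\<forall>(s, t)\<in>S. a \<le> s \<and> s < t \<and> t \<le> b) \<and>
    pairwise (\<lambda>(s, t) (s', t'). disjnt {s<..<t} {s'<..<t'}) S \<and>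
    (\<forall>f::real\<Rightarrow>real. (\<Sum>(s, t)\<in>S. f t - f s) = (\<Sum>(s, t)\<in>C. f t - f s) - (\<Sum>(s, t)\<in>C'. f t - f s))"
  using assms
proof (induction C' arbitrary: C rule: finite_induct)
  case empty
  then show ?case by (intro exI[of _ C]) auto
next
  case (insert c C')
  obtain s' t' where c: "c = (s', t')" by fastforce
  obtain s t where J: "(s, t) \<in> C" "s \<le> s'" "t' \<le> t" using insert.prems(6) c by auto
  have st': "s' < t'" using insert.prems(3) c by auto
  \<comment> \<open>The filter discards empty end pieces, which keeps all intervals of the new
    family nondegenerate.\<close>
  define A where "A = {p \<in> {(s, s'), (t', t)}. fst p < snd p}"
  have A: "p \<in> A \<Longrightarrow> s \<le> fst p \<and> fst p < snd p \<and> snd p \<le> t" for p using J st' by (auto simp: A_def)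
  have disC: "disjnt {x<..<y} {x'<..<y'}" if "(x,y) \<in> C" "(x',y') \<in> C" "(x,y) \<noteq> (x',y')" for x y x' y'
    using insert.prems(4) that unfolding pairwise_def by fastforce
  have AC: "A \<inter> (C - {(s, t)}) = {}"
  proof (rule ccontr)
    assume "A \<inter> (C - {(s, t)}) \<noteq> {}"
    then obtain x y where xy: "(x,y) \<in> A" "(x,y) \<in> C" "(x,y) \<noteq> (s,t)" by auto
    have "disjnt {x<..<y} {s<..<t}" using disC xy J by blast
    then show False using A[OF xy(1)] by (auto simp: disjnt_def)
  qed
  let ?C = "(C - {(s, t)}) \<union> A"
  have finA: "finite A" by (simp add: A_def)
  have sumA: "(\<Sum>(s, t)\<in>A. f t - f s) = (f s' - f s) + (f t - f t')" for f :: "real \<Rightarrow> real"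
  proof -
    have "(\<Sum>(s, t)\<in>A. f t - f s) = (\<Sum>(s, t)\<in>{(s, s'), (t', t)}. f t - f s)"
      using J by (intro sum.mono_neutral_left) (auto simp: A_def less_le)
    also have "\<dots> = (f s' - f s) + (f t - f t')" using st' J by (subst sum.insert) auto
    finally show ?thesis .
  qed
  have IH: "\<exists>S. finite S \<and> (\<forall>(s, t)\<in>S. a \<le> s \<and> s < t \<and> t \<le> b) \<and>
    pairwise (\<lambda>(s, t) (s', t'). disjnt {s<..<t} {s'<..<t'}) S \<and>
    (\<forall>f::real\<Rightarrow>real. (\<Sum>(s, t)\<in>S. f t - f s) = (\<Sum>(s, t)\<in>?C. f t - f s) - (\<Sum>(s, t)\<in>C'. f t - f s))"
  proof (rule insert.IH)
    show "finite ?C" using insert.prems finA by auto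
    show "\<forall>(s, t)\<in>?C. a \<le> s \<and> s < t \<and> t \<le> b" using insert.prems(2) J A by fastforce
    show "\<forall>(s, t)\<in>C'. s < t" using insert.prems by auto
    show "pairwise (\<lambda>(s, t) (s', t'). disjnt {s<..<t} {s'<..<t'}) C'"
      using insert.prems(5) by (auto simp: pairwise_insert)
    have dis: "disjnt {x<..<y} {x'<..<y'}" if "(x,y) \<in> A" "(x',y') \<in> C - {(s,t)}" for x y x' y'
    proof -
      have "disjnt {s<..<t} {x'<..<y'}" using that J by (intro disC) auto
      then show ?thesis using A[OF that(1)] unfolding disjnt_def by fastforce
    qed
    have disA: "disjnt {x<..<y} {x'<..<y'}" if "(x,y) \<in> A" "(x',y') \<in> A" "(x,y) \<noteq> (x',y')" for x y x' y'
      using that st' by (auto simp: A_def disjnt_def)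
    show "pairwise (\<lambda>(s, t) (s', t'). disjnt {s<..<t} {s'<..<t'}) ?C"
    proof (rule pairwise_prodI)
      fix x y x' y' assume *: "(x, y) \<in> ?C" "(x', y') \<in> ?C" "(x, y) \<noteq> (x', y')"
      show "disjnt {x<..<y} {x'<..<y'}"
      proof (cases "(x, y) \<in> A")
        case True
        then show ?thesis using disA[of x y x' y'] dis[of x y x' y'] * by (cases "(x', y') \<in> A") simp_all
      next
        case False
        then show ?thesis using disC[of x y x' y'] dis[of x' y' x y, THEN disjnt_sym] * 
          by (cases "(x', y') \<in> A") simp_all
      qed
    qed
    show "\<forall>(x, y)\<in>C'. \<exists>(s, t)\<in>?C. s \<le> x \<and> y \<le> t"
    proof clarify
      fix x y assume xy: "(x, y) \<in> C'"
      then have xyl: "x < y" using insert.prems(3) by auto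
      obtain x' y' where xy': "(x', y') \<in> C" "x' \<le> x" "y \<le> y'" using insert.prems(6) xy by fastforce
      show "\<exists>(s, t)\<in>?C. s \<le> x \<and> y \<le> t"
      proof (cases "(x', y') = (s, t)")
        case False then show ?thesis using xy' by auto
      next
        case True
        \<comment> \<open>\<open>(x, y)\<close> lay in the interval just split; being disjoint from
          \<open>(s', t')\<close>, it must fall into one of the two remaining pieces.\<close>
        have "(x, y) \<noteq> c" using xy insert.hyps by auto
        then have "disjnt {x<..<y} {s'<..<t'}" using insert.prems(5) xy c 
          unfolding pairwise_def by fastforce
        then have "y \<le> s' \<or> t' \<le> x" using xyl st'
          by (auto simp: disjnt_def min_def max_def split: if_splits)
        then show ?thesis
        proof
          assume "y \<le> s'"
          then have "(s, s') \<in> A" using xyl xy' True by (auto simp: A_def)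
          then show ?thesis using \<open>y \<le> s'\<close> xy' True by auto
        next
          assume "t' \<le> x"
          then have "(t', t) \<in> A" using xyl xy' True by (auto simp: A_def)
          then show ?thesis using \<open>t' \<le> x\<close> xy' True by auto
        qed
      qed
    qed
  qed
  have sums: "(\<Sum>(s, t)\<in>?C. f t - f s) - (\<Sum>(s, t)\<in>C'. f t - f s) =
     (\<Sum>(s, t)\<in>C. f t - f s) - (\<Sum>(s, t)\<in>insert c C'. f t - f s)" for f :: "real \<Rightarrow> real"
  proof -
    have "(\<Sum>(s, t)\<in>?C. f t - f s) = (\<Sum>(s, t)\<in>C - {(s,t)}. f t - f s) + (\<Sum>(s, t)\<in>A. f t - f s)"
      using AC finA insert.prems by (intro sum.union_disjoint) auto
    also have "(\<Sum>(s, t)\<in>C - {(s,t)}. f t - f s) = (\<Sum>(s, t)\<in>C. f t - f s) - (f t - f s)"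
      using J insert.prems by (subst sum_diff1) auto
    finally show ?thesis using sumA[of f] insert.hyps c by simp
  qed
  show ?case using IH unfolding sums .
qed

lemma AC_neg:
  "absolutely_continuous_on_interval a b F \<Longrightarrow> absolutely_continuous_on_interval a b (\<lambda>x. - F x)"
  unfolding absolutely_continuous_on_interval_def by (simp add: abs_minus_commute)

lemma AC_imp_continuous_on:
  assumes "absolutely_continuous_on_interval a b F"
  shows "continuous_on {a..b} F"
proof (unfold continuous_on_iff, intro ballI allI impI)
  fix x e :: real assume x: "x \<in> {a..b}" and e: "0 < e"
  obtain d where d0: "d > 0" and d: "\<forall>S. finite S \<and> (\<forall>(s, t)\<in>S. a \<le> s \<and> s \<le> t \<and> t \<le> b) \<and>
        pairwise (\<lambda>(s, t) (s', t'). disjnt {s<..<t} {s'<..<t'}) S \<and>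
        (\<Sum>(s, t)\<in>S. t - s) < d \<longrightarrow> (\<Sum>(s, t)\<in>S. \<bar>F t - F s\<bar>) < e"
    using assms e unfolding absolutely_continuous_on_interval_def by blast
  have "dist (F y) (F x) < e" if "y \<in> {a..b}" "dist y x < d" for y
    using d[rule_format, of "{(min x y, max x y)}"] that x
    by (auto simp: min_def max_def dist_real_def abs_if split: if_splits)
  then show "\<exists>d>0. \<forall>y\<in>{a..b}. dist y x < d \<longrightarrow> dist (F y) (F x) < e" using d0 by blast
qed

text \<open>The points near which \<open>R\<close> holds for arbitrarily short intervals straddling the point: level sets
  of Dini-type derivatives, in a form to which the Vitali covering theorem applies directly.\<close>

definition fine_points :: "real \<Rightarrow> real \<Rightarrow> (real \<Rightarrow> real \<Rightarrow> bool) \<Rightarrow> real set" where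
  "fine_points a b R = {x. \<forall>d>0. \<exists>s t. a \<le> s \<and> s < x \<and> x < t \<and> t \<le> b \<and> t - s < d \<and> R s t}"

lemma fine_points_sub: "fine_points a b R \<subseteq> {a<..<b}"
  unfolding fine_points_def by (auto intro: zero_less_one dest: spec[of _ 1])

text \<open>Whatever \<open>R\<close> is, the set is a countable intersection of open sets: an
  interval that witnesses the condition for one of its interior points does so for all of
  them.\<close>

lemma fine_points_lmeasurable: "fine_points a b R \<in> lmeasurable"
proof (rule bounded_set_imp_lmeasurable)
  show "bounded (fine_points a b R)" using fine_points_sub by (rule bounded_subset[rotated]) auto
  have "fine_points a b R = (\<Inter>n::nat. \<Union>{I. \<exists>s t. I = {s<..<t} \<and> a \<le> s \<and> t \<le> b \<and> t - s < inverse (real (Suc n)) \<and> R s t})"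
    (is "_ = ?X")
  proof (intro equalityI subsetI)
    fix x assume x: "x \<in> fine_points a b R"
    show "x \<in> ?X"
    proof (rule INT_I)
      fix n :: nat
      have "inverse (real (Suc n)) > 0" by simp
      then obtain s t where "a \<le> s" "s < x" "x < t" "t \<le> b" "t - s < inverse (real (Suc n))" "R s t"
        using x unfolding fine_points_def by blast
      then have "x \<in> {s<..<t}" "{s<..<t} \<in> {I. \<exists>s t. I = {s<..<t} \<and> a \<le> s \<and> t \<le> b \<and> t - s < inverse (real (Suc n)) \<and> R s t}"
        by auto
      then show "x \<in> \<Union>{I. \<exists>s t. I = {s<..<t} \<and> a \<le> s \<and> t \<le> b \<and> t - s < inverse (real (Suc n)) \<and> R s t}"
        by blast
    qed
  next
    fix x assume x: "x \<in> ?X"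
    show "x \<in> fine_points a b R" unfolding fine_points_def
    proof (intro CollectI allI impI)
      fix d :: real assume "d > 0"
      then obtain n where "inverse (real (Suc n)) < d" using reals_Archimedean by blast
      then show "\<exists>s t. a \<le> s \<and> s < x \<and> x < t \<and> t \<le> b \<and> t - s < d \<and> R s t"
        using INT_D[OF x UNIV_I, of n] by fastforce
    qed
  qed
  also have "\<dots> \<in> sets lebesgue"
  proof (rule sets.countable_INT''[OF _ countableI_type])
    fix n :: nat 
    have "open (\<Union>{I. \<exists>s t. I = {s<..<t} \<and> a \<le> s \<and> t \<le> b \<and> t - s < inverse (real (Suc n)) \<and> R s t})"
      by (rule open_Union) auto
    then show "\<Union>{I. \<exists>s t. I = {s<..<t} \<and> a \<le> s \<and> t \<le> b \<and> t - s < inverse (real (Suc n)) \<and> R s t} \<in> sets lebesgue"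
      by (intro sets_completionI_sets) (simp only: sets_lborel borel_open)
  qed simp
  finally show "fine_points a b R \<in> sets lebesgue" .
qed

text \<open>The Vitali cover is taken inside a prescribed open set, so that the total length of the
  chosen intervals is at most the measure of that set.\<close>

lemma fine_points_cover:
  assumes "E \<subseteq> fine_points a b R" "E \<in> lmeasurable" "open U" "E \<subseteq> U" "e > 0"
  obtains C where "finite C" "\<forall>(s, t)\<in>C. a \<le> s \<and> s < t \<and> t \<le> b \<and> {s..t} \<subseteq> U \<and> R s t"
    "pairwise (\<lambda>(s, t) (s', t'). disjnt {s<..<t} {s'<..<t'}) C"
    "measure lebesgue (E - (\<Union>(s,t)\<in>C. {s<..<t})) < e"
proof (rule Vitali_finite_cover[OF assms(2,5), of "{(s, t). a \<le> s \<and> t \<le> b \<and> {s..t} \<subseteq> U \<and> R s t}"])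
  fix x d :: real assume x: "x \<in> E" and d: "d > 0"
  obtain r where r: "r > 0" "ball x r \<subseteq> U" using assms(3,4) x by (meson openE subsetD)
  have "min d r > 0" using d r by simp
  then obtain s t where st: "a \<le> s" "s < x" "x < t" "t \<le> b" "t - s < min d r" "R s t"
    using x assms(1) unfolding fine_points_def by blast
  moreover have "{s..t} \<subseteq> ball x r" using st by (auto simp: dist_real_def)
  ultimately show "\<exists>s t. (s, t) \<in> {(s, t). a \<le> s \<and> t \<le> b \<and> {s..t} \<subseteq> U \<and> R s t} \<and> s < x \<and> x < t \<and> t - s < d"
    using r by (intro exI[of _ s] exI[of _ t]) auto
next
  fix C assume "finite C" "C \<subseteq> {(s, t). a \<le> s \<and> t \<le> b \<and> {s..t} \<subseteq> U \<and> R s t}" "\<forall>(s, t)\<in>C. s < t"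
    "pairwise (\<lambda>(s, t) (s', t'). disjnt {s<..<t} {s'<..<t'}) C"
    "measure lebesgue (E - (\<Union>(s,t)\<in>C. {s<..<t})) < e"
  then show thesis by (intro that[of C]) auto
qed

lemma measure_le_of_sub:
  assumes "V \<in> lmeasurable" "finite S" "\<forall>(s, t)\<in>S. s \<le> t \<and> {s<..<t} \<subseteq> V"
    "pairwise (\<lambda>(s, t) (s', t'). disjnt {s<..<t} {s'<..<t'}) S"
  shows "(\<Sum>(s, t)\<in>S. t - s) \<le> measure lebesgue V"
proof -
  have "(\<Sum>(s, t)\<in>S. t - s) = measure lebesgue (\<Union>(s,t)\<in>S. {s<..<t})"
    using assms by (intro sum_lengths_eq_measure) auto
  also have "\<dots> \<le> measure lebesgue V"
    using assms by (intro measure_mono_fmeasurable) (auto intro!: sets.finite_UN simp: split_beta)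
  finally show ?thesis .
qed

text \<open>If the set had positive measure, it could be covered by disjoint intervals of slope below \<open>u\<close>,
  and within them by disjoint intervals of slope above \<open>v\<close> of almost the same total length. The
  difference of the two families is short but carries a definite increment of \<open>F\<close>.\<close>

lemma AC_slopes_agree:
  assumes ac: "absolutely_continuous_on_interval a b F" and uv: "u < v"
  shows "negligible (fine_points a b (\<lambda>s t. F t - F s < u * (t - s)) \<inter> fine_points a b (\<lambda>s t. F t - F s > v * (t - s)))"
    (is "negligible (?E1 \<inter> ?E2)")
proof -
  define E where "E = ?E1 \<inter> ?E2"
  have Em: "E \<in> lmeasurable" unfolding E_def using fine_points_lmeasurable by (intro fmeasurable_Int_fmeasurable) (auto simp: fmeasurableD)
  define m where "m = measure lebesgue E"
  have "\<not> m > 0"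
  proof
    assume m: "m > 0"
    \<comment> \<open>If both families had total length exactly \<open>m\<close>, their increments
      would differ by at least \<open>(v - u) * m = 3 * e\<close>; absolute continuity and the
      length errors account for at most \<open>2 * e\<close>.\<close>
    define e where "e = (v - u) * m / 3"
    have e: "e > 0" using m uv by (simp add: e_def)
    obtain d0 where d0: "d0 > 0" and acd: "\<forall>S. finite S \<and> (\<forall>(s, t)\<in>S. a \<le> s \<and> s \<le> t \<and> t \<le> b) \<and>
        pairwise (\<lambda>(s, t) (s', t'). disjnt {s<..<t} {s'<..<t'}) S \<and>
        (\<Sum>(s, t)\<in>S. t - s) < d0 \<longrightarrow> (\<Sum>(s, t)\<in>S. \<bar>F t - F s\<bar>) < e"
      using ac e unfolding absolutely_continuous_on_interval_def by blast
    \<comment> \<open>The leftover length \<open>l1 - l2\<close> will be below \<open>3 * d\<close>,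
      hence below \<open>d0\<close>; the second bound limits the effect of the length errors, at
      most \<open>2 * d\<close> each, to \<open>e\<close>.\<close>
    define d where "d = min (d0 / 4) (e / (4 * (\<bar>u\<bar> + \<bar>v\<bar> + 1)))"
    have d: "d > 0" "3 * d < d0" using d0 e by (auto simp: d_def min_def)
    have de: "2 * d * (\<bar>u\<bar> + \<bar>v\<bar>) \<le> e"
    proof -
      have "2 * d * (\<bar>u\<bar> + \<bar>v\<bar>) \<le> 2 * d * (2 * (\<bar>u\<bar> + \<bar>v\<bar> + 1))" using d by (intro mult_left_mono) auto
      also have "\<dots> = d * (4 * (\<bar>u\<bar> + \<bar>v\<bar> + 1))" by simp
      also have "\<dots> \<le> e / (4 * (\<bar>u\<bar> + \<bar>v\<bar> + 1)) * (4 * (\<bar>u\<bar> + \<bar>v\<bar> + 1))"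
        by (intro mult_right_mono) (auto simp: d_def)
      also have "\<dots> = e" by (simp add: add_nonneg_eq_0_iff)
      finally show ?thesis .
    qed
    obtain U where U: "open U" "E \<subseteq> U" "U - E \<in> lmeasurable" "emeasure lebesgue (U - E) < ennreal d"
      using sets_lebesgue_outer_open[OF fmeasurableD[OF Em] d(1)] by blast
    have Um: "U \<in> lmeasurable"
      using fmeasurable.Un[OF U(3) Em] U(2) by (simp add: Un_absorb2)
    have "measure lebesgue (U - E) < d"
      using U(3,4) d by (metis emeasure_eq_measure2 ennreal_less_iff measure_nonneg)
    then have mU: "measure lebesgue U < m + d"
      using measurable_measure_Diff[OF Um fmeasurableD[OF Em] U(2)] by (simp add: m_def)
    obtain C1 where C1: "finite C1" "\<forall>(s, t)\<in>C1. a \<le> s \<and> s < t \<and> t \<le> b \<and> {s..t} \<subseteq> U \<and> F t - F s < u * (t - s)"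
      "pairwise (\<lambda>(s, t) (s', t'). disjnt {s<..<t} {s'<..<t'}) C1"
      "measure lebesgue (E - (\<Union>(s,t)\<in>C1. {s<..<t})) < d"
      by (rule fine_points_cover[of E a b "\<lambda>s t. F t - F s < u * (t - s)" U d])
        (use Em U d in \<open>auto simp: E_def\<close>)
    define W where "W = (\<Union>(s,t)\<in>C1. {s<..<t})"
    have W: "open W" "W \<in> sets lebesgue" unfolding W_def by (auto intro!: sets.finite_UN C1 simp: split_beta)
    have EW: "E \<inter> W \<in> lmeasurable" using Em W by (intro fmeasurable_Int_fmeasurable)
    text \<open>A short interval around a point of \<open>W\<close> lies inside a single member of \<open>C1\<close>, so the steep
      intervals can be chosen to refine the flat ones, with nearly the same total length.\<close>
    have EWR: "E \<inter> W \<subseteq> fine_points a b (\<lambda>s t. F t - F s > v * (t - s) \<and> (\<exists>(s', t')\<in>C1. s' \<le> s \<and> t \<le> t'))"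
    proof
      fix x assume x: "x \<in> E \<inter> W"
      then obtain s' t' where st': "(s', t') \<in> C1" "s' < x" "x < t'" by (auto simp: W_def)
      show "x \<in> fine_points a b (\<lambda>s t. F t - F s > v * (t - s) \<and> (\<exists>(s', t')\<in>C1. s' \<le> s \<and> t \<le> t'))"
        unfolding fine_points_def
      proof (intro CollectI allI impI)
        fix r :: real assume "r > 0"
        then have "min r (min (x - s') (t' - x)) > 0" using st' by simp
        then obtain s t where "a \<le> s" "s < x" "x < t" "t \<le> b" "t - s < min r (min (x - s') (t' - x))" "F t - F s > v * (t - s)"
          using x unfolding E_def fine_points_def by blast
        then show "\<exists>s t. a \<le> s \<and> s < x \<and> x < t \<and> t \<le> b \<and> t - s < r \<and>
          v * (t - s) < F t - F s \<and> (\<exists>(s', t')\<in>C1. s' \<le> s \<and> t \<le> t')"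
          using st' by (intro exI[of _ s] exI[of _ t]) (auto intro!: bexI[of _ "(s', t')"])
      qed
    qed
    obtain C2 where C2: "finite C2" "\<forall>(s, t)\<in>C2. a \<le> s \<and> s < t \<and> t \<le> b \<and> {s..t} \<subseteq> W \<and>
         (F t - F s > v * (t - s) \<and> (\<exists>(s', t')\<in>C1. s' \<le> s \<and> t \<le> t'))"
      "pairwise (\<lambda>(s, t) (s', t'). disjnt {s<..<t} {s'<..<t'}) C2"
      "measure lebesgue (E \<inter> W - (\<Union>(s,t)\<in>C2. {s<..<t})) < d"
      by (rule fine_points_cover[OF EWR EW W(1) _ d(1)]) auto
    define l1 where "l1 = (\<Sum>(s, t)\<in>C1. t - s)"
    define l2 where "l2 = (\<Sum>(s, t)\<in>C2. t - s)"
    define X where "X = (\<Union>(s,t)\<in>C2. {s<..<t})"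
    have Xs: "X \<in> sets lebesgue" unfolding X_def by (auto intro!: sets.finite_UN C2 simp: split_beta)
    have "X \<subseteq> {a<..<b}" unfolding X_def using C2(2) by fastforce
    then have Xm: "X \<in> lmeasurable" using Xs by (intro bounded_set_imp_lmeasurable) (rule bounded_subset[of "{a<..<b}"], auto)
    have l1: "l1 \<le> measure lebesgue U" unfolding l1_def
    proof (rule measure_le_of_sub[OF Um C1(1) _ C1(3)])
      show "\<forall>(s, t)\<in>C1. s \<le> t \<and> {s<..<t} \<subseteq> U" using C1(2) by fastforce
    qed
    have l2: "l2 = measure lebesgue X" unfolding l2_def X_def
      using C2 by (intro sum_lengths_eq_measure) auto
    have "m \<le> measure lebesgue ((E - W) \<union> ((E \<inter> W - X) \<union> X))" unfolding m_def
      using Em W Xm EW by (intro measure_mono_fmeasurable fmeasurable.Un fmeasurable_Diff) (auto simp: fmeasurableD)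
    also have "\<dots> \<le> measure lebesgue (E - W) + (measure lebesgue (E \<inter> W - X) + measure lebesgue X)"
      using Em W Xm EW by (intro order.trans[OF measure_Un_le] add_left_mono) (auto simp: fmeasurableD)
    finally have ml2: "m < 2 * d + l2" using C1(4) C2(4) l2 unfolding W_def[symmetric] X_def[symmetric] by simp
    \<comment> \<open>The flat intervals with the steep ones cut out: a short family over which
      \<open>F\<close> would have to drop substantially.\<close>
    obtain S where S: "finite S" "\<forall>(s, t)\<in>S. a \<le> s \<and> s < t \<and> t \<le> b"
      "pairwise (\<lambda>(s, t) (s', t'). disjnt {s<..<t} {s'<..<t'}) S"
      "\<forall>f::real\<Rightarrow>real. (\<Sum>(s, t)\<in>S. f t - f s) = (\<Sum>(s, t)\<in>C1. f t - f s) - (\<Sum>(s, t)\<in>C2. f t - f s)"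
    proof -
      have f1: "\<forall>(s, t)\<in>C1. a \<le> s \<and> s < t \<and> t \<le> b" using C1(2) by (simp add: split_beta)
      have f2: "\<forall>(s, t)\<in>C2. s < t" using C2(2) by (simp add: split_beta)
      have f3: "\<forall>(s', t')\<in>C2. \<exists>(s, t)\<in>C1. s \<le> s' \<and> t' \<le> t" using C2(2) by (simp add: split_beta)
      from remove_subintervals[OF C2(1) C1(1) f1 f2 C1(3) C2(3) f3] show thesis
        by (elim exE conjE) (rule that)
    qed
    have Sl: "(\<Sum>(s, t)\<in>S. t - s) = l1 - l2" using S(4)[rule_format, of "\<lambda>x. x"] by (simp add: l1_def l2_def)
    have "(\<Sum>(s, t)\<in>S. t - s) \<ge> 0" using S(2) by (intro sum_nonneg) auto
    have "(\<Sum>(s, t)\<in>S. t - s) < d0" using Sl l1 mU ml2 d by simp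
    moreover have "\<forall>(s, t)\<in>S. a \<le> s \<and> s \<le> t \<and> t \<le> b" using S(2) by fastforce
    ultimately have "(\<Sum>(s, t)\<in>S. \<bar>F t - F s\<bar>) < e" using acd S(1,3) by blast
    moreover have "- (\<Sum>(s, t)\<in>S. F t - F s) \<le> (\<Sum>(s, t)\<in>S. \<bar>F t - F s\<bar>)"
      unfolding sum_negf[symmetric] by (intro sum_mono) auto
    ultimately have 1: "(\<Sum>(s, t)\<in>C2. F t - F s) - (\<Sum>(s, t)\<in>C1. F t - F s) < e"
      using S(4) by simp
    have 2: "(\<Sum>(s, t)\<in>C1. F t - F s) \<le> u * l1" unfolding l1_def sum_distrib_left
      using C1(2) by (intro sum_mono) auto
    have 3: "(\<Sum>(s, t)\<in>C2. F t - F s) \<ge> v * l2" unfolding l2_def sum_distrib_left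
      using C2(2) by (intro sum_mono) auto
    have b1: "\<bar>l1 - m\<bar> \<le> 2 * d" "\<bar>l2 - m\<bar> \<le> 2 * d"
      using Sl \<open>(\<Sum>(s, t)\<in>S. t - s) \<ge> 0\<close> l1 mU ml2 d by auto
    have "u * (l1 - m) \<le> \<bar>u\<bar> * (2 * d)" "- (v * (l2 - m)) \<le> \<bar>v\<bar> * (2 * d)"
      using mult_left_mono[OF b1(1), of "\<bar>u\<bar>"] mult_left_mono[OF b1(2), of "\<bar>v\<bar>"]
      by (simp_all add: abs_mult[symmetric] abs_le_iff)
    then have "(v - u) * m \<le> e + 2 * d * (\<bar>u\<bar> + \<bar>v\<bar>)" using 1 2 3 by (simp add: algebra_simps)
    also have "\<dots> \<le> 2 * e" using de by simp
    also have "2 * e < 3 * e" using e by simp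
    also have "3 * e = (v - u) * m" by (simp add: e_def)
    finally show False by simp
  qed
  then have "m = 0" unfolding m_def by (simp add: zero_less_measure_iff)
  then show ?thesis using Em unfolding m_def E_def[symmetric] by (simp add: negligible_iff_measure)
qed

text \<open>Intervals of slope above \<open>v\<close> covering half of a set of measure
  \<open>m\<close> produce an increment above \<open>v * m / 2\<close>, which exceeds 1 for large
  \<open>v\<close>. Absolute continuity forbids this only for small total length, hence the
  localisation to a ball \<open>U\<close> of measure below \<open>d\<close>.\<close>

lemma AC_slopes_bounded:
  assumes ac: "absolutely_continuous_on_interval a b F"
  shows "negligible (\<Inter>v::nat. fine_points a b (\<lambda>s t. F t - F s > real v * (t - s)))" (is "negligible ?E")
proof -
  define E0 where "E0 = ?E"
  have E0v: "E0 \<subseteq> fine_points a b (\<lambda>s t. F t - F s > real v * (t - s))" for v :: nat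
    unfolding E0_def by blast
  have Em: "E0 \<in> sets lebesgue" unfolding E0_def
    using fine_points_lmeasurable by (intro sets.countable_INT''[OF _ countableI_type]) (auto simp: fmeasurableD)
  have "negligible E0"
  proof (subst locally_negligible_alt, intro ballI)
  fix c assume c: "c \<in> E0"
  obtain d where d: "d > 0" and acd: "\<forall>S. finite S \<and> (\<forall>(s, t)\<in>S. a \<le> s \<and> s \<le> t \<and> t \<le> b) \<and>
        pairwise (\<lambda>(s, t) (s', t'). disjnt {s<..<t} {s'<..<t'}) S \<and>
        (\<Sum>(s, t)\<in>S. t - s) < d \<longrightarrow> (\<Sum>(s, t)\<in>S. \<bar>F t - F s\<bar>) < 1"
      using ac zero_less_one unfolding absolutely_continuous_on_interval_def by blast
  define U where "U = ball c (d / 4)"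
  have U: "open U" "U \<in> lmeasurable" "measure lebesgue U < d" "c \<in> U"
    using d by (auto simp: U_def content_ball unit_ball_vol_1)
  have EU: "E0 \<inter> U \<in> lmeasurable" using Em U by (intro fmeasurableI2[OF U(2)]) auto
  define m where "m = measure lebesgue (E0 \<inter> U)"
  have "\<not> m > 0"
  proof
    assume m: "m > 0"
    obtain v :: nat where v: "real v > 2 / m" using reals_Archimedean2 by blast
    have sub: "E0 \<inter> U \<subseteq> fine_points a b (\<lambda>s t. F t - F s > real v * (t - s))" using E0v[of v] by blast
    have m2: "m / 2 > 0" using m by simp
    obtain C where C: "finite C" "\<forall>(s, t)\<in>C. a \<le> s \<and> s < t \<and> t \<le> b \<and> {s..t} \<subseteq> U \<and> F t - F s > real v * (t - s)"
      "pairwise (\<lambda>(s, t) (s', t'). disjnt {s<..<t} {s'<..<t'}) C"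
      "measure lebesgue (E0 \<inter> U - (\<Union>(s,t)\<in>C. {s<..<t})) < m / 2"
      by (rule fine_points_cover[OF sub EU U(1) Int_lower2 m2]) (rule that)
    define X where "X = (\<Union>(s,t)\<in>C. {s<..<t})"
    have Xs: "X \<in> sets lebesgue" unfolding X_def by (auto intro!: sets.finite_UN C simp: split_beta)
    have "X \<subseteq> {a<..<b}" unfolding X_def using C(2) by fastforce
    then have Xm: "X \<in> lmeasurable" using Xs by (intro bounded_set_imp_lmeasurable) (rule bounded_subset[of "{a<..<b}"], auto)
    define l where "l = (\<Sum>(s, t)\<in>C. t - s)"
    have lX: "l = measure lebesgue X" unfolding l_def X_def
      using C by (intro sum_lengths_eq_measure) auto
    have "m \<le> measure lebesgue ((E0 \<inter> U - X) \<union> X)" unfolding m_def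
      using EU Xm by (intro measure_mono_fmeasurable fmeasurable.Un fmeasurable_Diff) (auto simp: fmeasurableD)
    also have "\<dots> \<le> measure lebesgue (E0 \<inter> U - X) + measure lebesgue X"
      using EU Xm by (intro measure_Un_le) (auto simp: fmeasurableD)
    finally have "m / 2 < l" using C(4) lX unfolding X_def[symmetric] by simp
    then have "2 / m * (m / 2) \<le> real v * l" using v m by (intro mult_mono) auto
    then have "1 \<le> real v * l" using m by simp
    also have "real v * l \<le> (\<Sum>(s, t)\<in>C. F t - F s)" unfolding l_def sum_distrib_left
      using C(2) by (intro sum_mono) auto
    also have "\<dots> \<le> (\<Sum>(s, t)\<in>C. \<bar>F t - F s\<bar>)" by (intro sum_mono) auto
    also have "\<dots> < 1"
    proof -
      have "l \<le> measure lebesgue U" unfolding l_def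
      proof (rule measure_le_of_sub[OF U(2) C(1) _ C(3)])
        show "\<forall>(s, t)\<in>C. s \<le> t \<and> {s<..<t} \<subseteq> U" using C(2) by fastforce
      qed
      then have "(\<Sum>(s, t)\<in>C. t - s) < d" using U(3) l_def by simp
      moreover have "\<forall>(s, t)\<in>C. a \<le> s \<and> s \<le> t \<and> t \<le> b" using C(2) by fastforce
      ultimately show ?thesis using acd C(1,3) by blast
    qed
    finally show False by simp
  qed
  then have "m = 0" unfolding m_def by (simp add: zero_less_measure_iff)
  then have "negligible (E0 \<inter> U)" using EU unfolding m_def by (simp add: negligible_iff_measure)
  then show "\<exists>V. openin (top_of_set E0) V \<and> c \<in> V \<and> negligible V"
    using U c by (intro exI[of _ "E0 \<inter> U"]) (auto simp: openin_open)
qed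
  then show ?thesis unfolding E0_def .
qed

text \<open>Off the exceptional set the slopes of \<open>F\<close> over short intervals straddling
  \<open>x\<close> stay bounded, and no two rationals separate their lower and upper limits, so they
  converge; the limit is the supremum \<open>D\<close> of the levels exceeded arbitrarily close to
  \<open>x\<close>. Continuity of \<open>F\<close> then lets one end point move to
  \<open>x\<close>.\<close>

lemma AC_differentiable_ae:
  assumes ac: "absolutely_continuous_on_interval a b F"
  shows "\<exists>N. negligible N \<and> (\<forall>x\<in>{a<..<b} - N. F differentiable at x)"
proof -
  define lo where "lo u = fine_points a b (\<lambda>s t. F t - F s < u * (t - s))" for u
  define hi where "hi v = fine_points a b (\<lambda>s t. F t - F s > v * (t - s))" for v
  define lo' where "lo' v = fine_points a b (\<lambda>s t. - F t - - F s > v * (t - s))" for v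
  define N where "N = (\<Union>p\<in>{p::rat \<times> rat. fst p < snd p}. lo (of_rat (fst p)) \<inter> hi (of_rat (snd p)))
     \<union> (\<Inter>v::nat. hi (real v)) \<union> (\<Inter>v::nat. lo' (real v))"
  have "negligible N"
  proof -
    have "negligible (\<Union>((\<lambda>p. lo (of_rat (fst p)) \<inter> hi (of_rat (snd p))) ` {p::rat \<times> rat. fst p < snd p}))"
    proof (rule negligible_countable_Union)
      show "countable ((\<lambda>p. lo (of_rat (fst p)) \<inter> hi (of_rat (snd p))) ` {p::rat \<times> rat. fst p < snd p})"
        by (intro countable_image countableI_type)
    qed (auto simp: lo_def hi_def of_rat_less intro: AC_slopes_agree[OF ac])
    moreover have "negligible (\<Inter>v::nat. hi (real v))" unfolding hi_def by (rule AC_slopes_bounded[OF ac])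
    moreover have "negligible (\<Inter>v::nat. lo' (real v))" unfolding lo'_def by (rule AC_slopes_bounded[OF AC_neg[OF ac]])
    ultimately show ?thesis unfolding N_def by (intro negligible_Un)
  qed
  moreover have "F differentiable at x" if x: "x \<in> {a<..<b} - N" for x
  proof -
    have nhi: "\<exists>d>0. \<forall>s t. a \<le> s \<longrightarrow> s < x \<longrightarrow> x < t \<longrightarrow> t \<le> b \<longrightarrow> t - s < d \<longrightarrow> F t - F s \<le> v * (t - s)"
      if "x \<notin> hi v" for v
      using that unfolding hi_def fine_points_def by (clarsimp simp: not_less) (meson not_le)
    have nlo: "\<exists>d>0. \<forall>s t. a \<le> s \<longrightarrow> s < x \<longrightarrow> x < t \<longrightarrow> t \<le> b \<longrightarrow> t - s < d \<longrightarrow> F t - F s \<ge> u * (t - s)"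
      if "x \<notin> lo u" for u
      using that unfolding lo_def fine_points_def by (clarsimp simp: not_less) (meson not_le)
    have hi_mono: "x \<in> hi w" if vw: "x \<in> hi v" "w \<le> v" for v w
      unfolding hi_def fine_points_def
    proof (intro CollectI allI impI)
      fix d :: real assume "d > 0"
      then obtain s t where st: "a \<le> s" "s < x" "x < t" "t \<le> b" "t - s < d" "F t - F s > v * (t - s)"
        using vw(1) unfolding hi_def fine_points_def by blast
      have "w * (t - s) \<le> v * (t - s)" using vw(2) st by (intro mult_right_mono) auto
      then have "F t - F s > w * (t - s)" using st(6) by linarith
      then show "\<exists>s t. a \<le> s \<and> s < x \<and> x < t \<and> t \<le> b \<and> t - s < d \<and> F t - F s > w * (t - s)"
        using st by (intro exI[of _ s] exI[of _ t]) auto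
    qed
    define A where "A = {q. x \<in> hi q}"
    obtain v :: nat where v: "x \<notin> hi (real v)" using x unfolding N_def by blast
    have bdd: "bdd_above A"
      using hi_mono v unfolding A_def bdd_above_def by (metis linear mem_Collect_eq)
    obtain v' :: nat where v': "x \<notin> lo' (real v')" using x unfolding N_def by blast
    \<comment> \<open>The supremum defining \<open>D\<close> needs a nonempty set: short symmetric
      intervals have slope at least \<open>- real v'\<close>, because \<open>x\<close> is outside
      \<open>lo' (real v')\<close>.\<close>
    have "- real v' - 1 \<in> A" unfolding A_def hi_def fine_points_def
    proof (intro CollectI allI impI)
      fix d :: real assume d: "d > 0"
      obtain d' where d': "d' > 0" "\<And>s t. a \<le> s \<Longrightarrow> s < x \<Longrightarrow> x < t \<Longrightarrow> t \<le> b \<Longrightarrow> t - s < d' \<Longrightarrow> - F t - - F s \<le> real v' * (t - s)"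
        using v' unfolding lo'_def fine_points_def by (clarsimp simp: not_less) (meson not_le)
      define r0 where "r0 = min (min d d') (min (x - a) (b - x))"
      have r0: "r0 > 0" "r0 \<le> d" "r0 \<le> d'" "r0 \<le> x - a" "r0 \<le> b - x"
        using d d'(1) x by (auto simp: r0_def)
      define r where "r = r0 / 3"
      have r: "r > 0" "x - r \<ge> a" "x + r \<le> b" "(x + r) - (x - r) < d'" "(x + r) - (x - r) < d"
        using r0 by (simp_all add: r_def)
      have "- F (x + r) - - F (x - r) \<le> real v' * ((x + r) - (x - r))"
        using r by (intro d'(2)) auto
      moreover have "(- real v' - 1) * ((x + r) - (x - r)) = - real v' * ((x + r) - (x - r)) - 2 * r"
        by (simp add: algebra_simps)
      ultimately have "F (x + r) - F (x - r) > (- real v' - 1) * ((x + r) - (x - r))" using r by simp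
      then show "\<exists>s t. a \<le> s \<and> s < x \<and> x < t \<and> t \<le> b \<and> t - s < d \<and> F t - F s > (- real v' - 1) * (t - s)"
        using r by (intro exI[of _ "x - r"] exI[of _ "x + r"]) auto
    qed
    then have ne: "A \<noteq> {}" by blast
    define D where "D = Sup A"
    have key: "\<exists>d>0. \<forall>s t. a \<le> s \<longrightarrow> s < x \<longrightarrow> x < t \<longrightarrow> t \<le> b \<longrightarrow> t - s < d \<longrightarrow> \<bar>F t - F s - D * (t - s)\<bar> \<le> e * (t - s)"
      if e: "e > 0" for e
    proof -
      have "x \<notin> hi (D + e)" using cSup_upper[OF _ bdd, of "D + e"] e unfolding A_def D_def by auto
      then obtain d1 where d1: "d1 > 0" "\<And>s t. a \<le> s \<Longrightarrow> s < x \<Longrightarrow> x < t \<Longrightarrow> t \<le> b \<Longrightarrow> t - s < d1 \<Longrightarrow> F t - F s \<le> (D + e) * (t - s)"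
        using nhi by blast
      \<comment> \<open>Rationals with \<open>D - e < u < D - e / 2 < w < D\<close>: the level
        \<open>w\<close> is exceeded arbitrarily near \<open>x\<close>, so slopes below
        \<open>u\<close> cannot occur arbitrarily near \<open>x\<close>.\<close>
      obtain w :: rat where w: "D - e / 2 < of_rat w" "of_rat w < D" using of_rat_dense[of "D - e / 2" D] e by auto
      obtain u :: rat where u: "D - e < of_rat u" "of_rat u < D - e / 2" using of_rat_dense[of "D - e" "D - e / 2"] e by auto
      obtain q where q: "q \<in> A" "of_rat w < q" using less_cSup_iff[OF ne bdd, of "of_rat w"] w unfolding D_def by auto
      have "x \<in> hi (of_rat w)" using hi_mono[of q "of_rat w"] q unfolding A_def by auto
      moreover have "u < w" using u w by (metis of_rat_less order.strict_trans)
      ultimately have "x \<notin> lo (of_rat u)" using x unfolding N_def by force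
      then obtain d2 where d2: "d2 > 0" "\<And>s t. a \<le> s \<Longrightarrow> s < x \<Longrightarrow> x < t \<Longrightarrow> t \<le> b \<Longrightarrow> t - s < d2 \<Longrightarrow> F t - F s \<ge> of_rat u * (t - s)"
        using nlo by blast
      have "\<bar>F t - F s - D * (t - s)\<bar> \<le> e * (t - s)"
        if st: "a \<le> s" "s < x" "x < t" "t \<le> b" "t - s < min d1 d2" for s t
      proof -
        have "(D - e) * (t - s) \<le> of_rat u * (t - s)" using u st by (intro mult_right_mono) auto
        then show ?thesis using d1(2)[of s t] d2(2)[of s t] st by (simp add: abs_le_iff algebra_simps)
      qed
      then show ?thesis using d1(1) d2(1) by (intro exI[of _ "min d1 d2"]) auto
    qed
    have cont: "continuous_on {a..b} F" by (rule AC_imp_continuous_on[OF ac])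
    have "(F has_derivative (\<lambda>h. D * h)) (at x)"
      unfolding has_derivative_within_alt
    proof (intro conjI bounded_linear_mult_right allI impI)
      fix e :: real assume e: "e > 0"
      obtain d where d: "d > 0" "\<And>s t. a \<le> s \<Longrightarrow> s < x \<Longrightarrow> x < t \<Longrightarrow> t \<le> b \<Longrightarrow> t - s < d \<Longrightarrow> \<bar>F t - F s - D * (t - s)\<bar> \<le> e * (t - s)"
        using key[OF e] by blast
      define r where "r = min (d / 2) (min (x - a) (b - x))"
      have r: "r > 0" using d x by (simp add: r_def)
      \<comment> \<open>The bound for intervals from \<open>s < x\<close> to \<open>y\<close> passes
        to \<open>s = x\<close> by continuity.\<close>
      have right: "\<bar>F y - F x - D * (y - x)\<bar> - e * (y - x) \<le> 0" if y: "x < y" "y - x < r" for y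
      proof -
        have "(\<lambda>s. \<bar>F y - F s - D * (y - s)\<bar> - e * (y - s)) x \<le> 0"
        proof (rule continuous_le_on_closure[where f = "\<lambda>s. \<bar>F y - F s - D * (y - s)\<bar> - e * (y - s)" and S = "{x - r<..<x}"])
          show "continuous_on (closure {x - r<..<x}) (\<lambda>s. \<bar>F y - F s - D * (y - s)\<bar> - e * (y - s))"
            using r x by (intro continuous_intros continuous_on_subset[OF cont]) (auto simp: r_def)
          show "x \<in> closure {x - r<..<x}" using r by simp
          show "\<bar>F y - F s - D * (y - s)\<bar> - e * (y - s) \<le> 0" if "s \<in> {x - r<..<x}" for s
            using d(2)[of s y] that y by (auto simp: r_def)
        qed
        then show ?thesis by simp
      qed
      have left: "\<bar>F x - F y - D * (x - y)\<bar> - e * (x - y) \<le> 0" if y: "y < x" "x - y < r" for y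
      proof -
        have "(\<lambda>s. \<bar>F s - F y - D * (s - y)\<bar> - e * (s - y)) x \<le> 0"
        proof (rule continuous_le_on_closure[where f = "\<lambda>s. \<bar>F s - F y - D * (s - y)\<bar> - e * (s - y)" and S = "{x<..<x + r}"])
          show "continuous_on (closure {x<..<x + r}) (\<lambda>s. \<bar>F s - F y - D * (s - y)\<bar> - e * (s - y))"
            using r x by (intro continuous_intros continuous_on_subset[OF cont]) (auto simp: r_def)
          show "x \<in> closure {x<..<x + r}" using r by simp
          show "\<bar>F s - F y - D * (s - y)\<bar> - e * (s - y) \<le> 0" if "s \<in> {x<..<x + r}" for s
            using d(2)[of y s] that y by (auto simp: r_def)
        qed
        then show ?thesis by simp
      qed
      have "norm (F y - F x - D * (y - x)) \<le> e * norm (y - x)" if "norm (y - x) < r" for y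
      proof -
        consider "y = x" | "x < y" | "y < x" by linarith
        then show ?thesis
        proof cases
          case 3
          have "F x - F y - D * (x - y) = - (F y - F x - D * (y - x))" by (simp add: algebra_simps)
          then show ?thesis using left[of y] 3 that by (simp only: abs_minus_cancel real_norm_def) auto
        qed (use right[of y] that in auto)
      qed
      then show "\<exists>d>0. \<forall>y\<in>UNIV. norm (y - x) < d \<longrightarrow> norm (F y - F x - D * (y - x)) \<le> e * norm (y - x)"
        using r by blast
    qed
    then show ?thesis by (auto simp: differentiable_def)
  qed
  ultimately show ?thesis by blast
qed

text \<open>The derivative bound is asked only at points of differentiability, which matches the
  supremum in \<open>C_const\<close>; these are almost all points.\<close>

lemma AC_increment_le_of_deriv:
  fixes F P :: "real \<Rightarrow> real"
  assumes ac: "absolutely_continuous_on_interval a b F" and ab: "a \<le> b"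
    and P: "\<And>x. x \<in> {a..b} \<Longrightarrow> (P has_real_derivative g x) (at x)" and g: "\<And>x. x \<in> {a..b} \<Longrightarrow> g x \<ge> 0"
    and der: "\<And>x. x \<in> {a<..<b} \<Longrightarrow> F differentiable at x \<Longrightarrow> deriv F x \<le> g x"
  shows "F b - F a \<le> P b - P a"
proof -
  obtain N where N: "negligible N" "\<And>x. x \<in> {a<..<b} - N \<Longrightarrow> F differentiable at x"
    using AC_differentiable_ae[OF ac] by blast
  show ?thesis
  proof (rule AC_increment_le[OF ac ab, of "N \<union> {a, b}"])
    show "negligible (N \<union> {a, b})" using N(1) by (simp add: negligible_Un negligible_insert)
    show "mono_on {a..b} P"
    proof (rule mono_onI)
      fix s t assume st: "s \<in> {a..b}" "t \<in> {a..b}" "s \<le> t"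
      show "P s \<le> P t"
        by (rule DERIV_nonneg_imp_nondecreasing[OF st(3)]) (use st P g in \<open>meson atLeastAtMost_iff order_trans\<close>)
    qed
    show "\<exists>D E. (F has_real_derivative D) (at x within {a..b}) \<and> (P has_real_derivative E) (at x within {a..b}) \<and> D \<le> E"
      if x: "x \<in> {a..b} - (N \<union> {a, b})" for x
    proof -
      have "F differentiable at x" using N x by auto
      moreover have "(F has_real_derivative deriv F x) (at x)" 
        using calculation by (metis DERIV_deriv_iff_real_differentiable)
      ultimately show ?thesis using der[of x] P[of x] x
        by (intro exI[of _ "deriv F x"] exI[of _ "g x"]) (auto intro: has_field_derivative_at_within)
    qed
  qed
qed

section \<open>Smooth functions\<close>

text \<open>The functions \<open>t ^ (-k) * exp (- 1 / t)\<close> continued by zero: up to linear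
  combinations the family is closed under differentiation, and \<open>flat 0\<close> is the
  classical building block of bump functions.\<close>

definition flat :: "nat \<Rightarrow> real \<Rightarrow> real" where
  "flat k t = (if t > 0 then inverse t ^ k * exp (- inverse t) else 0)"

text \<open>This is the difference quotient at 0; with \<open>y = 1 / t\<close> it becomes the decay
  of \<open>y ^ (k + 1) / exp y\<close>.\<close>

lemma flat_over_tendsto_0: "((\<lambda>t. flat k t / t) \<longlongrightarrow> 0) (at 0)"
proof -
  have "((\<lambda>y::real. y ^ Suc k / exp y) \<longlongrightarrow> 0) at_top" by (rule tendsto_power_div_exp_0)
  then have "((\<lambda>t::real. inverse t ^ Suc k / exp (inverse t)) \<longlongrightarrow> 0) (at_right 0)"
    by (rule filterlim_compose[OF _ filterlim_inverse_at_top_right])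
  then have "((\<lambda>t. flat k t / t) \<longlongrightarrow> 0) (at_right 0)"
    by (rule Lim_transform_eventually)
      (auto simp: eventually_at_filter flat_def exp_minus divide_simps)
  moreover have "((\<lambda>t. flat k t / t) \<longlongrightarrow> 0) (at_left 0)"
    by (rule Lim_transform_eventually[of "\<lambda>_. 0"]) (auto simp: eventually_at_filter flat_def)
  ultimately show ?thesis by (simp add: filterlim_split_at)
qed

lemma flat_has_derivative:
  "(flat k has_real_derivative flat (k + 2) t - real k * flat (k + 1) t) (at t)"
proof -
  consider "t > 0" | "t = 0" | "t < 0" by linarith
  then show ?thesis
  proof cases
    case 1
    have "((\<lambda>t. inverse t ^ k * exp (- inverse t)) has_real_derivative flat (k + 2) t - real k * flat (k + 1) t) (at t)"
    proof -
      have d1: "((\<lambda>t. inverse t ^ k) has_real_derivative - real k * inverse t ^ (k + 1)) (at t)"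
        using DERIV_power[OF DERIV_inverse[of t], of k] 1
        by (cases k) (simp_all add: algebra_simps)
      have d2: "((\<lambda>t. exp (- inverse t)) has_real_derivative exp (- inverse t) * (inverse t * inverse t)) (at t)"
        using 1 by (auto intro!: derivative_eq_intros simp: power2_eq_square)
      show ?thesis using DERIV_mult[OF d1 d2] 1
        by (simp add: flat_def algebra_simps power_add)
    qed
    then show ?thesis
      by (rule has_field_derivative_transform_within_open[of _ _ _ "{0<..}"]) (use 1 in \<open>auto simp: flat_def\<close>)
  next
    case 2
    then show ?thesis using flat_over_tendsto_0[of k]
      by (simp add: has_field_derivative_iff flat_def)
  next
    case 3
    have "((\<lambda>t::real. 0::real) has_real_derivative flat (k + 2) t - real k * flat (k + 1) t) (at t)"
      using 3 by (simp add: flat_def)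
    then show ?thesis
      by (rule has_field_derivative_transform_within_open[of _ _ _ "{..<0}"]) (use 3 in \<open>auto simp: flat_def\<close>)
  qed
qed

text \<open>A syntactic class closed under differentiation, so that smoothness of the test functions built from
  it needs no explicit formulas for higher derivatives; likewise \<open>smooth_fun\<close> in several variables.\<close>

inductive smooth_real :: "(real \<Rightarrow> real) \<Rightarrow> bool" where
  flat: "smooth_real (flat k)"
| const: "smooth_real (\<lambda>_. c)"
| ident: "smooth_real (\<lambda>t. t)"
| add: "smooth_real f \<Longrightarrow> smooth_real g \<Longrightarrow> smooth_real (\<lambda>t. f t + g t)"
| mult: "smooth_real f \<Longrightarrow> smooth_real g \<Longrightarrow> smooth_real (\<lambda>t. f t * g t)"
| comp: "smooth_real f \<Longrightarrow> smooth_real g \<Longrightarrow> smooth_real (\<lambda>t. f (g t))"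
| antideriv: "smooth_real f \<Longrightarrow> (\<And>t. (F has_real_derivative f t) (at t)) \<Longrightarrow> smooth_real F"

lemma smooth_real_derivative:
  assumes "smooth_real f"
  shows "\<exists>f'. smooth_real f' \<and> (\<forall>t. (f has_real_derivative f' t) (at t))"
  using assms
proof induction
    case (flat k)
    have "smooth_real (\<lambda>t. flat (k + 2) t + (- real k) * flat (k + 1) t)"
      by (intro smooth_real.intros)
    then show ?case using flat_has_derivative[of k] by (intro exI conjI) (assumption, simp)
  next
    case (const c)
    then show ?case by (intro exI[of _ "\<lambda>_. 0"]) (auto intro: smooth_real.intros)
  next
    case ident
    then show ?case by (intro exI[of _ "\<lambda>_. 1"]) (auto intro: smooth_real.intros)
  next
    case (add f g)
    obtain f' where f': "smooth_real f'" "\<And>t. (f has_real_derivative f' t) (at t)" using add.IH(1) by blast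
    obtain g' where g': "smooth_real g'" "\<And>t. (g has_real_derivative g' t) (at t)" using add.IH(2) by blast
    have "smooth_real (\<lambda>t. f' t + g' t)" using f' g' by (intro smooth_real.add)
    then show ?case using DERIV_add[OF f'(2) g'(2)] by (intro exI conjI allI)
  next
    case (mult f g)
    obtain f' where f': "smooth_real f'" "\<And>t. (f has_real_derivative f' t) (at t)" using mult.IH(1) by blast
    obtain g' where g': "smooth_real g'" "\<And>t. (g has_real_derivative g' t) (at t)" using mult.IH(2) by blast
    have "smooth_real (\<lambda>t. f' t * g t + g' t * f t)"
      using f' g' mult.hyps by (intro smooth_real.add smooth_real.mult)
    then show ?case using DERIV_mult[OF f'(2) g'(2)] by (intro exI conjI allI)
  next
    case (comp f g)
    obtain f' where f': "smooth_real f'" "\<And>t. (f has_real_derivative f' t) (at t)" using comp.IH(1) by blast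
    obtain g' where g': "smooth_real g'" "\<And>t. (g has_real_derivative g' t) (at t)" using comp.IH(2) by blast
    have "smooth_real (\<lambda>t. f' (g t) * g' t)"
      using f' g' comp.hyps by (intro smooth_real.mult[OF smooth_real.comp[of f' g]])
    moreover have "((\<lambda>t. f (g t)) has_real_derivative f' (g t) * g' t) (at t)" for t
      by (rule DERIV_chain2[OF f'(2) g'(2)])
    ultimately show ?case by (intro exI[of _ "\<lambda>t. f' (g t) * g' t"]) simp
  next
    case (antideriv f F)
    then show ?case by (intro exI[of _ f]) simp
qed

lemma smooth_real_isCont: "smooth_real f \<Longrightarrow> isCont f x"
  using smooth_real_derivative[of f] by (auto intro: DERIV_isCont)

text \<open>\<open>B\<close> is a smooth substitute for \<open>max 0\<close>, \<open>B1\<close> for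
  the Heaviside step and \<open>\<beta>\<close> for the point mass. The rescaled
  \<open>d * B (t / d)\<close> differs from \<open>max 0 t\<close> by at most \<open>2 * d\<close>,
  while \<open>\<beta> (t / d) / d\<close> has integral 1 and lives on an interval of width
  \<open>2 * d\<close>.\<close>

lemma smooth_hinge:
  obtains B B1 \<beta> where "smooth_real B" "smooth_real B1" "continuous_on UNIV \<beta>"
    "\<forall>t. (B has_real_derivative B1 t) (at t)" "\<forall>t. (B1 has_real_derivative \<beta> t) (at t)"
    "\<forall>t. \<beta> t \<ge> 0" "\<forall>t. \<bar>t\<bar> \<ge> 1 \<longrightarrow> \<beta> t = 0"
    "\<forall>t. 0 \<le> B1 t \<and> B1 t \<le> 1" "\<forall>t\<le>-1. B1 t = 0" "\<forall>t\<ge>1. B1 t = 1"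
    "\<forall>t\<le>-1. B t = 0" "\<forall>t\<ge>1. B t = B 1 + (t - 1)" "\<forall>t. \<bar>B t - max 0 t\<bar> \<le> 2"
proof -
  have antideriv: "\<exists>F. \<forall>t. (F has_real_derivative f t) (at t)" if "smooth_real f" for f
  proof -
    have "\<exists>F. \<forall>x. -\<infinity> < ereal x \<longrightarrow> ereal x < \<infinity> \<longrightarrow> (F has_vector_derivative f x) (at x)"
      by (rule einterval_antiderivative) (use smooth_real_isCont[OF that] in auto)
    then show ?thesis by (simp add: has_real_derivative_iff_has_vector_derivative)
  qed
  \<comment> \<open>\<open>flat 0\<close> vanishes for nonpositive arguments, so the product
    vanishes outside \<open>(-1, 1)\<close>; the arguments are written in the form that the
    constructors of \<open>smooth_real\<close> produce.\<close>
  define b where "b t = flat 0 (t + 1) * flat 0 (1 + (-1) * t)" for t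
  have sb: "smooth_real b" unfolding b_def
    by (rule smooth_real.mult[OF
          smooth_real.comp[OF smooth_real.flat smooth_real.add[OF smooth_real.ident smooth_real.const]]
          smooth_real.comp[OF smooth_real.flat smooth_real.add[OF smooth_real.const
            smooth_real.mult[OF smooth_real.const smooth_real.ident]]]])
  have b0: "b t \<ge> 0" for t by (auto simp: b_def flat_def)
  have b1: "b t = 0" if "\<bar>t\<bar> \<ge> 1" for t using that by (auto simp: b_def flat_def)
  obtain F where F: "\<And>t. (F has_real_derivative b t) (at t)" using antideriv[OF sb] by auto
  have Fmono: "F s \<le> F t" if "s \<le> t" for s t
    by (rule DERIV_nonneg_imp_nondecreasing[OF that]) (use F b0 in blast)
  have constl: "f t = f (-1)"
    if d0: "\<And>x. x < -1 \<Longrightarrow> (f has_real_derivative 0) (at x)" and d: "\<And>x. (f has_real_derivative f' x) (at x)"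
      and t: "t \<le> -1" for f f' :: "real \<Rightarrow> real" and t
  proof (cases "t = -1")
    case False
    have "continuous_on {t..-1} f" using d by (meson DERIV_isCont continuous_at_imp_continuous_on)
    then have "f (-1) = f t" using DERIV_isconst_end[of t "-1" f] d0 t False by auto
    then show ?thesis by simp
  qed simp
  have constr: "f t = f 1"
    if d0: "\<And>x. x > 1 \<Longrightarrow> (f has_real_derivative 0) (at x)" and d: "\<And>x. (f has_real_derivative f' x) (at x)"
      and t: "t \<ge> 1" for f f' :: "real \<Rightarrow> real" and t
  proof (cases "t = 1")
    case False
    have "continuous_on {1..t} f" using d by (meson DERIV_isCont continuous_at_imp_continuous_on)
    then show ?thesis using DERIV_isconst_end[of 1 t f] d0 t False by auto
  qed simp
  have Fl: "F t = F (-1)" if "t \<le> -1" for t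
  proof (rule constl[OF _ F that])
    show "(F has_real_derivative 0) (at x)" if "x < -1" for x using F[of x] b1[of x] that by simp
  qed
  have Fr: "F t = F 1" if "t \<ge> 1" for t
  proof (rule constr[OF _ F that])
    show "(F has_real_derivative 0) (at x)" if "x > 1" for x using F[of x] b1[of x] that by simp
  qed
  \<comment> \<open>The mass of the bump, by which \<open>\<beta>\<close> is normalised.\<close>
  define m where "m = F 1 - F (-1)"
  have m: "m > 0"
  proof -
    have "F (-1) \<noteq> F 1"
    proof
      assume "F (-1) = F 1"
      then have "F t = F 1" if "t \<in> {-1<..<1}" for t
        using Fmono[of "-1" t] Fmono[of t 1] that by auto
      then have "((\<lambda>t. F 1) has_real_derivative b 0) (at 0)"
        using has_field_derivative_transform_within_open[OF F[of 0], of "{-1<..<1}" "\<lambda>_. F 1"] by auto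
      then have "b 0 = 0" using DERIV_unique[OF _ DERIV_const] by blast
      then show False by (simp add: b_def flat_def)
    qed
    then show ?thesis using Fmono[of "-1" 1] by (simp add: m_def)
  qed
  define \<beta> where "\<beta> t = (1 / m) * b t" for t
  define B1 where "B1 t = (1 / m) * (F t + (- F (-1)))" for t
  have s\<beta>: "smooth_real \<beta>" unfolding \<beta>_def by (rule smooth_real.mult[OF smooth_real.const sb])
  have sF: "smooth_real F" by (rule smooth_real.antideriv[OF sb F])
  have sB1: "smooth_real B1" unfolding B1_def
    by (rule smooth_real.mult[OF smooth_real.const smooth_real.add[OF sF smooth_real.const]])
  have dB1: "(B1 has_real_derivative \<beta> t) (at t)" for t
    unfolding B1_def \<beta>_def using m by (auto intro!: derivative_eq_intros F)
  have B1l: "B1 t = 0" if "t \<le> -1" for t using Fl[OF that] by (simp add: B1_def)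
  have B1r: "B1 t = 1" if "t \<ge> 1" for t using Fr[OF that] m by (simp add: B1_def m_def)
  have B1mono: "B1 s \<le> B1 t" if "s \<le> t" for s t
    using Fmono[OF that] m unfolding B1_def by (intro mult_left_mono) auto
  have B10: "0 \<le> B1 t" for t using B1mono[of "min t (-1)" t] B1l[of "min t (-1)"] by simp
  have B11: "B1 t \<le> 1" for t using B1mono[of t "max t 1"] B1r[of "max t 1"] by simp
  obtain H where H: "\<And>t. (H has_real_derivative B1 t) (at t)" using antideriv[OF sB1] by auto
  define B where "B t = H t + (- H (-1))" for t
  have dB: "(B has_real_derivative B1 t) (at t)" for t
    unfolding B_def by (auto intro!: derivative_eq_intros H)
  have sB: "smooth_real B" by (rule smooth_real.antideriv[OF sB1 dB])
  have Bl: "B t = 0" if "t \<le> -1" for t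
  proof -
    have "B t = B (-1)"
    proof (rule constl[OF _ dB that])
      show "(B has_real_derivative 0) (at x)" if "x < -1" for x using dB[of x] B1l[of x] that by simp
    qed
    then show ?thesis by (simp add: B_def)
  qed
  have Br: "B t = B 1 + (t - 1)" if "t \<ge> 1" for t
  proof -
    have "(\<lambda>t. B t - t) t = (\<lambda>t. B t - t) 1"
    proof (rule constr[of _ "\<lambda>t. B1 t - 1"])
      show "((\<lambda>t. B t - t) has_real_derivative 0) (at x)" if "x > 1" for x
        using B1r[of x] that by (auto intro!: derivative_eq_intros dB)
      show "((\<lambda>t. B t - t) has_real_derivative B1 x - 1) (at x)" for x
        by (auto intro!: derivative_eq_intros dB)
    qed (use that in auto)
    then show ?thesis by simp
  qed
  have Bbound: "0 \<le> B t - B s \<and> B t - B s \<le> t - s" if "s \<le> t" for s t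
  proof -
    have "B s \<le> B t" by (rule DERIV_nonneg_imp_nondecreasing[OF that]) (use dB B10 in blast)
    moreover have "(\<lambda>t. B t - t) t \<le> (\<lambda>t. B t - t) s"
    proof (rule DERIV_nonpos_imp_nonincreasing[OF that])
      show "\<exists>y. ((\<lambda>t. B t - t) has_real_derivative y) (at x) \<and> y \<le> 0" for x
        using B11[of x] by (intro exI[of _ "B1 x - 1"]) (auto intro!: derivative_eq_intros dB)
    qed
    ultimately show ?thesis by simp
  qed
  have Bm: "\<bar>B t - max 0 t\<bar> \<le> 2" for t
  proof -
    consider "t \<le> -1" | "-1 \<le> t" "t \<le> 1" | "t \<ge> 1" by linarith
    then show ?thesis
    proof cases
      case 1 then show ?thesis using Bl by simp
    next
      case 2 then show ?thesis using Bbound[of "-1" t] Bl[of "-1"] by (auto simp: max_def abs_le_iff)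
    next
      case 3 then show ?thesis using Br[of t] Bbound[of "-1" 1] Bl[of "-1"] by (auto simp: max_def abs_le_iff)
    qed
  qed
  have "continuous_on UNIV \<beta>"
    using smooth_real_isCont[OF s\<beta>] by (simp add: continuous_at_imp_continuous_on)
  then show thesis
  proof (rule that[OF sB sB1])
    show "\<forall>t. (B has_real_derivative B1 t) (at t)" by (intro allI dB)
    show "\<forall>t. (B1 has_real_derivative \<beta> t) (at t)" by (intro allI dB1)
    show "\<forall>t. \<beta> t \<ge> 0" using b0 m by (simp add: \<beta>_def)
    show "\<forall>t. \<bar>t\<bar> \<ge> 1 \<longrightarrow> \<beta> t = 0" using b1 by (simp add: \<beta>_def)
    show "\<forall>t. 0 \<le> B1 t \<and> B1 t \<le> 1" by (intro allI conjI B10 B11)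
    show "\<forall>t\<le>-1. B1 t = 0" by (intro allI impI B1l)
    show "\<forall>t\<ge>1. B1 t = 1" by (intro allI impI B1r)
    show "\<forall>t\<le>-1. B t = 0" by (intro allI impI Bl)
    show "\<forall>t\<ge>1. B t = B 1 + (t - 1)" by (intro allI impI Br)
    show "\<forall>t. \<bar>B t - max 0 t\<bar> \<le> 2" by (intro allI Bm)
  qed
qed

section \<open>Partial derivatives and smooth functions of several variables\<close>

lemma partial_has_derivative:
  fixes f :: "real^'n::finite \<Rightarrow> real"
  assumes "(f has_derivative f') (at x)"
  shows "partial i f x = f' (axis i 1)"
proof -
  have "((\<lambda>t. x + t *\<^sub>R axis i 1) has_derivative (\<lambda>t. t *\<^sub>R axis i (1::real))) (at 0)"
    by (auto intro!: derivative_eq_intros)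
  moreover have "(f has_derivative f') (at (x + 0 *\<^sub>R axis i 1))" using assms by simp
  ultimately have "((\<lambda>t. f (x + t *\<^sub>R axis i 1)) has_derivative (\<lambda>t. f' (t *\<^sub>R axis i 1))) (at 0)"
    by (rule has_derivative_compose)
  moreover have "f' (t *\<^sub>R axis i 1) = f' (axis i 1) * t" for t
    using linear_scale[OF has_derivative_linear[OF assms]] by simp
  ultimately have "((\<lambda>t. f (x + t *\<^sub>R axis i 1)) has_real_derivative f' (axis i 1)) (at 0)"
    by (simp add: has_field_derivative_def)
  then show ?thesis unfolding partial_def by (rule DERIV_imp_deriv)
qed

lemma partial_cong_open:
  assumes "open S" "x \<in> S" "\<And>y. y \<in> S \<Longrightarrow> f y = g y"
  shows "partial i f x = partial i g x"
proof -
  have "continuous_on UNIV (\<lambda>t::real. x + t *\<^sub>R axis i (1::real))" by (intro continuous_intros)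
  then have "open ((\<lambda>t::real. x + t *\<^sub>R axis i (1::real)) -` S)" using assms(1) by (simp add: open_vimage)
  moreover have "0 \<in> (\<lambda>t::real. x + t *\<^sub>R axis i (1::real)) -` S" using assms(2) by simp
  ultimately have "eventually (\<lambda>t. t \<in> (\<lambda>t::real. x + t *\<^sub>R axis i (1::real)) -` S) (nhds 0)"
    by (rule eventually_nhds_in_open)
  then have "eventually (\<lambda>t. f (x + t *\<^sub>R axis i 1) = g (x + t *\<^sub>R axis i 1)) (nhds 0)"
    by (rule eventually_mono) (use assms(3) in auto)
  then show ?thesis unfolding partial_def by (intro deriv_cong_ev refl)
qed

lemma partials_cong_open:
  assumes "open S" "x \<in> S" "\<And>y. y \<in> S \<Longrightarrow> f y = g y"
  shows "partials is f x = partials is g x"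
  using assms(2)
proof (induction "is" arbitrary: x)
  case Nil
  then show ?case using assms by (simp add: partials_def)
next
  case (Cons i "is")
  then show ?case using partial_cong_open[OF assms(1) Cons.prems, of "partials is f" "partials is g" i]
    by (simp add: partials_def)
qed

lemma partials_zero: "partials is (\<lambda>_::real^'n::finite. 0) x = 0"
proof (induction "is" arbitrary: x)
  case (Cons i "is")
  then have "partials is (\<lambda>_::real^'n. 0) = (\<lambda>_. 0)" by auto
  moreover have "partial i (\<lambda>_::real^'n. 0) x = 0" by (simp add: partial_def)
  ultimately show ?case by (simp add: partials_def)
qed (simp add: partials_def)

lemma partials_eq_0_outside_support:
  fixes f :: "real^'n::finite \<Rightarrow> real"
  assumes "x \<notin> closure {x. f x \<noteq> 0}"
  shows "partials is f x = 0"
proof -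
  have z: "f y = 0" if "y \<in> - closure {x. f x \<noteq> 0}" for y
    using that subsetD[OF closure_subset, of y "{x. f x \<noteq> 0}"] by auto
  have "partials is f x = partials is (\<lambda>_. 0) x"
  proof (rule partials_cong_open)
    show "open (- closure {x. f x \<noteq> 0})" by (rule open_Compl[OF closed_closure])
    show "x \<in> - closure {x. f x \<noteq> 0}" using assms by simp
  qed (rule z)
  then show ?thesis by (simp add: partials_zero)
qed

text \<open>The clause \<open>cong\<close> makes the class depend on values on \<open>S\<close>
  only: formulas for partial derivatives, for instance of powers of the norm, are available only
  there.\<close>

inductive smooth_fun :: "(real^'n::finite) set \<Rightarrow> (real^'n \<Rightarrow> real) \<Rightarrow> bool" for S where
  coord: "smooth_fun S (\<lambda>x. x $ i)"
| const: "smooth_fun S (\<lambda>_. c)"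
| add: "smooth_fun S f \<Longrightarrow> smooth_fun S g \<Longrightarrow> smooth_fun S (\<lambda>x. f x + g x)"
| mult: "smooth_fun S f \<Longrightarrow> smooth_fun S g \<Longrightarrow> smooth_fun S (\<lambda>x. f x * g x)"
| comp: "smooth_real h \<Longrightarrow> smooth_fun S f \<Longrightarrow> smooth_fun S (\<lambda>x. h (f x))"
| norm_powr: "0 \<notin> S \<Longrightarrow> smooth_fun S (\<lambda>x. norm x powr a)"
| cong: "smooth_fun S f \<Longrightarrow> (\<And>x. x \<in> S \<Longrightarrow> f x = g x) \<Longrightarrow> smooth_fun S g"

lemma norm_powr_has_derivative:
  fixes x :: "'a::real_inner"
  assumes "x \<noteq> 0"
  shows "((\<lambda>x. norm x powr a) has_derivative (\<lambda>h. a * norm x powr (a - 2) * (x \<bullet> h))) (at x)"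
proof -
  have 1: "((\<lambda>x. norm x) has_derivative (\<lambda>h. h \<bullet> sgn x)) (at x)"
    using has_derivative_norm[OF assms] by (simp add: inner_commute)
  have 2: "((\<lambda>t. t powr a) has_real_derivative a * norm x powr (a - 1)) (at (norm x))"
    using assms by (intro has_real_derivative_powr) auto
  have "((\<lambda>x. norm x powr a) has_derivative (\<lambda>h. a * norm x powr (a - 1) * (h \<bullet> sgn x))) (at x)"
    using has_derivative_compose[OF 1 2[unfolded has_field_derivative_def]] by simp
  moreover have "a * norm x powr (a - 1) * (h \<bullet> sgn x) = a * norm x powr (a - 2) * (x \<bullet> h)" for h
  proof -
    have "norm x powr (a - 1) = norm x powr (a - 2) * norm x"
      using assms powr_add[of "norm x" "a - 2" 1] by simp
    then show ?thesis using assms by (simp add: sgn_div_norm inner_commute)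
  qed
  ultimately show ?thesis by simp
qed

lemma partial_add:
  assumes "f differentiable at x" "g differentiable at x"
  shows "partial i (\<lambda>x. f x + g x) x = partial i f x + partial i g x"
proof -
  obtain f' where f: "(f has_derivative f') (at x)" using assms(1) unfolding differentiable_def by auto
  obtain g' where g: "(g has_derivative g') (at x)" using assms(2) unfolding differentiable_def by auto
  note fg = f g
  show ?thesis
    using partial_has_derivative[OF has_derivative_add[OF fg]] partial_has_derivative[OF fg(1)]
      partial_has_derivative[OF fg(2)] by simp
qed

lemma partial_mult:
  assumes "f differentiable at x" "g differentiable at x"
  shows "partial i (\<lambda>x. f x * g x) x = f x * partial i g x + partial i f x * g x"
proof -
  obtain f' where f: "(f has_derivative f') (at x)" using assms(1) unfolding differentiable_def by auto
  obtain g' where g: "(g has_derivative g') (at x)" using assms(2) unfolding differentiable_def by auto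
  note fg = f g
  show ?thesis
    using partial_has_derivative[OF has_derivative_mult[OF fg]] partial_has_derivative[OF fg(1)]
      partial_has_derivative[OF fg(2)] by simp
qed

lemma comp_has_derivative:
  assumes "(h has_real_derivative d) (at (f x))" "(f has_derivative f') (at x)"
  shows "((\<lambda>x. h (f x)) has_derivative (\<lambda>v. d * f' v)) (at x)"
  using has_derivative_compose[OF assms(2) assms(1)[unfolded has_field_derivative_def]] by simp

lemma partial_comp:
  assumes "(h has_real_derivative d) (at (f x))" "f differentiable at x"
  shows "partial i (\<lambda>x. h (f x)) x = d * partial i f x"
proof -
  obtain f' where f: "(f has_derivative f') (at x)" using assms(2) unfolding differentiable_def by auto
  show ?thesis
    using partial_has_derivative[OF comp_has_derivative[OF assms(1) f]] partial_has_derivative[OF f] by simp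
qed

lemma partial_norm_powr:
  fixes x :: "real^'n::finite"
  assumes "x \<noteq> 0"
  shows "partial i (\<lambda>x. norm x powr a) x = a * norm x powr (a - 2) * x $ i"
  using partial_has_derivative[OF norm_powr_has_derivative[OF assms]] by (simp add: inner_axis)

lemma partial_coord: "partial i (\<lambda>x. x $ j) x = (if i = j then 1 else 0)"
  using partial_has_derivative[OF bounded_linear_imp_has_derivative[OF bounded_linear_vec_nth], where x = x and i = i]
  by (auto simp: axis_def)

lemma smooth_fun_derivative:
  fixes f :: "real^'n::finite \<Rightarrow> real"
  assumes S: "open S" and "smooth_fun S f"
  shows "(\<forall>x\<in>S. f differentiable at x) \<and> (\<forall>i. smooth_fun S (partial i f))"
  using assms(2)
proof induction
  case (coord j)
  have "partial i (\<lambda>x::real^'n. x $ j) = (\<lambda>_. if i = j then 1 else 0)" for i by (simp add: partial_coord fun_eq_iff)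
  then show ?case by (auto intro: smooth_fun.const bounded_linear_imp_differentiable bounded_linear_vec_nth)
next
  case (const c)
  have "partial i (\<lambda>x::real^'n. c) = (\<lambda>_. 0)" for i by (simp add: partial_def fun_eq_iff)
  then show ?case by (auto intro: smooth_fun.const)
next
  case (add f g)
  have "smooth_fun S (partial i (\<lambda>x. f x + g x))" for i
  proof (rule smooth_fun.cong)
    show "smooth_fun S (\<lambda>x. partial i f x + partial i g x)" using add.IH by (intro smooth_fun.add) auto
  qed (use add.IH in \<open>simp add: partial_add\<close>)
  then show ?case using add.IH by simp
next
  case (mult f g)
  have "smooth_fun S (partial i (\<lambda>x. f x * g x))" for i
  proof (rule smooth_fun.cong)
    show "smooth_fun S (\<lambda>x. f x * partial i g x + partial i f x * g x)"
      using mult by (intro smooth_fun.add smooth_fun.mult) auto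
  qed (use mult.IH in \<open>simp add: partial_mult\<close>)
  then show ?case using mult.IH by simp
next
  case (comp h f)
  obtain h' where h': "smooth_real h'" "\<And>t. (h has_real_derivative h' t) (at t)"
    using smooth_real_derivative[OF comp.hyps(1)] by auto
  have "smooth_fun S (partial i (\<lambda>x. h (f x)))" for i
  proof (rule smooth_fun.cong)
    show "smooth_fun S (\<lambda>x. h' (f x) * partial i f x)"
      using comp h' by (intro smooth_fun.mult smooth_fun.comp[of h' S f]) auto
  qed (use comp.IH in \<open>simp add: partial_comp[OF h'(2)]\<close>)
  moreover have "(\<lambda>x. h (f x)) differentiable at x" if xS: "x \<in> S" for x
  proof -
    obtain f' where "(f has_derivative f') (at x)" using comp.IH xS unfolding differentiable_def by auto
    from comp_has_derivative[OF h'(2) this] show ?thesis by (rule differentiableI)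
  qed
  ultimately show ?case by simp
next
  case (norm_powr a)
  have nz: "x \<noteq> 0" if "x \<in> S" for x using that norm_powr by metis
  have "smooth_fun S (partial i (\<lambda>x. norm x powr a))" for i
  proof (rule smooth_fun.cong)
    show "smooth_fun S (\<lambda>x. a * norm x powr (a - 2) * x $ i)"
      using norm_powr by (intro smooth_fun.mult smooth_fun.const smooth_fun.norm_powr smooth_fun.coord) 
    show "a * norm x powr (a - 2) * x $ i = partial i (\<lambda>x. norm x powr a) x" if "x \<in> S" for x
      using partial_norm_powr[OF nz[OF that]] by simp
  qed
  moreover have "(\<lambda>x. norm x powr a) differentiable at x" if "x \<in> S" for x
    by (rule differentiableI[OF norm_powr_has_derivative[OF nz[OF that]]])
  ultimately show ?case by simp
next
  case (cong f g)
  have "smooth_fun S (partial i g)" for i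
  proof (rule smooth_fun.cong)
    show "smooth_fun S (partial i f)" using cong.IH by simp
    show "partial i f x = partial i g x" if "x \<in> S" for x
      by (rule partial_cong_open[OF S that]) (use cong.hyps in auto)
  qed
  moreover have "g differentiable at x" if x: "x \<in> S" for x
  proof -
    obtain f' where "(f has_derivative f') (at x)" using cong.IH x unfolding differentiable_def by auto
    then have "(g has_derivative f') (at x)"
      by (rule has_derivative_transform_within_open[OF _ S x]) (use cong.hyps in auto)
    then show ?thesis by (rule differentiableI)
  qed
  ultimately show ?case by simp
qed

lemma smooth_fun_partials: "open S \<Longrightarrow> smooth_fun S f \<Longrightarrow> smooth_fun S (partials is f)"
  by (induction "is") (auto simp: partials_def smooth_fun_derivative)

text \<open>Gluing: the formula for \<open>f\<close> may break down off \<open>S\<close>, for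
  example at the origin, but there \<open>f\<close> is locally zero.\<close>

lemma smooth_if_smooth_fun:
  assumes "open S" "smooth_fun S f" "open U" "\<And>x. x \<in> U \<Longrightarrow> f x = 0" "S \<union> U = UNIV"
  shows "smooth f"
  unfolding smooth_def
proof (intro allI)
  fix "is" and x
  show "partials is f differentiable at x"
  proof (cases "x \<in> S")
    case True
    then show ?thesis using smooth_fun_derivative[OF assms(1) smooth_fun_partials[OF assms(1,2)]] by blast
  next
    case False
    then have x: "x \<in> U" using assms(5) by blast
    have "partials is f y = 0" if "y \<in> U" for y
      using partials_cong_open[OF assms(3) that, of f "\<lambda>_. 0"] assms(4) by (simp add: partials_zero)
    then have "(partials is f has_derivative (\<lambda>_. 0)) (at x)"
      by (intro has_derivative_transform_within_open[OF has_derivative_const[of 0] assms(3) x]) simp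
    then show ?thesis by (rule differentiableI)
  qed
qed

section \<open>The fundamental lemma of the calculus of variations\<close>

lemma smooth_partials_continuous: "smooth f \<Longrightarrow> continuous_on S (partials is f)"
  unfolding smooth_def by (meson continuous_at_imp_continuous_on differentiable_imp_continuous_within)

lemma smooth_continuous: "smooth f \<Longrightarrow> continuous_on S f"
  using smooth_partials_continuous[of f S "[]"] by (simp add: partials_def)

lemma set_integrable_mult_bounded:
  fixes f g :: "'a::euclidean_space \<Rightarrow> real"
  assumes f: "set_integrable lebesgue K f" and g: "set_borel_measurable lebesgue K g"
    and b: "\<And>x. x \<in> K \<Longrightarrow> \<bar>g x\<bar> \<le> M"
  shows "set_integrable lebesgue K (\<lambda>x. f x * g x)"
proof -
  have "integrable lebesgue (\<lambda>x. M * (indicator K x *\<^sub>R f x))"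
    using f unfolding set_integrable_def by simp
  moreover have "(\<lambda>x. indicator K x *\<^sub>R (f x * g x)) \<in> borel_measurable lebesgue"
  proof -
    have "(\<lambda>x. (indicator K x *\<^sub>R f x) * (indicator K x *\<^sub>R g x)) \<in> borel_measurable lebesgue"
      using f g unfolding set_integrable_def set_borel_measurable_def by (intro borel_measurable_times) auto
    moreover have "(\<lambda>x. (indicator K x *\<^sub>R f x) * (indicator K x *\<^sub>R g x)) = (\<lambda>x. indicator K x *\<^sub>R (f x * g x))"
      by (auto simp: fun_eq_iff indicator_def)
    ultimately show ?thesis by simp
  qed
  ultimately show ?thesis unfolding set_integrable_def
  proof (rule Bochner_Integration.integrable_bound, intro AE_I2)
    fix x show "norm (indicator K x *\<^sub>R (f x * g x)) \<le> norm (M * (indicator K x *\<^sub>R f x))"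
    proof (cases "x \<in> K")
      case True
      have "\<bar>f x\<bar> * \<bar>g x\<bar> \<le> \<bar>f x\<bar> * \<bar>M\<bar>" using b[OF True] by (intro mult_left_mono) auto
      then show ?thesis using True by (simp add: abs_mult mult.commute)
    qed simp
  qed
qed

lemma compact_continuous_set_measurable:
  fixes g :: "'a::euclidean_space \<Rightarrow> real"
  assumes "compact K" "continuous_on K g"
  shows "set_borel_measurable lebesgue K g"
proof -
  have "K \<in> sets borel" using assms(1) by (intro borel_closed compact_imp_closed)
  then have "(\<lambda>x. indicator K x *\<^sub>R g x) \<in> borel_measurable borel"
    by (rule borel_measurable_continuous_on_indicator[OF _ assms(2)])
  then show ?thesis unfolding set_borel_measurable_def by (intro measurable_completion) simp
qed

lemma set_integrable_mult_continuous:
  fixes f g :: "'a::euclidean_space \<Rightarrow> real"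
  assumes f: "set_integrable lebesgue K f" and K: "compact K" "continuous_on K g"
  shows "set_integrable lebesgue K (\<lambda>x. f x * g x)"
proof -
  have "bounded (g ` K)" using K by (intro compact_imp_bounded compact_continuous_image)
  then obtain M where "\<forall>x\<in>K. \<bar>g x\<bar> \<le> M" unfolding bounded_iff by auto
  then show ?thesis
    by (intro set_integrable_mult_bounded[OF f compact_continuous_set_measurable[OF K]]) auto
qed

lemma set_integral_support:
  fixes f :: "'a::euclidean_space \<Rightarrow> real"
  assumes "K \<subseteq> U" "\<And>x. x \<in> U - K \<Longrightarrow> f x = 0"
  shows "(LINT x:U|lebesgue. f x) = (LINT x:K|lebesgue. f x)"
    and "set_integrable lebesgue U f \<longleftrightarrow> set_integrable lebesgue K f"
proof -
  have "(\<lambda>x. indicator U x *\<^sub>R f x) = (\<lambda>x. indicator K x *\<^sub>R f x)"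
    using assms by (auto simp: fun_eq_iff indicator_def)
  then show "(LINT x:U|lebesgue. f x) = (LINT x:K|lebesgue. f x)"
    "set_integrable lebesgue U f \<longleftrightarrow> set_integrable lebesgue K f"
    unfolding set_lebesgue_integral_def set_integrable_def by simp_all
qed

lemma smooth_fun_prod:
  "finite I \<Longrightarrow> (\<And>i. i \<in> I \<Longrightarrow> smooth_fun S (f i)) \<Longrightarrow> smooth_fun S (\<lambda>x. \<Prod>i\<in>I. f i x)"
  by (induction I rule: finite_induct) (auto intro: smooth_fun.intros(2,4))

text \<open>Products over the coordinates of smooth steps in \<open>k\<close> times the distance to
  each face. Such cut-offs turn a condition on test functions into one on integrals over
  boxes.\<close>

lemma box_bumps:
  fixes a b :: "real^'n::finite"
  obtains \<phi> where "\<forall>k. test_function (cbox a b) (\<phi> k)" "\<forall>k x. 0 \<le> \<phi> k x \<and> \<phi> k x \<le> 1"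
    "\<forall>k x. x \<notin> box a b \<longrightarrow> \<phi> k x = 0" "\<forall>x\<in>box a b. (\<lambda>k::nat. \<phi> k x) \<longlonglongrightarrow> 1"
proof -
  obtain B B1 \<beta> where "smooth_real B" and B1: "smooth_real B1" and "continuous_on UNIV \<beta>"
    "\<forall>t. (B has_real_derivative B1 t) (at t)" "\<forall>t. (B1 has_real_derivative \<beta> t) (at t)"
    "\<forall>t. \<beta> t \<ge> 0" "\<forall>t. \<bar>t\<bar> \<ge> 1 \<longrightarrow> \<beta> t = 0"
    and B1_01: "\<forall>t. 0 \<le> B1 t \<and> B1 t \<le> 1" and B1_0: "\<forall>t\<le>-1. B1 t = 0" and B1_1: "\<forall>t\<ge>1. B1 t = 1" and
    "\<forall>t\<le>-1. B t = 0" "\<forall>t\<ge>1. B t = B 1 + (t - 1)" "\<forall>t. \<bar>B t - max 0 t\<bar> \<le> 2"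
    by (rule smooth_hinge) (rule that)
  \<comment> \<open>The step \<open>B1\<close> is 0 up to -1 and 1 from 1 on; the shift by -1 makes
    a factor vanish at distance 0 from its face and equal 1 once \<open>k\<close> times the distance
    is at least 2.\<close>
  define \<phi> where "\<phi> k x = (\<Prod>i\<in>UNIV. B1 (real k * (x $ i + - a $ i) + -1) * B1 (real k * (b $ i + (-1) * x $ i) + -1))"
    for k :: nat and x :: "real^'n"
  have sm: "smooth_fun UNIV (\<phi> k)" for k
    unfolding \<phi>_def
    by (intro smooth_fun_prod finite smooth_fun.mult smooth_fun.comp[OF B1] smooth_fun.add smooth_fun.coord smooth_fun.const)
  have b01: "0 \<le> \<phi> k x \<and> \<phi> k x \<le> 1" for k x
    unfolding \<phi>_def using B1_01 by (auto intro!: prod_nonneg prod_le_1 mult_le_one mult_nonneg_nonneg)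
  have z: "\<phi> k x = 0" if xn: "x \<notin> box a b" for k x
  proof -
    obtain i where i: "x $ i \<le> a $ i \<or> b $ i \<le> x $ i" using xn by (auto simp: mem_box_cart not_less)
    then have "B1 (real k * (x $ i + - a $ i) + -1) * B1 (real k * (b $ i + (-1) * x $ i) + -1) = 0"
    proof
      assume "x $ i \<le> a $ i"
      then have "real k * (x $ i + - a $ i) \<le> 0" by (intro mult_nonneg_nonpos) auto
      then show ?thesis using B1_0 by simp
    next
      assume "b $ i \<le> x $ i"
      then have "real k * (b $ i + (-1) * x $ i) \<le> 0" by (intro mult_nonneg_nonpos) auto
      then show ?thesis using B1_0 by simp
    qed
    then show ?thesis unfolding \<phi>_def by (intro prod_zero) auto
  qed
  have supp: "closure {x. \<phi> k x \<noteq> 0} \<subseteq> cbox a b" for k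
  proof (rule closure_minimal)
    show "{x. \<phi> k x \<noteq> 0} \<subseteq> cbox a b" using z[of _ k] box_subset_cbox[of a b] by blast
  qed (rule closed_cbox)
  have "compact (closure {x. \<phi> k x \<noteq> 0})" for k
    using supp[of k] bounded_subset[OF bounded_cbox] by (auto simp: compact_eq_bounded_closed)
  moreover have "smooth (\<phi> k)" for k
    by (rule smooth_if_smooth_fun[OF open_UNIV sm open_empty]) auto
  ultimately have tf: "test_function (cbox a b) (\<phi> k)" for k
    using supp[of k] unfolding test_function_def by blast
  have lim: "(\<lambda>k::nat. \<phi> k x) \<longlonglongrightarrow> 1" if x: "x \<in> box a b" for x
  proof -
    have "(\<lambda>k::nat. B1 (real k * (x $ i + - a $ i) + -1) * B1 (real k * (b $ i + (-1) * x $ i) + -1)) \<longlonglongrightarrow> 1" for i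
    proof (rule tendsto_eventually)
      have one: "eventually (\<lambda>k::nat. B1 (real k * e + -1) = 1) sequentially" if "e > 0" for e
      proof -
        obtain K :: nat where K: "real K > 2 / e" using reals_Archimedean2 by blast
        have "B1 (real k * e + -1) = 1" if "k \<ge> K" for k
        proof -
          have "2 / e \<le> real k" using K that by linarith
          then have "2 \<le> real k * e" using \<open>e > 0\<close> by (simp add: field_simps)
          then show ?thesis using B1_1 by simp
        qed
        then show ?thesis by (rule eventually_sequentiallyI)
      qed
      have "x $ i + - a $ i > 0" "b $ i + (-1) * x $ i > 0" using x by (auto simp: mem_box_cart)
      from one[OF this(1)] one[OF this(2)]
      show "eventually (\<lambda>k::nat. B1 (real k * (x $ i + - a $ i) + -1) * B1 (real k * (b $ i + (-1) * x $ i) + -1) = 1) sequentially"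
        by eventually_elim simp
    qed
    then have "(\<lambda>k::nat. \<phi> k x) \<longlonglongrightarrow> (\<Prod>i\<in>(UNIV::'n set). 1)" unfolding \<phi>_def by (rule tendsto_prod)
    then show ?thesis by simp
  qed
  show thesis
  proof (rule that[of \<phi>])
    show "\<forall>k. test_function (cbox a b) (\<phi> k)" by (intro allI tf)
    show "\<forall>k x. 0 \<le> \<phi> k x \<and> \<phi> k x \<le> 1" by (intro allI b01)
    show "\<forall>k x. x \<notin> box a b \<longrightarrow> \<phi> k x = 0" by (intro allI impI z)
    show "\<forall>x\<in>box a b. (\<lambda>k::nat. \<phi> k x) \<longlonglongrightarrow> 1" by (intro ballI lim)
  qed
qed

lemma test_function_mono: "test_function U f \<Longrightarrow> U \<subseteq> V \<Longrightarrow> test_function V f"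
  unfolding test_function_def by blast

text \<open>Dominated convergence along the bumps of \<open>box_bumps\<close>; the faces of the box,
  where the bumps stay 0, form a null set.\<close>

lemma box_integral_eq_0:
  fixes f :: "real^'n::finite \<Rightarrow> real"
  assumes f: "set_integrable lebesgue (cbox a b) f" and sub: "cbox a b \<subseteq> U"
    and z: "\<And>\<phi>. test_function U \<phi> \<Longrightarrow> (LINT x:U|lebesgue. f x * \<phi> x) = 0"
  shows "integral (cbox a b) f = 0"
proof -
  obtain \<phi> where \<phi>': "\<forall>k. test_function (cbox a b) (\<phi> k)" "\<forall>k x. 0 \<le> \<phi> k x \<and> \<phi> k x \<le> 1"
    "\<forall>k x. x \<notin> box a b \<longrightarrow> \<phi> k x = 0" "\<forall>x\<in>box a b. (\<lambda>k::nat. \<phi> k x) \<longlonglongrightarrow> 1"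
    by (rule box_bumps[of a b]) (rule that)
  note \<phi> = \<phi>'(1)[rule_format] \<phi>'(2)[rule_format] \<phi>'(3)[rule_format] \<phi>'(4)[rule_format]
  have fm: "(\<lambda>x. indicator (cbox a b) x *\<^sub>R f x) \<in> borel_measurable lebesgue"
    using f unfolding set_integrable_def by auto
  have fI: "integrable lebesgue (\<lambda>x. indicator (cbox a b) x *\<^sub>R f x)"
    using f unfolding set_integrable_def .
  have box_eq: "indicator (box a b) x *\<^sub>R f x = indicator (box a b) x * (indicator (cbox a b) x *\<^sub>R f x)" for x
    using box_subset_cbox[of a b] by (auto simp: indicator_def)
  have cont: "continuous_on S (\<phi> k)" for S k
    using \<phi>(1)[of k] by (intro smooth_continuous) (simp add: test_function_def)
  have lim: "(\<lambda>k. LINT x|lebesgue. indicator (cbox a b) x *\<^sub>R (f x * \<phi> k x)) \<longlonglongrightarrow> (LINT x|lebesgue. indicator (box a b) x *\<^sub>R f x)"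
  proof (rule integral_dominated_convergence[where w = "\<lambda>x. \<bar>indicator (cbox a b) x *\<^sub>R f x\<bar>"])
    show "(\<lambda>x. indicator (box a b) x *\<^sub>R f x) \<in> borel_measurable lebesgue"
      unfolding box_eq by (intro borel_measurable_times fm borel_measurable_indicator) auto
    show "(\<lambda>x. indicator (cbox a b) x *\<^sub>R (f x * \<phi> k x)) \<in> borel_measurable lebesgue" for k
      using set_integrable_mult_continuous[OF f compact_cbox cont[of _ k]] unfolding set_integrable_def by auto
    show "integrable lebesgue (\<lambda>x. \<bar>indicator (cbox a b) x *\<^sub>R f x\<bar>)" using fI by (rule integrable_abs)
    show "AE x in lebesgue. (\<lambda>k. indicator (cbox a b) x *\<^sub>R (f x * \<phi> k x)) \<longlonglongrightarrow> indicator (box a b) x *\<^sub>R f x"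
    proof (rule AE_I2)
      fix x
      show "(\<lambda>k. indicator (cbox a b) x *\<^sub>R (f x * \<phi> k x)) \<longlonglongrightarrow> indicator (box a b) x *\<^sub>R f x"
      proof (cases "x \<in> box a b")
        case True
        then have "x \<in> cbox a b" using box_subset_cbox by blast
        then show ?thesis using tendsto_mult[OF tendsto_const[of "f x"] \<phi>(4)[OF True]] True by simp
      qed (simp add: \<phi>(3))
    qed
    show "AE x in lebesgue. norm (indicator (cbox a b) x *\<^sub>R (f x * \<phi> k x)) \<le> \<bar>indicator (cbox a b) x *\<^sub>R f x\<bar>" for k
    proof (rule AE_I2)
      fix x
      have "\<bar>f x\<bar> * \<bar>\<phi> k x\<bar> \<le> \<bar>f x\<bar> * 1" using \<phi>(2)[of k x] by (intro mult_left_mono) auto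
      then show "norm (indicator (cbox a b) x *\<^sub>R (f x * \<phi> k x)) \<le> \<bar>indicator (cbox a b) x *\<^sub>R f x\<bar>"
        by (simp add: abs_mult indicator_def)
    qed
  qed
  have zero: "(LINT x|lebesgue. indicator (cbox a b) x *\<^sub>R (f x * \<phi> k x)) = 0" for k
  proof -
    have "(LINT x:U|lebesgue. f x * \<phi> k x) = (LINT x:cbox a b|lebesgue. f x * \<phi> k x)"
    proof (rule set_integral_support(1)[OF sub])
      show "f x * \<phi> k x = 0" if "x \<in> U - cbox a b" for x
        using \<phi>(3)[of x k] that box_subset_cbox[of a b] by auto
    qed
    then show ?thesis using z[OF test_function_mono[OF \<phi>(1) sub], of k] unfolding set_lebesgue_integral_def by simp
  qed
  have 0: "(LINT x|lebesgue. indicator (box a b) x *\<^sub>R f x) = 0"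
    by (rule LIMSEQ_unique[OF lim]) (simp only: zero tendsto_const)
  have "(LINT x:cbox a b|lebesgue. f x) = (LINT x|lebesgue. indicator (box a b) x *\<^sub>R f x)"
    unfolding set_lebesgue_integral_def
  proof (rule integral_cong_AE)
    have "negligible (cbox a b - box a b)" by (rule negligible_frontier_interval)
    then have "AE x in lebesgue. x \<notin> cbox a b - box a b"
      by (intro AE_not_in) (simp add: negligible_iff_null_sets)
    then show "AE x in lebesgue. indicator (cbox a b) x *\<^sub>R f x = indicator (box a b) x *\<^sub>R f x"
      by eventually_elim (use box_subset_cbox[of a b] in \<open>auto simp: indicator_def\<close>)
    show "(\<lambda>x. indicator (box a b) x *\<^sub>R f x) \<in> borel_measurable lebesgue"
      unfolding box_eq by (intro borel_measurable_times fm borel_measurable_indicator) auto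
  qed (rule fm)
  then show ?thesis using 0 set_lebesgue_integral_eq_integral(2)[OF f] by simp
qed

text \<open>\<open>f\<close> integrates to 0 over every small cube, and by Lebesgue differentiation
  over cubes with corner \<open>x\<close> its value at almost every \<open>x\<close> is the limit of
  such averages. Null sets can be recognised locally, so a box around each point is enough.\<close>

lemma fundamental_lemma:
  fixes f :: "real^'n::finite \<Rightarrow> real"
  assumes U: "open U" and f: "\<And>K. compact K \<Longrightarrow> K \<subseteq> U \<Longrightarrow> set_integrable lebesgue K f"
    and z: "\<And>\<phi>. test_function U \<phi> \<Longrightarrow> (LINT x:U|lebesgue. f x * \<phi> x) = 0"
  shows "negligible {x \<in> U. f x \<noteq> 0}"
proof (subst locally_negligible_alt, intro ballI)
  fix x0 assume "x0 \<in> {x \<in> U. f x \<noteq> 0}"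
  then have x0: "x0 \<in> U" "f x0 \<noteq> 0" by auto
  obtain c d where cd: "x0 \<in> box c d" "cbox c d \<subseteq> U"
    using open_contains_cbox[OF U x0(1)] by metis
  \<comment> \<open>Truncation to a box inside \<open>U\<close> provides a function integrable on
    every box, as the differentiation theorem requires.\<close>
  define f' where "f' x = (if x \<in> cbox c d then f x else 0)" for x
  have fI: "set_integrable lebesgue (cbox c d) f" using f[OF compact_cbox cd(2)] .
  have "f' integrable_on cbox a b" for a b
  proof -
    have "f integrable_on cbox c d" using set_lebesgue_integral_eq_integral(1)[OF fI] .
    then have "f integrable_on (cbox c d \<inter> cbox a b)"
      unfolding Int_interval by (rule integrable_on_subcbox) (simp only: Int_interval[symmetric] Int_lower1)
    then show ?thesis unfolding f'_def by (simp add: integrable_restrict_Int Int_commute)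
  qed
  then obtain N where N: "negligible N" "\<And>x e. x \<notin> N \<Longrightarrow> 0 < e \<Longrightarrow>
       \<exists>d>0. \<forall>h. 0 < h \<and> h < d \<longrightarrow> norm (integral (cbox x (x + h *\<^sub>R One)) f' /\<^sub>R h ^ DIM(real^'n) - f' x) < e"
  proof (rule integrable_ccontinuous_explicit)
    fix N assume "negligible N" "\<And>x e. \<lbrakk>x \<notin> N; 0 < e\<rbrakk> \<Longrightarrow>
       \<exists>d>0. \<forall>h. 0 < h \<and> h < d \<longrightarrow> norm (integral (cbox x (x + h *\<^sub>R One)) f' /\<^sub>R h ^ DIM(real^'n) - f' x) < e"
    then show thesis by (rule that)
  qed
  have zero: "f x = 0" if x: "x \<in> box c d" "x \<notin> N" for x
  proof (rule ccontr)
    assume nz: "f x \<noteq> 0"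
    obtain r where r: "r > 0" "\<forall>h. 0 < h \<and> h < r \<longrightarrow> norm (integral (cbox x (x + h *\<^sub>R One)) f' /\<^sub>R h ^ DIM(real^'n) - f' x) < \<bar>f x\<bar>"
      using N(2)[OF x(2), of "\<bar>f x\<bar>"] nz by auto
    obtain s where s: "s > 0" "cball x s \<subseteq> box c d" using open_contains_cball open_box x(1) by metis
    \<comment> \<open>Small enough for the cube with corner \<open>x\<close> and side
      \<open>h\<close> to stay inside the box, where \<open>f'\<close> and \<open>f\<close>
      agree.\<close>
    define h where "h = min (r / 2) (s / (norm (One :: real^'n) + 1))"
    have h: "0 < h" "h < r" "h * norm (One :: real^'n) \<le> s"
    proof -
      show "0 < h" using r s by (simp add: h_def add_nonneg_pos)
      have "h \<le> r / 2" unfolding h_def by (rule min.cobounded1)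
      then show "h < r" using r by simp
      have "h * norm (One :: real^'n) \<le> s / (norm (One :: real^'n) + 1) * (norm (One :: real^'n) + 1)"
        using s by (intro mult_mono) (auto simp: h_def)
      also have "\<dots> = s" by (simp add: add_nonneg_eq_0_iff)
      finally show "h * norm (One :: real^'n) \<le> s" .
    qed
    have sub: "cbox x (x + h *\<^sub>R One) \<subseteq> cbox c d"
    proof -
      have "x + h *\<^sub>R One \<in> cball x s" using h by (simp add: dist_norm)
      then have "x \<in> cbox c d" "x + h *\<^sub>R One \<in> cbox c d" using s(2) x(1) box_subset_cbox[of c d] by auto
      then show ?thesis by (auto simp: mem_box) (meson order_trans)+
    qed
    have "integral (cbox x (x + h *\<^sub>R One)) f' = integral (cbox x (x + h *\<^sub>R One)) f"
      using sub by (intro integral_cong) (auto simp: f'_def)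
    also have "\<dots> = 0"
      using sub cd(2) by (intro box_integral_eq_0[OF _ _ z] f) auto
    finally have "norm (0 - f' x) < \<bar>f x\<bar>" using r(2) h by force
    then show False using x(1) box_subset_cbox[of c d] by (auto simp: f'_def split: if_splits)
  qed
  have "negligible ({x \<in> U. f x \<noteq> 0} \<inter> box c d)" by (rule negligible_subset[OF N(1)]) (use zero in auto)
  then show "\<exists>V. openin (top_of_set {x \<in> U. f x \<noteq> 0}) V \<and> x0 \<in> V \<and> negligible V"
    using x0 cd by (intro exI[of _ "{x \<in> U. f x \<noteq> 0} \<inter> box c d"]) (auto simp: openin_open intro: open_box)
qed

section \<open>Radial functions with a weak Laplacian\<close>

definition annulus :: "real \<Rightarrow> real \<Rightarrow> (real^'n::finite) set" where
  "annulus a b = {x. a \<le> norm x \<and> norm x \<le> b}"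

lemma compact_annulus: "compact (annulus a b)"
proof -
  have "annulus a b = cball 0 b - ball (0::real^'n) a" by (auto simp: annulus_def)
  then show ?thesis by (metis compact_cball compact_diff open_ball)
qed

lemma annulus_sets: "annulus a b \<in> sets borel"
  using compact_annulus by (intro borel_closed compact_imp_closed)

text \<open>The surface area of the unit sphere: the derivative at \<open>t = 1\<close> of the
  volume of the ball of radius \<open>t\<close>.\<close>

definition sphere_const :: "'n::finite itself \<Rightarrow> real" where
  "sphere_const _ = real CARD('n) * unit_ball_vol (real CARD('n))"

lemma sphere_const_pos: "sphere_const TYPE('n::finite) > 0"
  unfolding sphere_const_def by simp

text \<open>Polar coordinates for radial functions. Both measures need only be compared on
  half-lines, where the left one is the volume of a ball and the fundamental theorem evaluates the
  right one.\<close>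

lemma distr_norm:
  "distr lborel borel (norm :: real^'n::finite \<Rightarrow> real) =
     density lborel (\<lambda>\<rho>. ennreal (sphere_const TYPE('n) * \<rho> ^ (CARD('n) - 1) * indicator {0..} \<rho>))"
  (is "?M = ?N")
proof (rule measure_eqI_generator_eq[where E = "range atMost" and \<Omega> = UNIV and A = "\<lambda>n. {..real n}"])
  show "Int_stable (range (atMost :: real \<Rightarrow> real set))"
    by (auto simp: Int_stable_def)
  have em: "emeasure ?M {..t} = ennreal (unit_ball_vol (real CARD('n)) * max 0 t ^ CARD('n))" for t
  proof -
    have "emeasure ?M {..t} = emeasure lborel (cball (0::real^'n) t)"
      by (subst emeasure_distr) (auto intro!: arg_cong2[where f = emeasure] simp: cball_def vimage_def dist_norm)
    also have "\<dots> = ennreal (unit_ball_vol (real CARD('n)) * max 0 t ^ CARD('n))"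
    proof (cases "t \<ge> 0")
      case True
      then show ?thesis by (simp add: emeasure_cball)
    next
      case False
      then have "cball (0::real^'n) t = {}" by simp
      then show ?thesis using False by (simp add: max_def power_0_left)
    qed
    finally show ?thesis .
  qed
  fix X assume "X \<in> range (atMost :: real \<Rightarrow> real set)"
  then obtain t where t: "X = {..t}" by auto
  have "emeasure ?N {..t} = (\<integral>\<^sup>+\<rho>. ennreal (sphere_const TYPE('n) * \<rho> ^ (CARD('n) - 1) * indicator {0..} \<rho>) * indicator {..t} \<rho> \<partial>lborel)"
    by (subst emeasure_density) auto
  also have "\<dots> = (\<integral>\<^sup>+\<rho>. ennreal (sphere_const TYPE('n) * \<rho> ^ (CARD('n) - 1)) * indicator {0..max 0 t} \<rho> * indicator {..t} \<rho> \<partial>lborel)"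
    by (intro nn_integral_cong) (auto simp: indicator_def)
  also have "\<dots> = ennreal (unit_ball_vol (real CARD('n)) * max 0 t ^ CARD('n))"
  proof (cases "t \<ge> 0")
    case True
    have "(\<integral>\<^sup>+\<rho>. ennreal (sphere_const TYPE('n) * \<rho> ^ (CARD('n) - 1)) * indicator {0..max 0 t} \<rho> * indicator {..t} \<rho> \<partial>lborel) =
        (\<integral>\<^sup>+\<rho>. ennreal (sphere_const TYPE('n) * \<rho> ^ (CARD('n) - 1)) * indicator {0..t} \<rho> \<partial>lborel)"
      using True by (intro nn_integral_cong) (auto simp: indicator_def)
    also have "\<dots> = ennreal (unit_ball_vol (real CARD('n)) * t ^ CARD('n) - unit_ball_vol (real CARD('n)) * 0 ^ CARD('n))"
    proof (rule nn_integral_FTC_Icc[where F = "\<lambda>x. unit_ball_vol (real CARD('n)) * x ^ CARD('n)"])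
      show "((\<lambda>x. unit_ball_vol (real CARD('n)) * x ^ CARD('n)) has_real_derivative sphere_const TYPE('n) * x ^ (CARD('n) - 1)) (at x)" for x
        unfolding sphere_const_def by (auto intro!: derivative_eq_intros)
      show "0 \<le> sphere_const TYPE('n) * x ^ (CARD('n) - 1)" if "x \<in> {0..t}" for x
        using sphere_const_pos[where 'n = 'n] that by simp
    qed (use True in auto)
    finally show ?thesis using True by (simp add: power_0_left)
  next
    case False
    then have "(\<integral>\<^sup>+\<rho>. ennreal (sphere_const TYPE('n) * \<rho> ^ (CARD('n) - 1)) * indicator {0..max 0 t} \<rho> * indicator {..t} \<rho> \<partial>lborel) = nn_integral lborel (\<lambda>_::real. 0)"
      by (intro nn_integral_cong) (auto simp: indicator_def)
    then show ?thesis using False by (simp add: max_def power_0_left)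
  qed
  finally show "emeasure ?M X = emeasure ?N X" unfolding t em by simp
next
  show "range (\<lambda>n. {..real n}) \<subseteq> range atMost" by auto
  show "(\<Union>n. {..real n}) = UNIV" using real_arch_simple by auto
  show "emeasure ?M {..real i} \<noteq> \<infinity>" for i
  proof -
    have "emeasure ?M {..real i} = emeasure lborel (cball (0::real^'n) (real i))"
      by (subst emeasure_distr) (auto intro!: arg_cong2[where f = emeasure] simp: cball_def vimage_def dist_norm)
    then show ?thesis by (simp add: emeasure_cball)
  qed
  show "sets ?M = sigma_sets UNIV (range atMost)" by (simp add: borel_eq_atMost)
  show "sets ?N = sigma_sets UNIV (range atMost)" by (simp add: borel_eq_atMost)
qed auto

lemma set_integrable_continuous_compact:
  fixes g :: "'a::euclidean_space \<Rightarrow> real"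
  assumes "compact K" "continuous_on K g"
  shows "set_integrable lebesgue K g"
  using borel_integrable_compact[OF assms] unfolding set_integrable_def
  by (subst integrable_completion) auto

lemma radial_integral:
  fixes g :: "real \<Rightarrow> real"
  assumes a: "0 < a" and g: "continuous_on {a..b} g"
  shows "set_integrable lebesgue (annulus a b :: (real^'n::finite) set) (\<lambda>x. g (norm x))"
    and "(LINT x:(annulus a b :: (real^'n) set)|lebesgue. g (norm x)) =
      sphere_const TYPE('n) * integral {a..b} (\<lambda>\<rho>. \<rho> ^ (CARD('n) - 1) * g \<rho>)"
proof -
  let ?c = "sphere_const TYPE('n)"
  define g0 where "g0 \<rho> = indicator {a..b} \<rho> * g \<rho>" for \<rho>
  have g0m [measurable]: "g0 \<in> borel_measurable borel"
    using borel_measurable_continuous_on_indicator[OF _ g] unfolding g0_def by simp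
  have eq: "(\<lambda>x::real^'n. indicator (annulus a b) x *\<^sub>R g (norm x)) = (\<lambda>x. g0 (norm x))"
    by (auto simp: fun_eq_iff g0_def annulus_def indicator_def)
  show "set_integrable lebesgue (annulus a b :: (real^'n::finite) set) (\<lambda>x. g (norm x))"
    by (intro set_integrable_continuous_compact compact_annulus continuous_on_compose2[OF g] continuous_intros)
       (auto simp: annulus_def)
  have "(LINT x:(annulus a b :: (real^'n) set)|lebesgue. g (norm x)) = (LINT x|lebesgue. g0 (norm (x::real^'n)))"
    unfolding set_lebesgue_integral_def eq ..
  also have "\<dots> = (LINT x|lborel. g0 (norm (x::real^'n)))"
    by (rule integral_completion) measurable
  also have "\<dots> = (LINT \<rho>|distr lborel borel (norm :: real^'n \<Rightarrow> real). g0 \<rho>)"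
    by (rule integral_distr[symmetric]) auto
  also have "\<dots> = (LINT \<rho>|lborel. (?c * \<rho> ^ (CARD('n) - 1) * indicator {0..} \<rho>) *\<^sub>R g0 \<rho>)"
    unfolding distr_norm
    by (rule integral_density) (use sphere_const_pos[where 'n = 'n] in \<open>auto simp: indicator_def\<close>)
  also have "\<dots> = (LINT \<rho>:{a..b}|lborel. ?c * \<rho> ^ (CARD('n) - 1) * g \<rho>)"
    unfolding set_lebesgue_integral_def
    by (intro Bochner_Integration.integral_cong) (use a in \<open>auto simp: g0_def indicator_def\<close>)
  also have "\<dots> = integral {a..b} (\<lambda>\<rho>. ?c * \<rho> ^ (CARD('n) - 1) * g \<rho>)"
    by (intro set_borel_integral_eq_integral(2) borel_integrable_atLeastAtMost' continuous_intros g)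
  also have "\<dots> = ?c * integral {a..b} (\<lambda>\<rho>. \<rho> ^ (CARD('n) - 1) * g \<rho>)"
    by (simp add: mult.assoc)
  finally show "(LINT x:(annulus a b :: (real^'n) set)|lebesgue. g (norm x)) =
      ?c * integral {a..b} (\<lambda>\<rho>. \<rho> ^ (CARD('n) - 1) * g \<rho>)" .
qed

text \<open>The radial fundamental solution, normalised by \<open>\<tau>'(\<rho>) = \<rho> powr (1 - N)\<close>; at \<open>\<rho> = 0\<close> it takes the
  junk value 0, which exceeds every \<open>\<tau>(\<rho>)\<close> with \<open>\<rho> > 0\<close>.\<close>

definition fund :: "real \<Rightarrow> real \<Rightarrow> real" where
  "fund N \<rho> = (- 1 / (N - 2)) * \<rho> powr (2 - N)"

section \<open>Testing the weak Laplacian with functions of the fundamental solution\<close>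

lemma fund_has_derivative:
  "N > 2 \<Longrightarrow> \<rho> > 0 \<Longrightarrow> (fund N has_real_derivative \<rho> powr (1 - N)) (at \<rho>)"
proof -
  assume N: "N > 2" and r: "\<rho> > 0"
  have "((\<lambda>\<rho>. (- 1 / (N - 2)) * \<rho> powr (2 - N)) has_real_derivative (- 1 / (N - 2)) * ((2 - N) * \<rho> powr (2 - N - 1))) (at \<rho>)"
    by (intro DERIV_cmult has_real_derivative_powr r)
  moreover have "(- 1 / (N - 2)) * ((2 - N) * \<rho> powr (2 - N - 1)) = \<rho> powr (1 - N)"
  proof -
    have "(- 1 / (N - 2)) * (2 - N) = 1" using N by (simp add: field_simps)
    then show ?thesis by (simp add: mult.assoc[symmetric])
  qed
  ultimately show ?thesis by (simp add: fund_def[abs_def])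
qed

lemma fund_neg: "N > 2 \<Longrightarrow> \<rho> > 0 \<Longrightarrow> fund N \<rho> < 0"
  unfolding fund_def by (auto simp: mult_less_0_iff divide_less_0_iff)

lemma fund_strict_mono: "N > 2 \<Longrightarrow> 0 < \<rho> \<Longrightarrow> \<rho> < \<sigma> \<Longrightarrow> fund N \<rho> < fund N \<sigma>"
  unfolding fund_def by (intro mult_strict_left_mono_neg powr_less_mono2_neg) auto

lemma fund_le_iff: "N > 2 \<Longrightarrow> 0 < \<rho> \<Longrightarrow> 0 < \<sigma> \<Longrightarrow> fund N \<rho> \<le> fund N \<sigma> \<longleftrightarrow> \<rho> \<le> \<sigma>"
  by (metis fund_strict_mono linorder_not_le order_le_less)

lemma fund_continuous: "N > 2 \<Longrightarrow> 0 < a \<Longrightarrow> continuous_on {a..b} (fund N)"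
  by (intro continuous_at_imp_continuous_on ballI DERIV_isCont[OF fund_has_derivative]) auto

text \<open>In the variable \<open>t = fund N (norm x)\<close> the Laplacian of
  \<open>\<eta> t\<close> is \<open>\<eta>2 t\<close> times the squared gradient of
  \<open>t\<close>, because \<open>t\<close> is harmonic off the origin; that squared gradient is
  \<open>norm x powr (2 - 2 * N)\<close>. Smoothness at the origin holds because the function
  vanishes nearby.\<close>

lemma radial_test_function:
  fixes \<eta> \<eta>1 \<eta>2 :: "real \<Rightarrow> real"
  assumes N: "N = real CARD('n::finite)" "N > 2" and ab: "0 < a" "a < b" "b < r"
    and sm: "smooth_real \<eta>" and d1: "\<And>t. (\<eta> has_real_derivative \<eta>1 t) (at t)"
    and d2: "\<And>t. (\<eta>1 has_real_derivative \<eta>2 t) (at t)"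
    and supp: "\<And>t. t \<notin> {fund N a..fund N b} \<Longrightarrow> \<eta> t = 0"
  defines "\<phi> \<equiv> \<lambda>x::real^'n. \<eta> (fund N (norm x))"
  shows "test_function (ball 0 r) \<phi>" and "\<And>x is. x \<notin> annulus a b \<Longrightarrow> partials is \<phi> x = 0"
    and "\<And>x. x \<noteq> 0 \<Longrightarrow> (\<Sum>i\<in>UNIV. partials [i, i] \<phi> x) = \<eta>2 (fund N (norm x)) * norm x powr (2 - 2 * N)"
proof -
  have fundc: "fund N (norm x) = (- 1 / (N - 2)) * norm x powr (2 - N)" for x :: "real^'n"
    by (simp add: fund_def)
  have sm1: "smooth_fun (- {0}) \<phi>"
    unfolding \<phi>_def fundc
    by (rule smooth_fun.comp[OF sm]) (intro smooth_fun.mult smooth_fun.const smooth_fun.norm_powr, simp)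
  have z: "\<phi> x = 0" if "x \<notin> annulus a b" for x
  proof (cases "x = 0")
    case True
    have "0 \<notin> {fund N a..fund N b}" using fund_neg[of N b] N(2) ab by auto
    then have "\<eta> 0 = 0" by (rule supp)
    then show ?thesis using True by (simp add: \<phi>_def fund_def)
  next
    case False
    then have "norm x < a \<or> b < norm x" using that by (auto simp: annulus_def)
    then have "fund N (norm x) < fund N a \<or> fund N b < fund N (norm x)"
      using fund_strict_mono[of N "norm x" a] fund_strict_mono[of N b "norm x"] N ab False by auto
    then show ?thesis using supp unfolding \<phi>_def by auto
  qed
  have smooth: "smooth \<phi>"
    by (rule smooth_if_smooth_fun[OF _ sm1 open_ball[of 0 a]]) (use z ab in \<open>auto simp: annulus_def\<close>)
  have "closure {x. \<phi> x \<noteq> 0} \<subseteq> annulus a b"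
    using z by (intro closure_minimal compact_imp_closed compact_annulus) blast
  moreover have "annulus a b \<subseteq> ball (0::real^'n) r" using ab by (auto simp: annulus_def)
  ultimately show "test_function (ball 0 r) \<phi>"
    using smooth compact_annulus unfolding test_function_def
    by (metis closed_closure closed_subset compact_closure compact_imp_bounded bounded_subset subset_trans bounded_closure_image closure_closure)
  show "partials is \<phi> x = 0" if "x \<notin> annulus a b" for x "is"
    using partials_eq_0_outside_support[of x \<phi> "is"] \<open>closure {x. \<phi> x \<noteq> 0} \<subseteq> annulus a b\<close> that by blast
  show "(\<Sum>i\<in>UNIV. partials [i, i] \<phi> x) = \<eta>2 (fund N (norm x)) * norm x powr (2 - 2 * N)" if x: "x \<noteq> 0" for x
  proof -
    have S: "open (- {0::real^'n})" by auto
    have dfund: "(\<lambda>y::real^'n. fund N (norm y)) differentiable at y" if "y \<noteq> 0" for y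
      unfolding fundc using norm_powr_has_derivative[OF that]
      by (intro differentiable_mult differentiable_const differentiableI)
    have pfund: "partial i (\<lambda>y::real^'n. fund N (norm y)) y = norm y powr (- N) * y $ i" if "y \<noteq> 0" for y i
    proof -
      have "(- 1 / (N - 2)) * (2 - N) = 1" using N by (simp add: field_simps)
      have "partial i (\<lambda>y::real^'n. fund N (norm y)) y = (- 1 / (N - 2)) * ((2 - N) * norm y powr (2 - N - 2) * y $ i)"
        unfolding fundc using partial_mult[of "\<lambda>_. - 1 / (N - 2)" y "\<lambda>y. norm y powr (2 - N)" i]
          partial_norm_powr[OF that, of i "2 - N"] norm_powr_has_derivative[OF that, THEN differentiableI]
        by (simp add: partial_def)
      also have "\<dots> = ((- 1 / (N - 2)) * (2 - N)) * norm y powr (- N) * y $ i" by simp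
      finally show ?thesis unfolding \<open>(- 1 / (N - 2)) * (2 - N) = 1\<close> by simp
    qed
    have p1: "partial i \<phi> y = \<eta>1 (fund N (norm y)) * (norm y powr (- N) * y $ i)" if "y \<noteq> 0" for y i
      unfolding \<phi>_def using partial_comp[OF d1 dfund[OF that], of i] pfund[OF that] by simp
    have p2: "partial i (partial i \<phi>) x = \<eta>2 (fund N (norm x)) * (norm x powr (- N) * x $ i) * (norm x powr (- N) * x $ i)
       + \<eta>1 (fund N (norm x)) * (norm x powr (- N) + (- N) * norm x powr (- N - 2) * x $ i * x $ i)" for i
    proof -
      have dc: "(\<lambda>y::real^'n. y $ i) differentiable at x"
        by (intro bounded_linear_imp_differentiable bounded_linear_vec_nth)
      have dn: "(\<lambda>y::real^'n. norm y powr (- N)) differentiable at x"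
        by (rule norm_powr_has_derivative[OF x, THEN differentiableI])
      have de: "(\<lambda>y::real^'n. \<eta>1 (fund N (norm y))) differentiable at x"
      proof -
        obtain f' where "((\<lambda>y::real^'n. fund N (norm y)) has_derivative f') (at x)"
          using dfund[OF x] unfolding differentiable_def by auto
        from comp_has_derivative[OF d2 this] show ?thesis by (rule differentiableI)
      qed
      have dm: "(\<lambda>y::real^'n. norm y powr (- N) * y $ i) differentiable at x"
        using dn dc by (rule differentiable_mult)
      have "partial i (partial i \<phi>) x = partial i (\<lambda>y. \<eta>1 (fund N (norm y)) * (norm y powr (- N) * y $ i)) x"
        by (rule partial_cong_open[OF S]) (use x p1 in auto)
      also have "\<dots> = \<eta>1 (fund N (norm x)) * partial i (\<lambda>y. norm y powr (- N) * y $ i) x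
          + partial i (\<lambda>y. \<eta>1 (fund N (norm y))) x * (norm x powr (- N) * x $ i)"
        by (rule partial_mult[OF de dm])
      also have "partial i (\<lambda>y. \<eta>1 (fund N (norm y))) x = \<eta>2 (fund N (norm x)) * (norm x powr (- N) * x $ i)"
        using partial_comp[OF d2 dfund[OF x], of i] pfund[OF x] by simp
      also have "partial i (\<lambda>y. norm y powr (- N) * y $ i) x = norm x powr (- N) + (- N) * norm x powr (- N - 2) * x $ i * x $ i"
        using partial_mult[OF dn dc, of i] partial_norm_powr[OF x, of i "- N"] by (simp add: partial_coord)
      finally show ?thesis by simp
    qed
    have ss: "(\<Sum>i\<in>UNIV. x $ i * x $ i) = norm x powr 2"
      using x by (simp add: norm_vec_def L2_set_def sum_nonneg power2_eq_square)
    have "(\<Sum>i\<in>UNIV. partials [i, i] \<phi> x) = (\<Sum>i\<in>UNIV. \<eta>2 (fund N (norm x)) * (norm x powr (- N) * norm x powr (- N)) * (x $ i * x $ i)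
       + \<eta>1 (fund N (norm x)) * norm x powr (- N) + \<eta>1 (fund N (norm x)) * (- N) * norm x powr (- N - 2) * (x $ i * x $ i))"
      unfolding partials_def by (intro sum.cong) (auto simp: p2 algebra_simps)
    also have "\<dots> = \<eta>2 (fund N (norm x)) * (norm x powr (- N) * norm x powr (- N)) * norm x powr 2
       + N * (\<eta>1 (fund N (norm x)) * norm x powr (- N)) + \<eta>1 (fund N (norm x)) * (- N) * norm x powr (- N - 2) * norm x powr 2"
      unfolding sum.distrib sum_distrib_left[symmetric] ss by (simp add: N)
    also have "\<dots> = \<eta>2 (fund N (norm x)) * (norm x powr (- N) * norm x powr (- N) * norm x powr 2)
       + (N * (\<eta>1 (fund N (norm x)) * norm x powr (- N)) + \<eta>1 (fund N (norm x)) * (- N) * (norm x powr (- N - 2) * norm x powr 2))"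
      by (simp only: mult.assoc add.assoc)
    \<comment> \<open>With this the two terms in \<open>\<eta>1\<close> cancel, which is the
      harmonicity of \<open>fund\<close>.\<close>
    also have "norm x powr (- N - 2) * norm x powr 2 = norm x powr (- N)"
      unfolding powr_add[symmetric] by simp
    also have "norm x powr (- N) * norm x powr (- N) * norm x powr 2 = norm x powr (2 - 2 * N)"
      unfolding powr_add[symmetric] by simp
    finally show ?thesis by simp
  qed
qed

text \<open>Dominated convergence along shrinking neighbourhoods of the level, whose intersection is
  the null level set. It supplies differentiability with respect to the level and, later, continuity
  of the flux.\<close>

lemma small_level_set:
  fixes F q :: "'a::euclidean_space \<Rightarrow> real"
  assumes F: "integrable lebesgue F" and q: "q \<in> borel_measurable borel" and n: "negligible {x. q x = t0}" and e: "e > 0"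
  shows "\<exists>d>0. (LINT x|lebesgue. \<bar>F x\<bar> * indicator {x. \<bar>q x - t0\<bar> \<le> d} x) < e"
proof -
  have ql: "q \<in> borel_measurable lebesgue" using q by (intro measurable_completion) simp
  have Fm: "F \<in> borel_measurable lebesgue" using F by auto
  have lev: "{x. \<bar>q x - t0\<bar> \<le> d} \<in> sets lebesgue" for d
  proof -
    have "(\<lambda>x. \<bar>q x - t0\<bar>) \<in> borel_measurable lebesgue" using ql by measurable
    then have "{x \<in> space lebesgue. \<bar>q x - t0\<bar> \<le> d} \<in> sets lebesgue" by measurable
    then show ?thesis by simp
  qed
  have "(\<lambda>k. LINT x|lebesgue. \<bar>F x\<bar> * indicator {x. \<bar>q x - t0\<bar> \<le> inverse (real (Suc k))} x) \<longlonglongrightarrow> integral\<^sup>L lebesgue (\<lambda>x::'a. 0::real)"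
  proof (rule integral_dominated_convergence[where w = "\<lambda>x. \<bar>F x\<bar>"])
    show "(\<lambda>x. \<bar>F x\<bar> * indicator {x. \<bar>q x - t0\<bar> \<le> inverse (real (Suc k))} x) \<in> borel_measurable lebesgue" for k
      using lev Fm by (intro borel_measurable_times borel_measurable_indicator borel_measurable_abs)
    show "integrable lebesgue (\<lambda>x. \<bar>F x\<bar>)" using F by (rule integrable_abs)
    show "AE x in lebesgue. norm (\<bar>F x\<bar> * indicator {x. \<bar>q x - t0\<bar> \<le> inverse (real (Suc k))} x) \<le> \<bar>F x\<bar>" for k
      by (intro AE_I2) (auto simp: indicator_def)
    have "AE x in lebesgue. x \<notin> {x. q x = t0}"
      using n by (intro AE_not_in) (simp add: negligible_iff_null_sets)
    then show "AE x in lebesgue. (\<lambda>k. \<bar>F x\<bar> * indicator {x. \<bar>q x - t0\<bar> \<le> inverse (real (Suc k))} x) \<longlonglongrightarrow> 0"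
    proof eventually_elim
      case (elim x)
      then have "\<bar>q x - t0\<bar> > 0" by simp
      then have "eventually (\<lambda>k. inverse (real (Suc k)) < \<bar>q x - t0\<bar>) sequentially"
        using LIMSEQ_inverse_real_of_nat by (rule order_tendstoD(2)[rotated])
      then have "eventually (\<lambda>k. \<bar>F x\<bar> * indicator {x. \<bar>q x - t0\<bar> \<le> inverse (real (Suc k))} x = 0) sequentially"
        by eventually_elim simp
      then show ?case by (rule tendsto_eventually)
    qed
  qed simp
  then have "(\<lambda>k. LINT x|lebesgue. \<bar>F x\<bar> * indicator {x. \<bar>q x - t0\<bar> \<le> inverse (real (Suc k))} x) \<longlonglongrightarrow> 0"
    by simp
  then have "eventually (\<lambda>k. (LINT x|lebesgue. \<bar>F x\<bar> * indicator {x. \<bar>q x - t0\<bar> \<le> inverse (real (Suc k))} x) < e) sequentially"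
    using e by (rule order_tendstoD(2))
  then obtain k where "(LINT x|lebesgue. \<bar>F x\<bar> * indicator {x. \<bar>q x - t0\<bar> \<le> inverse (real (Suc k))} x) < e"
    by (meson eventually_sequentially order_refl)
  then show ?thesis by (intro exI[of _ "inverse (real (Suc k))"]) simp
qed

text \<open>The factor \<open>\<rho> powr (N - 1)\<close> from polar coordinates and the Laplacian
  factor \<open>\<rho> powr (2 - 2 * N)\<close> combine to \<open>\<rho> powr (1 - N)\<close>, the
  derivative of \<open>fund N\<close>. So the left side is, up to the sphere constant, the integral
  of \<open>w\<close> against \<open>\<eta>2\<close> in the variable
  \<open>fund N \<rho>\<close>.\<close>

lemma radial_weak_identity:
  fixes u :: "real^'n::finite \<Rightarrow> real" and g :: "'n \<Rightarrow> real^'n \<Rightarrow> real"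
  assumes N: "N = real CARD('n::finite)" "N > 2" and ab: "0 < a" "a < b" "b < r"
    and u: "\<And>x. x \<in> ball 0 r \<Longrightarrow> u x = w (norm x)" and w: "continuous_on {a..b} w"
    and wk: "\<And>i. has_weak_deriv (ball 0 r) [i, i] u (g i)"
    and sm: "smooth_real \<eta>" and d1: "\<And>t. (\<eta> has_real_derivative \<eta>1 t) (at t)"
    and d2: "\<And>t. (\<eta>1 has_real_derivative \<eta>2 t) (at t)"
    and supp: "\<And>t. t \<notin> {fund N a..fund N b} \<Longrightarrow> \<eta> t = 0" and c2: "continuous_on UNIV \<eta>2"
  shows "sphere_const TYPE('n) * integral {a..b} (\<lambda>\<rho>. w \<rho> * \<eta>2 (fund N \<rho>) * \<rho> powr (1 - N)) =
    (LINT x:annulus a b|lebesgue. (\<Sum>i\<in>UNIV. g i x) * \<eta> (fund N (norm x)))"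
proof -
  define \<phi> where "\<phi> = (\<lambda>x::real^'n. \<eta> (fund N (norm x)))"
  have rt1: "test_function (ball 0 r) \<phi>"
    unfolding \<phi>_def by (rule radial_test_function(1)[OF N ab sm d1 d2]) (rule supp)
  have rt2: "partials is \<phi> x = 0" if "x \<notin> annulus a b" for x "is"
    unfolding \<phi>_def by (rule radial_test_function(2)[OF N ab sm d1 d2]) (use supp that in blast)+
  have rt3: "(\<Sum>i\<in>UNIV. partials [i, i] \<phi> x) = \<eta>2 (fund N (norm x)) * norm x powr (2 - 2 * N)" if "x \<noteq> 0" for x
    unfolding \<phi>_def by (rule radial_test_function(3)[OF N ab sm d1 d2]) (use supp that in blast)+
  have sub: "annulus a b \<subseteq> ball (0::real^'n) r" using ab by (auto simp: annulus_def)
  have smooth: "smooth \<phi>" using rt1 by (simp add: test_function_def)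
  have K: "compact (annulus a b) \<and> annulus a b \<subseteq> ball (0::real^'n) r"
    using sub compact_annulus by blast
  have li: "locally_integrable (ball 0 r) u" "locally_integrable (ball 0 r) (g i)" for i
    using wk[of i] unfolding has_weak_deriv_def by simp_all
  have loc: "set_integrable lebesgue (annulus a b) u" "\<And>i. set_integrable lebesgue (annulus a b) (g i)"
    by (rule li(1)[unfolded locally_integrable_def, rule_format, OF K])
      (rule li(2)[unfolded locally_integrable_def, rule_format, OF K])
  have 0: "\<phi> x = 0" if "x \<notin> annulus a b" for x using rt2[OF that, of "[]"] by (simp add: partials_def)
  have each: "(LINT x:annulus a b|lebesgue. u x * partials [i, i] \<phi> x) = (LINT x:annulus a b|lebesgue. g i x * \<phi> x)" for i
  proof -
    have "(LINT x:ball 0 r|lebesgue. u x * partials [i, i] \<phi> x) = (-1) ^ length [i, i] * (LINT x:ball 0 r|lebesgue. g i x * \<phi> x)"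
      using wk[of i] rt1 unfolding has_weak_deriv_def by blast
    moreover have "(LINT x:ball 0 r|lebesgue. u x * partials [i, i] \<phi> x) = (LINT x:annulus a b|lebesgue. u x * partials [i, i] \<phi> x)"
      by (rule set_integral_support(1)[OF sub]) (simp add: rt2)
    moreover have "(LINT x:ball 0 r|lebesgue. g i x * \<phi> x) = (LINT x:annulus a b|lebesgue. g i x * \<phi> x)"
      by (rule set_integral_support(1)[OF sub]) (simp add: 0)
    ultimately show ?thesis by simp
  qed
  have iu: "set_integrable lebesgue (annulus a b) (\<lambda>x. u x * partials [i, i] \<phi> x)" for i
    by (intro set_integrable_mult_continuous[OF loc(1) compact_annulus] smooth_partials_continuous smooth)
  have ig: "set_integrable lebesgue (annulus a b) (\<lambda>x. g i x * \<phi> x)" for i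
    by (intro set_integrable_mult_continuous[OF loc(2) compact_annulus] smooth_continuous smooth)
  have sum_swap: "(\<Sum>i\<in>(UNIV::'n set). LINT x:annulus a b|lebesgue. f i x) = (LINT x:annulus a b|lebesgue. \<Sum>i\<in>UNIV. f i x)"
    if "\<And>i. set_integrable lebesgue (annulus a b) (f i)" for f :: "'n \<Rightarrow> real^'n \<Rightarrow> real"
    using that unfolding set_lebesgue_integral_def set_integrable_def
    by (simp add: Bochner_Integration.integral_sum[symmetric] sum_distrib_left)
  have "(LINT x:annulus a b|lebesgue. (\<Sum>i\<in>UNIV. g i x) * \<phi> x) = (\<Sum>i\<in>UNIV. LINT x:annulus a b|lebesgue. g i x * \<phi> x)"
    unfolding sum_swap[OF ig] by (simp add: sum_distrib_right)
  also have "\<dots> = (\<Sum>i\<in>UNIV. LINT x:annulus a b|lebesgue. u x * partials [i, i] \<phi> x)"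
    by (simp only: each)
  also have "\<dots> = (LINT x:annulus a b|lebesgue. \<Sum>i\<in>UNIV. u x * partials [i, i] \<phi> x)"
    by (rule sum_swap[OF iu])
  also have "\<dots> = (LINT x:(annulus a b :: (real^'n) set)|lebesgue. w (norm x) * (\<eta>2 (fund N (norm x)) * norm x powr (2 - 2 * N)))"
  proof (rule set_lebesgue_integral_cong)
    show "annulus a b \<in> sets lebesgue" using annulus_sets by (intro sets_completionI_sets) simp
    show "\<forall>x. x \<in> annulus a b \<longrightarrow> (\<Sum>i\<in>UNIV. u x * partials [i, i] \<phi> x) = w (norm x) * (\<eta>2 (fund N (norm x)) * norm x powr (2 - 2 * N))"
    proof (intro allI impI)
      fix x :: "real^'n" assume x: "x \<in> annulus a b"
      then have "x \<noteq> 0" "x \<in> ball 0 r" using ab by (auto simp: annulus_def)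
      then show "(\<Sum>i\<in>UNIV. u x * partials [i, i] \<phi> x) = w (norm x) * (\<eta>2 (fund N (norm x)) * norm x powr (2 - 2 * N))"
        using rt3[of x] u[of x] by (simp add: sum_distrib_left[symmetric])
    qed
  qed
  also have "\<dots> = sphere_const TYPE('n) * integral {a..b} (\<lambda>\<rho>. \<rho> ^ (CARD('n) - 1) * (w \<rho> * (\<eta>2 (fund N \<rho>) * \<rho> powr (2 - 2 * N))))"
  proof (rule radial_integral(2)[OF ab(1)])
    show "continuous_on {a..b} (\<lambda>\<rho>. w \<rho> * (\<eta>2 (fund N \<rho>) * \<rho> powr (2 - 2 * N)))"
      using ab by (intro continuous_intros w continuous_on_compose2[OF c2 fund_continuous[OF N(2) ab(1)]]) auto
  qed
  also have "integral {a..b} (\<lambda>\<rho>. \<rho> ^ (CARD('n) - 1) * (w \<rho> * (\<eta>2 (fund N \<rho>) * \<rho> powr (2 - 2 * N)))) =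
     integral {a..b} (\<lambda>\<rho>. w \<rho> * \<eta>2 (fund N \<rho>) * \<rho> powr (1 - N))"
  proof (rule integral_cong)
    fix \<rho> assume "\<rho> \<in> {a..b}"
    then have r0: "\<rho> > 0" using ab by auto
    have "\<rho> ^ (CARD('n) - 1) = \<rho> powr (N - 1)"
      using r0 N by (simp add: powr_realpow[symmetric] of_nat_diff)
    then have "\<rho> ^ (CARD('n) - 1) * \<rho> powr (2 - 2 * N) = \<rho> powr (1 - N)"
      by (simp add: powr_add[symmetric])
    then show "\<rho> ^ (CARD('n) - 1) * (w \<rho> * (\<eta>2 (fund N \<rho>) * \<rho> powr (2 - 2 * N))) = w \<rho> * \<eta>2 (fund N \<rho>) * \<rho> powr (1 - N)"
      by (metis mult.assoc mult.left_commute)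
  qed
  finally show ?thesis by (simp add: \<phi>_def)
qed

text \<open>The kernel is the derivative of
  \<open>B1 ((fund N \<rho> - fund N \<rho>0) / d)\<close>, hence has integral 1 once
  \<open>d\<close> is small, and it concentrates at \<open>\<rho>0\<close>: an approximate identity
  in the variable \<open>fund N \<rho>\<close>.\<close>

lemma bump_average_tendsto:
  fixes w :: "real \<Rightarrow> real"
  assumes N: "N > 2" and a: "0 < a" and \<rho>0: "\<rho>0 \<in> {a<..<b}" and w: "continuous_on {a..b} w"
    and \<beta>: "continuous_on UNIV \<beta>" "\<forall>t. (B1 has_real_derivative \<beta> t) (at t)" "\<forall>t. \<beta> t \<ge> 0" "\<forall>t. \<bar>t\<bar> \<ge> 1 \<longrightarrow> \<beta> t = 0"
    "\<forall>t\<le>-1. B1 t = 0" "\<forall>t\<ge>1. B1 t = (1::real)"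
  shows "((\<lambda>d. integral {a..b} (\<lambda>\<rho>. w \<rho> * (\<beta> ((fund N \<rho> - fund N \<rho>0) / d) / d) * \<rho> powr (1 - N))) \<longlongrightarrow> w \<rho>0) (at_right 0)"
proof (rule tendstoI)
  fix e :: real assume e: "e > 0"
  define t0 where "t0 = fund N \<rho>0"
  obtain s where s: "s > 0" "\<And>\<rho>. \<rho> \<in> {a..b} \<Longrightarrow> dist \<rho> \<rho>0 < s \<Longrightarrow> dist (w \<rho>) (w \<rho>0) < e / 2"
    using w \<rho>0 e unfolding continuous_on_iff by (metis greaterThanLessThan_iff atLeastAtMost_iff half_gt_zero less_imp_le)
  define s' where "s' = min (s / 2) (min (\<rho>0 - a) (b - \<rho>0))"
  have s': "s' > 0" "s' < s" "a \<le> \<rho>0 - s'" "\<rho>0 + s' \<le> b" using s \<rho>0 by (auto simp: s'_def)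
  \<comment> \<open>Below this width the kernel lives on radii within \<open>s'\<close> of
    \<open>\<rho>0\<close>, and the step \<open>B1\<close> is already 0 at the end \<open>a\<close>
    and 1 at the end \<open>b\<close>.\<close>
  define d0 where "d0 = min (fund N (\<rho>0 + s') - t0) (t0 - fund N (\<rho>0 - s'))"
  have d0: "d0 > 0" using fund_strict_mono[OF N, of \<rho>0 "\<rho>0 + s'"] fund_strict_mono[OF N, of "\<rho>0 - s'" \<rho>0] s' a
    by (auto simp: d0_def t0_def)
  have key: "dist (integral {a..b} (\<lambda>\<rho>. w \<rho> * (\<beta> ((fund N \<rho> - t0) / d) / d) * \<rho> powr (1 - N))) (w \<rho>0) < e"
    if d: "0 < d" "d < d0" for d
  proof -
    define k where "k \<rho> = (\<beta> ((fund N \<rho> - t0) / d) / d) * \<rho> powr (1 - N)" for \<rho>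
    have kc: "continuous_on {a..b} k" unfolding k_def
      using a d by (intro continuous_intros continuous_on_compose2[OF \<beta>(1)] fund_continuous[OF N]) auto
    have k0: "k \<rho> \<ge> 0" for \<rho> using \<beta>(3) d by (simp add: k_def)
    have kz: "k \<rho> = 0" if "\<rho> \<in> {a..b}" "\<not> dist \<rho> \<rho>0 < s" for \<rho>
    proof -
      have "\<rho> \<le> \<rho>0 - s' \<or> \<rho>0 + s' \<le> \<rho>" using that s' by (auto simp: dist_real_def)
      then have "\<bar>fund N \<rho> - t0\<bar> \<ge> d0"
        using fund_le_iff[OF N, of \<rho> "\<rho>0 - s'"] fund_le_iff[OF N, of "\<rho>0 + s'" \<rho>] that a s' by (auto simp: d0_def)
      then have "\<bar>(fund N \<rho> - t0) / d\<bar> \<ge> 1" using d by (simp add: abs_divide)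
      then show ?thesis using \<beta>(4) by (simp add: k_def)
    qed
    have "(k has_integral B1 ((fund N b - t0) / d) - B1 ((fund N a - t0) / d)) {a..b}"
    proof (rule fundamental_theorem_of_calculus)
      show "a \<le> b" using \<rho>0 by auto
      show "((\<lambda>\<rho>. B1 ((fund N \<rho> - t0) / d)) has_vector_derivative k \<rho>) (at \<rho> within {a..b})" if "\<rho> \<in> {a..b}" for \<rho>
      proof -
        have 1: "((\<lambda>\<rho>. (fund N \<rho> - t0) / d) has_real_derivative \<rho> powr (1 - N) / d) (at \<rho>)"
          using that a d by (auto intro!: derivative_eq_intros fund_has_derivative[OF N])
        have "((\<lambda>\<rho>. B1 ((fund N \<rho> - t0) / d)) has_real_derivative k \<rho>) (at \<rho>)"
          using DERIV_chain2[OF \<beta>(2)[rule_format] 1] by (simp add: k_def)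
        then show ?thesis
          by (simp add: has_real_derivative_iff_has_vector_derivative has_vector_derivative_at_within)
      qed
    qed
    moreover have "B1 ((fund N b - t0) / d) = 1"
    proof -
      have "fund N (\<rho>0 + s') \<le> fund N b" using fund_le_iff[OF N] s' a \<rho>0 by auto
      then have "(fund N b - t0) / d \<ge> 1" using d by (simp add: d0_def)
      then show ?thesis using \<beta>(6) by simp
    qed
    moreover have "B1 ((fund N a - t0) / d) = 0"
    proof -
      have "fund N a \<le> fund N (\<rho>0 - s')" using fund_le_iff[OF N] s' a \<rho>0 by auto
      then have "fund N a - t0 \<le> - d" using d by (simp add: d0_def)
      then have "(fund N a - t0) / d \<le> -1" using d by (simp add: divide_le_eq)
      then show ?thesis using \<beta>(5) by simp
    qed
    ultimately have k1: "(k has_integral 1) {a..b}" by simp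
    have "((\<lambda>\<rho>. w \<rho>0 * k \<rho>) has_integral w \<rho>0 * 1) {a..b}" by (rule has_integral_mult_right[OF k1])
    moreover have "(\<lambda>\<rho>. w \<rho> * k \<rho>) integrable_on {a..b}"
      by (intro integrable_continuous_real continuous_intros w kc)
    ultimately have "integral {a..b} (\<lambda>\<rho>. w \<rho> * k \<rho>) - w \<rho>0 = integral {a..b} (\<lambda>\<rho>. w \<rho> * k \<rho> - w \<rho>0 * k \<rho>)"
      by (simp add: Henstock_Kurzweil_Integration.integral_diff has_integral_iff)
    also have "norm \<dots> \<le> integral {a..b} (\<lambda>\<rho>. e / 2 * k \<rho>)"
    proof (rule integral_norm_bound_integral)
      show "(\<lambda>\<rho>. w \<rho> * k \<rho> - w \<rho>0 * k \<rho>) integrable_on {a..b}" "(\<lambda>\<rho>. e / 2 * k \<rho>) integrable_on {a..b}"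
        by (intro integrable_continuous_real continuous_intros w kc)+
      show "norm (w \<rho> * k \<rho> - w \<rho>0 * k \<rho>) \<le> e / 2 * k \<rho>" if "\<rho> \<in> {a..b}" for \<rho>
      proof (cases "dist \<rho> \<rho>0 < s")
        case True
        have "norm (w \<rho> * k \<rho> - w \<rho>0 * k \<rho>) = dist (w \<rho>) (w \<rho>0) * k \<rho>"
          using k0[of \<rho>] by (simp add: left_diff_distrib[symmetric] abs_mult dist_real_def)
        also have "\<dots> \<le> e / 2 * k \<rho>" using s(2)[OF that True] k0[of \<rho>] by (intro mult_right_mono) auto
        finally show ?thesis .
      qed (use kz[OF that] in simp)
    qed
    also have "\<dots> = e / 2" using has_integral_mult_right[OF k1, of "e / 2"] by (simp add: has_integral_iff)
    finally show ?thesis using e by (simp add: dist_real_def k_def mult.assoc)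
  qed
  have "eventually (\<lambda>d. d \<in> {0<..<d0}) (at_right 0)" using d0 by (rule eventually_at_right_real)
  then show "eventually (\<lambda>d. dist (integral {a..b} (\<lambda>\<rho>. w \<rho> * (\<beta> ((fund N \<rho> - fund N \<rho>0) / d) / d) * \<rho> powr (1 - N))) (w \<rho>0) < e) (at_right 0)"
    by (rule eventually_mono) (use key in \<open>auto simp: t0_def\<close>)
qed

lemma norm_integral_le_integral:
  fixes f :: "'a \<Rightarrow> real"
  assumes "integrable M f" "integrable M g" "\<And>x. norm (f x) \<le> g x"
  shows "norm (integral\<^sup>L M f) \<le> integral\<^sup>L M g"
proof -
  have "norm (integral\<^sup>L M f) \<le> (LINT x|M. norm (f x))" by (rule integral_norm_bound)
  also have "\<dots> \<le> integral\<^sup>L M g" using assms by (intro integral_mono) auto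
  finally show ?thesis .
qed

lemma smooth_real_sum:
  "finite J \<Longrightarrow> (\<And>j. j \<in> J \<Longrightarrow> smooth_real (f j)) \<Longrightarrow> smooth_real (\<lambda>t. \<Sum>j\<in>J. f j t)"
  by (induction J rule: finite_induct) (auto intro: smooth_real.const smooth_real.add)

lemma fund_norm_measurable: "(\<lambda>x::real^'n::finite. fund N (norm x)) \<in> borel_measurable borel"
  unfolding fund_def by measurable

text \<open>The two conditions on \<open>c\<close> make the combination of hinges vanish on both sides of the annulus, so
  that it is a limit of admissible test functions.\<close>

lemma hinge_combination_identity:
  fixes u :: "real^'n::finite \<Rightarrow> real" and g :: "'n \<Rightarrow> real^'n \<Rightarrow> real" and c \<rho> :: "nat \<Rightarrow> real"
  assumes N: "N = real CARD('n::finite)" "N > 2" and ab: "0 < a" "a < b" "b < r"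
    and u: "\<And>x. x \<in> ball 0 r \<Longrightarrow> u x = w (norm x)" and w: "continuous_on {a..b} w"
    and wk: "\<And>i. has_weak_deriv (ball 0 r) [i, i] u (g i)"
    and J: "finite J" "\<And>j. j \<in> J \<Longrightarrow> \<rho> j \<in> {a<..<b}"
    and c: "(\<Sum>j\<in>J. c j) = 0" "(\<Sum>j\<in>J. c j * fund N (\<rho> j)) = 0"
  shows "sphere_const TYPE('n) * (\<Sum>j\<in>J. c j * w (\<rho> j)) =
    (LINT x:annulus a b|lebesgue. (\<Sum>i\<in>UNIV. g i x) * (\<Sum>j\<in>J. c j * max 0 (fund N (norm x) - fund N (\<rho> j))))"
proof -
  let ?s = "sphere_const TYPE('n)"
  define L where "L x = (\<Sum>i\<in>UNIV. g i x)" for x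
  define q where "q x = fund N (norm (x::real^'n))" for x
  define t where "t j = fund N (\<rho> j)" for j
  obtain B B1 \<beta> where B: "smooth_real B" and B1: "smooth_real B1" and \<beta>c: "continuous_on UNIV \<beta>"
    and dB: "\<forall>t. (B has_real_derivative B1 t) (at t)" and dB1: "\<forall>t. (B1 has_real_derivative \<beta> t) (at t)"
    and \<beta>0: "\<forall>t. \<beta> t \<ge> 0" and \<beta>z: "\<forall>t. \<bar>t\<bar> \<ge> 1 \<longrightarrow> \<beta> t = 0"
    and "\<forall>t. 0 \<le> B1 t \<and> B1 t \<le> 1" and B1l: "\<forall>t\<le>-1. B1 t = 0" and B1r: "\<forall>t\<ge>1. B1 t = 1"
    and Bl: "\<forall>t\<le>-1. B t = 0" and Br: "\<forall>t\<ge>1. B t = B 1 + (t - 1)" and Bm: "\<forall>t. \<bar>B t - max 0 t\<bar> \<le> 2"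
    by (rule smooth_hinge) (rule that)
  have Lint: "set_integrable lebesgue (annulus a b) L"
  proof -
    have K: "compact (annulus a b) \<and> annulus a b \<subseteq> ball (0::real^'n) r"
      using ab compact_annulus by (auto simp: annulus_def)
    have li: "locally_integrable (ball 0 r) (g i)" for i
      using wk[of i] unfolding has_weak_deriv_def by simp
    have "set_integrable lebesgue (annulus a b) (g i)" for i
      by (rule li[unfolded locally_integrable_def, rule_format, OF K])
    then have "integrable lebesgue (\<lambda>x. \<Sum>i\<in>UNIV. indicator (annulus a b) x *\<^sub>R g i x)"
      unfolding set_integrable_def by (intro Bochner_Integration.integrable_sum)
    then show ?thesis unfolding set_integrable_def L_def by (simp only: scaleR_sum_right)
  qed
  \<comment> \<open>Smoothings of width \<open>d\<close>: the prefactor \<open>d\<close> makes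
    \<open>\<eta> d\<close> tend uniformly to the hinge combination, while \<open>\<eta>2 d\<close>
    becomes a combination of approximate identities at the \<open>t j\<close>.\<close>
  define \<eta> where "\<eta> d s = (\<Sum>j\<in>J. (c j * d) * B ((1 / d) * (s + - t j)))" for d s
  define \<eta>1 where "\<eta>1 d s = (\<Sum>j\<in>J. c j * B1 ((1 / d) * (s + - t j)))" for d s
  define \<eta>2 where "\<eta>2 d s = (\<Sum>j\<in>J. c j * (\<beta> ((s - t j) / d) / d))" for d s
  \<comment> \<open>For smaller \<open>d\<close> the smoothed corners stay between
    \<open>fund N a\<close> and \<open>fund N b\<close>.\<close>
  define d0 where "d0 = Min (insert 1 ((\<lambda>j. min (fund N b - t j) (t j - fund N a)) ` J))"
  have tj: "fund N a < t j" "t j < fund N b" if "j \<in> J" for j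
    using J(2)[OF that] ab fund_strict_mono[OF N(2)] by (auto simp: t_def)
  have d0: "d0 > 0" unfolding d0_def using J(1) tj by (subst Min_gr_iff) auto
  have d0j: "d0 \<le> fund N b - t j" "d0 \<le> t j - fund N a" if "j \<in> J" for j
  proof -
    have "d0 \<le> min (fund N b - t j) (t j - fund N a)" unfolding d0_def using J(1) that by (intro Min_le) auto
    then show "d0 \<le> fund N b - t j" "d0 \<le> t j - fund N a" by auto
  qed
  have ident: "?s * integral {a..b} (\<lambda>\<rho>. w \<rho> * \<eta>2 d (fund N \<rho>) * \<rho> powr (1 - N)) =
      (LINT x:annulus a b|lebesgue. L x * \<eta> d (q x))" if d: "0 < d" "d < d0" for d
    unfolding L_def q_def
  proof (rule radial_weak_identity[OF N ab u w wk])
    show "smooth_real (\<eta> d)" unfolding \<eta>_def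
    proof (rule smooth_real_sum[OF J(1)])
      fix j
      have "smooth_real (\<lambda>s. (1 / d) * (s + - t j))"
        by (rule smooth_real.mult[OF smooth_real.const smooth_real.add[OF smooth_real.ident smooth_real.const]])
      from smooth_real.mult[OF smooth_real.const smooth_real.comp[OF B this]]
      show "smooth_real (\<lambda>s. (c j * d) * B ((1 / d) * (s + - t j)))" .
    qed
    show "(\<eta> d has_real_derivative \<eta>1 d s) (at s)" for s
      unfolding \<eta>_def \<eta>1_def
    proof (rule DERIV_sum)
      fix j
      have 1: "((\<lambda>s. (1 / d) * (s + - t j)) has_real_derivative 1 / d) (at s)"
        using d by (auto intro!: derivative_eq_intros)
      show "((\<lambda>s. (c j * d) * B ((1 / d) * (s + - t j))) has_real_derivative c j * B1 ((1 / d) * (s + - t j))) (at s)"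
        using DERIV_cmult[OF DERIV_chain2[OF dB[rule_format] 1], of "c j * d"] d by simp
    qed
    show "(\<eta>1 d has_real_derivative \<eta>2 d s) (at s)" for s
      unfolding \<eta>1_def \<eta>2_def
    proof (rule DERIV_sum)
      fix j
      have 1: "((\<lambda>s. (1 / d) * (s + - t j)) has_real_derivative 1 / d) (at s)"
        using d by (auto intro!: derivative_eq_intros)
      show "((\<lambda>s. c j * B1 ((1 / d) * (s + - t j))) has_real_derivative c j * (\<beta> ((s - t j) / d) / d)) (at s)"
        using DERIV_cmult[OF DERIV_chain2[OF dB1[rule_format] 1], of "c j"] d by simp
    qed
    show "\<eta> d s = 0" if s: "s \<notin> {fund N a..fund N b}" for s
    proof -
      consider "s < fund N a" | "s > fund N b" using s by force
      then show ?thesis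
      proof cases
        case 1
        have "B ((1 / d) * (s + - t j)) = 0" if "j \<in> J" for j
        proof -
          have "s + - t j \<le> - d" using d0j(2)[OF that] d 1 by simp
          then have "(1 / d) * (s + - t j) \<le> -1" using d by (simp add: field_simps)
          then show ?thesis using Bl by simp
        qed
        then show ?thesis by (simp add: \<eta>_def)
      next
        case 2
        \<comment> \<open>Beyond all corners each smoothed hinge is affine with slope 1 and the same
          extra shift \<open>d * (B 1 - 1)\<close>, so smoothing does not disturb the
          cancellation.\<close>
        have "(c j * d) * B ((1 / d) * (s + - t j)) = c j * (d * (B 1 - 1) + s) - c j * t j" if "j \<in> J" for j
        proof -
          have "s + - t j \<ge> d" using d0j(1)[OF that] d 2 by simp
          then have "(1 / d) * (s + - t j) \<ge> 1" using d by (simp add: field_simps)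
          then have "B ((1 / d) * (s + - t j)) = B 1 + ((1 / d) * (s + - t j) - 1)" using Br by blast
          moreover have "d * (B 1 + ((1 / d) * (s + - t j) - 1)) = d * (B 1 - 1) + s - t j"
            using d by (simp add: algebra_simps)
          ultimately have "d * B ((1 / d) * (s + - t j)) = d * (B 1 - 1) + s - t j" by simp
          then show ?thesis by (simp only: mult.assoc right_diff_distrib)
        qed
        then have "\<eta> d s = (\<Sum>j\<in>J. c j * (d * (B 1 - 1) + s) - c j * t j)"
          unfolding \<eta>_def by (intro sum.cong) auto
        also have "\<dots> = (\<Sum>j\<in>J. c j) * (d * (B 1 - 1) + s) - (\<Sum>j\<in>J. c j * t j)"
          by (simp add: sum_subtractf sum_distrib_right)
        finally show ?thesis using c by (simp add: t_def)
      qed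
    qed
    show "continuous_on UNIV (\<eta>2 d)"
      unfolding \<eta>2_def using d by (intro continuous_intros continuous_on_compose2[OF \<beta>c]) auto
  qed
  have split: "integral {a..b} (\<lambda>\<rho>. w \<rho> * \<eta>2 d (fund N \<rho>) * \<rho> powr (1 - N)) =
     (\<Sum>j\<in>J. c j * integral {a..b} (\<lambda>\<rho>. w \<rho> * (\<beta> ((fund N \<rho> - t j) / d) / d) * \<rho> powr (1 - N)))" if d: "0 < d" for d
  proof -
    have ii: "(\<lambda>\<rho>. c j * (w \<rho> * (\<beta> ((fund N \<rho> - t j) / d) / d) * \<rho> powr (1 - N))) integrable_on {a..b}" for j
      using d ab by (intro integrable_continuous_real continuous_intros w continuous_on_compose2[OF \<beta>c] fund_continuous[OF N(2)]) auto
    have "integral {a..b} (\<lambda>\<rho>. w \<rho> * \<eta>2 d (fund N \<rho>) * \<rho> powr (1 - N)) =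
       integral {a..b} (\<lambda>\<rho>. \<Sum>j\<in>J. c j * (w \<rho> * (\<beta> ((fund N \<rho> - t j) / d) / d) * \<rho> powr (1 - N)))"
      unfolding \<eta>2_def by (intro integral_cong) (simp add: sum_distrib_left sum_distrib_right mult_ac)
    also have "\<dots> = (\<Sum>j\<in>J. integral {a..b} (\<lambda>\<rho>. c j * (w \<rho> * (\<beta> ((fund N \<rho> - t j) / d) / d) * \<rho> powr (1 - N))))"
      by (rule Henstock_Kurzweil_Integration.integral_sum[OF J(1) ii])
    finally show ?thesis by simp
  qed
  have lhs: "((\<lambda>d. ?s * integral {a..b} (\<lambda>\<rho>. w \<rho> * \<eta>2 d (fund N \<rho>) * \<rho> powr (1 - N))) \<longlongrightarrow> ?s * (\<Sum>j\<in>J. c j * w (\<rho> j))) (at_right 0)"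
  proof (rule Lim_transform_eventually)
    show "((\<lambda>d. ?s * (\<Sum>j\<in>J. c j * integral {a..b} (\<lambda>\<rho>. w \<rho> * (\<beta> ((fund N \<rho> - t j) / d) / d) * \<rho> powr (1 - N)))) \<longlongrightarrow> ?s * (\<Sum>j\<in>J. c j * w (\<rho> j))) (at_right 0)"
      unfolding t_def
      by (intro tendsto_mult tendsto_const tendsto_sum bump_average_tendsto[OF N(2) ab(1) J(2) w \<beta>c dB1 \<beta>0 \<beta>z B1l B1r])
    show "\<forall>\<^sub>F d in at_right 0. ?s * (\<Sum>j\<in>J. c j * integral {a..b} (\<lambda>\<rho>. w \<rho> * (\<beta> ((fund N \<rho> - t j) / d) / d) * \<rho> powr (1 - N))) =
       ?s * integral {a..b} (\<lambda>\<rho>. w \<rho> * \<eta>2 d (fund N \<rho>) * \<rho> powr (1 - N))"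
      using eventually_at_right_less[of 0] by eventually_elim (simp add: split)
  qed
  define h where "h s = (\<Sum>j\<in>J. c j * max 0 (s - t j))" for s
  have qc: "continuous_on (annulus a b) q"
    unfolding q_def by (rule continuous_on_compose2[OF fund_continuous[OF N(2) ab(1), of b]])
      (auto simp: annulus_def intro: continuous_intros)
  have \<eta>i: "set_integrable lebesgue (annulus a b) (\<lambda>x. L x * \<eta> d (q x))" if "d > 0" for d
  proof (rule set_integrable_mult_continuous[OF Lint compact_annulus])
    have "continuous_on UNIV B" using smooth_real_isCont[OF B] by (simp add: continuous_at_imp_continuous_on)
    then have "continuous_on (annulus a b) (\<lambda>x. B ((1 / d) * (q x + - t j)))" for j
      by (rule continuous_on_compose2) (intro continuous_intros qc, auto)
    then show "continuous_on (annulus a b) (\<lambda>x. \<eta> d (q x))"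
      unfolding \<eta>_def by (intro continuous_on_sum continuous_on_mult continuous_on_const)
  qed
  have hi: "set_integrable lebesgue (annulus a b) (\<lambda>x. L x * h (q x))"
    unfolding h_def by (intro set_integrable_mult_continuous[OF Lint compact_annulus] continuous_intros qc)
  define M where "M = (LINT x:annulus a b|lebesgue. \<bar>L x\<bar>)"
  define S where "S = (\<Sum>j\<in>J. \<bar>c j\<bar> * 2)"
  have close: "\<bar>\<eta> d s - h s\<bar> \<le> d * S" if d: "d > 0" for d s
  proof -
    have "\<eta> d s - h s = (\<Sum>j\<in>J. (c j * d) * (B ((1 / d) * (s + - t j)) - max 0 ((1 / d) * (s + - t j))))"
    proof -
      have "max 0 (s - t j) = d * max 0 ((1 / d) * (s + - t j))" for j
        using d by (auto simp: max_def field_simps)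
      then show ?thesis unfolding \<eta>_def h_def by (simp add: sum_subtractf right_diff_distrib mult.assoc)
    qed
    also have "\<bar>\<dots>\<bar> \<le> (\<Sum>j\<in>J. d * (\<bar>c j\<bar> * 2))"
    proof (rule order.trans[OF sum_abs], rule sum_mono)
      fix j
      have "(\<bar>c j\<bar> * d) * \<bar>B ((1 / d) * (s + - t j)) - max 0 ((1 / d) * (s + - t j))\<bar> \<le> (\<bar>c j\<bar> * d) * 2"
        using Bm d by (intro mult_left_mono) auto
      then show "\<bar>(c j * d) * (B ((1 / d) * (s + - t j)) - max 0 ((1 / d) * (s + - t j)))\<bar> \<le> d * (\<bar>c j\<bar> * 2)"
        using d by (simp add: abs_mult mult_ac)
    qed
    also have "\<dots> = d * S" by (simp add: S_def sum_distrib_left)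
    finally show ?thesis .
  qed
  have rhs: "((\<lambda>d. (LINT x:annulus a b|lebesgue. L x * \<eta> d (q x))) \<longlongrightarrow> (LINT x:annulus a b|lebesgue. L x * h (q x))) (at_right 0)"
  proof (rule Lim_transform2[OF tendsto_const])
    have "((\<lambda>d. d * S * M) \<longlongrightarrow> 0 * S * M) (at_right 0)" by (intro tendsto_intros)
    then have 0: "((\<lambda>d. d * S * M) \<longlongrightarrow> 0) (at_right 0)" by simp
    show "((\<lambda>d. (LINT x:annulus a b|lebesgue. L x * h (q x)) - (LINT x:annulus a b|lebesgue. L x * \<eta> d (q x))) \<longlongrightarrow> 0) (at_right 0)"
    proof (rule Lim_null_comparison[OF _ 0])
      show "\<forall>\<^sub>F d in at_right 0. norm ((LINT x:annulus a b|lebesgue. L x * h (q x)) - (LINT x:annulus a b|lebesgue. L x * \<eta> d (q x))) \<le> d * S * M"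
        using eventually_at_right_less[of 0]
      proof eventually_elim
        case (elim d)
        have "(LINT x:annulus a b|lebesgue. L x * h (q x)) - (LINT x:annulus a b|lebesgue. L x * \<eta> d (q x)) =
            (LINT x:annulus a b|lebesgue. L x * h (q x) - L x * \<eta> d (q x))"
          by (rule set_integral_diff(2)[symmetric, OF hi \<eta>i[OF elim]])
        also have "norm \<dots> \<le> (LINT x:annulus a b|lebesgue. d * S * \<bar>L x\<bar>)"
          unfolding set_lebesgue_integral_def
        proof (rule norm_integral_le_integral)
          show "integrable lebesgue (\<lambda>x. indicator (annulus a b) x *\<^sub>R (L x * h (q x) - L x * \<eta> d (q x)))"
            using set_integral_diff(1)[OF hi \<eta>i[OF elim]] unfolding set_integrable_def .
          have "set_integrable lebesgue (annulus a b) (\<lambda>x. d * S * \<bar>L x\<bar>)"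
            using set_integrable_abs[OF Lint] by (intro set_integrable_mult_right) auto
          then show "integrable lebesgue (\<lambda>x. indicator (annulus a b) x *\<^sub>R (d * S * \<bar>L x\<bar>))"
            unfolding set_integrable_def .
          show "norm (indicator (annulus a b) x *\<^sub>R (L x * h (q x) - L x * \<eta> d (q x))) \<le> indicator (annulus a b) x *\<^sub>R (d * S * \<bar>L x\<bar>)" for x
          proof -
            have "\<bar>L x * h (q x) - L x * \<eta> d (q x)\<bar> = \<bar>L x\<bar> * \<bar>\<eta> d (q x) - h (q x)\<bar>"
              unfolding right_diff_distrib[symmetric] abs_mult by (simp add: abs_minus_commute)
            also have "\<dots> \<le> \<bar>L x\<bar> * (d * S)" using close[OF elim] by (intro mult_left_mono) auto
            finally show ?thesis by (simp add: indicator_def mult_ac)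
          qed
        qed
        also have "\<dots> = d * S * M" unfolding M_def by simp
        finally show ?case .
      qed
    qed
  qed
  have "?s * (\<Sum>j\<in>J. c j * w (\<rho> j)) = (LINT x:annulus a b|lebesgue. L x * h (q x))"
  proof (rule tendsto_unique[OF _ lhs])
    show "((\<lambda>d. ?s * integral {a..b} (\<lambda>\<rho>. w \<rho> * \<eta>2 d (fund N \<rho>) * \<rho> powr (1 - N))) \<longlongrightarrow> (LINT x:annulus a b|lebesgue. L x * h (q x))) (at_right 0)"
    proof (rule Lim_transform_eventually[OF rhs])
      have "eventually (\<lambda>d. d \<in> {0<..<d0}) (at_right 0)" using d0 by (rule eventually_at_right_real)
      then show "\<forall>\<^sub>F d in at_right 0. (LINT x:annulus a b|lebesgue. L x * \<eta> d (q x)) = ?s * integral {a..b} (\<lambda>\<rho>. w \<rho> * \<eta>2 d (fund N \<rho>) * \<rho> powr (1 - N))"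
        by (rule eventually_mono) (use ident in auto)
    qed
  qed simp
  then show ?thesis by (simp add: L_def q_def h_def t_def)
qed

text \<open>Off the null level set the integrand has derivative \<open>- L x\<close> where
  \<open>t0 < q x\<close> and 0 where \<open>q x < t0\<close>. The error of this linearisation is at
  most \<open>\<bar>L x\<bar> * \<bar>t - t0\<bar>\<close> and is supported where
  \<open>\<bar>q x - t0\<bar> \<le> d\<close>, so \<open>small_level_set\<close> makes it
  negligible.\<close>

lemma hinge_integral_has_derivative:
  fixes L q :: "real^'n::finite \<Rightarrow> real"
  assumes L: "set_integrable lebesgue K L" and K: "compact K" and qc: "continuous_on K q"
    and q: "q \<in> borel_measurable borel" and n: "negligible {x. q x = t0}"
  shows "((\<lambda>t. LINT x:K|lebesgue. L x * max 0 (q x - t)) has_real_derivative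
      - (LINT x:K|lebesgue. L x * indicator {x. t0 < q x} x)) (at t0)"
proof -
  define V where "V t = (LINT x:K|lebesgue. L x * max 0 (q x - t))" for t
  define D where "D = (LINT x:K|lebesgue. L x * indicator {x. t0 < q x} x)"
  have Vi: "set_integrable lebesgue K (\<lambda>x. L x * max 0 (q x - t))" for t
    by (intro set_integrable_mult_continuous[OF L K] continuous_intros qc)
  have sb: "{x. t0 < q x} \<in> sets lebesgue" for t0
  proof -
    have "{x \<in> space borel. t0 < q x} \<in> sets borel" using q by measurable
    then show ?thesis by (intro sets_completionI_sets) simp
  qed
  have Di: "set_integrable lebesgue K (\<lambda>x. L x * indicator {x. t0 < q x} x)"
  proof (rule set_integrable_mult_bounded[OF L, where M = 1])
    have "K \<in> sets lebesgue" using K by (intro sets_completionI_sets) (simp add: borel_closed compact_imp_closed)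
    then show "set_borel_measurable lebesgue K (indicator {x. t0 < q x} :: _ \<Rightarrow> real)"
      unfolding set_borel_measurable_def using sb by (intro borel_measurable_scaleR borel_measurable_indicator)
  qed (auto simp: indicator_def)
  have LI: "integrable lebesgue (\<lambda>x. indicator K x *\<^sub>R L x)" using L unfolding set_integrable_def .
  have "(V has_derivative (\<lambda>h. - D * h)) (at t0)"
    unfolding has_derivative_within_alt
  proof (intro conjI bounded_linear_mult_right allI impI)
    fix e :: real assume e: "e > 0"
    obtain d where d: "d > 0" "(LINT x|lebesgue. \<bar>indicator K x *\<^sub>R L x\<bar> * indicator {x. \<bar>q x - t0\<bar> \<le> d} x) < e"
      using small_level_set[OF LI q n e] by blast
    have "norm (V t - V t0 - - D * (t - t0)) \<le> e * norm (t - t0)" if t: "norm (t - t0) < d" for t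
    proof -
      define R where "R x = L x * max 0 (q x - t) - L x * max 0 (q x - t0) + (t - t0) * (L x * indicator {x. t0 < q x} x)" for x
      have Ri: "set_integrable lebesgue K R" unfolding R_def
        by (intro set_integral_add(1) set_integral_diff(1) Vi set_integrable_mult_right) (use Di in auto)
      have "V t - V t0 - - D * (t - t0) = (LINT x:K|lebesgue. R x)"
      proof -
        have "(LINT x:K|lebesgue. R x) = (LINT x:K|lebesgue. L x * max 0 (q x - t) - L x * max 0 (q x - t0)) +
            (LINT x:K|lebesgue. (t - t0) * (L x * indicator {x. t0 < q x} x))"
          unfolding R_def by (intro set_integral_add(2) set_integral_diff(1) Vi set_integrable_mult_right) (use Di in auto)
        also have "(LINT x:K|lebesgue. L x * max 0 (q x - t) - L x * max 0 (q x - t0)) = V t - V t0"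
          unfolding V_def by (intro set_integral_diff(2) Vi)
        also have "(LINT x:K|lebesgue. (t - t0) * (L x * indicator {x. t0 < q x} x)) = (t - t0) * D"
          unfolding D_def by simp
        finally show ?thesis by (simp add: algebra_simps)
      qed
      also have "norm \<dots> \<le> (LINT x|lebesgue. \<bar>t - t0\<bar> * (\<bar>indicator K x *\<^sub>R L x\<bar> * indicator {x. \<bar>q x - t0\<bar> \<le> d} x))"
        unfolding set_lebesgue_integral_def
      proof (rule norm_integral_le_integral)
        show "integrable lebesgue (\<lambda>x. indicator K x *\<^sub>R R x)" using Ri unfolding set_integrable_def .
        have "{x. \<bar>q x - t0\<bar> \<le> d} \<in> sets lebesgue"
        proof -
          have "{x \<in> space borel. \<bar>q x - t0\<bar> \<le> d} \<in> sets borel" using q by measurable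
          then show ?thesis by (intro sets_completionI_sets) simp
        qed
        then have "integrable lebesgue (\<lambda>x. \<bar>indicator K x *\<^sub>R L x\<bar> * indicator {x. \<bar>q x - t0\<bar> \<le> d} x)"
          using integrable_mult_indicator[OF _ integrable_abs[OF LI], of "{x. \<bar>q x - t0\<bar> \<le> d}"] by (simp add: mult.commute)
        then show "integrable lebesgue (\<lambda>x. \<bar>t - t0\<bar> * (\<bar>indicator K x *\<^sub>R L x\<bar> * indicator {x. \<bar>q x - t0\<bar> \<le> d} x))"
          by (rule integrable_mult_right)
        show "norm (indicator K x *\<^sub>R R x) \<le> \<bar>t - t0\<bar> * (\<bar>indicator K x *\<^sub>R L x\<bar> * indicator {x. \<bar>q x - t0\<bar> \<le> d} x)" for x
        proof -
          have "R x = L x * (max 0 (q x - t) - max 0 (q x - t0) + (t - t0) * indicator {x. t0 < q x} x)"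
            by (simp add: R_def algebra_simps)
          moreover have "\<bar>max 0 (q x - t) - max 0 (q x - t0) + (t - t0) * indicator {x. t0 < q x} x\<bar> \<le>
              \<bar>t - t0\<bar> * indicator {x. \<bar>q x - t0\<bar> \<le> d} x"
            using t by (auto simp: indicator_def max_def abs_if split: if_splits)
          then have "\<bar>L x\<bar> * \<bar>max 0 (q x - t) - max 0 (q x - t0) + (t - t0) * indicator {x. t0 < q x} x\<bar> \<le>
              \<bar>L x\<bar> * (\<bar>t - t0\<bar> * indicator {x. \<bar>q x - t0\<bar> \<le> d} x)" by (intro mult_left_mono) auto
          ultimately show ?thesis by (simp add: abs_mult indicator_def mult_ac)
        qed
      qed
      also have "\<dots> = \<bar>t - t0\<bar> * (LINT x|lebesgue. \<bar>indicator K x *\<^sub>R L x\<bar> * indicator {x. \<bar>q x - t0\<bar> \<le> d} x)"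
        by simp
      also have "\<dots> \<le> \<bar>t - t0\<bar> * e" using d(2) by (intro mult_left_mono) auto
      finally show ?thesis by (simp add: mult.commute)
    qed
    then show "\<exists>d>0. \<forall>t\<in>UNIV. norm (t - t0) < d \<longrightarrow> norm (V t - V t0 - - D * (t - t0)) \<le> e * norm (t - t0)"
      using d(1) by blast
  qed
  then have "(V has_real_derivative - D) (at t0)" unfolding has_field_derivative_def .
  then show ?thesis unfolding V_def[abs_def] D_def .
qed

section \<open>Differentiability and flux of the radial profile\<close>

lemma annulus_shell_sets: "{x::real^'n::finite. a < norm x \<and> norm x \<le> b} \<in> sets borel"
proof -
  have "{x::real^'n. a < norm x \<and> norm x \<le> b} = cball 0 b - cball 0 a" by auto
  then show ?thesis by simp
qed

lemma negligible_norm_level: "negligible {x::real^'n::finite. norm x = t}"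
proof -
  have "{x::real^'n. norm x = t} = sphere 0 t" by auto
  then show ?thesis by (simp add: negligible_sphere)
qed

text \<open>Three hinges, at the variable radius and at two fixed radii, admit coefficients meeting
  the conditions of \<open>hinge_combination_identity\<close>. The identity then says that the
  sphere constant times \<open>w \<rho>\<close> differs from \<open>V (fund N \<rho>)\<close> by an
  affine function of \<open>fund N \<rho>\<close>, so the continuous function \<open>w\<close>
  inherits the differentiability of \<open>V\<close>.\<close>

lemma radial_derivative_local:
  fixes u :: "real^'n::finite \<Rightarrow> real" and g :: "'n \<Rightarrow> real^'n \<Rightarrow> real"
  assumes N: "N = real CARD('n::finite)" "N > 2" and ab: "0 < a" "a < b" "b < r"
    and u: "\<And>x. x \<in> ball 0 r \<Longrightarrow> u x = w (norm x)" and w: "continuous_on {a..b} w"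
    and wk: "\<And>i. has_weak_deriv (ball 0 r) [i, i] u (g i)"
  defines "T \<equiv> \<lambda>\<rho>. LINT x:annulus a b|lebesgue. (\<Sum>i\<in>UNIV. g i x) * indicator {x. \<rho> < norm x} x"
  shows "set_integrable lebesgue (annulus a b) (\<lambda>x. \<Sum>i\<in>UNIV. g i x)"
    and "\<exists>K. \<forall>\<rho>\<in>{a<..<b}. (w has_real_derivative \<rho> powr (1 - N) * ((K - T \<rho>) / sphere_const TYPE('n))) (at \<rho>)"
proof -
  let ?s = "sphere_const TYPE('n)"
  define L where "L x = (\<Sum>i\<in>UNIV. g i x)" for x
  define q where "q x = fund N (norm (x::real^'n))" for x
  have K: "compact (annulus a b) \<and> annulus a b \<subseteq> ball (0::real^'n) r"
    using ab compact_annulus by (auto simp: annulus_def)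
  have li: "locally_integrable (ball 0 r) (g i)" for i
    using wk[of i] unfolding has_weak_deriv_def by simp
  have gi: "set_integrable lebesgue (annulus a b) (g i)" for i
    by (rule li[unfolded locally_integrable_def, rule_format, OF K])
  have "integrable lebesgue (\<lambda>x. \<Sum>i\<in>UNIV. indicator (annulus a b) x *\<^sub>R g i x)"
    using gi unfolding set_integrable_def by (intro Bochner_Integration.integrable_sum)
  then have Lint: "set_integrable lebesgue (annulus a b) L"
    unfolding set_integrable_def L_def by (simp only: scaleR_sum_right)
  then show "set_integrable lebesgue (annulus a b) (\<lambda>x. \<Sum>i\<in>UNIV. g i x)" unfolding L_def .
  have qc: "continuous_on (annulus a b) q"
    unfolding q_def by (rule continuous_on_compose2[OF fund_continuous[OF N(2) ab(1), of b]])
      (auto simp: annulus_def intro: continuous_intros)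
  define V where "V t = (LINT x:annulus a b|lebesgue. L x * max 0 (q x - t))" for t
  have Vi: "set_integrable lebesgue (annulus a b) (\<lambda>x. L x * max 0 (q x - t))" for t
    by (intro set_integrable_mult_continuous[OF Lint compact_annulus] continuous_intros qc)
  \<comment> \<open>Two fixed nodes at the thirds of the interval; the values there determine the
    affine function.\<close>
  define p1 where "p1 = (2 * a + b) / 3"
  define p2 where "p2 = (a + 2 * b) / 3"
  have p: "p1 \<in> {a<..<b}" "p2 \<in> {a<..<b}" "p1 < p2" using ab by (auto simp: p1_def p2_def)
  define t1 where "t1 = fund N p1"
  define t2 where "t2 = fund N p2"
  have t12: "t1 < t2" unfolding t1_def t2_def using p ab by (intro fund_strict_mono[OF N(2)]) auto
  define z where "z \<rho> = ?s * w \<rho> - V (fund N \<rho>)" for \<rho>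
  define B where "B = (z p2 - z p1) / (t2 - t1)"
  have aff: "z \<rho> = z p1 + B * (fund N \<rho> - t1)" if \<rho>: "\<rho> \<in> {a<..<b}" for \<rho>
  proof -
    \<comment> \<open>The affine coordinate of \<open>fund N \<rho>\<close> with respect to
      \<open>t1\<close> and \<open>t2\<close>; the weights \<open>1\<close>,
      \<open>\<theta> - 1\<close>, \<open>- \<theta>\<close> annihilate affine functions of
      \<open>fund\<close>.\<close>
    define \<theta> where "\<theta> = (fund N \<rho> - t1) / (t2 - t1)"
    define c where "c j = (if j = 0 then 1 else if j = 1 then \<theta> - 1 else - \<theta>)" for j :: nat
    define \<sigma> where "\<sigma> j = (if j = 0 then \<rho> else if j = 1 then p1 else p2)" for j :: nat
    have th: "\<theta> * (t2 - t1) = fund N \<rho> - t1" using t12 by (simp add: \<theta>_def)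
    have J: "(\<Sum>j\<in>{0,1,2}. f j) = f 0 + f 1 + f 2" for f :: "nat \<Rightarrow> real" by (simp add: add.assoc)
    have "?s * (\<Sum>j\<in>{0,1,2}. c j * w (\<sigma> j)) =
      (LINT x:annulus a b|lebesgue. (\<Sum>i\<in>UNIV. g i x) * (\<Sum>j\<in>{0,1,2}. c j * max 0 (fund N (norm x) - fund N (\<sigma> j))))"
    proof (rule hinge_combination_identity[OF N ab u w wk])
      show "(\<Sum>j\<in>{0,1,2}. c j) = 0" unfolding J by (simp add: c_def)
      show "(\<Sum>j\<in>{0,1,2}. c j * fund N (\<sigma> j)) = 0"
        unfolding J using th by (simp add: c_def \<sigma>_def t1_def[symmetric] t2_def[symmetric] algebra_simps)
    qed (use \<rho> p in \<open>auto simp: \<sigma>_def\<close>)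
    also have "\<dots> = (LINT x:annulus a b|lebesgue. L x * max 0 (q x - fund N \<rho>) + (\<theta> - 1) * (L x * max 0 (q x - t1)) + (- \<theta>) * (L x * max 0 (q x - t2)))"
    proof -
      have cs: "c 0 = 1" "c 1 = \<theta> - 1" "c 2 = - \<theta>" "\<sigma> 0 = \<rho>" "\<sigma> 1 = p1" "\<sigma> 2 = p2"
        by (simp_all add: c_def \<sigma>_def)
      have alg: "l * (1 * m0 + (\<theta> - 1) * m1 + - \<theta> * m2) = l * m0 + (\<theta> - 1) * (l * m1) + (- \<theta>) * (l * m2)" for l m0 m1 m2
        by (simp add: algebra_simps)
      show ?thesis unfolding J cs t1_def[symmetric] t2_def[symmetric] L_def[symmetric] q_def[symmetric] alg ..
    qed
    also have "\<dots> = V (fund N \<rho>) + (\<theta> - 1) * V t1 + (- \<theta>) * V t2"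
    proof -
      have i1: "set_integrable lebesgue (annulus a b) (\<lambda>x. k * (L x * max 0 (q x - t)))" for k t
        using Vi by (intro set_integrable_mult_right)
      show ?thesis unfolding V_def set_integral_add(2)[OF set_integral_add(1)[OF Vi i1] i1] set_integral_add(2)[OF Vi i1]
        by (simp only: set_integral_mult_right)
    qed
    finally have "?s * w \<rho> + (\<theta> - 1) * (?s * w p1) + (- \<theta>) * (?s * w p2) = V (fund N \<rho>) + (\<theta> - 1) * V t1 + (- \<theta>) * V t2"
      unfolding J by (simp add: c_def \<sigma>_def algebra_simps)
    then have "z \<rho> = z p1 + \<theta> * (z p2 - z p1)" by (simp add: z_def t1_def t2_def algebra_simps)
    then show ?thesis by (simp add: B_def \<theta>_def)
  qed
  have wz: "w \<rho> = (z p1 + B * (fund N \<rho> - t1) + V (fund N \<rho>)) / ?s" if "\<rho> \<in> {a<..<b}" for \<rho>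
    using aff[OF that] sphere_const_pos[where 'n = 'n] by (simp add: z_def field_simps)
  show "\<exists>K. \<forall>\<rho>\<in>{a<..<b}. (w has_real_derivative \<rho> powr (1 - N) * ((K - T \<rho>) / ?s)) (at \<rho>)"
  proof (intro exI[of _ B] ballI)
    fix \<rho> assume \<rho>: "\<rho> \<in> {a<..<b}"
    then have \<rho>0: "\<rho> > 0" using ab by auto
    have neg: "negligible {x::real^'n. q x = fund N \<rho>}"
    proof (rule negligible_subset[OF negligible_Un[OF negligible_norm_level[of \<rho>] negligible_sing[of 0]]])
      show "{x. q x = fund N \<rho>} \<subseteq> {x. norm x = \<rho>} \<union> {0}"
      proof (intro subsetI, rule ccontr)
        fix x assume x: "x \<in> {x. q x = fund N \<rho>}" "x \<notin> {x. norm x = \<rho>} \<union> {0}"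
        then have "norm x > 0" "norm x \<noteq> \<rho>" "fund N (norm x) = fund N \<rho>" by (auto simp: q_def)
        then show False using fund_strict_mono[OF N(2), of "norm x" \<rho>] fund_strict_mono[OF N(2), of \<rho> "norm x"] \<rho>0
          by (cases "norm x < \<rho>") auto
      qed
    qed
    have "(V has_real_derivative - (LINT x:annulus a b|lebesgue. L x * indicator {x. fund N \<rho> < q x} x)) (at (fund N \<rho>))"
      unfolding V_def[abs_def] by (rule hinge_integral_has_derivative[OF Lint compact_annulus qc _ neg])
        (simp add: q_def[abs_def] fund_norm_measurable)
    moreover have "(LINT x:annulus a b|lebesgue. L x * indicator {x. fund N \<rho> < q x} x) = T \<rho>"
      unfolding T_def L_def[symmetric]
    proof (rule set_lebesgue_integral_cong)
      show "annulus a b \<in> sets lebesgue" using annulus_sets by (intro sets_completionI_sets) simp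
      show "\<forall>x. x \<in> annulus a b \<longrightarrow> L x * indicator {x. fund N \<rho> < q x} x = L x * indicator {x. \<rho> < norm x} x"
      proof (intro allI impI)
        fix x :: "real^'n" assume "x \<in> annulus a b"
        then have "norm x > 0" using ab unfolding annulus_def mem_Collect_eq by linarith
        then have "fund N \<rho> < q x \<longleftrightarrow> \<rho> < norm x"
          using fund_le_iff[OF N(2) _ \<rho>0, of "norm x"] by (simp add: q_def not_le[symmetric])
        then show "L x * indicator {x. fund N \<rho> < q x} x = L x * indicator {x. \<rho> < norm x} x"
          by (simp add: indicator_def)
      qed
    qed
    ultimately have dV: "(V has_real_derivative - T \<rho>) (at (fund N \<rho>))" by simp
    have dV': "((\<lambda>\<rho>. V (fund N \<rho>)) has_real_derivative - T \<rho> * \<rho> powr (1 - N)) (at \<rho>)"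
      by (rule DERIV_chain2[OF dV fund_has_derivative[OF N(2) \<rho>0]])
    have d0: "((\<lambda>\<rho>. (z p1 + B * (fund N \<rho> - t1) + V (fund N \<rho>)) / ?s) has_real_derivative (B * \<rho> powr (1 - N) + - T \<rho> * \<rho> powr (1 - N)) / ?s) (at \<rho>)"
      using sphere_const_pos[where 'n = 'n]
      by (auto intro!: derivative_eq_intros dV' fund_has_derivative[OF N(2) \<rho>0])
    have e0: "(B * \<rho> powr (1 - N) + - T \<rho> * \<rho> powr (1 - N)) / ?s = \<rho> powr (1 - N) * ((B - T \<rho>) / ?s)"
      by (simp add: algebra_simps diff_divide_distrib)
    from d0[unfolded e0]
    show "(w has_real_derivative \<rho> powr (1 - N) * ((B - T \<rho>) / ?s)) (at \<rho>)"
      by (rule has_field_derivative_transform_within_open[of _ _ _ "{a<..<b}"]) (use \<rho> wz in auto)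
  qed
qed

text \<open>On each annulus the flux equals a constant minus the integral of the Laplacian beyond
  radius \<open>\<rho>\<close>; the constant depends on the annulus but drops out of differences.
  The shells are half-open so that adjacent ones add up exactly. Continuity of the flux, and so of
  \<open>deriv w\<close>, comes from spheres being null sets.\<close>

lemma radial_flux:
  fixes u :: "real^'n::finite \<Rightarrow> real" and g :: "'n \<Rightarrow> real^'n \<Rightarrow> real"
  assumes N2: "CARD('n) > 2"
    and u: "\<And>x. x \<in> ball 0 r \<Longrightarrow> u x = w (norm x)" and w: "continuous_on {0<..<r} w"
    and wk: "\<And>i. has_weak_deriv (ball 0 r) [i, i] u (g i)"
  defines "y \<equiv> \<lambda>\<rho>. sphere_const TYPE('n) * \<rho> ^ (CARD('n) - 1) * deriv w \<rho>"
  shows "\<And>\<rho>. \<rho> \<in> {0<..<r} \<Longrightarrow> (w has_real_derivative deriv w \<rho>) (at \<rho>)"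
    and "continuous_on {0<..<r} (deriv w)"
    and "\<And>a b. 0 < a \<Longrightarrow> a \<le> b \<Longrightarrow> b < r \<Longrightarrow>
      set_integrable lebesgue {x. a < norm x \<and> norm x \<le> b} (\<lambda>x. \<Sum>i\<in>UNIV. g i x) \<and>
      y b - y a = (LINT x:{x. a < norm x \<and> norm x \<le> b}|lebesgue. (\<Sum>i\<in>UNIV. g i x))"
proof -
  let ?s = "sphere_const TYPE('n)"
  define N where "N = real CARD('n)"
  have N: "N = real CARD('n)" "N > 2" using N2 by (auto simp: N_def)
  define L where "L x = (\<Sum>i\<in>UNIV. g i x)" for x
  have loc: "set_integrable lebesgue (annulus a b) L \<and> (\<exists>K. \<forall>\<rho>\<in>{a<..<b}. (w has_real_derivative deriv w \<rho>) (at \<rho>) \<and>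
      y \<rho> = K - (LINT x:annulus a b|lebesgue. L x * indicator {x. \<rho> < norm x} x))" if ab: "0 < a" "a < b" "b < r" for a b
  proof -
    have wc: "continuous_on {a..b} w" by (rule continuous_on_subset[OF w]) (use ab in auto)
    note rd = radial_derivative_local[OF N ab u wc wk, folded L_def]
    obtain K where K: "\<forall>\<rho>\<in>{a<..<b}. (w has_real_derivative \<rho> powr (1 - N) * ((K - (LINT x:annulus a b|lebesgue. L x * indicator {x. \<rho> < norm x} x)) / ?s)) (at \<rho>)"
      using rd(2) by blast
    have "(w has_real_derivative deriv w \<rho>) (at \<rho>) \<and> y \<rho> = K - (LINT x:annulus a b|lebesgue. L x * indicator {x. \<rho> < norm x} x)"
      if \<rho>: "\<rho> \<in> {a<..<b}" for \<rho>
    proof -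
      have d: "deriv w \<rho> = \<rho> powr (1 - N) * ((K - (LINT x:annulus a b|lebesgue. L x * indicator {x. \<rho> < norm x} x)) / ?s)"
        using K \<rho> by (intro DERIV_imp_deriv) auto
      have "\<rho> > 0" using \<rho> ab by auto
      then have "\<rho> ^ (CARD('n) - 1) = \<rho> powr (N - 1)" using N by (simp add: powr_realpow[symmetric] of_nat_diff)
      then have "\<rho> ^ (CARD('n) - 1) * \<rho> powr (1 - N) = 1" using \<open>\<rho> > 0\<close> by (simp add: powr_add[symmetric])
      moreover have "y \<rho> = (\<rho> ^ (CARD('n) - 1) * \<rho> powr (1 - N)) * (?s * ((K - (LINT x:annulus a b|lebesgue. L x * indicator {x. \<rho> < norm x} x)) / ?s))"
        unfolding y_def d by (simp only: mult_ac)
      ultimately have "y \<rho> = K - (LINT x:annulus a b|lebesgue. L x * indicator {x. \<rho> < norm x} x)"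
        using sphere_const_pos[where 'n = 'n] by simp
      then show ?thesis using K \<rho> d by simp
    qed
    then show ?thesis using rd(1) by blast
  qed
  show "(w has_real_derivative deriv w \<rho>) (at \<rho>)" if "\<rho> \<in> {0<..<r}" for \<rho>
    using loc[of "\<rho> / 2" "(\<rho> + r) / 2"] that by auto
  have mb: "(indicator {x::real^'n. \<rho> < norm x} :: _ \<Rightarrow> real) \<in> borel_measurable lebesgue" for \<rho>
  proof -
    have "{x::real^'n. \<rho> < norm x} = - cball 0 \<rho>" by auto
    then have "{x::real^'n. \<rho> < norm x} \<in> sets lebesgue" by (intro sets_completionI_sets) simp
    then show ?thesis by (intro borel_measurable_indicator)
  qed
  have annL: "annulus a b \<in> sets lebesgue" for a b using annulus_sets by (intro sets_completionI_sets) simp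
  have LTi: "set_integrable lebesgue (annulus a b) (\<lambda>x. L x * indicator {x. \<rho> < norm x} x)"
    if "set_integrable lebesgue (annulus a b) L" for a b \<rho>
  proof (rule set_integrable_mult_bounded[OF that, where M = 1])
    show "set_borel_measurable lebesgue (annulus a b) (indicator {x::real^'n. \<rho> < norm x} :: _ \<Rightarrow> real)"
      unfolding set_borel_measurable_def by (rule borel_measurable_scaleR[OF borel_measurable_indicator[OF annL] mb])
  qed (auto simp: indicator_def)
  have "set_integrable lebesgue {x. a < norm x \<and> norm x \<le> b} L \<and>
      y b - y a = (LINT x:{x. a < norm x \<and> norm x \<le> b}|lebesgue. L x)" if ab: "0 < a" "a \<le> b" "b < r" for a b
  proof -
    define a0 where "a0 = a / 2"
    define b0 where "b0 = (b + r) / 2"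
    have a0: "0 < a0" "a0 < b0" "b0 < r" "a \<in> {a0<..<b0}" "b \<in> {a0<..<b0}" using ab by (auto simp: a0_def b0_def)
    obtain K where Li: "set_integrable lebesgue (annulus a0 b0) L" and
      K: "\<forall>\<rho>\<in>{a0<..<b0}. y \<rho> = K - (LINT x:annulus a0 b0|lebesgue. L x * indicator {x. \<rho> < norm x} x)"
      using loc[OF a0(1-3)] by blast
    have eq: "indicator (annulus a0 b0) x *\<^sub>R (L x * indicator {x. a < norm x} x - L x * indicator {x. b < norm x} x) =
       indicator {x. a < norm x \<and> norm x \<le> b} x *\<^sub>R L x" for x
      using a0 ab by (auto simp: indicator_def annulus_def)
    have "set_integrable lebesgue (annulus a0 b0) (\<lambda>x. L x * indicator {x. a < norm x} x - L x * indicator {x. b < norm x} x)"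
      by (intro set_integral_diff(1) LTi Li)
    then have 1: "set_integrable lebesgue {x. a < norm x \<and> norm x \<le> b} L"
      unfolding set_integrable_def eq .
    have "y b - y a = (LINT x:annulus a0 b0|lebesgue. L x * indicator {x. a < norm x} x) - (LINT x:annulus a0 b0|lebesgue. L x * indicator {x. b < norm x} x)"
      using K a0 by simp
    also have "\<dots> = (LINT x:annulus a0 b0|lebesgue. L x * indicator {x. a < norm x} x - L x * indicator {x. b < norm x} x)"
      by (intro set_integral_diff(2)[symmetric] LTi Li)
    also have "\<dots> = (LINT x:{x. a < norm x \<and> norm x \<le> b}|lebesgue. L x)"
      unfolding set_lebesgue_integral_def eq ..
    finally show ?thesis using 1 by simp
  qed
  then show "set_integrable lebesgue {x. a < norm x \<and> norm x \<le> b} (\<lambda>x. \<Sum>i\<in>UNIV. g i x) \<and>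
      y b - y a = (LINT x:{x. a < norm x \<and> norm x \<le> b}|lebesgue. (\<Sum>i\<in>UNIV. g i x))"
    if "0 < a" "a \<le> b" "b < r" for a b
    using that unfolding L_def by blast
  have "isCont y \<rho>0" if \<rho>0: "\<rho>0 \<in> {0<..<r}" for \<rho>0
    unfolding continuous_at_eps_delta
  proof (intro allI impI)
    fix e :: real assume e: "e > 0"
    define a0 where "a0 = \<rho>0 / 2"
    define b0 where "b0 = (\<rho>0 + r) / 2"
    have a0: "0 < a0" "a0 < b0" "b0 < r" "a0 < \<rho>0" "\<rho>0 < b0" using \<rho>0 by (auto simp: a0_def b0_def)
    obtain K where Li: "set_integrable lebesgue (annulus a0 b0) L" and
      K: "\<forall>\<rho>\<in>{a0<..<b0}. y \<rho> = K - (LINT x:annulus a0 b0|lebesgue. L x * indicator {x. \<rho> < norm x} x)"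
      using loc[OF a0(1-3)] by blast
    have LI: "integrable lebesgue (\<lambda>x. indicator (annulus a0 b0) x *\<^sub>R L x)" using Li unfolding set_integrable_def .
    have nm: "(\<lambda>x::real^'n. norm x) \<in> borel_measurable borel" by measurable
    obtain d where d: "d > 0" "(LINT x|lebesgue. \<bar>indicator (annulus a0 b0) x *\<^sub>R L x\<bar> * indicator {x. \<bar>norm x - \<rho>0\<bar> \<le> d} x) < e"
      using small_level_set[OF LI nm negligible_norm_level e] by blast
    define d' where "d' = min d (min (\<rho>0 - a0) (b0 - \<rho>0))"
    have d': "d' > 0" using d a0 by (simp add: d'_def)
    have "dist (y \<rho>) (y \<rho>0) < e" if \<rho>: "dist \<rho> \<rho>0 < d'" for \<rho>
    proof -
      have in0: "\<rho> \<in> {a0<..<b0}" "\<rho>0 \<in> {a0<..<b0}" "\<bar>\<rho> - \<rho>0\<bar> \<le> d" using \<rho> a0 by (auto simp: d'_def dist_real_def)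
      have "y \<rho> - y \<rho>0 = (LINT x:annulus a0 b0|lebesgue. L x * indicator {x. \<rho>0 < norm x} x - L x * indicator {x. \<rho> < norm x} x)"
        using K in0 set_integral_diff(2)[OF LTi[OF Li, of \<rho>0] LTi[OF Li, of \<rho>]] by simp
      also have "norm \<dots> \<le> (LINT x|lebesgue. \<bar>indicator (annulus a0 b0) x *\<^sub>R L x\<bar> * indicator {x. \<bar>norm x - \<rho>0\<bar> \<le> d} x)"
        unfolding set_lebesgue_integral_def
      proof (rule norm_integral_le_integral)
        show "integrable lebesgue (\<lambda>x. indicator (annulus a0 b0) x *\<^sub>R (L x * indicator {x. \<rho>0 < norm x} x - L x * indicator {x. \<rho> < norm x} x))"
          using set_integral_diff(1)[OF LTi[OF Li, of \<rho>0] LTi[OF Li, of \<rho>]] unfolding set_integrable_def .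
        have "closed {x::real^'n. \<bar>norm x - \<rho>0\<bar> \<le> d}"
          by (intro closed_Collect_le continuous_intros)
        then have "{x::real^'n. \<bar>norm x - \<rho>0\<bar> \<le> d} \<in> sets lebesgue"
          by (intro sets_completionI_sets) (simp add: borel_closed)
        then show "integrable lebesgue (\<lambda>x. \<bar>indicator (annulus a0 b0) x *\<^sub>R L x\<bar> * indicator {x. \<bar>norm x - \<rho>0\<bar> \<le> d} x)"
          using integrable_mult_indicator[OF _ integrable_abs[OF LI], of "{x. \<bar>norm x - \<rho>0\<bar> \<le> d}"] by (simp add: mult.commute)
        show "norm (indicator (annulus a0 b0) x *\<^sub>R (L x * indicator {x. \<rho>0 < norm x} x - L x * indicator {x. \<rho> < norm x} x))
          \<le> \<bar>indicator (annulus a0 b0) x *\<^sub>R L x\<bar> * indicator {x. \<bar>norm x - \<rho>0\<bar> \<le> d} x" for x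
          using in0(3) by (auto simp: indicator_def)
      qed
      also have "\<dots> < e" by (rule d(2))
      finally show ?thesis by (simp add: dist_real_def)
    qed
    then show "\<exists>d>0. \<forall>x'. dist x' \<rho>0 < d \<longrightarrow> dist (y x') (y \<rho>0) < e" using d' by blast
  qed
  then have yc: "continuous_on {0<..<r} y" by (intro continuous_at_imp_continuous_on ballI)
  have "continuous_on {0<..<r} (\<lambda>\<rho>. y \<rho> / (?s * \<rho> ^ (CARD('n) - 1)))"
    using sphere_const_pos[where 'n = 'n] by (intro continuous_intros yc) auto
  then show "continuous_on {0<..<r} (deriv w)"
    by (rule continuous_on_eq) (use sphere_const_pos[where 'n = 'n] in \<open>auto simp: y_def\<close>)
qed

section \<open>The weak gradient of a radial function\<close>

lemma line_derivative:
  assumes "(F has_derivative F') (at (x + s *\<^sub>R e))"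
  shows "((\<lambda>t. F (x + t *\<^sub>R e)) has_real_derivative F' e) (at s)"
proof -
  have "((\<lambda>t. x + t *\<^sub>R e) has_derivative (\<lambda>t. t *\<^sub>R e)) (at s)"
    by (auto intro!: derivative_eq_intros)
  then have "((\<lambda>t. F (x + t *\<^sub>R e)) has_derivative (\<lambda>t. F' (t *\<^sub>R e))) (at s)"
    using assms by (rule has_derivative_compose)
  moreover have "F' (t *\<^sub>R e) = F' e * t" for t
    using linear_scale[OF has_derivative_linear[OF assms]] by simp
  ultimately show ?thesis by (simp add: has_field_derivative_def)
qed

text \<open>Translation invariance makes every difference quotient in direction \<open>e\<close>
  integrate to 0; the mean value theorem bounds the quotients uniformly, so the limit may be taken
  under the integral.\<close>

lemma integral_directional_derivative_eq_0:
  fixes F :: "'a::euclidean_space \<Rightarrow> real"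
  assumes der: "\<And>x. (F has_derivative F' x) (at x)" and G: "continuous_on UNIV (\<lambda>x. F' x e)"
    and K: "compact K" and z: "\<And>x. x \<notin> K \<Longrightarrow> F x = 0"
  shows "(LINT x|lborel. F' x e) = 0"
proof -
  define G where "G x = F' x e" for x
  have Gc: "continuous_on UNIV G" using G by (simp add: G_def[abs_def])
  have Fc: "continuous_on UNIV F"
    using der by (meson continuous_at_imp_continuous_on has_derivative_continuous)
  have G0: "G x = 0" if "x \<notin> K" for x
  proof -
    have "((\<lambda>_. 0) has_derivative F' x) (at x)"
      by (rule has_derivative_transform_within_open[OF der, of "- K"])
        (use K z that in \<open>auto simp: compact_imp_closed\<close>)
    then have "F' x = (\<lambda>_. 0)" by (rule has_derivative_unique) simp
    then show ?thesis by (simp add: G_def)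
  qed
  obtain M where M: "\<And>x. \<bar>G x\<bar> \<le> M"
  proof -
    have "bounded (G ` K)" using K by (intro compact_imp_bounded compact_continuous_image continuous_on_subset[OF Gc]) auto
    then obtain M where M: "\<forall>x\<in>K. \<bar>G x\<bar> \<le> M" unfolding bounded_iff by auto
    have "\<bar>G x\<bar> \<le> max M 0" for x using M G0[of x] by (cases "x \<in> K") auto
    then show thesis by (rule that)
  qed
  \<comment> \<open>All points that a translation by \<open>t *\<^sub>R e\<close> with
    \<open>t\<close> in \<open>[0, 1]\<close> can carry into \<open>K\<close>: a common compact
    support for the difference quotients.\<close>
  define K' where "K' = (\<lambda>(x, t). x - t *\<^sub>R e) ` (K \<times> {0..1::real})"
  have K': "compact K'" unfolding K'_def
    by (intro compact_continuous_image compact_Times K compact_Icc) (auto simp: split_beta intro!: continuous_intros)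
  have outK: "x + t *\<^sub>R e \<notin> K" if "x \<notin> K'" "t \<in> {0..1}" for x t
  proof
    assume "x + t *\<^sub>R e \<in> K"
    then have "(\<lambda>(x, t). x - t *\<^sub>R e) (x + t *\<^sub>R e, t) \<in> K'" unfolding K'_def using that(2) by (intro imageI) auto
    then show False using that(1) by simp
  qed
  have Fi: "integrable lborel F"
  proof -
    have "(\<lambda>x. indicator K x *\<^sub>R F x) = F" using z by (auto simp: fun_eq_iff indicator_def)
    then show ?thesis using borel_integrable_compact[OF K continuous_on_subset[OF Fc]] by simp
  qed
  have shift: "integrable lborel (\<lambda>x. F (x + v)) \<and> (LINT x|lborel. F (x + v)) = (LINT x|lborel. F x)" for v
  proof -
    have d: "distr lborel borel ((+) v) = (lborel :: 'a measure)" by (rule lborel_distr_plus)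
    have Fb: "F \<in> borel_measurable borel" using Fc by (rule borel_measurable_continuous_onI)
    have "integrable (distr lborel borel ((+) v)) F" unfolding d by (rule Fi)
    then have "integrable lborel (\<lambda>x. F (v + x))" using Fb by (subst (asm) integrable_distr_eq) auto
    moreover have "(LINT x|distr lborel borel ((+) v). F x) = (LINT x|lborel. F (v + x))"
      using Fb by (subst integral_distr) auto
    ultimately show ?thesis unfolding d by (simp add: add.commute)
  qed
  define D where "D k x = (F (x + inverse (real (Suc k)) *\<^sub>R e) - F x) / inverse (real (Suc k))" for k x
  have Dint: "(LINT x|lborel. D k x) = 0" for k
  proof -
    have "(LINT x|lborel. D k x) = (LINT x|lborel. F (x + inverse (real (Suc k)) *\<^sub>R e) - F x) / inverse (real (Suc k))"
      unfolding D_def by (rule integral_divide_zero)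
    also have "(LINT x|lborel. F (x + inverse (real (Suc k)) *\<^sub>R e) - F x) = 0"
      using shift[of "inverse (real (Suc k)) *\<^sub>R e"] Fi by (subst Bochner_Integration.integral_diff) auto
    finally show ?thesis by simp
  qed
  have "(\<lambda>k. LINT x|lborel. D k x) \<longlonglongrightarrow> (LINT x|lborel. G x)"
  proof (rule integral_dominated_convergence[where w = "\<lambda>x. M * indicator K' x"])
    show "G \<in> borel_measurable lborel" using borel_measurable_continuous_onI[OF Gc] by simp
    have [measurable]: "F \<in> borel_measurable borel" using Fc by (rule borel_measurable_continuous_onI)
    show "D k \<in> borel_measurable lborel" for k unfolding D_def by measurable
    have "emeasure lborel K' < \<infinity>" using K' by (rule emeasure_compact_finite)
    then show "integrable lborel (\<lambda>x. M * indicator K' x)"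
      using K' by (intro integrable_mult_right integrable_real_indicator) (auto intro: borel_closed compact_imp_closed)
    show "AE x in lborel. (\<lambda>k. D k x) \<longlonglongrightarrow> G x"
    proof (rule AE_I2)
      fix x
      have "((\<lambda>t. F (x + t *\<^sub>R e)) has_real_derivative G x) (at 0)"
        unfolding G_def by (rule line_derivative) (use der[of x] in simp)
      then have "((\<lambda>h. (F (x + h *\<^sub>R e) - F x) / h) \<longlongrightarrow> G x) (at 0)"
        by (simp add: has_field_derivative_iff)
      moreover have "filterlim (\<lambda>k. inverse (real (Suc k))) (at 0) sequentially"
        using LIMSEQ_inverse_real_of_nat by (intro filterlim_atI) auto
      ultimately show "(\<lambda>k. D k x) \<longlonglongrightarrow> G x" unfolding D_def by (rule filterlim_compose)
    qed
    show "AE x in lborel. norm (D k x) \<le> M * indicator K' x" for k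
    proof (rule AE_I2)
      fix x
      define h where "h = inverse (real (Suc k))"
      have Dh: "D k x = (F (x + h *\<^sub>R e) - F x) / h" by (simp only: D_def h_def)
      have h: "0 < h" "h \<le> 1" by (auto simp: h_def inverse_le_1_iff)
      show "norm (D k x) \<le> M * indicator K' x"
      proof (cases "x \<in> K'")
        case True
        have "\<exists>\<xi>>0. \<xi> < h \<and> F (x + h *\<^sub>R e) - F (x + 0 *\<^sub>R e) = (h - 0) * G (x + \<xi> *\<^sub>R e)"
          by (rule MVT2[OF h(1)]) (unfold G_def, rule line_derivative, rule der)
        then obtain \<xi> where "F (x + h *\<^sub>R e) - F x = h * G (x + \<xi> *\<^sub>R e)" by auto
        then have "D k x = G (x + \<xi> *\<^sub>R e)" using h by (simp add: Dh)
        then show ?thesis using M True by simp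
      next
        case False
        then have "F (x + h *\<^sub>R e) = 0" "F x = 0" using outK[of x h] outK[of x 0] h z by auto
        then show ?thesis using False by (simp add: Dh)
      qed
    qed
  qed
  then have "(LINT x|lborel. G x) = 0" unfolding Dint by (simp add: LIMSEQ_const_iff)
  then show ?thesis by (simp add: G_def)
qed

text \<open>Off the origin \<open>u\<close> is continuously differentiable, so its classical partial
  derivative is also a weak one, and the fundamental lemma identifies the two almost
  everywhere.\<close>

lemma weak_gradient_radial:
  fixes u :: "real^'n::finite \<Rightarrow> real"
  assumes u: "\<And>x. x \<in> ball 0 r \<Longrightarrow> u x = w (norm x)"
    and dw: "\<And>\<rho>. \<rho> \<in> {0<..<r} \<Longrightarrow> (w has_real_derivative w1 \<rho>) (at \<rho>)" and w1: "continuous_on {0<..<r} w1"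
    and wk: "has_weak_deriv (ball 0 r) [i] u v"
  shows "negligible {x \<in> ball 0 r - {0}. v x - w1 (norm x) * (x $ i / norm x) \<noteq> 0}"
proof (rule fundamental_lemma)
  let ?U = "ball 0 r - {0::real^'n}"
  show U: "open ?U" by (intro open_Diff) auto
  have nU: "norm x \<in> {0<..<r}" if "x \<in> ?U" for x using that by auto
  have nc: "continuous_on ?U (\<lambda>x. w1 (norm x))"
    by (rule continuous_on_compose2[OF w1]) (use nU in \<open>auto intro: continuous_intros\<close>)
  have duc: "continuous_on ?U (\<lambda>x. w1 (norm x) * (x $ i / norm x))"
    by (intro continuous_intros nc) auto
  have v: "set_integrable lebesgue K v" if "compact K" "K \<subseteq> ball 0 r" for K
    using wk that unfolding has_weak_deriv_def locally_integrable_def by blast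
  have lu: "set_integrable lebesgue K u" if "compact K" "K \<subseteq> ball 0 r" for K
    using wk that unfolding has_weak_deriv_def locally_integrable_def by blast
  have du_int: "set_integrable lebesgue K (\<lambda>x. w1 (norm x) * (x $ i / norm x))" if "compact K" "K \<subseteq> ?U" for K
    by (intro set_integrable_continuous_compact that continuous_on_subset[OF duc])
  show "set_integrable lebesgue K (\<lambda>x. v x - w1 (norm x) * (x $ i / norm x))" if "compact K" "K \<subseteq> ?U" for K
  proof (rule set_integral_diff(1)[OF v du_int])
    show "K \<subseteq> ball 0 r" using that(2) by auto
  qed (use that in auto)
  fix \<phi> assume tf: "test_function ?U \<phi>"
  define K where "K = closure {x. \<phi> x \<noteq> 0}"
  have K: "compact K" "K \<subseteq> ?U" using tf by (auto simp: test_function_def K_def)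
  have K': "K \<subseteq> ball 0 r" using K(2) by auto
  have smooth: "smooth \<phi>" using tf by (simp add: test_function_def)
  have \<phi>0: "\<phi> x = 0" if "x \<notin> K" for x using that closure_subset[of "{x. \<phi> x \<noteq> 0}"] unfolding K_def by auto
  have p\<phi>0: "partial i \<phi> x = 0" if "x \<notin> K" for x
    using partials_eq_0_outside_support[of x \<phi> "[i]"] that unfolding K_def by (simp add: partials_def)
  have p\<phi>c: "continuous_on S (partial i \<phi>)" for S
    using smooth_partials_continuous[OF smooth, of S "[i]"] by (simp add: partials_def)
  have \<phi>d: "(\<phi> has_derivative frechet_derivative \<phi> (at x)) (at x)" for x
    using smooth[unfolded smooth_def, rule_format, of "[]" x] by (simp add: partials_def frechet_derivative_works)
  have p\<phi>: "partial i \<phi> x = frechet_derivative \<phi> (at x) (axis i 1)" for x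
    by (rule partial_has_derivative[OF \<phi>d])
  \<comment> \<open>\<open>u * \<phi>\<close> continued by zero; since the support of
    \<open>\<phi>\<close> avoids the origin and the boundary, this is a compactly supported C1
    function on the whole space.\<close>
  define F where "F x = (if x \<in> ?U then u x * \<phi> x else 0)" for x
  define F' where "F' x h = (if x \<in> ?U then u x * frechet_derivative \<phi> (at x) h + w1 (norm x) * (h \<bullet> sgn x) * \<phi> x else 0)" for x h
  have Fz: "F x = 0" if "x \<notin> K" for x using \<phi>0[OF that] by (simp add: F_def)
  have dF: "(F has_derivative F' x) (at x)" for x
  proof (cases "x \<in> ?U")
    case True
    then have x0: "x \<noteq> 0" by auto
    have n: "((\<lambda>x. norm x) has_derivative (\<lambda>h. h \<bullet> sgn x)) (at x)"
      using has_derivative_norm[OF x0] by (simp add: inner_commute)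
    have "((\<lambda>x. w (norm x)) has_derivative (\<lambda>h. w1 (norm x) * (h \<bullet> sgn x))) (at x)"
      by (rule comp_has_derivative[OF dw[OF nU[OF True]] n])
    then have "(u has_derivative (\<lambda>h. w1 (norm x) * (h \<bullet> sgn x))) (at x)"
      by (rule has_derivative_transform_within_open[OF _ U True]) (simp add: u)
    from has_derivative_mult[OF this \<phi>d]
    have "((\<lambda>x. u x * \<phi> x) has_derivative F' x) (at x)"
      using True by (simp add: F'_def[abs_def])
    then show ?thesis
      by (rule has_derivative_transform_within_open[OF _ U True]) (simp add: F_def)
  next
    case False
    then have xK: "x \<in> - K" using K(2) by blast
    have "F' x = (\<lambda>_. 0)" by (rule ext) (use False in \<open>auto simp: F'_def\<close>)
    then have "((\<lambda>_. 0) has_derivative F' x) (at x)" by simp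
    then show ?thesis
      by (rule has_derivative_transform_within_open[OF _ _ xK]) (use K(1) Fz in \<open>auto simp: compact_imp_closed\<close>)
  qed
  define G where "G x = u x * partial i \<phi> x + (w1 (norm x) * (x $ i / norm x)) * \<phi> x" for x
  have FG: "F' x (axis i 1) = (if x \<in> K then G x else 0)" for x
  proof (cases "x \<in> K")
    case True
    then have "x \<in> ?U" using K(2) by blast
    then show ?thesis using True
      by (simp add: F'_def G_def p\<phi> inner_axis' sgn_div_norm inner_commute[of "axis i 1"] inner_axis divide_inverse)
  next
    case False
    then show ?thesis using \<phi>0[OF False] p\<phi>0[OF False] p\<phi>[of x] by (simp add: F'_def)
  qed
  have Gc: "continuous_on UNIV (\<lambda>x. F' x (axis i 1))"
  proof -
    have wc: "continuous_on ?U (\<lambda>x. w (norm x))"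
    proof (rule continuous_on_compose2[of "{0<..<r}" w])
      show "continuous_on {0<..<r} w" using dw by (meson DERIV_isCont continuous_at_imp_continuous_on)
    qed (use nU in \<open>auto intro: continuous_intros\<close>)
    have "continuous_on ?U (\<lambda>x. w (norm x) * partial i \<phi> x + (w1 (norm x) * (x $ i / norm x)) * \<phi> x)"
      by (intro continuous_intros wc duc p\<phi>c smooth_continuous[OF smooth])
    then have c1: "continuous_on ?U (\<lambda>x. F' x (axis i 1))"
      by (rule continuous_on_eq) (auto simp: FG G_def u \<phi>0 p\<phi>0)
    have c2: "continuous_on (- K) (\<lambda>x. F' x (axis i 1))"
      by (rule continuous_on_eq[OF continuous_on_const[of _ 0]]) (simp add: FG)
    have "?U \<union> - K = UNIV" using K(2) by blast
    then show ?thesis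
      using continuous_on_open_Un[OF U _ c1 c2] K(1) by (simp add: compact_imp_closed open_Compl)
  qed
  have "(LINT x|lborel. F' x (axis i 1)) = 0"
    by (rule integral_directional_derivative_eq_0[OF dF Gc K(1) Fz])
  moreover have FGi: "(\<lambda>x. F' x (axis i 1)) = (\<lambda>x. indicator K x *\<^sub>R G x)" by (auto simp: FG fun_eq_iff)
  ultimately have "(LINT x|lborel. indicator K x *\<^sub>R G x) = 0" by simp
  moreover have "(LINT x|lborel. indicator K x *\<^sub>R G x) = (LINT x:K|lebesgue. G x)"
  proof -
    have "(\<lambda>x. F' x (axis i 1)) \<in> borel_measurable lborel" using borel_measurable_continuous_onI[OF Gc] by simp
    then show ?thesis unfolding FGi set_lebesgue_integral_def by (simp add: integral_completion)
  qed
  ultimately have G0: "(LINT x:K|lebesgue. G x) = 0" by simp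
  have i1: "set_integrable lebesgue K (\<lambda>x. u x * partial i \<phi> x)"
    by (intro set_integrable_mult_continuous[OF lu[OF K(1) K'] K(1)] p\<phi>c)
  have i2: "set_integrable lebesgue K (\<lambda>x. (w1 (norm x) * (x $ i / norm x)) * \<phi> x)"
    by (intro set_integrable_mult_continuous[OF du_int[OF K] K(1)] smooth_continuous smooth)
  have i3: "set_integrable lebesgue K (\<lambda>x. v x * \<phi> x)"
    by (intro set_integrable_mult_continuous[OF v[OF K(1) K'] K(1)] smooth_continuous smooth)
  have "(LINT x:K|lebesgue. u x * partial i \<phi> x) = - (LINT x:K|lebesgue. v x * \<phi> x)"
  proof -
    have "test_function (ball 0 r) \<phi>" by (rule test_function_mono[OF tf]) auto
    then have "(LINT x:ball 0 r|lebesgue. u x * partials [i] \<phi> x) = (-1) ^ length [i] * (LINT x:ball 0 r|lebesgue. v x * \<phi> x)"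
      using wk unfolding has_weak_deriv_def by blast
    moreover have "(LINT x:ball 0 r|lebesgue. u x * partials [i] \<phi> x) = (LINT x:K|lebesgue. u x * partials [i] \<phi> x)"
      by (rule set_integral_support(1)[OF K']) (simp add: partials_def p\<phi>0)
    moreover have "(LINT x:ball 0 r|lebesgue. v x * \<phi> x) = (LINT x:K|lebesgue. v x * \<phi> x)"
      by (rule set_integral_support(1)[OF K']) (simp add: \<phi>0)
    ultimately show ?thesis by (simp add: partials_def)
  qed
  moreover have "(LINT x:K|lebesgue. G x) = (LINT x:K|lebesgue. u x * partial i \<phi> x) + (LINT x:K|lebesgue. (w1 (norm x) * (x $ i / norm x)) * \<phi> x)"
    unfolding G_def by (rule set_integral_add(2)[OF i1 i2])
  moreover have "(LINT x:K|lebesgue. v x * \<phi> x - (w1 (norm x) * (x $ i / norm x)) * \<phi> x) =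
     (LINT x:K|lebesgue. v x * \<phi> x) - (LINT x:K|lebesgue. (w1 (norm x) * (x $ i / norm x)) * \<phi> x)"
    by (rule set_integral_diff(2)[OF i3 i2])
  ultimately have "(LINT x:K|lebesgue. (v x - w1 (norm x) * (x $ i / norm x)) * \<phi> x) = 0"
    using G0 by (simp add: left_diff_distrib)
  moreover have "(LINT x:?U|lebesgue. (v x - w1 (norm x) * (x $ i / norm x)) * \<phi> x) = (LINT x:K|lebesgue. (v x - w1 (norm x) * (x $ i / norm x)) * \<phi> x)"
    by (rule set_integral_support(1)[OF K(2)]) (simp add: \<phi>0)
  ultimately show "(LINT x:?U|lebesgue. (v x - w1 (norm x) * (x $ i / norm x)) * \<phi> x) = 0" by simp
qed

section \<open>The inequality on an annulus\<close>

text \<open>\<open>h\<close> is continuous only on the open interval, so the fundamental theorem is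
  applied from the base point \<open>a = l / 2\<close>, the integral up to \<open>a\<close> being a
  constant.\<close>

lemma H_fun_has_derivative:
  assumes h: "continuous_on {0<..<B} h" and hi: "\<forall>l\<in>{0<..<B}. set_integrable lborel {0<..<l} h"
    and l: "l \<in> {0<..<B}"
  shows "(H_fun h C has_real_derivative h l) (at l)"
proof -
  define a where "a = l / 2"
  define b where "b = (l + B) / 2"
  have ab: "0 < a" "a < l" "l < b" "b < B" using l by (auto simp: a_def b_def)
  have eq: "H_fun h C x = (integral {0..a} h - C) + integral {a..x} h" if x: "x \<in> {a<..<b}" for x
  proof -
    have si: "set_integrable lborel {0<..<x} h" using hi x ab by auto
    have "H_fun h C x = integral {0<..<x} h - C"
      using set_borel_integral_eq_integral(2)[OF si] by (simp add: H_fun_def)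
    also have "integral {0<..<x} h = integral {0..x} h"
      using integral_open_interval[of 0 x h] by (simp add: box_real)
    also have "integral {0..x} h = integral {0..a} h + integral {a..x} h"
    proof (rule Henstock_Kurzweil_Integration.integral_combine[symmetric])
      have "h integrable_on {0<..<x}" using set_borel_integral_eq_integral(1)[OF si] .
      then show "h integrable_on {0..x}" using integrable_on_open_interval[of h 0 x] by (simp add: box_real)
    qed (use x ab in auto)
    finally show ?thesis by simp
  qed
  have "((\<lambda>x. integral {a..x} h) has_real_derivative h l) (at l within {a..b})"
    by (rule integral_has_real_derivative) (use ab in \<open>auto intro: continuous_on_subset[OF h]\<close>)
  then have "((\<lambda>x. integral {a..x} h) has_real_derivative h l) (at l)"
    using ab by (simp add: at_within_Icc_at)
  then have "((\<lambda>x. (integral {0..a} h - C) + integral {a..x} h) has_real_derivative 0 + h l) (at l)"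
    by (intro DERIV_add DERIV_const)
  then have "((\<lambda>x. (integral {0..a} h - C) + integral {a..x} h) has_real_derivative h l) (at l)" by simp
  then show ?thesis
    by (rule has_field_derivative_transform_within_open[of _ _ _ "{a<..<b}"]) (use ab eq in auto)
qed

text \<open>At every point of differentiability the derivative of \<open>G\<close> is bounded by
  \<open>C_const\<close> times that of \<open>P\<close>. Absolute continuity, applied to
  \<open>G\<close> and to \<open>-G\<close>, turns this into a bound on increments, which can be
  composed with \<open>w\<close> without a chain rule for \<open>G\<close>.\<close>

lemma G_fun_increment_le:
  assumes p: "p > 0" and h: "continuous_on {0<..<B} h" and hp: "\<forall>l\<in>{0<..<B}. 0 < h l"
    and G: "locally_absolutely_continuous B G" "\<forall>l\<in>{0<..<B}. G l = G_fun h C p l"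
    and fin: "C_const h C p B < \<infinity>"
    and P: "\<And>l. l \<in> {0<..<B} \<Longrightarrow> (P has_real_derivative h l powr (1 / p)) (at l)"
    and st: "0 < s" "s \<le> t" "t < B"
  shows "\<bar>G_fun h C p t - G_fun h C p s\<bar> \<le> enn2real (C_const h C p B) * (P t - P s)"
proof -
  define c where "c = enn2real (C_const h C p B)"
  have ac: "absolutely_continuous_on_interval s t G"
    using G(1) st unfolding locally_absolutely_continuous_def by auto
  have D: "\<bar>deriv G x\<bar> \<le> c * h x powr (1 / p)" if x: "x \<in> {s<..<t}" "G differentiable at x" for x
  proof -
    have xB: "x \<in> {0<..<B}" using x st by auto
    obtain d where d: "(G has_real_derivative d) (at x)" using x(2) by (auto simp: real_differentiable_def)
    \<comment> \<open>The supremum in \<open>C_const\<close> concerns \<open>G_fun\<close>, which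
      agrees with its extension \<open>G\<close> on the open interval.\<close>
    have dG: "(G_fun h C p has_real_derivative d) (at x)"
      by (rule has_field_derivative_transform_within_open[OF d, of "{0<..<B}"]) (use xB G(2) in auto)
    then have "G_fun h C p differentiable at x" by (auto simp: real_differentiable_def)
    then have "ennreal (\<bar>deriv (G_fun h C p) x\<bar> / h x powr (1 / p)) \<le> C_const h C p B"
      unfolding C_const_def using xB by (intro SUP_upper) auto
    \<comment> \<open>Finiteness matters here: \<open>enn2real\<close> would send an infinite
      supremum to 0.\<close>
    also have "C_const h C p B = ennreal c" unfolding c_def using fin by simp
    finally have "\<bar>d\<bar> / h x powr (1 / p) \<le> c"
      using DERIV_imp_deriv[OF dG] by (simp add: c_def ennreal_le_iff)
    moreover have "h x powr (1 / p) > 0"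
    proof -
      have "h x > 0" using hp xB by blast
      then show ?thesis by simp
    qed
    ultimately show ?thesis using DERIV_imp_deriv[OF d] by (simp add: field_simps)
  qed
  have c0: "c \<ge> 0" by (simp add: c_def)
  have P': "((\<lambda>x. c * P x) has_real_derivative c * h x powr (1 / p)) (at x)" if "x \<in> {s..t}" for x
    using that st by (intro DERIV_cmult P) auto
  have "G t - G s \<le> c * P t - c * P s"
  proof (rule AC_increment_le_of_deriv[OF ac st(2) P'])
    show "deriv G x \<le> c * h x powr (1 / p)" if "x \<in> {s<..<t}" "G differentiable at x" for x
      using D[OF that] by simp
  qed (use c0 in auto)
  moreover have "- G t - - G s \<le> c * P t - c * P s"
  proof (rule AC_increment_le_of_deriv[OF AC_neg[OF ac] st(2) P'])
    show "deriv (\<lambda>x. - G x) x \<le> c * h x powr (1 / p)" if x: "x \<in> {s<..<t}" "(\<lambda>x. - G x) differentiable at x" for x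
    proof -
      obtain d where d: "((\<lambda>x. - G x) has_real_derivative d) (at x)" using x(2) by (auto simp: real_differentiable_def)
      from DERIV_minus[OF d] have "(G has_real_derivative - d) (at x)" by simp
      then have "G differentiable at x" "deriv G x = - d" by (auto simp: real_differentiable_def intro: DERIV_imp_deriv)
      then show ?thesis using D[OF x(1)] DERIV_imp_deriv[OF d] by simp
    qed
  qed (use c0 in auto)
  ultimately show ?thesis using G(2) st by (simp add: c_def[symmetric] abs_le_iff right_diff_distrib)
qed

section \<open>Integration by parts over shells\<close>

lemma shell_annulus:
  fixes f :: "real^'n::finite \<Rightarrow> real"
  shows "set_integrable lebesgue (annulus a b) f \<longleftrightarrow> set_integrable lebesgue {x. a < norm x \<and> norm x \<le> b} f"
    and "(LINT x:annulus a b|lebesgue. f x) = (LINT x:{x. a < norm x \<and> norm x \<le> b}|lebesgue. f x)"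
proof -
  have n: "negligible (annulus a b - {x::real^'n. a < norm x \<and> norm x \<le> b})"
    by (rule negligible_subset[OF negligible_norm_level[of a]]) (auto simp: annulus_def)
  have sub: "{x::real^'n. a < norm x \<and> norm x \<le> b} \<subseteq> annulus a b" by (auto simp: annulus_def)
  let ?S = "{x::real^'n. a < norm x \<and> norm x \<le> b}"
  have n1: "negligible {x \<in> annulus a b - ?S. f x \<noteq> 0}" by (rule negligible_subset[OF n]) auto
  have n2: "negligible {x \<in> ?S - annulus a b. f x \<noteq> 0}"
  proof -
    have "{x \<in> ?S - annulus a b. f x \<noteq> 0} = {}" using sub by blast
    then show ?thesis by (simp only: negligible_empty)
  qed
  show si: "set_integrable lebesgue (annulus a b) f \<longleftrightarrow> set_integrable lebesgue ?S f"
    by (rule absolutely_integrable_spike_set_eq[OF n1 n2])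
  show "(LINT x:annulus a b|lebesgue. f x) = (LINT x:?S|lebesgue. f x)"
  proof (cases "set_integrable lebesgue (annulus a b) f")
    case True
    then have "(LINT x:annulus a b|lebesgue. f x) = integral (annulus a b) f"
      by (rule set_lebesgue_integral_eq_integral(2))
    also have "\<dots> = integral ?S f" by (rule integral_spike_set[OF n1 n2])
    also have "\<dots> = (LINT x:?S|lebesgue. f x)"
      using si True by (intro set_lebesgue_integral_eq_integral(2)[symmetric]) simp
    finally show ?thesis .
  next
    case False
    then show ?thesis using si
      unfolding set_lebesgue_integral_def set_integrable_def by (simp add: not_integrable_integral_eq)
  qed
qed

text \<open>Short intervals of a Riemann-Stieltjes sum evaluate the two factors at different points;
  this is the uniform error bound for such mixed products.\<close>

lemma uniform_continuity_product:
  fixes f g :: "real \<Rightarrow> real"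
  assumes f: "continuous_on {a..b} f" and g: "continuous_on {a..b} g" and e: "e > 0"
  shows "\<exists>d>0. \<forall>\<sigma>\<in>{a..b}. \<forall>\<tau>\<in>{a..b}. \<forall>\<rho>\<in>{a..b}. \<bar>\<sigma> - \<rho>\<bar> < d \<longrightarrow> \<bar>\<tau> - \<rho>\<bar> < d
    \<longrightarrow> \<bar>f \<sigma> * g \<tau> - f \<rho> * g \<rho>\<bar> < e"
proof -
  let ?F = "\<lambda>z::real \<times> real. f (fst z) * g (snd z)"
  have "continuous_on ({a..b} \<times> {a..b}) ?F"
    by (intro continuous_intros continuous_on_compose2[OF f] continuous_on_compose2[OF g]) auto
  then have "uniformly_continuous_on ({a..b} \<times> {a..b}) ?F"
    by (rule compact_uniformly_continuous) (intro compact_Times compact_Icc)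
  then obtain d where d: "d > 0" "\<And>z z'. z \<in> {a..b} \<times> {a..b} \<Longrightarrow> z' \<in> {a..b} \<times> {a..b} \<Longrightarrow> dist z' z < d \<Longrightarrow> dist (?F z') (?F z) < e"
    using e unfolding uniformly_continuous_on_def by metis
  have "\<bar>f \<sigma> * g \<tau> - f \<rho> * g \<rho>\<bar> < e"
    if "\<sigma> \<in> {a..b}" "\<tau> \<in> {a..b}" "\<rho> \<in> {a..b}" "\<bar>\<sigma> - \<rho>\<bar> < d / 2" "\<bar>\<tau> - \<rho>\<bar> < d / 2" for \<sigma> \<tau> \<rho>
  proof -
    have "dist (\<sigma>, \<tau>) (\<rho>, \<rho>) \<le> \<bar>\<sigma> - \<rho>\<bar> + \<bar>\<tau> - \<rho>\<bar>"
      unfolding dist_Pair_Pair dist_real_def using sqrt_sum_squares_le_sum_abs[of "\<bar>\<sigma> - \<rho>\<bar>" "\<bar>\<tau> - \<rho>\<bar>"] by simp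
    also have "\<dots> < d" using that by simp
    finally show ?thesis using d(2)[of "(\<rho>, \<rho>)" "(\<sigma>, \<tau>)"] that by (simp add: dist_real_def)
  qed
  then show ?thesis using d(1) by (intro exI[of _ "d / 2"]) auto
qed

text \<open>\<open>y\<close> need not be differentiable: the mean value theorem is applied to
  \<open>\<phi>\<close> between two values of \<open>y\<close>, and the intermediate value theorem
  realises the mean point as \<open>y \<rho>\<close>.\<close>

lemma mean_value_compose:
  fixes \<phi> y :: "real \<Rightarrow> real"
  assumes st: "s \<le> t" and y: "continuous_on {s..t} y" and \<phi>: "\<And>v. (\<phi> has_real_derivative \<phi>1 v) (at v)"
  shows "\<exists>\<rho>\<in>{s..t}. \<phi> (y t) - \<phi> (y s) = \<phi>1 (y \<rho>) * (y t - y s)"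
proof -
  consider "y s = y t" | "y s < y t" | "y t < y s" by linarith
  then show ?thesis
  proof cases
    case 1
    then show ?thesis using st by (intro bexI[of _ s]) auto
  next
    case 2
    obtain z where z: "y s < z" "z < y t" "\<phi> (y t) - \<phi> (y s) = (y t - y s) * \<phi>1 z"
      using MVT2[OF 2, of \<phi> \<phi>1] \<phi> by blast
    obtain \<rho> where "s \<le> \<rho>" "\<rho> \<le> t" "y \<rho> = z" using IVT'[of y s z t] z st y by auto
    then show ?thesis using z by (intro bexI[of _ \<rho>]) (auto simp: mult.commute)
  next
    case 3
    obtain z where z: "y t < z" "z < y s" "\<phi> (y s) - \<phi> (y t) = (y s - y t) * \<phi>1 z"
      using MVT2[OF 3, of \<phi> \<phi>1] \<phi> by blast
    obtain \<rho> where "s \<le> \<rho>" "\<rho> \<le> t" "y \<rho> = z" using IVT2'[of y t z s] z st y by auto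
    then show ?thesis using z by (intro bexI[of _ \<rho>]) (auto simp: algebra_simps)
  qed
qed

lemma shell_integral_diff:
  fixes f :: "real^'n::finite \<Rightarrow> real"
  assumes f: "set_integrable lebesgue {x. a < norm x \<and> norm x \<le> b} f" and st: "a \<le> s" "s \<le> t" "t \<le> b"
  shows "set_integrable lebesgue {x. s < norm x \<and> norm x \<le> t} f"
    and "(LINT x:{x. a < norm x \<and> norm x \<le> t}|lebesgue. f x) - (LINT x:{x. a < norm x \<and> norm x \<le> s}|lebesgue. f x)
      = (LINT x:{x. s < norm x \<and> norm x \<le> t}|lebesgue. f x)"
proof -
  let ?S = "\<lambda>s t. {x::real^'n. s < norm x \<and> norm x \<le> t}"
  have m: "?S s t \<in> sets lebesgue" for s t using annulus_shell_sets by (intro sets_completionI_sets) simp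
  have i: "set_integrable lebesgue (?S s t) f" if "a \<le> s" "t \<le> b" for s t
    by (rule set_integrable_subset[OF f m]) (use that in auto)
  show "set_integrable lebesgue (?S s t) f" using i st by simp
  have "?S a t = ?S a s \<union> ?S s t" using st by auto
  moreover have "(LINT x:?S a s \<union> ?S s t|lebesgue. f x) = (LINT x:?S a s|lebesgue. f x) + (LINT x:?S s t|lebesgue. f x)"
    by (rule set_integral_Un) (use i st in auto)
  ultimately show "(LINT x:?S a t|lebesgue. f x) - (LINT x:?S a s|lebesgue. f x) = (LINT x:?S s t|lebesgue. f x)" by simp
qed

lemma integral_Icc_diff:
  fixes f :: "real \<Rightarrow> real"
  assumes "continuous_on {a..b} f" "a \<le> s" "s \<le> t" "t \<le> b"
  shows "integral {a..t} f - integral {a..s} f = integral {s..t} f"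
proof -
  have "f integrable_on {a..t}" using assms by (intro integrable_continuous_real continuous_on_subset[OF assms(1)]) auto
  then show ?thesis using Henstock_Kurzweil_Integration.integral_combine[of a s t f] assms by simp
qed

text \<open>The rule \<open>d (\<phi>(y) N) = \<phi>1(y) N dy + \<phi>(y) N1 dt\<close> for a
  \<open>y\<close> whose increments are integrals of \<open>L\<close> over shells. On a short
  interval the defect is at most \<open>e\<close> times the increment of \<open>M t + t\<close>,
  where \<open>M\<close>, the integral of \<open>\<bar>L\<bar>\<close>, dominates the variation of
  \<open>y\<close>; adding up and letting \<open>e\<close> tend to 0 removes it.\<close>

lemma stieltjes_parts:
  fixes L :: "real^'n::finite \<Rightarrow> real"
  assumes ab: "0 < a" "a \<le> b" and L: "set_integrable lebesgue {x. a < norm x \<and> norm x \<le> b} L"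
    and y: "\<And>s t. a \<le> s \<Longrightarrow> s \<le> t \<Longrightarrow> t \<le> b \<Longrightarrow> y t - y s = (LINT x:{x. s < norm x \<and> norm x \<le> t}|lebesgue. L x)"
    and yc: "continuous_on {a..b} y"
    and \<phi>: "\<And>v. (\<phi> has_real_derivative \<phi>1 v) (at v)" and \<phi>1: "continuous_on UNIV \<phi>1"
    and N: "\<And>t. t \<in> {a..b} \<Longrightarrow> (N has_real_derivative N1 t) (at t)" and N1: "continuous_on {a..b} N1"
  shows "\<phi> (y b) * N b - \<phi> (y a) * N a =
    (LINT x:annulus a b|lebesgue. (\<phi>1 (y (norm x)) * N (norm x)) * L x) + integral {a..b} (\<lambda>t. \<phi> (y t) * N1 t)"
proof -
  let ?S = "\<lambda>s t. {x::real^'n. s < norm x \<and> norm x \<le> t}"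
  define A where "A t = \<phi>1 (y t)" for t
  define A2 where "A2 t = \<phi> (y t)" for t
  have Ac: "continuous_on {a..b} A" unfolding A_def by (rule continuous_on_compose2[OF \<phi>1 yc]) simp
  have "continuous_on UNIV \<phi>" using \<phi> by (meson DERIV_isCont continuous_at_imp_continuous_on)
  then have A2c: "continuous_on {a..b} A2" unfolding A2_def by (rule continuous_on_compose2[OF _ yc]) simp
  have Nc: "continuous_on {a..b} N" using N by (meson DERIV_isCont continuous_at_imp_continuous_on)
  define EL where "EL x = (A (norm x) * N (norm x)) * L x" for x :: "real^'n"
  have Lann: "set_integrable lebesgue (annulus a b) L" using L shell_annulus(1) by blast
  have ELann: "set_integrable lebesgue (annulus a b) EL"
  proof -
    have "continuous_on (annulus a b) (\<lambda>x::real^'n. A (norm x) * N (norm x))"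
      by (intro continuous_intros continuous_on_compose2[OF Ac] continuous_on_compose2[OF Nc]) (auto simp: annulus_def)
    from set_integrable_mult_continuous[OF Lann compact_annulus this] show ?thesis
      by (simp add: EL_def[abs_def] mult.commute)
  qed
  have ELs: "set_integrable lebesgue (?S a b) EL" using ELann shell_annulus(1) by blast
  have aLs: "set_integrable lebesgue (?S a b) (\<lambda>x. \<bar>L x\<bar>)" using L by (rule set_integrable_abs)
  define J where "J t = (LINT x:?S a t|lebesgue. EL x)" for t
  define M where "M t = (LINT x:?S a t|lebesgue. \<bar>L x\<bar>)" for t
  have ANc: "continuous_on {a..b} (\<lambda>t. A2 t * N1 t)" by (intro continuous_intros A2c N1)
  define D where "D t = A2 t * N t - J t - integral {a..t} (\<lambda>t. A2 t * N1 t)" for t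
  have loc: "\<exists>d>0. \<forall>s t. a \<le> s \<longrightarrow> s \<le> t \<longrightarrow> t \<le> b \<longrightarrow> t - s < d \<longrightarrow> \<bar>D t - D s\<bar> \<le> e * ((M t + t) - (M s + s))"
    if e: "e > 0" for e
  proof -
    obtain d1 where d1: "d1 > 0" "\<And>\<sigma> \<tau> \<rho>. \<sigma> \<in> {a..b} \<Longrightarrow> \<tau> \<in> {a..b} \<Longrightarrow> \<rho> \<in> {a..b} \<Longrightarrow> \<bar>\<sigma> - \<rho>\<bar> < d1 \<Longrightarrow> \<bar>\<tau> - \<rho>\<bar> < d1
       \<Longrightarrow> \<bar>A \<sigma> * N \<tau> - A \<rho> * N \<rho>\<bar> < e"
      using uniform_continuity_product[OF Ac Nc e] by metis
    obtain d2 where d2: "d2 > 0" "\<And>\<sigma> \<tau> \<rho>. \<sigma> \<in> {a..b} \<Longrightarrow> \<tau> \<in> {a..b} \<Longrightarrow> \<rho> \<in> {a..b} \<Longrightarrow> \<bar>\<sigma> - \<rho>\<bar> < d2 \<Longrightarrow> \<bar>\<tau> - \<rho>\<bar> < d2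
       \<Longrightarrow> \<bar>A2 \<sigma> * N1 \<tau> - A2 \<rho> * N1 \<rho>\<bar> < e"
      using uniform_continuity_product[OF A2c N1 e] by metis
    have "\<bar>D t - D s\<bar> \<le> e * ((M t + t) - (M s + s))"
      if st: "a \<le> s" "s \<le> t" "t \<le> b" "t - s < min d1 d2" for s t
    proof -
      obtain \<rho> where \<rho>: "\<rho> \<in> {s..t}" "A2 t - A2 s = A \<rho> * (y t - y s)"
        using mean_value_compose[OF st(2) continuous_on_subset[OF yc] \<phi>] st unfolding A_def A2_def by auto
      have Li: "set_integrable lebesgue (?S s t) L" by (rule shell_integral_diff(1)[OF L st(1-3)])
      have ELi: "set_integrable lebesgue (?S s t) EL" by (rule shell_integral_diff(1)[OF ELs st(1-3)])
      have aLi: "set_integrable lebesgue (?S s t) (\<lambda>x. \<bar>L x\<bar>)" by (rule shell_integral_diff(1)[OF aLs st(1-3)])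
      have kLi: "set_integrable lebesgue (?S s t) (\<lambda>x. (A \<rho> * N t) * L x)" using Li by (intro set_integrable_mult_right)
      have "(A2 t - A2 s) * N t = (LINT x:?S s t|lebesgue. (A \<rho> * N t) * L x)"
        unfolding \<rho>(2) y[OF st(1-3)] by (simp add: mult_ac)
      moreover have "J t - J s = (LINT x:?S s t|lebesgue. EL x)"
        unfolding J_def by (rule shell_integral_diff(2)[OF ELs st(1-3)])
      ultimately have "(A2 t - A2 s) * N t - (J t - J s) = (LINT x:?S s t|lebesgue. (A \<rho> * N t) * L x - EL x)"
        using set_integral_diff(2)[OF kLi ELi] by simp
      also have "\<bar>\<dots>\<bar> \<le> (LINT x:?S s t|lebesgue. e * \<bar>L x\<bar>)"
        unfolding set_lebesgue_integral_def real_norm_def[symmetric]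
      proof (rule norm_integral_le_integral)
        show "integrable lebesgue (\<lambda>x. indicator (?S s t) x *\<^sub>R ((A \<rho> * N t) * L x - EL x))"
          using set_integral_diff(1)[OF kLi ELi] unfolding set_integrable_def .
        have "set_integrable lebesgue (?S s t) (\<lambda>x. e * \<bar>L x\<bar>)" using aLi by (intro set_integrable_mult_right)
        then show "integrable lebesgue (\<lambda>x. indicator (?S s t) x *\<^sub>R (e * norm (L x)))"
          unfolding set_integrable_def real_norm_def .
        show "norm (indicator (?S s t) x *\<^sub>R ((A \<rho> * N t) * L x - EL x)) \<le> indicator (?S s t) x *\<^sub>R (e * norm (L x))" for x
        proof (cases "x \<in> ?S s t")
          case True
          have "\<bar>A \<rho> * N t - A (norm x) * N (norm x)\<bar> < e"
            by (rule d1(2)) (use True \<rho>(1) st in auto)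
          then have "\<bar>A \<rho> * N t - A (norm x) * N (norm x)\<bar> * \<bar>L x\<bar> \<le> e * \<bar>L x\<bar>" by (intro mult_right_mono) auto
          then show ?thesis using True by (simp add: EL_def left_diff_distrib[symmetric] abs_mult)
        qed simp
      qed
      also have "(LINT x:?S s t|lebesgue. e * \<bar>L x\<bar>) = e * (LINT x:?S s t|lebesgue. \<bar>L x\<bar>)" by simp
      also have "(LINT x:?S s t|lebesgue. \<bar>L x\<bar>) = M t - M s"
        unfolding M_def by (rule shell_integral_diff(2)[OF aLs st(1-3), symmetric])
      finally have 1: "\<bar>(A2 t - A2 s) * N t - (J t - J s)\<bar> \<le> e * (M t - M s)" .
      have N1st: "continuous_on {s..t} N1" "continuous_on {s..t} A2"
        using st by (auto intro: continuous_on_subset[OF N1] continuous_on_subset[OF A2c])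
      have "(N1 has_integral N t - N s) {s..t}"
        by (rule fundamental_theorem_of_calculus) (use st N in \<open>auto simp: has_real_derivative_iff_has_vector_derivative[symmetric] intro: has_field_derivative_at_within\<close>)
      then have "((\<lambda>\<sigma>. A2 s * N1 \<sigma>) has_integral A2 s * (N t - N s)) {s..t}" by (rule has_integral_mult_right)
      then have "A2 s * (N t - N s) - integral {s..t} (\<lambda>t. A2 t * N1 t) = integral {s..t} (\<lambda>\<sigma>. A2 s * N1 \<sigma> - A2 \<sigma> * N1 \<sigma>)"
        using N1st by (subst Henstock_Kurzweil_Integration.integral_diff)
          (auto simp: has_integral_iff intro!: integrable_continuous_real continuous_intros)
      also have "norm \<dots> \<le> integral {s..t} (\<lambda>\<sigma>. e)"
      proof (rule Henstock_Kurzweil_Integration.integral_norm_bound_integral)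
        show "(\<lambda>\<sigma>. A2 s * N1 \<sigma> - A2 \<sigma> * N1 \<sigma>) integrable_on {s..t}"
          using N1st by (intro integrable_continuous_real continuous_intros)
        show "norm (A2 s * N1 \<sigma> - A2 \<sigma> * N1 \<sigma>) \<le> e" if "\<sigma> \<in> {s..t}" for \<sigma>
          using d2(2)[of s \<sigma> \<sigma>] that st by auto
      qed auto
      also have "\<dots> = e * (t - s)" using st by simp
      finally have 2: "\<bar>A2 s * (N t - N s) - integral {s..t} (\<lambda>t. A2 t * N1 t)\<bar> \<le> e * (t - s)" by simp
      \<comment> \<open>The increment of the product is split with \<open>N\<close> taken at
        \<open>t\<close> and \<open>A2\<close> at \<open>s\<close>, so that no product of two
        increments remains.\<close>
      have "D t - D s = ((A2 t - A2 s) * N t - (J t - J s)) + (A2 s * (N t - N s) - integral {s..t} (\<lambda>t. A2 t * N1 t))"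
        using integral_Icc_diff[OF ANc st(1-3)] by (simp add: D_def algebra_simps)
      then have "\<bar>D t - D s\<bar> \<le> e * (M t - M s) + e * (t - s)" using 1 2 by linarith
      then show ?thesis by (simp add: algebra_simps)
    qed
    then show ?thesis using d1(1) d2(1) by (intro exI[of _ "min d1 d2"]) auto
  qed
  have bound: "\<bar>D b - D a\<bar> \<le> e * ((M b + b) - (M a + a))" if e: "e > 0" for e
  proof -
    obtain d where d: "d > 0" "\<And>s t. a \<le> s \<Longrightarrow> s \<le> t \<Longrightarrow> t \<le> b \<Longrightarrow> t - s < d \<Longrightarrow> \<bar>D t - D s\<bar> \<le> e * ((M t + t) - (M s + s))"
      using loc[OF e] by blast
    have "D b - D a \<le> e * (M b + b) - e * (M a + a)"
    proof (rule increment_le_of_local[OF ab(2)], intro exI[of _ d] conjI allI impI)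
      fix s t assume "a \<le> s" "s < t" "t \<le> b" "t - s < d"
      then show "D t - D s \<le> e * (M t + t) - e * (M s + s)"
        using d(2)[of s t] by (simp add: abs_le_iff right_diff_distrib)
    qed (rule d(1))
    moreover have "- D b - - D a \<le> e * (M b + b) - e * (M a + a)"
    proof (rule increment_le_of_local[OF ab(2)], intro exI[of _ d] conjI allI impI)
      fix s t assume "a \<le> s" "s < t" "t \<le> b" "t - s < d"
      then show "- D t - - D s \<le> e * (M t + t) - e * (M s + s)"
        using d(2)[of s t] by (simp add: abs_le_iff right_diff_distrib)
    qed (rule d(1))
    ultimately show ?thesis by (simp add: abs_le_iff right_diff_distrib)
  qed
  have "\<bar>D b - D a\<bar> \<le> 0"
  proof (rule field_le_epsilon)
    fix e :: real assume e: "e > 0"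
    define k where "k = \<bar>(M b + b) - (M a + a)\<bar> + 1"
    have k: "k > 0" by (simp add: k_def)
    have "\<bar>D b - D a\<bar> \<le> e / k * ((M b + b) - (M a + a))" using e k by (intro bound) simp
    also have "\<dots> \<le> e / k * k" using e k by (intro mult_left_mono) (auto simp: k_def)
    also have "\<dots> = 0 + e" using k by simp
    finally show "\<bar>D b - D a\<bar> \<le> 0 + e" .
  qed
  then have "D b = D a" by simp
  moreover have "?S a a = {}" by auto
  ultimately have "A2 b * N b - A2 a * N a = J b + integral {a..b} (\<lambda>t. A2 t * N1 t)"
    by (simp add: D_def J_def set_lebesgue_integral_def)
  then show ?thesis unfolding J_def shell_annulus(2)[symmetric] EL_def A_def A2_def by simp
qed

section \<open>Powers, Hardy's inequality and Young's inequality\<close>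

lemma signed_powr_has_derivative:
  fixes q :: real
  assumes q: "q > 0"
  shows "((\<lambda>v. \<bar>v\<bar> powr q * v) has_real_derivative (q + 1) * \<bar>v\<bar> powr q) (at v)"
proof -
  consider "v > 0" | "v < 0" | "v = 0" by linarith
  then show ?thesis
  proof cases
    case 1
    have "((\<lambda>v. v powr (q + 1)) has_real_derivative (q + 1) * v powr (q + 1 - 1)) (at v)"
      using 1 by (rule has_real_derivative_powr)
    then have "((\<lambda>v. v powr (q + 1)) has_real_derivative (q + 1) * \<bar>v\<bar> powr q) (at v)" using 1 by simp
    then show ?thesis
      by (rule has_field_derivative_transform_within_open[of _ _ _ "{0<..}"]) (use 1 in \<open>auto simp: powr_add\<close>)
  next
    case 2
    have "((\<lambda>v. v powr (q + 1)) has_real_derivative (q + 1) * (- v) powr (q + 1 - 1)) (at (- v))"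
      using 2 by (intro has_real_derivative_powr) simp
    from DERIV_minus[OF DERIV_chain2[OF this DERIV_minus[OF DERIV_ident]]]
    have "((\<lambda>v. - ((- v) powr (q + 1))) has_real_derivative (q + 1) * \<bar>v\<bar> powr q) (at v)" using 2 by simp
    then show ?thesis
      by (rule has_field_derivative_transform_within_open[of _ _ _ "{..<0}"]) (use 2 in \<open>auto simp: powr_add\<close>)
  next
    case 3
    have "((\<lambda>h::real. \<bar>h\<bar> powr q) \<longlongrightarrow> \<bar>0\<bar> powr q) (at 0)"
      using q by (intro tendsto_powr' tendsto_rabs tendsto_ident_at tendsto_const) auto
    then have "((\<lambda>h::real. \<bar>h\<bar> powr q) \<longlongrightarrow> 0) (at 0)" by simp
    then have "((\<lambda>h::real. (\<bar>0 + h\<bar> powr q * (0 + h) - \<bar>0\<bar> powr q * 0) / h) \<longlongrightarrow> 0) (at 0)"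
      by (rule Lim_transform_eventually) (auto simp: eventually_at_filter)
    then show ?thesis using 3 by (simp add: has_field_derivative_iff)
  qed
qed

lemma abs_powr_continuous: "q > 0 \<Longrightarrow> continuous_on S (\<lambda>v::real. \<bar>v\<bar> powr q)"
  by (intro continuous_on_powr' continuous_intros) auto

text \<open>For smooth \<open>k\<close> one integrates
  \<open>(k^p t^q)' = q k^p t^(q-1) + p k^(p-1) k' t^q\<close> and drops the boundary term at
  \<open>a\<close>, which has the right sign. As \<open>k\<close> only has increments bounded by
  those of \<open>\<pi>\<close>, the same computation is done on short intervals: the defect
  \<open>f\<close> grows by at most a multiple of \<open>e\<close>.\<close>

lemma hardy_interval:
  fixes k \<pi> :: "real \<Rightarrow> real"
  assumes ab: "0 < a" "a \<le> b" and q: "q > 0" and p: "p > 1" and c: "c \<ge> 0"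
    and kc: "continuous_on {a..b} k" and k0: "\<And>t. t \<in> {a..b} \<Longrightarrow> k t \<ge> 0"
    and \<pi>: "\<And>t. t \<in> {a..b} \<Longrightarrow> (\<pi> has_real_derivative \<pi>1 t) (at t)" and \<pi>1: "continuous_on {a..b} \<pi>1"
    and inc: "\<And>s t. a \<le> s \<Longrightarrow> s \<le> t \<Longrightarrow> t \<le> b \<Longrightarrow> \<bar>k t - k s\<bar> \<le> c * \<bar>\<pi> t - \<pi> s\<bar>"
  shows "q * integral {a..b} (\<lambda>t. k t powr p * t powr (q - 1)) \<le>
    k b powr p * b powr q + p * c * integral {a..b} (\<lambda>t. k t powr (p - 1) * \<bar>\<pi>1 t\<bar> * t powr q)"
proof -
  define K where "K t = k t powr p" for t
  define K1 where "K1 t = k t powr (p - 1)" for t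
  define Q where "Q t = t powr q" for t :: real
  define Q1 where "Q1 t = q * t powr (q - 1)" for t :: real
  define R where "R t = p * c * \<bar>\<pi>1 t\<bar>" for t
  have Kc: "continuous_on {a..b} K" unfolding K_def using p k0 by (intro continuous_on_powr' kc continuous_intros) auto
  have K1c: "continuous_on {a..b} K1" unfolding K1_def using p k0 by (intro continuous_on_powr' kc continuous_intros) auto
  have Qc: "continuous_on {a..b} Q" unfolding Q_def using ab by (intro continuous_intros) auto
  have Q1c: "continuous_on {a..b} Q1" unfolding Q1_def using ab by (intro continuous_intros) auto
  have Rc: "continuous_on {a..b} R" unfolding R_def by (intro continuous_intros \<pi>1)
  have R0: "R t \<ge> 0" for t using p c by (simp add: R_def)
  have dQ: "(Q has_real_derivative Q1 t) (at t)" if "t \<in> {a..b}" for t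
    unfolding Q_def Q1_def using that ab by (intro has_real_derivative_powr) auto
  have vc: "continuous_on {a..b} (\<lambda>t. K t * Q1 t - K1 t * Q t * R t)" by (intro continuous_intros Kc K1c Qc Q1c Rc)
  have Rc1: "continuous_on {a..b} (\<lambda>t. R t + 1)" by (intro continuous_intros Rc)
  define f where "f t = - (K t * Q t) + integral {a..t} (\<lambda>t. K t * Q1 t - K1 t * Q t * R t)" for t
  have bound: "f b - f a \<le> e * integral {a..b} (\<lambda>t. R t + 1) - e * integral {a..a} (\<lambda>t. R t + 1)" if e: "e > 0" for e
  proof -
    obtain d1 where d1: "d1 > 0" "\<And>\<sigma> \<tau> \<rho>. \<sigma> \<in> {a..b} \<Longrightarrow> \<tau> \<in> {a..b} \<Longrightarrow> \<rho> \<in> {a..b} \<Longrightarrow> \<bar>\<sigma> - \<rho>\<bar> < d1 \<Longrightarrow> \<bar>\<tau> - \<rho>\<bar> < d1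
       \<Longrightarrow> \<bar>K1 \<sigma> * Q \<tau> - K1 \<rho> * Q \<rho>\<bar> < e"
      using uniform_continuity_product[OF K1c Qc e] by metis
    obtain d2 where d2: "d2 > 0" "\<And>\<sigma> \<tau> \<rho>. \<sigma> \<in> {a..b} \<Longrightarrow> \<tau> \<in> {a..b} \<Longrightarrow> \<rho> \<in> {a..b} \<Longrightarrow> \<bar>\<sigma> - \<rho>\<bar> < d2 \<Longrightarrow> \<bar>\<tau> - \<rho>\<bar> < d2
       \<Longrightarrow> \<bar>K \<sigma> * Q1 \<tau> - K \<rho> * Q1 \<rho>\<bar> < e"
      using uniform_continuity_product[OF Kc Q1c e] by metis
    show ?thesis
    proof (rule increment_le_of_local[OF ab(2)], intro exI[of _ "min d1 d2"] conjI allI impI)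
      show "min d1 d2 > 0" using d1 d2 by simp
      fix s t assume st: "a \<le> s" "s < t" "t \<le> b" "t - s < min d1 d2"
      have st': "s \<le> t" using st by simp
      have c': "continuous_on {s..t} g" if "continuous_on {a..b} g" for g :: "real \<Rightarrow> real"
        using that by (rule continuous_on_subset) (use st in auto)
      note cs = c'[OF Kc] c'[OF K1c] c'[OF Qc] c'[OF Q1c] c'[OF Rc] c'[OF \<pi>1]
      \<comment> \<open>The signed power has a derivative on the whole line, as
        \<open>mean_value_compose\<close> asks; on the nonnegative values of \<open>k\<close> it
        agrees with \<open>powr p\<close>.\<close>
      obtain \<rho> where \<rho>: "\<rho> \<in> {s..t}" "\<bar>k t\<bar> powr (p - 1) * k t - \<bar>k s\<bar> powr (p - 1) * k s = (p - 1 + 1) * \<bar>k \<rho>\<bar> powr (p - 1) * (k t - k s)"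
        using mean_value_compose[OF st' c'[OF kc] signed_powr_has_derivative, of "p - 1"] p by auto
      have pw: "\<bar>k x\<bar> powr (p - 1) * k x = K x" if "x \<in> {a..b}" for x
      proof -
        have "k x powr p = k x powr (p - 1) * k x powr 1" unfolding powr_add[symmetric] by simp
        then show ?thesis using k0[OF that] by (simp add: K_def)
      qed
      have "K t - K s = p * K1 \<rho> * (k t - k s)"
        using \<rho> st pw[of t] pw[of s] k0[of \<rho>] by (simp add: K1_def)
      moreover have "p * K1 \<rho> * \<bar>k t - k s\<bar> \<le> p * K1 \<rho> * (c * integral {s..t} (\<lambda>\<sigma>. \<bar>\<pi>1 \<sigma>\<bar>))"
      proof (rule mult_left_mono)
        have "(\<pi>1 has_integral \<pi> t - \<pi> s) {s..t}"
          by (rule fundamental_theorem_of_calculus) (use st \<pi> in \<open>auto simp: has_real_derivative_iff_has_vector_derivative[symmetric] intro: has_field_derivative_at_within\<close>)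
        then have "\<pi> t - \<pi> s = integral {s..t} \<pi>1" by (simp add: integral_unique)
        also have "norm \<dots> \<le> integral {s..t} (\<lambda>\<sigma>. \<bar>\<pi>1 \<sigma>\<bar>)"
          using cs by (intro Henstock_Kurzweil_Integration.integral_norm_bound_integral integrable_continuous_real continuous_intros) auto
        finally have "c * \<bar>\<pi> t - \<pi> s\<bar> \<le> c * integral {s..t} (\<lambda>\<sigma>. \<bar>\<pi>1 \<sigma>\<bar>)" using c by (intro mult_left_mono) auto
        then show "\<bar>k t - k s\<bar> \<le> c * integral {s..t} (\<lambda>\<sigma>. \<bar>\<pi>1 \<sigma>\<bar>)" using inc[of s t] st by simp
        show "0 \<le> p * K1 \<rho>" using p by (simp add: K1_def)
      qed
      moreover have "p * K1 \<rho> * (c * integral {s..t} (\<lambda>\<sigma>. \<bar>\<pi>1 \<sigma>\<bar>)) = K1 \<rho> * integral {s..t} R"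
        unfolding R_def by simp
      ultimately have kk: "- (K t - K s) \<le> K1 \<rho> * integral {s..t} R"
      proof -
        have "- (K t - K s) \<le> \<bar>p * K1 \<rho> * (k t - k s)\<bar>" using \<open>K t - K s = _\<close> by simp
        also have "\<dots> = p * K1 \<rho> * \<bar>k t - k s\<bar>" using p by (simp add: abs_mult K1_def)
        finally show ?thesis using \<open>p * K1 \<rho> * \<bar>k t - k s\<bar> \<le> _\<close> \<open>_ = K1 \<rho> * integral {s..t} R\<close> by linarith
      qed
      have Qt: "Q t \<ge> 0" by (simp add: Q_def)
      have "- (K t - K s) * Q t \<le> K1 \<rho> * integral {s..t} R * Q t" using kk Qt by (rule mult_right_mono)
      also have "\<dots> = integral {s..t} (\<lambda>\<sigma>. K1 \<rho> * Q t * R \<sigma>)" by simp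
      finally have 1: "- (K t - K s) * Q t \<le> integral {s..t} (\<lambda>\<sigma>. K1 \<rho> * Q t * R \<sigma>)" .
      have "(Q1 has_integral Q t - Q s) {s..t}"
        by (rule fundamental_theorem_of_calculus) (use st dQ in \<open>auto simp: has_real_derivative_iff_has_vector_derivative[symmetric] intro: has_field_derivative_at_within\<close>)
      then have 2: "K s * (Q t - Q s) = integral {s..t} (\<lambda>\<sigma>. K s * Q1 \<sigma>)" by (simp add: integral_unique)
      have i1: "(\<lambda>\<sigma>. K1 \<rho> * Q t * R \<sigma>) integrable_on {s..t}"
        using cs by (intro integrable_continuous_real continuous_intros)
      have i2: "(\<lambda>\<sigma>. K s * Q1 \<sigma>) integrable_on {s..t}"
        using cs by (intro integrable_continuous_real continuous_intros)
      have i3: "(\<lambda>t. K t * Q1 t - K1 t * Q t * R t) integrable_on {s..t}"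
        using cs by (intro integrable_continuous_real continuous_intros)
      have "f t - f s = - (K t - K s) * Q t - K s * (Q t - Q s) + integral {s..t} (\<lambda>t. K t * Q1 t - K1 t * Q t * R t)"
        using integral_Icc_diff[OF vc, of s t] st by (simp add: f_def algebra_simps)
      also have "\<dots> \<le> integral {s..t} (\<lambda>\<sigma>. K1 \<rho> * Q t * R \<sigma>) - integral {s..t} (\<lambda>\<sigma>. K s * Q1 \<sigma>) + integral {s..t} (\<lambda>t. K t * Q1 t - K1 t * Q t * R t)"
        using 1 2 by linarith
      also have "\<dots> = integral {s..t} (\<lambda>\<sigma>. (K1 \<rho> * Q t * R \<sigma> - K s * Q1 \<sigma>) + (K \<sigma> * Q1 \<sigma> - K1 \<sigma> * Q \<sigma> * R \<sigma>))"
        unfolding Henstock_Kurzweil_Integration.integral_add[OF integrable_diff[OF i1 i2] i3]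
          Henstock_Kurzweil_Integration.integral_diff[OF i1 i2] ..
      also have "\<dots> \<le> integral {s..t} (\<lambda>\<sigma>. e * (R \<sigma> + 1))"
      proof (rule integral_le)
        show "(\<lambda>\<sigma>. (K1 \<rho> * Q t * R \<sigma> - K s * Q1 \<sigma>) + (K \<sigma> * Q1 \<sigma> - K1 \<sigma> * Q \<sigma> * R \<sigma>)) integrable_on {s..t}"
          by (intro integrable_add integrable_diff i1 i2 i3)
        show "(\<lambda>\<sigma>. e * (R \<sigma> + 1)) integrable_on {s..t}"
          using cs by (intro integrable_continuous_real continuous_intros)
        fix \<sigma> assume \<sigma>: "\<sigma> \<in> {s..t}"
        have "\<bar>K1 \<rho> * Q t - K1 \<sigma> * Q \<sigma>\<bar> < e" by (rule d1(2)) (use \<sigma> \<rho>(1) st in auto)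
        then have "(K1 \<rho> * Q t - K1 \<sigma> * Q \<sigma>) * R \<sigma> \<le> e * R \<sigma>" using R0 by (intro mult_right_mono) auto
        moreover have "\<bar>K s * Q1 \<sigma> - K \<sigma> * Q1 \<sigma>\<bar> < e" by (rule d2(2)) (use \<sigma> st in auto)
        ultimately show "(K1 \<rho> * Q t * R \<sigma> - K s * Q1 \<sigma>) + (K \<sigma> * Q1 \<sigma> - K1 \<sigma> * Q \<sigma> * R \<sigma>) \<le> e * (R \<sigma> + 1)"
          by (simp add: algebra_simps abs_less_iff)
      qed
      also have "\<dots> = e * integral {a..t} (\<lambda>t. R t + 1) - e * integral {a..s} (\<lambda>t. R t + 1)"
        unfolding right_diff_distrib[symmetric] integral_Icc_diff[OF Rc1 st(1) st' st(3)] by simp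
      finally show "f t - f s \<le> e * integral {a..t} (\<lambda>t. R t + 1) - e * integral {a..s} (\<lambda>t. R t + 1)" .
    qed
  qed
  define I where "I = integral {a..b} (\<lambda>t. R t + 1)"
  have "f b - f a \<le> 0"
  proof (rule field_le_epsilon)
    fix e :: real assume e: "e > 0"
    have k: "\<bar>I\<bar> + 1 > 0" by simp
    have "f b - f a \<le> e / (\<bar>I\<bar> + 1) * I" using bound[of "e / (\<bar>I\<bar> + 1)"] e by (simp add: I_def)
    also have "\<dots> \<le> e / (\<bar>I\<bar> + 1) * (\<bar>I\<bar> + 1)" using e by (intro mult_left_mono) auto
    also have "\<dots> = 0 + e" using k by simp
    finally show "f b - f a \<le> 0 + e" .
  qed
  then have "integral {a..b} (\<lambda>t. K t * Q1 t - K1 t * Q t * R t) \<le> K b * Q b - K a * Q a" by (simp add: f_def)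
  also have "\<dots> \<le> K b * Q b" by (simp add: K_def Q_def)
  finally have "integral {a..b} (\<lambda>t. K t * Q1 t) - integral {a..b} (\<lambda>t. K1 t * Q t * R t) \<le> K b * Q b"
    using Kc K1c Qc Q1c Rc by (subst (asm) Henstock_Kurzweil_Integration.integral_diff) (auto intro!: integrable_continuous_real continuous_intros)
  moreover have "integral {a..b} (\<lambda>t. K t * Q1 t) = q * integral {a..b} (\<lambda>t. k t powr p * t powr (q - 1))"
    unfolding K_def Q1_def integral_mult_right[symmetric] by (simp add: mult_ac)
  moreover have "integral {a..b} (\<lambda>t. K1 t * Q t * R t) = p * c * integral {a..b} (\<lambda>t. k t powr (p - 1) * \<bar>\<pi>1 t\<bar> * t powr q)"
    unfolding K1_def Q_def R_def integral_mult_right[symmetric] by (simp add: mult_ac)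
  ultimately show ?thesis by (simp add: K_def Q_def)
qed

text \<open>Exponents \<open>p / (p - 1)\<close> and \<open>p\<close>, with a free weight
  \<open>m\<close> by which the two mixed terms can be balanced against each other.\<close>

lemma young_weighted:
  fixes x y m p :: real
  assumes "x \<ge> 0" "y \<ge> 0" "m > 0" "p > 1"
  shows "x powr (p - 1) * y \<le> (p - 1) / p * m * x powr p + m powr (1 - p) * y powr p / p"
proof -
  have "x powr (p - 1) * (y / m) \<le> (x powr (p - 1)) powr (p / (p - 1)) / (p / (p - 1)) + (y / m) powr p / p"
    by (rule Youngs_inequality) (use assms in \<open>auto simp: field_simps\<close>)
  also have "(x powr (p - 1)) powr (p / (p - 1)) = x powr p" using assms by (simp add: powr_powr)
  also have "(y / m) powr p = y powr p / m powr p" using assms by (intro powr_divide)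
  finally have "m * (x powr (p - 1) * (y / m)) \<le> m * (x powr p / (p / (p - 1)) + y powr p / m powr p / p)"
    using assms by (intro mult_left_mono) auto
  moreover have "m * (x powr (p - 1) * (y / m)) = x powr (p - 1) * y" using assms by simp
  moreover have "m * (x powr p / (p / (p - 1)) + y powr p / m powr p / p) =
      (p - 1) / p * m * x powr p + m powr (1 - p) * y powr p / p"
  proof -
    have "m powr (1 - p) = m / m powr p" using assms by (simp add: powr_diff)
    then show ?thesis using assms by (simp add: distrib_left)
  qed
  ultimately show ?thesis by simp
qed

text \<open>Exponents \<open>p / (p - 2)\<close> and \<open>p / 2\<close>, for the Laplacian term:
  the power \<open>p / 2\<close> of \<open>z\<close> will be the integrand on the right of the
  theorem.\<close>

lemma young_weighted':
  fixes x z m p :: real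
  assumes "x \<ge> 0" "z \<ge> 0" "m > 0" "p > 2"
  shows "x powr (p - 2) * z \<le> m * ((p - 2) / p * x powr p + 2 / p * (m powr (- (p / 2)) * z powr (p / 2)))"
proof -
  have "x powr (p - 2) * (z / m) \<le> (x powr (p - 2)) powr (p / (p - 2)) / (p / (p - 2)) + (z / m) powr (p / 2) / (p / 2)"
    by (rule Youngs_inequality) (use assms in \<open>auto simp: field_simps\<close>)
  also have "(x powr (p - 2)) powr (p / (p - 2)) = x powr p" using assms by (simp add: powr_powr)
  also have "(z / m) powr (p / 2) = m powr (- (p / 2)) * z powr (p / 2)"
    unfolding powr_minus powr_divide by (simp only: divide_inverse mult.commute)
  finally have "m * (x powr (p - 2) * (z / m)) \<le> m * (x powr p / (p / (p - 2)) + m powr (- (p / 2)) * z powr (p / 2) / (p / 2))"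
    using assms by (intro mult_left_mono) auto
  moreover have "m * (x powr (p - 2) * (z / m)) = x powr (p - 2) * z" using assms by simp
  moreover have "x powr p / (p / (p - 2)) + m powr (- (p / 2)) * z powr (p / 2) / (p / 2) =
     (p - 2) / p * x powr p + 2 / p * (m powr (- (p / 2)) * z powr (p / 2))" by (simp add: mult_ac)
  ultimately show ?thesis by (simp only:)
qed

text \<open>Below, \<open>I\<close> is the gradient term, \<open>K\<close> the Hardy term, and \<open>Yab\<close>, \<open>Yba\<close> are the two mixed terms; Young's
  inequality with the weights \<open>\<tau>\<close> and \<open>1 / \<tau>\<close> turns the Hardy inequality into a bound for \<open>Yab\<close>.\<close>

lemma annulus_inequality:
  fixes L :: "real^'n::finite \<Rightarrow> real" and h H P w w1 :: "real \<Rightarrow> real" and p c \<tau> a b B :: real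
  defines "\<sigma> \<equiv> sphere_const TYPE('n)" and "n \<equiv> real CARD('n)"
  assumes p: "2 < p" "p < n" and ab: "0 < a" "a \<le> b"
    and w: "\<And>t. t \<in> {a..b} \<Longrightarrow> (w has_real_derivative w1 t) (at t)" and w1: "continuous_on {a..b} w1"
    and wB: "\<And>t. t \<in> {a..b} \<Longrightarrow> w t \<in> {0<..<B}"
    and L: "set_integrable lebesgue {x. a < norm x \<and> norm x \<le> b} L"
    and y: "\<And>s t. a \<le> s \<Longrightarrow> s \<le> t \<Longrightarrow> t \<le> b \<Longrightarrow>
      \<sigma> * t ^ (CARD('n) - 1) * w1 t - \<sigma> * s ^ (CARD('n) - 1) * w1 s = (LINT x:{x. s < norm x \<and> norm x \<le> t}|lebesgue. L x)"
    and h: "continuous_on {0<..<B} h" "\<And>l. l \<in> {0<..<B} \<Longrightarrow> h l > 0"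
    and H: "\<And>l. l \<in> {0<..<B} \<Longrightarrow> (H has_real_derivative h l) (at l)" "\<And>l. l \<in> {0<..<B} \<Longrightarrow> H l > 0"
    and P: "\<And>l. l \<in> {0<..<B} \<Longrightarrow> (P has_real_derivative h l powr (1 / p)) (at l)"
    and G: "\<And>l. l \<in> {0<..<B} \<Longrightarrow> G l = H l / h l * h l powr (1 / p)"
    and inc: "\<And>s t. 0 < s \<Longrightarrow> s \<le> t \<Longrightarrow> t < B \<Longrightarrow> \<bar>G t - G s\<bar> \<le> c * (P t - P s)" and c: "c \<ge> 0"
    and \<tau>: "\<tau> > 0" "p * c \<le> \<tau> * (n - p)" and D: "D = (n - 1) * (p - 2) * \<tau>" "D < 1"
    and J: "set_integrable lebesgue (annulus a b) (\<lambda>x. \<bar>L x * (H (w (norm x)) / h (w (norm x)))\<bar> powr (p / 2) * h (w (norm x)))"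
  shows "(LINT x:annulus a b|lebesgue. \<bar>w1 (norm (x::real^'n))\<bar> powr p * h (w (norm x))) \<le>
    ((p - 1) / (1 - D)) powr (p / 2) *
      (LINT x:annulus a b|lebesgue. \<bar>L x * (H (w (norm x)) / h (w (norm x)))\<bar> powr (p / 2) * h (w (norm x))) +
    p / (2 * (1 - D)) * (\<sigma> * b ^ (CARD('n) - 1) * (\<bar>w1 b\<bar> powr (p - 2) * w1 b) * H (w b)
      - \<sigma> * a ^ (CARD('n) - 1) * (\<bar>w1 a\<bar> powr (p - 2) * w1 a) * H (w a)
      + (n - 1) * (p - 2) * \<tau> powr (1 - p) * (\<sigma> * (G (w b) powr p * b powr (n - p)) / (n - p)))"
proof -
  let ?A = "annulus a b :: (real^'n) set"
  have \<sigma>: "\<sigma> > 0" unfolding \<sigma>_def by (rule sphere_const_pos)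
  define hh where "hh t = h (w t)" for t
  define HH where "HH t = H (w t)" for t
  define T where "T t = HH t / hh t" for t
  define k where "k t = G (w t)" for t
  \<comment> \<open>With \<open>a0\<close> and \<open>b0\<close>, \<open>a0 powr p\<close> is the
    gradient integrand, \<open>b0 powr p\<close> the Hardy integrand, and
    \<open>a0 powr (p - 1) * b0\<close> equals
    \<open>\<bar>w1 t\<bar> powr (p - 1) * HH t / t\<close>, the cross term.\<close>
  define a0 where "a0 t = \<bar>w1 t\<bar> * hh t powr (1 / p)" for t
  define b0 where "b0 t = k t / t" for t
  define j where "j x = \<bar>L x * T (norm x)\<bar> powr (p / 2) * hh (norm x)" for x
  define Z where "Z t = \<sigma> * t ^ (CARD('n) - 1) * (\<bar>w1 t\<bar> powr (p - 2) * w1 t) * HH t" for t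
  \<comment> \<open>The boundary term that the Hardy inequality leaves at the outer radius.\<close>
  define \<eta> where "\<eta> = \<sigma> * (k b powr p * b powr (n - p)) / (n - p)"
  have wc: "continuous_on {a..b} w" using w by (meson DERIV_isCont continuous_at_imp_continuous_on)
  have hhc: "continuous_on {a..b} hh" unfolding hh_def
    by (rule continuous_on_compose2[OF h(1) wc]) (use wB in auto)
  have "continuous_on {0<..<B} H" using H(1) by (meson DERIV_isCont continuous_at_imp_continuous_on)
  then have HHc: "continuous_on {a..b} HH" unfolding HH_def
    by (rule continuous_on_compose2[OF _ wc]) (use wB in auto)
  have hh0: "hh t > 0" if "t \<in> {a..b}" for t using h(2)[OF wB[OF that]] by (simp add: hh_def)
  have HH0: "HH t > 0" if "t \<in> {a..b}" for t using H(2)[OF wB[OF that]] by (simp add: HH_def)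
  have T0: "T t > 0" if "t \<in> {a..b}" for t using hh0[OF that] HH0[OF that] by (simp add: T_def)
  have hp: "continuous_on {a..b} (\<lambda>t. hh t powr s)" for s
    by (intro continuous_on_powr' hhc continuous_on_const) (use hh0 in \<open>auto intro: less_imp_le simp: less_le\<close>)
  have Tc: "continuous_on {a..b} T" unfolding T_def using hh0 by (intro continuous_intros HHc hhc) force
  have kT: "k t = T t * hh t powr (1 / p)" if "t \<in> {a..b}" for t
    using G[OF wB[OF that]] by (simp add: k_def T_def HH_def hh_def)
  have k0: "k t \<ge> 0" if "t \<in> {a..b}" for t using kT[OF that] T0[OF that] by simp
  have kc: "continuous_on {a..b} k"
    by (rule continuous_on_eq[of _ "\<lambda>t. T t * hh t powr (1 / p)"]) (use kT in \<open>auto intro!: continuous_intros Tc hp\<close>)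
  have a0c: "continuous_on {a..b} a0" unfolding a0_def by (intro continuous_intros w1 hp)
  have a00: "a0 t \<ge> 0" for t by (simp add: a0_def)
  have b0c: "continuous_on {a..b} b0" unfolding b0_def using ab by (intro continuous_intros kc) auto
  have b00: "b0 t \<ge> 0" if "t \<in> {a..b}" for t using k0[OF that] that ab by (simp add: b0_def)
  have pc: "continuous_on {a..b} (\<lambda>t. f t powr s)" if "continuous_on {a..b} f" "\<And>t. t \<in> {a..b} \<Longrightarrow> f t \<ge> 0" "s > 0" for f :: "real \<Rightarrow> real" and s
    by (rule continuous_on_powr'[OF that(1), of "\<lambda>_. s"]) (use that(2,3) in auto)
  have tpos: "t > 0" if "t \<in> {a..b}" for t using that ab by auto
  have tn: "t ^ (CARD('n) - 1) = t powr (n - 1)" if "t > 0" for t :: real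
    using that p by (simp add: n_def powr_realpow[symmetric] of_nat_diff)
  have nx: "norm x \<in> {a..b}" if "x \<in> ?A" for x using that by (auto simp: annulus_def)
  define I where "I = (LINT x:?A|lebesgue. a0 (norm x) powr p)"
  define K where "K = (LINT x:?A|lebesgue. b0 (norm x) powr p)"
  define Yab where "Yab = (LINT x:?A|lebesgue. a0 (norm x) powr (p - 1) * b0 (norm x))"
  define Yba where "Yba = (LINT x:?A|lebesgue. b0 (norm x) powr (p - 1) * a0 (norm x))"
  define Jt where "Jt = (LINT x:?A|lebesgue. j x)"
  have c1: "continuous_on {a..b} (\<lambda>t. a0 t powr p)" "continuous_on {a..b} (\<lambda>t. a0 t powr (p - 1))"
    using p a00 by (auto intro!: pc a0c)
  have c2: "continuous_on {a..b} (\<lambda>t. b0 t powr p)" "continuous_on {a..b} (\<lambda>t. b0 t powr (p - 1))"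
    using p b00 by (auto intro!: pc b0c)
  have iI: "set_integrable lebesgue ?A (\<lambda>x. a0 (norm x) powr p)" by (rule radial_integral(1)[OF ab(1) c1(1)])
  have iK: "set_integrable lebesgue ?A (\<lambda>x. b0 (norm x) powr p)" by (rule radial_integral(1)[OF ab(1) c2(1)])
  have cab: "continuous_on {a..b} (\<lambda>t. a0 t powr (p - 1) * b0 t)" by (intro continuous_intros c1 b0c)
  have cba: "continuous_on {a..b} (\<lambda>t. b0 t powr (p - 1) * a0 t)" by (intro continuous_intros c2 a0c)
  have iYab: "set_integrable lebesgue ?A (\<lambda>x. a0 (norm x) powr (p - 1) * b0 (norm x))" by (rule radial_integral(1)[OF ab(1) cab])
  have iYba: "set_integrable lebesgue ?A (\<lambda>x. b0 (norm x) powr (p - 1) * a0 (norm x))" by (rule radial_integral(1)[OF ab(1) cba])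
  have ij: "set_integrable lebesgue ?A j" using J by (simp add: j_def[abs_def] T_def HH_def hh_def)
  have Iold: "(LINT x:?A|lebesgue. \<bar>w1 (norm x)\<bar> powr p * h (w (norm x))) = I"
    unfolding I_def
  proof (rule set_lebesgue_integral_cong)
    show "?A \<in> sets lebesgue" using annulus_sets by (intro sets_completionI_sets) simp
    show "\<forall>x. x \<in> ?A \<longrightarrow> \<bar>w1 (norm x)\<bar> powr p * h (w (norm x)) = a0 (norm x) powr p"
    proof (intro allI impI)
      fix x assume "x \<in> ?A"
      from hh0[OF nx[OF this]] show "\<bar>w1 (norm x)\<bar> powr p * h (w (norm x)) = a0 (norm x) powr p"
        using p by (simp add: a0_def powr_mult powr_powr hh_def)
    qed
  qed
  have "K \<le> \<eta> + \<tau> * Yba"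
  proof -
    \<comment> \<open>The Hardy exponent is \<open>q = n - p\<close>: the polar weight
      \<open>t powr (n - 1)\<close> times \<open>t powr (- p)\<close> from \<open>b0 powr p\<close>
      is \<open>t powr (q - 1)\<close>.\<close>
    have hardy: "(n - p) * integral {a..b} (\<lambda>t. k t powr p * t powr ((n - p) - 1)) \<le>
      k b powr p * b powr (n - p) + p * c * integral {a..b} (\<lambda>t. k t powr (p - 1) * \<bar>hh t powr (1 / p) * w1 t\<bar> * t powr (n - p))"
    proof (rule hardy_interval[OF ab _ _ c kc k0, where \<pi> = "\<lambda>t. P (w t)"])
      show "((\<lambda>t. P (w t)) has_real_derivative hh t powr (1 / p) * w1 t) (at t)" if "t \<in> {a..b}" for t
        unfolding hh_def by (rule DERIV_chain2[OF P[OF wB[OF that]] w[OF that]])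
      show "continuous_on {a..b} (\<lambda>t. hh t powr (1 / p) * w1 t)" by (intro continuous_intros hp w1)
      show "\<bar>k t - k s\<bar> \<le> c * \<bar>P (w t) - P (w s)\<bar>" if st: "a \<le> s" "s \<le> t" "t \<le> b" for s t
      proof -
        have ws: "0 < w s" "w s < B" "0 < w t" "w t < B" using wB[of s] wB[of t] st by auto
        have m: "c * (P v - P u) \<le> c * \<bar>P v - P u\<bar>" for u v using c by (intro mult_left_mono) auto
        show ?thesis
        proof (cases "w s \<le> w t")
          case True
          then show ?thesis using inc[of "w s" "w t"] ws m[of "w t" "w s"] by (simp add: k_def)
        next
          case False
          then show ?thesis using inc[of "w t" "w s"] ws m[of "w s" "w t"] by (simp add: k_def abs_minus_commute)
        qed
      qed
    qed (use p in auto)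
    have e1: "K = \<sigma> * integral {a..b} (\<lambda>t. k t powr p * t powr ((n - p) - 1))"
    proof -
      have "K = \<sigma> * integral {a..b} (\<lambda>t. t ^ (CARD('n) - 1) * b0 t powr p)"
        unfolding K_def \<sigma>_def by (rule radial_integral(2)[OF ab(1) c2(1)])
      also have "integral {a..b} (\<lambda>t. t ^ (CARD('n) - 1) * b0 t powr p) = integral {a..b} (\<lambda>t. k t powr p * t powr ((n - p) - 1))"
      proof (rule integral_cong)
        fix t assume t: "t \<in> {a..b}"
        have "t powr (n - 1) / t powr p = t powr ((n - p) - 1)" unfolding powr_diff[symmetric] by (simp add: algebra_simps)
        moreover have "t ^ (CARD('n) - 1) * b0 t powr p = k t powr p * (t powr (n - 1) / t powr p)"
          unfolding tn[OF tpos[OF t]] b0_def powr_divide by simp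
        ultimately show "t ^ (CARD('n) - 1) * b0 t powr p = k t powr p * t powr ((n - p) - 1)" by (simp only:)
      qed
      finally show ?thesis .
    qed
    have e2: "Yba = \<sigma> * integral {a..b} (\<lambda>t. k t powr (p - 1) * \<bar>hh t powr (1 / p) * w1 t\<bar> * t powr (n - p))"
    proof -
      have "Yba = \<sigma> * integral {a..b} (\<lambda>t. t ^ (CARD('n) - 1) * (b0 t powr (p - 1) * a0 t))"
        unfolding Yba_def \<sigma>_def by (rule radial_integral(2)[OF ab(1) cba])
      also have "integral {a..b} (\<lambda>t. t ^ (CARD('n) - 1) * (b0 t powr (p - 1) * a0 t)) =
        integral {a..b} (\<lambda>t. k t powr (p - 1) * \<bar>hh t powr (1 / p) * w1 t\<bar> * t powr (n - p))"
      proof (rule integral_cong)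
        fix t assume t: "t \<in> {a..b}"
        have "t powr (n - 1) / t powr (p - 1) = t powr (n - p)" unfolding powr_diff[symmetric] by simp
        moreover have "t ^ (CARD('n) - 1) * b0 t powr (p - 1) = k t powr (p - 1) * (t powr (n - 1) / t powr (p - 1))"
          unfolding tn[OF tpos[OF t]] b0_def powr_divide by simp
        ultimately have bt: "t ^ (CARD('n) - 1) * b0 t powr (p - 1) = k t powr (p - 1) * t powr (n - p)" by (simp only:)
        have "a0 t = \<bar>hh t powr (1 / p) * w1 t\<bar>" by (simp add: a0_def abs_mult mult.commute)
        then show "t ^ (CARD('n) - 1) * (b0 t powr (p - 1) * a0 t) = k t powr (p - 1) * \<bar>hh t powr (1 / p) * w1 t\<bar> * t powr (n - p)"
          unfolding mult.assoc[symmetric] bt by simp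
      qed
      finally show ?thesis .
    qed
    have "\<sigma> * ((n - p) * integral {a..b} (\<lambda>t. k t powr p * t powr ((n - p) - 1))) \<le>
      \<sigma> * (k b powr p * b powr (n - p) + p * c * integral {a..b} (\<lambda>t. k t powr (p - 1) * \<bar>hh t powr (1 / p) * w1 t\<bar> * t powr (n - p)))"
      using hardy \<sigma> by (intro mult_left_mono) auto
    then have "(n - p) * K \<le> \<sigma> * (k b powr p * b powr (n - p)) + p * c * Yba"
      unfolding e1 e2 by (simp only: distrib_left mult_ac)
    \<comment> \<open>This is the purpose of the condition on \<open>\<tau>\<close>: the factor
      \<open>n - p\<close> cancels and \<open>\<tau>\<close> is all that remains of
      \<open>c\<close>.\<close>
    also have "p * c * Yba \<le> \<tau> * (n - p) * Yba"
    proof (rule mult_right_mono[OF \<tau>(2)])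
      show "Yba \<ge> 0" unfolding Yba_def set_lebesgue_integral_def
        by (intro integral_nonneg_AE AE_I2) (auto simp: a00)
    qed
    finally have "(n - p) * K \<le> (n - p) * (\<eta> + \<tau> * Yba)" using p by (simp add: \<eta>_def distrib_left mult_ac)
    then show ?thesis using p by simp
  qed
  moreover have "\<tau> * Yba \<le> (p - 1) / p * K + \<tau> powr p * I / p"
  proof -
    have "Yba \<le> (LINT x:?A|lebesgue. (p - 1) / p * (1 / \<tau>) * b0 (norm x) powr p + (1 / \<tau>) powr (1 - p) / p * a0 (norm x) powr p)"
      unfolding Yba_def
    proof (rule set_integral_mono[OF iYba])
      show "set_integrable lebesgue ?A (\<lambda>x. (p - 1) / p * (1 / \<tau>) * b0 (norm x) powr p + (1 / \<tau>) powr (1 - p) / p * a0 (norm x) powr p)"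
        using iK iI by (intro set_integral_add(1) set_integrable_mult_right)
      show "b0 (norm x) powr (p - 1) * a0 (norm x) \<le> (p - 1) / p * (1 / \<tau>) * b0 (norm x) powr p + (1 / \<tau>) powr (1 - p) / p * a0 (norm x) powr p" if "x \<in> ?A" for x
        using young_weighted[OF b00[OF nx[OF that]] a00, of "1 / \<tau>" p "norm x"] \<tau> p by simp
    qed
    also have "\<dots> = (LINT x:?A|lebesgue. (p - 1) / p * (1 / \<tau>) * b0 (norm x) powr p) + (LINT x:?A|lebesgue. (1 / \<tau>) powr (1 - p) / p * a0 (norm x) powr p)"
      using iK iI by (intro set_integral_add(2) set_integrable_mult_right)
    also have "\<dots> = (p - 1) / p * (1 / \<tau>) * K + (1 / \<tau>) powr (1 - p) / p * I"
      unfolding K_def I_def by (simp only: set_integral_mult_right)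
    finally have "\<tau> * Yba \<le> \<tau> * ((p - 1) / p * (1 / \<tau>) * K + (1 / \<tau>) powr (1 - p) / p * I)"
      using \<tau> by (intro mult_left_mono) auto
    also have "\<dots> = (p - 1) / p * K + (\<tau> * (1 / \<tau>) powr (1 - p)) * I / p" using \<tau> by (simp add: distrib_left)
    also have "\<tau> * (1 / \<tau>) powr (1 - p) = \<tau> powr p"
    proof -
      have "(1 / \<tau>) powr (1 - p) = \<tau> powr (p - 1)" using \<tau> by (simp add: powr_divide powr_minus_divide[symmetric])
      then show ?thesis using \<tau> by (simp add: powr_diff)
    qed
    finally show ?thesis .
  qed
  ultimately have "K \<le> \<eta> + (p - 1) / p * K + \<tau> powr p * I / p" by linarith
  \<comment> \<open>\<open>K\<close> carries the coefficient \<open>(p - 1) / p\<close> on the right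
    and can be absorbed.\<close>
  then have "p * K \<le> p * (\<eta> + (p - 1) / p * K + \<tau> powr p * I / p)" using p by (intro mult_left_mono) auto
  also have "\<dots> = p * \<eta> + (p - 1) * K + \<tau> powr p * I" using p by (simp add: distrib_left)
  finally have Kle: "K \<le> p * \<eta> + \<tau> powr p * I" by (simp add: algebra_simps)
  \<comment> \<open>The shares \<open>(p - 1) / p\<close> and \<open>1 / p\<close> of
    \<open>\<tau> * I\<close>, one direct and one through \<open>K\<close>, recombine to the full
    \<open>\<tau> * I\<close>; this is where the coefficient \<open>D\<close> comes from.\<close>
  have Yle: "Yab \<le> \<tau> * I + \<tau> powr (1 - p) * \<eta>"
  proof -
    have "Yab \<le> (LINT x:?A|lebesgue. (p - 1) / p * \<tau> * a0 (norm x) powr p + \<tau> powr (1 - p) / p * b0 (norm x) powr p)"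
      unfolding Yab_def
    proof (rule set_integral_mono[OF iYab])
      show "set_integrable lebesgue ?A (\<lambda>x. (p - 1) / p * \<tau> * a0 (norm x) powr p + \<tau> powr (1 - p) / p * b0 (norm x) powr p)"
        using iK iI by (intro set_integral_add(1) set_integrable_mult_right)
      show "a0 (norm x) powr (p - 1) * b0 (norm x) \<le> (p - 1) / p * \<tau> * a0 (norm x) powr p + \<tau> powr (1 - p) / p * b0 (norm x) powr p" if "x \<in> ?A" for x
        using young_weighted[OF a00 b00[OF nx[OF that]] \<tau>(1), of p "norm x"] p by simp
    qed
    also have "\<dots> = (LINT x:?A|lebesgue. (p - 1) / p * \<tau> * a0 (norm x) powr p) + (LINT x:?A|lebesgue. \<tau> powr (1 - p) / p * b0 (norm x) powr p)"
      using iK iI by (intro set_integral_add(2) set_integrable_mult_right)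
    also have "\<dots> = (p - 1) / p * \<tau> * I + \<tau> powr (1 - p) / p * K"
      unfolding K_def I_def by (simp only: set_integral_mult_right)
    also have "\<tau> powr (1 - p) / p * K \<le> \<tau> powr (1 - p) / p * (p * \<eta> + \<tau> powr p * I)"
      using Kle p by (intro mult_left_mono) auto
    also have "\<dots> = \<tau> powr (1 - p) * \<eta> + (\<tau> powr (1 - p) * \<tau> powr p) * I / p" using p by (simp add: distrib_left)
    also have "\<tau> powr (1 - p) * \<tau> powr p = \<tau>" unfolding powr_add[symmetric] using \<tau> by simp
    also have "(p - 1) / p * \<tau> * I + (\<tau> powr (1 - p) * \<eta> + \<tau> * I / p) = \<tau> * I + \<tau> powr (1 - p) * \<eta>"
      using p by (simp add: field_simps)
    finally show ?thesis by simp
  qed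
  define X where "X = (LINT x:?A|lebesgue. ((p - 1) * \<bar>w1 (norm x)\<bar> powr (p - 2) * HH (norm x)) * L x)"
  define g where "g t = (\<bar>w1 t\<bar> powr (p - 2) * w1 t) * (hh t * w1 t - (n - 1) * (p - 2) / t * HH t)" for t
  have w1p: "continuous_on {a..b} (\<lambda>t. \<bar>w1 t\<bar> powr (p - 2))"
    using p by (intro pc continuous_intros w1) auto
  have gc: "continuous_on {a..b} g" unfolding g_def using ab by (intro continuous_intros w1p w1 hhc HHc) auto
  have Lann: "set_integrable lebesgue ?A L" using L shell_annulus(1) by blast
  have iX: "set_integrable lebesgue ?A (\<lambda>x. ((p - 1) * \<bar>w1 (norm x)\<bar> powr (p - 2) * HH (norm x)) * L x)"
  proof -
    have "continuous_on ?A (\<lambda>x. (p - 1) * \<bar>w1 (norm x)\<bar> powr (p - 2) * HH (norm x))"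
      by (intro continuous_intros continuous_on_compose2[OF w1p] continuous_on_compose2[OF HHc]) (use nx in auto)
    from set_integrable_mult_continuous[OF Lann compact_annulus this] show ?thesis by (simp add: mult.commute)
  qed
  have parts: "Z b - Z a = X + (LINT x:?A|lebesgue. g (norm x))"
  proof -
    \<comment> \<open>The flux \<open>Y\<close> carries \<open>\<sigma> * t powr (n - 1)\<close>
      into its power \<open>p - 2\<close>; the factor
      \<open>\<sigma> powr (2 - p) * t powr (- m)\<close> in \<open>N\<close> takes it out again, so
      that \<open>\<bar>Y\<bar> powr (p - 2) * Y * N\<close> is \<open>Z\<close>. Differentiating
      \<open>t powr (- m)\<close> is what creates the cross term.\<close>
    define m where "m = (n - 1) * (p - 2)"
    define N where "N t = \<sigma> powr (2 - p) * (t powr (- m) * HH t)" for t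
    define N1 where "N1 t = \<sigma> powr (2 - p) * (- m * t powr (- m - 1) * HH t + (hh t * w1 t) * t powr (- m))" for t
    define Y where "Y t = \<sigma> * t ^ (CARD('n) - 1) * w1 t" for t
    have Yp: "\<bar>Y t\<bar> powr (p - 2) * (\<sigma> powr (2 - p) * t powr (- m)) = \<bar>w1 t\<bar> powr (p - 2)" if "t \<in> {a..b}" for t
    proof -
      have t: "t > 0" using tpos[OF that] .
      have "\<bar>Y t\<bar> = \<sigma> * t powr (n - 1) * \<bar>w1 t\<bar>" using \<sigma> t tn[OF t] by (simp add: Y_def abs_mult)
      then have "\<bar>Y t\<bar> powr (p - 2) = \<sigma> powr (p - 2) * t powr m * \<bar>w1 t\<bar> powr (p - 2)"
        using \<sigma> t by (simp add: powr_mult powr_powr m_def)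
      then have "\<bar>Y t\<bar> powr (p - 2) * (\<sigma> powr (2 - p) * t powr (- m)) =
        (\<sigma> powr (p - 2) * \<sigma> powr (2 - p)) * (t powr m * t powr (- m)) * \<bar>w1 t\<bar> powr (p - 2)" by (simp only: mult_ac)
      also have "\<dots> = \<bar>w1 t\<bar> powr (p - 2)" unfolding powr_add[symmetric] using \<sigma> t by simp
      finally show ?thesis .
    qed
    have st: "(\<bar>Y b\<bar> powr (p - 2) * Y b) * N b - (\<bar>Y a\<bar> powr (p - 2) * Y a) * N a =
      (LINT x:?A|lebesgue. ((p - 2 + 1) * \<bar>Y (norm x)\<bar> powr (p - 2) * N (norm x)) * L x) + integral {a..b} (\<lambda>t. (\<bar>Y t\<bar> powr (p - 2) * Y t) * N1 t)"
    proof (rule stieltjes_parts[OF ab L])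
      show "Y t - Y s = (LINT x:{x. s < norm x \<and> norm x \<le> t}|lebesgue. L x)" if "a \<le> s" "s \<le> t" "t \<le> b" for s t
        unfolding Y_def by (rule y[OF that])
      show "continuous_on {a..b} Y" unfolding Y_def by (intro continuous_intros w1)
      show "((\<lambda>v. \<bar>v\<bar> powr (p - 2) * v) has_real_derivative (p - 2 + 1) * \<bar>v\<bar> powr (p - 2)) (at v)" for v
        using p by (intro signed_powr_has_derivative) simp
      show "continuous_on UNIV (\<lambda>v::real. (p - 2 + 1) * \<bar>v\<bar> powr (p - 2))"
        using p by (intro continuous_intros abs_powr_continuous) simp
      show "(N has_real_derivative N1 t) (at t)" if t: "t \<in> {a..b}" for t
      proof -
        have 1: "((\<lambda>t. t powr (- m)) has_real_derivative - m * t powr (- m - 1)) (at t)"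
          using tpos[OF t] by (rule has_real_derivative_powr)
        have 2: "(HH has_real_derivative hh t * w1 t) (at t)"
          unfolding HH_def hh_def by (rule DERIV_chain2[OF H(1)[OF wB[OF t]] w[OF t]])
        show ?thesis unfolding N_def N1_def by (rule DERIV_cmult[OF DERIV_mult[OF 1 2]])
      qed
      show "continuous_on {a..b} N1" unfolding N1_def using ab by (intro continuous_intros HHc hhc w1) auto
    qed
    have zt: "(\<bar>Y t\<bar> powr (p - 2) * Y t) * N t = Z t" if "t \<in> {a..b}" for t
    proof -
      have "(\<bar>Y t\<bar> powr (p - 2) * Y t) * N t = (\<bar>Y t\<bar> powr (p - 2) * (\<sigma> powr (2 - p) * t powr (- m))) * (Y t * HH t)"
        unfolding N_def by (simp only: mult_ac)
      also have "\<dots> = Z t" unfolding Yp[OF that] by (simp add: Z_def Y_def mult_ac)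
      finally show ?thesis .
    qed
    have "(LINT x:?A|lebesgue. ((p - 2 + 1) * \<bar>Y (norm x)\<bar> powr (p - 2) * N (norm x)) * L x) = X"
      unfolding X_def
    proof (rule set_lebesgue_integral_cong)
      show "?A \<in> sets lebesgue" using annulus_sets by (intro sets_completionI_sets) simp
      show "\<forall>x. x \<in> ?A \<longrightarrow> ((p - 2 + 1) * \<bar>Y (norm x)\<bar> powr (p - 2) * N (norm x)) * L x = ((p - 1) * \<bar>w1 (norm x)\<bar> powr (p - 2) * HH (norm x)) * L x"
      proof (intro allI impI)
        fix x assume x: "x \<in> ?A"
        have "(p - 2 + 1) * \<bar>Y (norm x)\<bar> powr (p - 2) * N (norm x) =
          (p - 1) * (\<bar>Y (norm x)\<bar> powr (p - 2) * (\<sigma> powr (2 - p) * norm x powr (- m))) * HH (norm x)"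
          unfolding N_def by simp
        also have "\<dots> = (p - 1) * \<bar>w1 (norm x)\<bar> powr (p - 2) * HH (norm x)" unfolding Yp[OF nx[OF x]] ..
        finally show "((p - 2 + 1) * \<bar>Y (norm x)\<bar> powr (p - 2) * N (norm x)) * L x = ((p - 1) * \<bar>w1 (norm x)\<bar> powr (p - 2) * HH (norm x)) * L x"
          by (simp only:)
      qed
    qed
    moreover have "integral {a..b} (\<lambda>t. (\<bar>Y t\<bar> powr (p - 2) * Y t) * N1 t) = (LINT x:?A|lebesgue. g (norm x))"
    proof -
      have "integral {a..b} (\<lambda>t. (\<bar>Y t\<bar> powr (p - 2) * Y t) * N1 t) = integral {a..b} (\<lambda>t. \<sigma> * (t ^ (CARD('n) - 1) * g t))"
      proof (rule integral_cong)
        fix t assume t: "t \<in> {a..b}"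
        have t1: "t powr (- m - 1) = t powr (- m) / t" using tpos[OF t] by (simp add: powr_diff)
        have "(\<bar>Y t\<bar> powr (p - 2) * Y t) * N1 t =
          (\<bar>Y t\<bar> powr (p - 2) * (\<sigma> powr (2 - p) * t powr (- m))) * Y t * (hh t * w1 t - m / t * HH t)"
          unfolding N1_def t1 by (simp add: algebra_simps)
        also have "\<dots> = \<bar>w1 t\<bar> powr (p - 2) * Y t * (hh t * w1 t - m / t * HH t)" unfolding Yp[OF t] ..
        also have "\<dots> = \<sigma> * (t ^ (CARD('n) - 1) * g t)" unfolding Y_def g_def m_def by (simp only: mult_ac)
        finally show "(\<bar>Y t\<bar> powr (p - 2) * Y t) * N1 t = \<sigma> * (t ^ (CARD('n) - 1) * g t)" .
      qed
      also have "\<dots> = \<sigma> * integral {a..b} (\<lambda>t. t ^ (CARD('n) - 1) * g t)" by simp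
      also have "\<dots> = (LINT x:?A|lebesgue. g (norm x))" unfolding \<sigma>_def by (rule radial_integral(2)[OF ab(1) gc, symmetric])
      finally show ?thesis .
    qed
    ultimately show ?thesis using st zt[of a] zt[of b] ab by simp
  qed
  have ig: "set_integrable lebesgue ?A (\<lambda>x. g (norm x))" by (rule radial_integral(1)[OF ab(1) gc])
  have gle: "I - (n - 1) * (p - 2) * Yab \<le> (LINT x:?A|lebesgue. g (norm x))"
  proof -
    have "I - (n - 1) * (p - 2) * Yab = (LINT x:?A|lebesgue. a0 (norm x) powr p) - (LINT x:?A|lebesgue. (n - 1) * (p - 2) * (a0 (norm x) powr (p - 1) * b0 (norm x)))"
      unfolding I_def Yab_def by (simp only: set_integral_mult_right)
    also have "\<dots> = (LINT x:?A|lebesgue. a0 (norm x) powr p - (n - 1) * (p - 2) * (a0 (norm x) powr (p - 1) * b0 (norm x)))"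
      using iI iYab by (intro set_integral_diff(2)[symmetric] set_integrable_mult_right)
    also have "\<dots> \<le> (LINT x:?A|lebesgue. g (norm x))"
    proof (rule set_integral_mono[OF _ ig])
      show "set_integrable lebesgue ?A (\<lambda>x. a0 (norm x) powr p - (n - 1) * (p - 2) * (a0 (norm x) powr (p - 1) * b0 (norm x)))"
        using iI iYab by (intro set_integral_diff(1) set_integrable_mult_right)
      fix x assume "x \<in> ?A"
      note t = nx[OF this]
      define t where "t = norm x"
      define v where "v = w1 t"
      have hp0: "hh t > 0" "HH t > 0" "t > 0" using hh0[OF t] HH0[OF t] tpos[OF t] by (simp_all add: t_def)
      have vv: "\<bar>v\<bar> powr (p - 2) * v * v = \<bar>v\<bar> powr p"
      proof -
        have "\<bar>v\<bar> powr p = \<bar>v\<bar> powr (p - 2) * \<bar>v\<bar> powr 2" unfolding powr_add[symmetric] by simp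
        then show ?thesis by (cases "v = 0") (auto simp: power2_eq_square mult.assoc abs_mult_self_eq)
      qed
      have v1: "\<bar>v\<bar> powr (p - 2) * v \<le> \<bar>v\<bar> powr (p - 1)"
      proof -
        have "\<bar>v\<bar> powr (p - 1) = \<bar>v\<bar> powr (p - 2) * \<bar>v\<bar> powr 1" unfolding powr_add[symmetric] by simp
        moreover have "\<bar>v\<bar> powr (p - 2) * v \<le> \<bar>v\<bar> powr (p - 2) * \<bar>v\<bar>" by (intro mult_left_mono) auto
        ultimately show ?thesis by simp
      qed
      have A1: "a0 t powr p = \<bar>v\<bar> powr p * hh t" using hp0 p by (simp add: a0_def v_def powr_mult powr_powr)
      have A2: "a0 t powr (p - 1) * b0 t = \<bar>v\<bar> powr (p - 1) * (HH t / t)"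
      proof -
        have "a0 t powr (p - 1) * b0 t = \<bar>v\<bar> powr (p - 1) * (hh t powr ((p - 1) / p) * hh t powr (1 / p)) * (T t / t)"
          using t hp0 by (simp add: a0_def b0_def v_def powr_mult powr_powr kT t_def)
        also have "hh t powr ((p - 1) / p) * hh t powr (1 / p) = hh t"
          unfolding powr_add[symmetric] using hp0 p by (simp add: add_divide_distrib[symmetric])
        also have "\<bar>v\<bar> powr (p - 1) * hh t * (T t / t) = \<bar>v\<bar> powr (p - 1) * (HH t / t)" using hp0 by (simp add: T_def)
        finally show ?thesis .
      qed
      have "(n - 1) * (p - 2) * (HH t / t) * (\<bar>v\<bar> powr (p - 2) * v) \<le> (n - 1) * (p - 2) * (HH t / t) * \<bar>v\<bar> powr (p - 1)"
        using v1 hp0 p by (intro mult_left_mono) auto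
      moreover have "g t = \<bar>v\<bar> powr p * hh t - (n - 1) * (p - 2) * (HH t / t) * (\<bar>v\<bar> powr (p - 2) * v)"
      proof -
        have "g t = (\<bar>v\<bar> powr (p - 2) * v * v) * hh t - (n - 1) * (p - 2) * (HH t / t) * (\<bar>v\<bar> powr (p - 2) * v)"
          unfolding g_def v_def[symmetric] right_diff_distrib[of "\<bar>v\<bar> powr (p - 2) * v"] by (simp add: mult_ac)
        then show ?thesis unfolding vv .
      qed
      ultimately have "a0 t powr p - (n - 1) * (p - 2) * (a0 t powr (p - 1) * b0 t) \<le> g t"
        unfolding A1 A2 by (simp add: mult_ac)
      then show "a0 (norm x) powr p - (n - 1) * (p - 2) * (a0 (norm x) powr (p - 1) * b0 (norm x)) \<le> g (norm x)"
        by (simp add: t_def)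
    qed
    finally show ?thesis .
  qed
  \<comment> \<open>Chosen so that \<open>(p - 1) * \<kappa> = 1 - D\<close>: Young's inequality
    then uses up the share \<open>(p - 2) / p\<close> of the \<open>(1 - D) * I\<close> left after
    the cross term, and the share \<open>2 / p\<close> survives.\<close>
  define \<kappa> where "\<kappa> = (1 - D) / (p - 1)"
  have \<kappa>: "\<kappa> > 0" using D p by (simp add: \<kappa>_def)
  have Xle: "- X \<le> (1 - D) * ((p - 2) / p * I + 2 / p * (\<kappa> powr (- (p / 2)) * Jt))"
  proof -
    have "- X \<le> \<bar>X\<bar>" by simp
    also have "\<bar>X\<bar> \<le> (LINT x:?A|lebesgue. (1 - D) * ((p - 2) / p) * a0 (norm x) powr p + (1 - D) * (2 / p * \<kappa> powr (- (p / 2))) * j x)"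
      unfolding X_def set_lebesgue_integral_def real_norm_def[symmetric]
    proof (rule norm_integral_le_integral)
      show "integrable lebesgue (\<lambda>x. indicator ?A x *\<^sub>R (((p - 1) * norm (w1 (norm x)) powr (p - 2) * HH (norm x)) * L x))"
        using iX unfolding set_integrable_def real_norm_def .
      have "set_integrable lebesgue ?A (\<lambda>x. (1 - D) * ((p - 2) / p) * a0 (norm x) powr p + (1 - D) * (2 / p * \<kappa> powr (- (p / 2))) * j x)"
        using iI ij by (intro set_integral_add(1) set_integrable_mult_right)
      then show "integrable lebesgue (\<lambda>x. indicator ?A x *\<^sub>R ((1 - D) * ((p - 2) / p) * a0 (norm x) powr p + (1 - D) * (2 / p * \<kappa> powr (- (p / 2))) * j x))"
        unfolding set_integrable_def .
      show "norm (indicator ?A x *\<^sub>R (((p - 1) * norm (w1 (norm x)) powr (p - 2) * HH (norm x)) * L x))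
        \<le> indicator ?A x *\<^sub>R ((1 - D) * ((p - 2) / p) * a0 (norm x) powr p + (1 - D) * (2 / p * \<kappa> powr (- (p / 2))) * j x)" for x
      proof (cases "x \<in> ?A")
        case True
        note t = nx[OF True]
        define t where "t = norm x"
        have hp0: "hh t > 0" "HH t > 0" "t > 0" "T t > 0" using hh0[OF t] HH0[OF t] tpos[OF t] T0[OF t] by (simp_all add: t_def)
        \<comment> \<open>\<open>HH = T * hh\<close> is split by
          \<open>hh = hh powr ((p - 2) / p) * hh powr (2 / p)\<close>; the first factor goes into
          \<open>a0 powr (p - 2)\<close>, and \<open>z powr (p / 2)\<close> becomes exactly
          \<open>j x\<close>.\<close>
        define z where "z = \<bar>L x\<bar> * T t * hh t powr (2 / p)"
        have z0: "z \<ge> 0" using hp0 by (simp add: z_def)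
        have "a0 t powr (p - 2) * z = \<bar>w1 t\<bar> powr (p - 2) * HH t * \<bar>L x\<bar>"
        proof -
          have "a0 t powr (p - 2) * z = \<bar>w1 t\<bar> powr (p - 2) * (hh t powr ((p - 2) / p) * hh t powr (2 / p)) * T t * \<bar>L x\<bar>"
            using hp0 by (simp add: a0_def z_def powr_mult powr_powr)
          also have "hh t powr ((p - 2) / p) * hh t powr (2 / p) = hh t"
            unfolding powr_add[symmetric] using hp0 p by (simp add: add_divide_distrib[symmetric])
          also have "\<bar>w1 t\<bar> powr (p - 2) * hh t * T t * \<bar>L x\<bar> = \<bar>w1 t\<bar> powr (p - 2) * HH t * \<bar>L x\<bar>" using hp0 by (simp add: T_def)
          finally show ?thesis .
        qed
        then have "norm (((p - 1) * \<bar>w1 t\<bar> powr (p - 2) * HH t) * L x) = (p - 1) * (a0 t powr (p - 2) * z)"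
          using p hp0 by (simp add: abs_mult)
        also have "\<dots> \<le> (p - 1) * (\<kappa> * ((p - 2) / p * a0 t powr p + 2 / p * (\<kappa> powr (- (p / 2)) * z powr (p / 2))))"
          using young_weighted'[OF a00 z0 \<kappa> p(1)] p by (intro mult_left_mono) auto
        also have "\<dots> = (1 - D) * ((p - 2) / p * a0 t powr p + 2 / p * (\<kappa> powr (- (p / 2)) * z powr (p / 2)))"
          using p by (simp add: \<kappa>_def)
        also have "z powr (p / 2) = j x"
        proof -
          have "z powr (p / 2) = (\<bar>L x\<bar> * T t) powr (p / 2) * (hh t powr (2 / p)) powr (p / 2)"
            unfolding z_def using hp0 by (simp add: powr_mult)
          also have "(hh t powr (2 / p)) powr (p / 2) = hh t" using hp0 p by (simp add: powr_powr)
          finally show ?thesis using hp0 by (simp add: j_def t_def abs_mult)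
        qed
        finally show ?thesis using True by (simp add: t_def distrib_left mult_ac)
      qed simp
    qed
    also have "\<dots> = (LINT x:?A|lebesgue. (1 - D) * ((p - 2) / p) * a0 (norm x) powr p) + (LINT x:?A|lebesgue. (1 - D) * (2 / p * \<kappa> powr (- (p / 2))) * j x)"
      using iI ij by (intro set_integral_add(2) set_integrable_mult_right)
    also have "\<dots> = (1 - D) * ((p - 2) / p) * I + (1 - D) * (2 / p * \<kappa> powr (- (p / 2))) * Jt"
      unfolding I_def Jt_def by (simp only: set_integral_mult_right)
    finally show ?thesis by (simp only: distrib_left mult.assoc)
  qed
  define E where "E = Z b - Z a + (n - 1) * (p - 2) * \<tau> powr (1 - p) * \<eta>"
  have "(n - 1) * (p - 2) * Yab \<le> (n - 1) * (p - 2) * (\<tau> * I + \<tau> powr (1 - p) * \<eta>)"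
    using Yle p by (intro mult_left_mono) auto
  also have "\<dots> = D * I + (n - 1) * (p - 2) * \<tau> powr (1 - p) * \<eta>" unfolding D(1) by (simp only: distrib_left mult.assoc)
  finally have "I \<le> E + (1 - D) * ((p - 2) / p * I + 2 / p * (\<kappa> powr (- (p / 2)) * Jt)) + D * I"
    using gle parts Xle unfolding E_def by linarith
  then have "(1 - D) * I - (1 - D) * ((p - 2) / p * I) \<le> E + (1 - D) * (2 / p * (\<kappa> powr (- (p / 2)) * Jt))"
    by (simp add: algebra_simps)
  moreover have "(1 - D) * I - (1 - D) * ((p - 2) / p * I) = (1 - D) * (2 / p) * I"
    using p by (simp add: field_simps)
  ultimately have "(1 - D) * (2 / p) * I \<le> E + (1 - D) * (2 / p) * (\<kappa> powr (- (p / 2)) * Jt)" by (simp only: mult.assoc)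
  then have "p / (2 * (1 - D)) * ((1 - D) * (2 / p) * I) \<le> p / (2 * (1 - D)) * (E + (1 - D) * (2 / p) * (\<kappa> powr (- (p / 2)) * Jt))"
    using D p by (intro mult_left_mono) auto
  moreover have "p / (2 * (1 - D)) * ((1 - D) * (2 / p) * v) = v" for v
  proof -
    have "p / (2 * d) * (d * (2 / p) * v) = v" if "d \<noteq> 0" for d using that p by simp
    from this[of "1 - D"] show ?thesis using D(2) by simp
  qed
  ultimately have "I \<le> p / (2 * (1 - D)) * E + \<kappa> powr (- (p / 2)) * Jt" by (simp only: distrib_left)
  moreover have "\<kappa> powr (- (p / 2)) = ((p - 1) / (1 - D)) powr (p / 2)"
  proof -
    have "\<kappa> powr (- (p / 2)) = (1 / \<kappa>) powr (p / 2)" using \<kappa> by (simp add: powr_minus_divide powr_divide)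
    then show ?thesis by (simp add: \<kappa>_def)
  qed
  ultimately show ?thesis
    unfolding Iold E_def Z_def HH_def \<eta>_def k_def Jt_def j_def T_def hh_def by simp
qed

section \<open>Passage to the ball\<close>

text \<open>If the term exceeded \<open>\<zeta>\<close> at every radius, then \<open>w1 a\<close>
  would be negative there and, since \<open>H (w a)\<close> is bounded and
  \<open>a ^ (n - 1) \<le> a powr (p - 1)\<close> for \<open>a \<le> 1\<close>, even
  \<open>w1 a \<le> - \<mu> / a\<close>. Then \<open>w + \<mu> * ln\<close> would be nonincreasing
  near 0, against \<open>0 < w < B\<close>.\<close>

lemma inner_boundary_small:
  fixes w w1 H :: "real \<Rightarrow> real"
  assumes p: "2 < p" "p < real n" and r: "a0 > 0" "\<sigma> > 0" and \<zeta>: "\<zeta> > 0"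
    and w: "\<And>t. t \<in> {0<..a0} \<Longrightarrow> (w has_real_derivative w1 t) (at t)" and wc: "continuous_on {0..a0} w"
    and wB: "\<And>t. t \<in> {0..a0} \<Longrightarrow> w t \<in> {0<..<B}"
    and H: "continuous_on {0<..<B} H" "\<And>l. l \<in> {0<..<B} \<Longrightarrow> H l > 0"
  shows "\<exists>a\<in>{0<..a0}. - (\<sigma> * a ^ (n - 1) * (\<bar>w1 a\<bar> powr (p - 2) * w1 a) * H (w a)) \<le> \<zeta>"
proof (rule ccontr)
  assume "\<not> ?thesis"
  then have neg: "- (\<sigma> * a ^ (n - 1) * (\<bar>w1 a\<bar> powr (p - 2) * w1 a) * H (w a)) > \<zeta>" if "0 < a" "a \<le> a0" for a
    using that by (auto simp: not_le)
  have "continuous_on {0..a0} (\<lambda>t. H (w t))"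
    by (rule continuous_on_compose2[OF H(1) wc]) (use wB in auto)
  then have "bounded ((\<lambda>t. H (w t)) ` {0..a0})" by (intro compact_imp_bounded compact_continuous_image compact_Icc)
  then obtain M where "\<forall>t\<in>{0..a0}. \<bar>H (w t)\<bar> \<le> M" unfolding bounded_iff by auto
  then have M: "H (w t) \<le> M" if "t \<in> {0..a0}" for t using that by fastforce
  have M0: "M > 0" using M[of a0] H(2)[OF wB[of a0]] r by auto
  define \<mu> where "\<mu> = (\<zeta> / (\<sigma> * M)) powr (1 / (p - 1))"
  have \<mu>: "\<mu> > 0" using \<zeta> r M0 by (simp add: \<mu>_def)
  define a1 where "a1 = min a0 1"
  have a1: "a1 > 0" "a1 \<le> a0" "a1 \<le> 1" using r by (auto simp: a1_def)
  have steep: "w1 a + \<mu> / a \<le> 0" if a: "0 < a" "a \<le> a1" for a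
  proof -
    have n: "- (\<sigma> * a ^ (n - 1) * (\<bar>w1 a\<bar> powr (p - 2) * w1 a) * H (w a)) > \<zeta>" using neg a a1 by auto
    have Hw: "H (w a) > 0" "H (w a) \<le> M" using H(2)[OF wB[of a]] M[of a] a a1 by auto
    have wneg: "w1 a < 0"
    proof (rule ccontr)
      assume "\<not> w1 a < 0"
      then have "0 \<le> \<sigma> * a ^ (n - 1) * (\<bar>w1 a\<bar> powr (p - 2) * w1 a) * H (w a)" using r a Hw by (intro mult_nonneg_nonneg) auto
      then show False using n \<zeta> by simp
    qed
    have "\<bar>w1 a\<bar> powr (p - 1) = \<bar>w1 a\<bar> powr (p - 2) * \<bar>w1 a\<bar> powr 1" unfolding powr_add[symmetric] by simp
    then have "\<bar>w1 a\<bar> powr (p - 2) * w1 a = - (\<bar>w1 a\<bar> powr (p - 1))" using wneg by simp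
    then have "\<zeta> < \<sigma> * a ^ (n - 1) * \<bar>w1 a\<bar> powr (p - 1) * H (w a)" using n by simp
    also have "\<dots> \<le> \<sigma> * a ^ (n - 1) * \<bar>w1 a\<bar> powr (p - 1) * M" using Hw r a by (intro mult_left_mono) auto
    also have "a ^ (n - 1) = a powr (real n - 1)" using a p by (simp add: powr_realpow[symmetric] of_nat_diff)
    also have "\<sigma> * a powr (real n - 1) * \<bar>w1 a\<bar> powr (p - 1) * M \<le> \<sigma> * a powr (p - 1) * \<bar>w1 a\<bar> powr (p - 1) * M"
      using r a a1 M0 p by (intro mult_right_mono mult_left_mono powr_mono') auto
    also have "\<dots> = (\<sigma> * M) * (a * \<bar>w1 a\<bar>) powr (p - 1)" using a by (simp add: powr_mult)
    finally have "\<zeta> / (\<sigma> * M) < (a * \<bar>w1 a\<bar>) powr (p - 1)" using r M0 by (simp add: divide_less_eq mult.commute)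
    then have "(\<zeta> / (\<sigma> * M)) powr (1 / (p - 1)) \<le> ((a * \<bar>w1 a\<bar>) powr (p - 1)) powr (1 / (p - 1))"
      using \<zeta> r M0 p by (intro powr_mono2) auto
    also have "\<dots> = a * \<bar>w1 a\<bar>" using p a by (simp add: powr_powr)
    finally have "\<mu> \<le> a * \<bar>w1 a\<bar>" by (simp add: \<mu>_def)
    then show ?thesis using a wneg by (simp add: field_simps)
  qed
  \<comment> \<open>Chosen with \<open>ln a1 - ln a2 = B / \<mu>\<close>: from \<open>a1\<close>
    inward to \<open>a2\<close> the profile would rise by at least \<open>B\<close>.\<close>
  define a2 where "a2 = a1 * exp (- (B / \<mu>))"
  have B0: "B > 0" using wB[of 0] r by auto
  have a2: "0 < a2" "a2 \<le> a1" using a1 B0 \<mu> by (auto simp: a2_def)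
  have "(\<lambda>a. w a + \<mu> * ln a) a1 \<le> (\<lambda>a. w a + \<mu> * ln a) a2"
  proof (rule DERIV_nonpos_imp_nonincreasing[OF a2(2)])
    fix x assume x: "a2 \<le> x" "x \<le> a1"
    have "((\<lambda>a. w a + \<mu> * ln a) has_real_derivative w1 x + \<mu> * (1 / x)) (at x)"
      using x a2 a1 by (intro DERIV_add w DERIV_cmult DERIV_ln_divide) auto
    moreover have "w1 x + \<mu> * (1 / x) \<le> 0" using steep[of x] x a2 by simp
    ultimately show "\<exists>y. ((\<lambda>a. w a + \<mu> * ln a) has_real_derivative y) (at x) \<and> y \<le> 0" by blast
  qed
  moreover have "ln a2 = ln a1 - B / \<mu>" using a1 by (simp add: a2_def ln_mult)
  moreover have "\<mu> * (B / \<mu>) = B" using \<mu> by simp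
  ultimately have "w a1 + B \<le> w a2" by (simp add: right_diff_distrib)
  moreover have "w a1 > 0" "w a2 < B" using wB[of a1] wB[of a2] a1 a2 by auto
  ultimately show False by simp
qed

section \<open>Exhaustion of the ball by annuli\<close>

lemma nn_integral_annulus:
  fixes f :: "real^'n::finite \<Rightarrow> real"
  assumes "set_integrable lebesgue (annulus a b) f" "\<And>x. x \<in> annulus a b \<Longrightarrow> f x \<ge> 0"
  shows "(\<integral>\<^sup>+x\<in>annulus a b. ennreal (f x) \<partial>lebesgue) = ennreal (LINT x:annulus a b|lebesgue. f x)"
proof -
  have "(\<integral>\<^sup>+x\<in>annulus a b. ennreal (f x) \<partial>lebesgue) = (\<integral>\<^sup>+x. ennreal (indicator (annulus a b) x *\<^sub>R f x) \<partial>lebesgue)"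
    by (intro nn_integral_cong) (auto simp: indicator_def)
  also have "\<dots> = ennreal (LINT x|lebesgue. indicator (annulus a b) x *\<^sub>R f x)"
    using assms unfolding set_integrable_def by (intro nn_integral_eq_integral AE_I2) (auto simp: indicator_def)
  finally show ?thesis unfolding set_lebesgue_integral_def .
qed

text \<open>Monotone convergence along annuli increasing to the punctured ball; the origin is a null
  set.\<close>

lemma nn_integral_ball_le_annuli:
  fixes f :: "real^'n::finite \<Rightarrow> real"
  assumes "r > 0" and f: "\<And>a b. 0 < a \<Longrightarrow> a \<le> b \<Longrightarrow> b < r \<Longrightarrow> set_integrable lebesgue (annulus a b) f"
    and f0: "\<And>x. x \<in> ball 0 r \<Longrightarrow> f x \<ge> 0"
    and le: "\<And>a b. 0 < a \<Longrightarrow> a \<le> b \<Longrightarrow> b < r \<Longrightarrow> ennreal (LINT x:annulus a b|lebesgue. f x) \<le> c"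
  shows "(\<integral>\<^sup>+x\<in>ball 0 r. ennreal (f x) \<partial>lebesgue) \<le> c"
proof -
  \<comment> \<open>The offset 3 gives \<open>a k \<le> r / 3\<close> and
    \<open>b k \<ge> 2 * r / 3\<close>, so the radii are in order from the start.\<close>
  define a where "a k = r / (real k + 3)" for k :: nat
  define b where "b k = r - r / (real k + 3)" for k :: nat
  have ab: "0 < a k" "a k \<le> b k" "b k < r" for k
  proof -
    show "0 < a k" "b k < r" using assms(1) by (auto simp: a_def b_def)
    have "2 * r \<le> r * (real k + 3)" using assms(1) by (simp add: algebra_simps)
    then have "2 * (r / (real k + 3)) \<le> r" by (simp add: field_simps)
    then show "a k \<le> b k" by (simp add: a_def b_def)
  qed
  define F where "F k x = ennreal (indicator (annulus (a k) (b k)) x *\<^sub>R f x)" for k and x :: "real^'n"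
  have anti: "r / (real l + 3) \<le> r / (real k + 3)" if "k \<le> l" for k l
    using that assms(1) by (intro divide_left_mono) auto
  have sub: "annulus (a k) (b k) \<subseteq> ball (0::real^'n) r" for k using ab[of k] by (auto simp: annulus_def)
  have inc: "incseq F"
  proof (rule incseq_SucI, rule le_funI)
    fix k and x :: "real^'n"
    have "annulus (a k) (b k) \<subseteq> (annulus (a (Suc k)) (b (Suc k)) :: (real^'n) set)"
      using anti[of k "Suc k"] by (auto simp: annulus_def a_def b_def)
    moreover have "f x \<ge> 0" if "x \<in> annulus (a (Suc k)) (b (Suc k))" using f0 sub[of "Suc k"] that by blast
    ultimately show "F k x \<le> F (Suc k) x"
      unfolding F_def by (intro ennreal_leI) (auto simp: indicator_def)
  qed
  have Fm: "F k \<in> borel_measurable lebesgue" for k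
    using f[OF ab] unfolding F_def set_integrable_def by auto
  have "(\<integral>\<^sup>+x\<in>ball 0 r. ennreal (f x) \<partial>lebesgue) \<le> (\<integral>\<^sup>+x. (SUP k. F k x) \<partial>lebesgue)"
  proof (rule nn_integral_mono_AE)
    have "AE x in lebesgue. x \<notin> {0::real^'n}"
      by (intro AE_not_in) (simp add: negligible_iff_null_sets[symmetric])
    then show "AE x in lebesgue. ennreal (f x) * indicator (ball 0 r) x \<le> (SUP k. F k x)"
    proof eventually_elim
      case (elim x)
      show ?case
      proof (cases "x \<in> ball 0 r")
        case True
        define m where "m = min (norm x) (r - norm x)"
        have m: "m > 0" using True elim by (auto simp: m_def)
        obtain k :: nat where "real k > r / m" using reals_Archimedean2 by blast
        then have "r < m * (real k + 3)" using m by (simp add: divide_less_eq algebra_simps)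
        then have "r / (real k + 3) < m" by (simp add: divide_less_eq)
        then have "x \<in> annulus (a k) (b k)" by (auto simp: annulus_def a_def b_def m_def)
        then have "ennreal (f x) * indicator (ball 0 r) x = F k x" using True by (simp add: F_def)
        then show ?thesis by (metis SUP_upper UNIV_I)
      qed simp
    qed
  qed
  also have "\<dots> = (SUP k. \<integral>\<^sup>+x. F k x \<partial>lebesgue)" by (rule nn_integral_monotone_convergence_SUP[OF inc Fm])
  also have "\<dots> \<le> c"
  proof (rule SUP_least)
    fix k
    have "(\<integral>\<^sup>+x. F k x \<partial>lebesgue) = (\<integral>\<^sup>+x\<in>annulus (a k) (b k). ennreal (f x) \<partial>lebesgue)"
      unfolding F_def by (intro nn_integral_cong) (auto simp: indicator_def)
    also have "\<dots> = ennreal (LINT x:annulus (a k) (b k)|lebesgue. f x)"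
    proof (rule nn_integral_annulus[OF f[OF ab]])
      show "f x \<ge> 0" if "x \<in> annulus (a k) (b k)" for x using f0 sub[of k] that by blast
    qed
    also have "\<dots> \<le> c" by (rule le[OF ab])
    finally show "(\<integral>\<^sup>+x. F k x \<partial>lebesgue) \<le> c" .
  qed
  finally show ?thesis .
qed

theorem theorem4p2:
  fixes r B p C D A :: real
    and h :: "real \<Rightarrow> real"
    and \<Omega> :: "(real^'n::finite) set"
    and u :: "real^'n \<Rightarrow> real"
  assumes "0 < r" and "0 < B"
    and "2 < p" and "p < real CARD('n)"
    and \<Omega>: "\<Omega> = ball 0 r"
    and h_cont: "continuous_on {0<..<B} h"
    and h_pos: "\<forall>l\<in>{0<..<B}. 0 < h l"
    and h_int: "\<forall>l\<in>{0<..<B}. set_integrable lborel {0<..<l} h"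
    and a: "H_fun h C 0 \<ge> 0"
    and G_pos: "\<forall>l\<in>{0<..<B}. 0 < G_fun h C p l"
    and G_ext: "\<exists>G. locally_absolutely_continuous B G \<and> G 0 = 0 \<and>
                   (\<forall>l\<in>{0<..<B}. G l = G_fun h C p l)"
    and C_fin: "C_const h C p B < \<infinity>"
    and D: "D = (p - 2) * ((real CARD('n) - 1) * p / (real CARD('n) - p)) *
                enn2real (C_const h C p B)"
    and D_lt: "D < 1"
    and A: "A = (2 * (p - 1) / (1 - D\<^sup>2)) powr (p / 2)"
    and u_sob: "u \<in> sobolev_space 2 (p / 2) \<Omega>"
    and u_cont: "continuous_on (closure \<Omega>) u"
    and u_rad: "radially_symmetric_on \<Omega> u"
    and u_range: "\<forall>x\<in>\<Omega>. 0 < u x \<and> u x < B"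
    and u_bdry: "\<forall>x\<in>frontier \<Omega>. u x = 0"
    and u_fin: "(\<integral>\<^sup>+x\<in>\<Omega>. ennreal (T_fun h C (u x) powr p * (h (u x))\<^sup>2 / norm x powr p) \<partial>lebesgue)
                  < \<infinity>"
  shows "(\<integral>\<^sup>+x\<in>\<Omega>. ennreal (norm (weak_gradient \<Omega> u x) powr p * h (u x)) \<partial>lebesgue)
         \<le> ennreal A *
           (\<integral>\<^sup>+x\<in>\<Omega>. ennreal (sqrt \<bar>weak_laplacian \<Omega> u x * T_fun h C (u x)\<bar> powr p * h (u x)) \<partial>lebesgue)"
proof -
  note r = \<open>0 < r\<close> and B = \<open>0 < B\<close> and p2 = \<open>2 < p\<close> and pn = \<open>p < real CARD('n)\<close>
  define n where "n = real CARD('n)"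
  define \<sigma> where "\<sigma> = sphere_const TYPE('n)"
  have \<sigma>: "\<sigma> > 0" unfolding \<sigma>_def by (rule sphere_const_pos)
  have pn': "p < n" using pn by (simp add: n_def)
  have N2: "CARD('n) > 2" using p2 pn by linarith
  \<comment> \<open>A unit vector along which the profile \<open>w\<close> is read off
    \<open>u\<close>. The profile provided by \<open>u_rad\<close> is tied to \<open>u\<close> only
    inside the open ball; this one is continuous up to the radius \<open>r\<close>.\<close>
  define e where "e = (axis undefined 1 :: real^'n)"
  have e: "norm e = 1" by (simp add: e_def norm_axis_1)
  define w where "w t = u (t *\<^sub>R e)" for t
  have uw: "u x = w (norm x)" if "x \<in> ball 0 r" for x
  proof -
    obtain w0 where w0: "\<forall>x\<in>\<Omega>. u x = w0 (norm x)" using u_rad unfolding radially_symmetric_on_def by blast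
    have "norm x *\<^sub>R e \<in> \<Omega>" using that e by (simp add: \<Omega>)
    then show ?thesis using w0 that e by (simp add: w_def \<Omega>)
  qed
  have wc: "continuous_on {0..r} w"
  proof -
    have "continuous_on (cball 0 r) u" using u_cont r by (simp add: \<Omega>)
    then show ?thesis unfolding w_def
      by (rule continuous_on_compose2) (use e in \<open>auto intro!: continuous_intros\<close>)
  qed
  have wr: "w r = 0" using u_bdry r e by (simp add: w_def \<Omega>)
  have wB: "w t \<in> {0<..<B}" if "t \<in> {0..<r}" for t
    using u_range that e by (simp add: w_def \<Omega>)
  define g where "g i = weak_deriv \<Omega> [i, i] u" for i
  \<comment> \<open>Membership in the Sobolev space provides weak derivatives up to order 2, so the
    choice in \<open>weak_deriv\<close> picks a genuine one.\<close>
  have ex: "has_weak_deriv \<Omega> is u (weak_deriv \<Omega> is u)" if "length is \<le> 2" for "is"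
  proof -
    obtain v where "has_weak_deriv \<Omega> is u v" using u_sob \<open>length is \<le> 2\<close> unfolding sobolev_space_def by blast
    then show ?thesis unfolding weak_deriv_def by (rule someI[of "has_weak_deriv \<Omega> is u" v])
  qed
  have wk2: "has_weak_deriv (ball 0 r) [i, i] u (g i)" for i using ex[of "[i, i]"] by (simp add: g_def \<Omega>)
  have wk1: "has_weak_deriv (ball 0 r) [i] u (weak_deriv \<Omega> [i] u)" for i using ex[of "[i]"] by (simp add: \<Omega>)
  define L where "L x = (\<Sum>i\<in>UNIV. g i x)" for x
  have Llap: "weak_laplacian \<Omega> u x = L x" for x by (simp add: weak_laplacian_def L_def g_def)
  define w1 where "w1 = deriv w"
  have wc0: "continuous_on {0<..<r} w" by (rule continuous_on_subset[OF wc]) auto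
  have dw: "(w has_real_derivative w1 t) (at t)" if "t \<in> {0<..<r}" for t
    unfolding w1_def by (rule radial_flux(1)[OF N2 _ wc0 wk2 that]) (rule uw)
  have w1c: "continuous_on {0<..<r} w1"
    unfolding w1_def by (rule radial_flux(2)[OF N2 _ wc0 wk2]) (rule uw)
  have fl: "set_integrable lebesgue {x. a < norm x \<and> norm x \<le> b} L \<and>
      \<sigma> * b ^ (CARD('n) - 1) * w1 b - \<sigma> * a ^ (CARD('n) - 1) * w1 a = (LINT x:{x. a < norm x \<and> norm x \<le> b}|lebesgue. L x)"
    if "0 < a" "a \<le> b" "b < r" for a b
    unfolding w1_def \<sigma>_def L_def[abs_def] by (rule radial_flux(3)[OF N2 _ wc0 wk2 that]) (rule uw)
  have Li: "set_integrable lebesgue {x. a < norm x \<and> norm x \<le> b} L" if "0 < a" "a \<le> b" "b < r" for a b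
    using fl[OF that] by blast
  have flux: "\<sigma> * t ^ (CARD('n) - 1) * w1 t - \<sigma> * s ^ (CARD('n) - 1) * w1 s = (LINT x:{x. s < norm x \<and> norm x \<le> t}|lebesgue. L x)"
    if "0 < s" "s \<le> t" "t < r" for s t using fl[OF that] by blast
  define H where "H = H_fun h C"
  have dH: "(H has_real_derivative h l) (at l)" if "l \<in> {0<..<B}" for l
    unfolding H_def by (rule H_fun_has_derivative[OF h_cont h_int that])
  have Hc: "continuous_on {0<..<B} H" using dH by (meson DERIV_isCont continuous_at_imp_continuous_on)
  have Geq: "G_fun h C p l = H l / h l * h l powr (1 / p)" for l by (simp add: G_fun_def T_fun_def H_def)
  have hp: "h l > 0" if "l \<in> {0<..<B}" for l using h_pos that by blast
  have Hp: "H l > 0" if "l \<in> {0<..<B}" for l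
  proof -
    have "0 < H l / h l * h l powr (1 / p)" using G_pos that unfolding Geq by blast
    then show ?thesis using hp[OF that] by (simp add: zero_less_mult_iff zero_less_divide_iff)
  qed
  obtain G where G: "locally_absolutely_continuous B G" "G 0 = 0" "\<forall>l\<in>{0<..<B}. G l = G_fun h C p l"
    using G_ext by blast
  have hpc: "isCont (\<lambda>l. h l powr (1 / p)) x" if "x \<in> {0<..<B}" for x
  proof -
    have "isCont h x" using h_cont that by (simp add: continuous_on_eq_continuous_at)
    then show ?thesis using hp[OF that] by (intro continuous_intros) auto
  qed
  obtain P where P: "\<And>l. l \<in> {0<..<B} \<Longrightarrow> (P has_real_derivative h l powr (1 / p)) (at l)"
  proof -
    have "\<exists>P. \<forall>x. ereal 0 < ereal x \<longrightarrow> ereal x < ereal B \<longrightarrow> (P has_vector_derivative h x powr (1 / p)) (at x)"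
      by (rule einterval_antiderivative) (use B hpc in auto)
    then obtain P where "\<forall>x. 0 < x \<longrightarrow> x < B \<longrightarrow> (P has_vector_derivative h x powr (1 / p)) (at x)" by auto
    then have "(P has_real_derivative h l powr (1 / p)) (at l)" if "l \<in> {0<..<B}" for l
      using that by (simp add: has_real_derivative_iff_has_vector_derivative)
    then show thesis by (rule that)
  qed
  define c where "c = enn2real (C_const h C p B)"
  have c0: "c \<ge> 0" by (simp add: c_def)
  have inc: "\<bar>G_fun h C p t - G_fun h C p s\<bar> \<le> c * (P t - P s)" if "0 < s" "s \<le> t" "t < B" for s t
    unfolding c_def by (rule G_fun_increment_le[OF _ h_cont h_pos G(1,3) C_fin P that]) (use p2 in auto)
  text \<open>For \<open>c = 0\<close> any small \<open>\<tau>\<close> works; this one gives \<open>D' = 1 / 2\<close>, which just meets the constant \<open>A\<close>.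
    For \<open>c > 0\<close> there is slack, since \<open>1 / (1 - D) \<le> 2 / (1 - D\<^sup>2)\<close>.\<close>
  define \<tau> where "\<tau> = (if c > 0 then p * c / (n - p) else 1 / (2 * (p - 2) * (n - 1)))"
  define D' where "D' = (n - 1) * (p - 2) * \<tau>"
  have \<tau>0: "\<tau> > 0" using p2 pn' c0 by (auto simp: \<tau>_def)
  have \<tau>1: "p * c \<le> \<tau> * (n - p)" using p2 pn' c0 by (auto simp: \<tau>_def)
  have Dc: "D = (p - 2) * ((n - 1) * p / (n - p)) * c" unfolding D n_def c_def ..
  have D0: "D \<ge> 0" unfolding Dc using p2 pn' c0 by (intro mult_nonneg_nonneg divide_nonneg_nonneg) auto
  have D'1: "D' < 1" and D'A: "1 / (1 - D') \<le> 2 / (1 - D\<^sup>2)"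
  proof -
    have "D' < 1 \<and> 1 / (1 - D') \<le> 2 / (1 - D\<^sup>2)"
    proof (cases "c > 0")
      case True
      have "D' = D" unfolding D'_def Dc \<tau>_def using True by simp
      moreover have "1 - D\<^sup>2 = (1 - D) * (1 + D)" by (simp add: power2_eq_square algebra_simps)
      moreover have "1 / (1 - D) \<le> 2 / ((1 - D) * (1 + D))"
      proof -
        have "1 / (1 - D) = (1 + D) / ((1 - D) * (1 + D))" using D0 by simp
        also have "\<dots> \<le> 2 / ((1 - D) * (1 + D))" using D0 D_lt by (intro divide_right_mono) auto
        finally show ?thesis .
      qed
      ultimately show ?thesis using D_lt by simp
    next
      case False
      then have "c = 0" using c0 by simp
      then have "D = 0" "D' = 1 / 2" unfolding Dc D'_def \<tau>_def using p2 pn' by auto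
      show ?thesis unfolding \<open>D = 0\<close> \<open>D' = 1 / 2\<close> by simp
    qed
    then show "D' < 1" "1 / (1 - D') \<le> 2 / (1 - D\<^sup>2)" by auto
  qed
  define A' where "A' = ((p - 1) / (1 - D')) powr (p / 2)"
  have A'A: "A' \<le> A"
  proof -
    have "(p - 1) / (1 - D') = (p - 1) * (1 / (1 - D'))" by simp
    also have "\<dots> \<le> (p - 1) * (2 / (1 - D\<^sup>2))" using D'A p2 by (intro mult_left_mono) auto
    also have "\<dots> = 2 * (p - 1) / (1 - D\<^sup>2)" by simp
    finally show ?thesis unfolding A'_def A using D'1 p2 by (intro powr_mono2) auto
  qed
  have A0: "A > 0"
  proof -
    have "A' > 0" using D'1 p2 by (simp add: A'_def)
    then show ?thesis using A'A by simp
  qed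
  define j where "j x = \<bar>L x * (H (w (norm x)) / h (w (norm x)))\<bar> powr (p / 2) * h (w (norm x))" for x
  define f where "f x = \<bar>w1 (norm x)\<bar> powr p * h (w (norm x))" for x :: "real^'n"
  define Jn where "Jn = (\<integral>\<^sup>+x\<in>\<Omega>. ennreal (sqrt \<bar>weak_laplacian \<Omega> u x * T_fun h C (u x)\<bar> powr p * h (u x)) \<partial>lebesgue)"
  \<comment> \<open>Almost everywhere the weak gradient is \<open>w1 (norm x) / norm x\<close> times
    \<open>x\<close>, a vector of norm \<open>\<bar>w1 (norm x)\<bar>\<close>.\<close>
  have lhs: "(\<integral>\<^sup>+x\<in>\<Omega>. ennreal (norm (weak_gradient \<Omega> u x) powr p * h (u x)) \<partial>lebesgue) = (\<integral>\<^sup>+x\<in>ball 0 r. ennreal (f x) \<partial>lebesgue)"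
  proof (rule nn_integral_cong_AE)
    have "negligible (\<Union>i\<in>(UNIV::'n set). {x \<in> ball 0 r - {0}. weak_deriv \<Omega> [i] u x - w1 (norm x) * (x $ i / norm x) \<noteq> 0})"
    proof (rule negligible_Union)
      fix t assume "t \<in> range (\<lambda>i::'n. {x \<in> ball 0 r - {0}. weak_deriv \<Omega> [i] u x - w1 (norm x) * (x $ i / norm x) \<noteq> 0})"
      then obtain i :: 'n where t: "t = {x \<in> ball 0 r - {0}. weak_deriv \<Omega> [i] u x - w1 (norm x) * (x $ i / norm x) \<noteq> 0}" by blast
      show "negligible t" unfolding t by (rule weak_gradient_radial[OF _ _ w1c wk1]) (fact uw dw)+
    qed simp
    then have "AE x in lebesgue. x \<notin> (\<Union>i\<in>(UNIV::'n set). {x \<in> ball 0 r - {0}. weak_deriv \<Omega> [i] u x - w1 (norm x) * (x $ i / norm x) \<noteq> 0})"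
      by (intro AE_not_in) (simp only: negligible_iff_null_sets)
    moreover have "AE x in lebesgue. x \<notin> {0::real^'n}"
      by (intro AE_not_in) (simp add: negligible_iff_null_sets[symmetric])
    ultimately show "AE x in lebesgue. ennreal (norm (weak_gradient \<Omega> u x) powr p * h (u x)) * indicator \<Omega> x = ennreal (f x) * indicator (ball 0 r) x"
    proof eventually_elim
      case (elim x)
      show ?case
      proof (cases "x \<in> ball 0 r")
        case True
        then have "weak_deriv \<Omega> [i] u x = w1 (norm x) / norm x * x $ i" for i using elim by auto
        then have "weak_gradient \<Omega> u x = (w1 (norm x) / norm x) *\<^sub>R x"
          by (simp add: weak_gradient_def vec_eq_iff)
        then have "norm (weak_gradient \<Omega> u x) = \<bar>w1 (norm x)\<bar>" using elim by simp
        then show ?thesis using True uw[OF True] by (simp add: f_def \<Omega>)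
      qed (simp add: \<Omega>)
    qed
  qed
  have rhs: "Jn = (\<integral>\<^sup>+x\<in>ball 0 r. ennreal (j x) \<partial>lebesgue)"
    unfolding Jn_def
  proof (rule nn_integral_cong)
    fix x :: "real^'n"
    have sq: "sqrt z powr p = z powr (p / 2)" if "z \<ge> 0" for z
      using that by (simp add: powr_half_sqrt[symmetric] powr_powr)
    show "ennreal (sqrt \<bar>weak_laplacian \<Omega> u x * T_fun h C (u x)\<bar> powr p * h (u x)) * indicator \<Omega> x = ennreal (j x) * indicator (ball 0 r) x"
      using uw[of x] by (auto simp: indicator_def \<Omega> j_def sq Llap[unfolded \<Omega>] T_fun_def H_def)
  qed
  show ?thesis
  \<comment> \<open>An infinite right side leaves nothing to prove, as \<open>A > 0\<close>;
    otherwise finiteness makes \<open>j\<close> integrable on every annulus.\<close>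
  proof (cases "Jn = \<infinity>")
    case True
    then show ?thesis unfolding Jn_def[symmetric] using A0 by (simp add: ennreal_mult_top ennreal_top_mult)
  next
    case False
    define Jr where "Jr = enn2real Jn"
    have Jr: "Jn = ennreal Jr" using False by (simp add: Jr_def less_top)
    have Jr0: "Jr \<ge> 0" by (simp add: Jr_def)
    have wca: "continuous_on {a..b} w" "continuous_on {a..b} w1" "continuous_on {a..b} (\<lambda>t. h (w t))" "continuous_on {a..b} (\<lambda>t. H (w t))"
      if "0 < a" "b < r" for a b
    proof -
      show 1: "continuous_on {a..b} w" by (rule continuous_on_subset[OF wc]) (use that in auto)
      show "continuous_on {a..b} w1" by (rule continuous_on_subset[OF w1c]) (use that in auto)
      show "continuous_on {a..b} (\<lambda>t. h (w t))" "continuous_on {a..b} (\<lambda>t. H (w t))"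
        by (rule continuous_on_compose2[OF h_cont 1], use wB that in force)
          (rule continuous_on_compose2[OF Hc 1], use wB that in force)
    qed
    have hw: "h (w (norm x)) > 0" if "x \<in> ball 0 r" for x :: "real^'n" using hp wB[of "norm x"] that by auto
    have fi: "set_integrable lebesgue (annulus a b) f" if ab: "0 < a" "a \<le> b" "b < r" for a b
    proof -
      have "continuous_on {a..b} (\<lambda>t. \<bar>w1 t\<bar> powr p * h (w t))"
        using p2 by (intro continuous_intros continuous_on_powr' wca that) auto
      from radial_integral(1)[OF ab(1) this] show ?thesis by (simp add: f_def[abs_def])
    qed
    have f0: "f x \<ge> 0" if "x \<in> ball 0 r" for x using hw[OF that] by (simp add: f_def)
    have j0: "j x \<ge> 0" if "x \<in> ball 0 r" for x using hw[OF that] by (simp add: j_def)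
    have ji: "set_integrable lebesgue (annulus a b) j" "(LINT x:annulus a b|lebesgue. j x) \<le> Jr" if ab: "0 < a" "a \<le> b" "b < r" for a b
    proof -
      have sub: "annulus a b \<subseteq> ball (0::real^'n) r" using ab by (auto simp: annulus_def)
      have hz: "h (w t) \<noteq> 0" if "t \<in> {a..b}" for t using hp[OF wB[of t]] that ab by auto
      have cT: "continuous_on (annulus a b) (\<lambda>x::real^'n. H (w (norm x)) / h (w (norm x)))"
        by (rule continuous_on_compose2[of "{a..b}" "\<lambda>t. H (w t) / h (w t)" _ norm])
          (use hz in \<open>auto intro!: continuous_intros wca ab simp: annulus_def\<close>)
      have ch: "continuous_on (annulus a b) (\<lambda>x::real^'n. h (w (norm x)))"
        by (rule continuous_on_compose2[of "{a..b}" "\<lambda>t. h (w t)" _ norm])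
          (auto intro!: continuous_intros wca ab simp: annulus_def)
      have "set_integrable lebesgue (annulus a b) L" using Li[OF ab] shell_annulus(1) by blast
      then have m1: "(\<lambda>x. indicator (annulus a b) x *\<^sub>R (L x * (H (w (norm x)) / h (w (norm x))))) \<in> borel_measurable lebesgue"
        using set_integrable_mult_continuous[OF _ compact_annulus cT] unfolding set_integrable_def by blast
      have m2: "(\<lambda>x. indicator (annulus a b) x *\<^sub>R h (w (norm (x::real^'n)))) \<in> borel_measurable lebesgue"
        using compact_continuous_set_measurable[OF compact_annulus ch] unfolding set_borel_measurable_def .
      have eq: "indicator (annulus a b) x *\<^sub>R j x = \<bar>indicator (annulus a b) x *\<^sub>R (L x * (H (w (norm x)) / h (w (norm x))))\<bar> powr (p / 2)
          * (indicator (annulus a b) x *\<^sub>R h (w (norm x)))" for x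
        by (auto simp: j_def indicator_def)
      have m: "(\<lambda>x. indicator (annulus a b) x *\<^sub>R j x) \<in> borel_measurable lebesgue"
        unfolding eq by (intro borel_measurable_times measurable_abs_powr m1 m2)
      have le: "(\<integral>\<^sup>+x. ennreal (indicator (annulus a b) x *\<^sub>R j x) \<partial>lebesgue) \<le> Jn"
        unfolding rhs by (intro nn_integral_mono) (use sub in \<open>auto simp: indicator_def\<close>)
      have ind0: "indicator (annulus a b) x *\<^sub>R j x \<ge> 0" for x using j0 sub by (auto simp: indicator_def)
      have "integrable lebesgue (\<lambda>x. indicator (annulus a b) x *\<^sub>R j x)"
      proof (rule integrableI_nonneg[OF m])
        show "AE x in lebesgue. indicator (annulus a b) x *\<^sub>R j x \<ge> 0" by (rule AE_I2[OF ind0])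
        show "(\<integral>\<^sup>+x. ennreal (indicator (annulus a b) x *\<^sub>R j x) \<partial>lebesgue) < \<infinity>"
          using le False by (metis infinity_ennreal_def order_le_less_trans top.not_eq_extremum)
      qed
      then show ji: "set_integrable lebesgue (annulus a b) j" unfolding set_integrable_def .
      have "ennreal (LINT x:annulus a b|lebesgue. j x) = (\<integral>\<^sup>+x. ennreal (indicator (annulus a b) x *\<^sub>R j x) \<partial>lebesgue)"
        unfolding set_lebesgue_integral_def using ji[unfolded set_integrable_def] ind0 by (intro nn_integral_eq_integral[symmetric]) auto
      also have "\<dots> \<le> ennreal Jr" using le Jr by simp
      finally show "(LINT x:annulus a b|lebesgue. j x) \<le> Jr" using Jr0 by (simp add: ennreal_le_iff)
    qed
    \<comment> \<open>The boundary terms need not be small on the given annulus, so it is enlarged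
      to one with favourable inner and outer radii. This only increases the left side, while
      \<open>Jr\<close> bounds the integral of \<open>j\<close> over every annulus.\<close>
    have bound: "(LINT x:annulus a0 b0|lebesgue. f x) \<le> A' * Jr + \<delta>" if ab0: "0 < a0" "a0 \<le> b0" "b0 < r" and \<delta>: "\<delta> > 0" for a0 b0 \<delta>
    proof -
      define q where "q = p / (2 * (1 - D'))"
      have q: "q > 0" using p2 D'1 by (simp add: q_def)
      \<comment> \<open>\<open>M * g0 powr p\<close> majorises the Hardy boundary term at the outer
        radius when \<open>G\<close> there is at most \<open>g0\<close>; one half of
        \<open>\<delta>\<close> is reserved for it, the other for the inner radius.\<close>
      define M where "M = q * ((n - 1) * (p - 2) * \<tau> powr (1 - p) * (\<sigma> * r powr (n - p) / (n - p)))"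
      have M0: "M \<ge> 0" unfolding M_def using q p2 pn' \<sigma> by (intro mult_nonneg_nonneg divide_nonneg_nonneg) auto
      define g0 where "g0 = (\<delta> / (2 * (M + 1))) powr (1 / p)"
      have g0: "g0 > 0" using \<delta> M0 by (simp add: g0_def)
      have g0p: "M * g0 powr p \<le> \<delta> / 2"
      proof -
        have "g0 powr p = \<delta> / (2 * (M + 1))" using \<delta> M0 p2 by (simp add: g0_def powr_powr)
        then have "M * g0 powr p \<le> (M + 1) * (\<delta> / (2 * (M + 1)))" using \<delta> M0 by (intro mult_mono) auto
        also have "\<dots> = \<delta> / 2"
        proof -
          have "m * (\<delta> / (2 * m)) = \<delta> / 2" if "m \<noteq> 0" for m using that by simp
          from this[of "M + 1"] show ?thesis using M0 by simp
        qed
        finally show ?thesis .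
      qed
      \<comment> \<open>Here the continuity at 0 of the extension and its value
        \<open>G 0 = 0\<close> enter.\<close>
      obtain d where d: "d > 0" "\<And>l. l \<in> {0<..<B} \<Longrightarrow> l < d \<Longrightarrow> G_fun h C p l < g0"
      proof -
        have "absolutely_continuous_on_interval 0 (B / 2) G"
          using G(1) B unfolding locally_absolutely_continuous_def by auto
        from AC_imp_continuous_on[OF this] obtain d where d: "d > 0" "\<And>l. l \<in> {0..B / 2} \<Longrightarrow> dist l 0 < d \<Longrightarrow> dist (G l) (G 0) < g0"
          using g0 B unfolding continuous_on_iff by (metis atLeastAtMost_iff half_gt_zero less_imp_le order_refl)
        have "G_fun h C p l < g0" if "l \<in> {0<..<B}" "l < min d (B / 2)" for l
          using d(2)[of l] that G(2,3) by (auto simp: dist_real_def)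
        then show thesis using d(1) B by (intro that[of "min d (B / 2)"]) auto
      qed
      obtain b1 where b1: "b0 \<le> b1" "b1 < r" "\<And>t. b1 \<le> t \<Longrightarrow> t < r \<Longrightarrow> w t < d"
      proof -
        obtain s where s: "s > 0" "\<And>t. t \<in> {0..r} \<Longrightarrow> dist t r < s \<Longrightarrow> dist (w t) (w r) < d"
          using wc d(1) r unfolding continuous_on_iff by (metis atLeastAtMost_iff less_imp_le order_refl)
        have "w t < d" if "max b0 (r - s / 2) \<le> t" "t < r" for t
          using s(2)[of t] s(1) that ab0 by (auto simp: dist_real_def wr)
        then show thesis using s(1) ab0 by (intro that[of "max b0 (r - s / 2)"]) auto
      qed
      obtain b where b: "b1 < b" "b < r" "w r - w b1 = w1 b * (r - b1)"
      proof (rule mvt[of b1 r w "\<lambda>x h. w1 x * h"])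
        show "continuous_on {b1..r} w" by (rule continuous_on_subset[OF wc]) (use b1 ab0 in auto)
        show "(w has_derivative (\<lambda>h. w1 x * h)) (at x)" if "b1 < x" "x < r" for x
          using dw[of x] that b1 ab0 by (simp add: has_field_derivative_def)
      qed (use b1 that in auto)
      have w1b: "w1 b \<le> 0"
      proof (rule ccontr)
        assume "\<not> w1 b \<le> 0"
        then have "w1 b * (r - b1) > 0" using b1 by simp
        then show False using b(3) wr wB[of b1] b1 ab0 by auto
      qed
      \<comment> \<open>The tolerance is divided by \<open>q\<close>, the factor in front of the
        boundary terms.\<close>
      obtain a where a: "a \<in> {0<..a0}" "- (\<sigma> * a ^ (CARD('n) - 1) * (\<bar>w1 a\<bar> powr (p - 2) * w1 a) * H (w a)) \<le> \<delta> / (2 * q)"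
      proof -
        have "\<exists>a\<in>{0<..a0}. - (\<sigma> * a ^ (CARD('n) - 1) * (\<bar>w1 a\<bar> powr (p - 2) * w1 a) * H (w a)) \<le> \<delta> / (2 * q)"
        proof (rule inner_boundary_small[OF p2 pn ab0(1) \<sigma>, where w = w and H = H and B = B])
          show "\<delta> / (2 * q) > 0" using \<delta> q by simp
          show "(w has_real_derivative w1 t) (at t)" if "t \<in> {0<..a0}" for t using dw[of t] that ab0 by auto
          show "continuous_on {0..a0} w" by (rule continuous_on_subset[OF wc]) (use ab0 in auto)
          show "w t \<in> {0<..<B}" if "t \<in> {0..a0}" for t using wB[of t] that ab0 by auto
        qed (use Hc Hp in auto)
        then show thesis using that by blast
      qed
      have ab: "0 < a" "a \<le> b" "b < r" "a \<le> a0" "b0 \<le> b" using a b b1 ab0 by auto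
      have tB: "t \<in> {0<..<r}" if "t \<in> {a..b}" for t using that ab by auto
      have main: "(LINT x:annulus a b|lebesgue. f x) \<le> A' * (LINT x:annulus a b|lebesgue. j x) +
        q * (\<sigma> * b ^ (CARD('n) - 1) * (\<bar>w1 b\<bar> powr (p - 2) * w1 b) * H (w b)
          - \<sigma> * a ^ (CARD('n) - 1) * (\<bar>w1 a\<bar> powr (p - 2) * w1 a) * H (w a)
          + (n - 1) * (p - 2) * \<tau> powr (1 - p) * (\<sigma> * (G_fun h C p (w b) powr p * b powr (n - p)) / (n - p)))"
        unfolding f_def j_def A'_def q_def \<sigma>_def n_def
      proof (rule annulus_inequality[OF p2 pn ab(1,2), where B = B and P = P and c = c])
        show "(w has_real_derivative w1 t) (at t)" if "t \<in> {a..b}" for t by (rule dw[OF tB[OF that]])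
        show "continuous_on {a..b} w1" by (rule wca(2)[OF ab(1,3)])
        show "w t \<in> {0<..<B}" if "t \<in> {a..b}" for t using wB[of t] tB[OF that] by auto
        show "set_integrable lebesgue {x. a < norm x \<and> norm x \<le> b} L" by (rule Li[OF ab(1-3)])
        show "sphere_const TYPE('n) * t ^ (CARD('n) - 1) * w1 t - sphere_const TYPE('n) * s ^ (CARD('n) - 1) * w1 s =
          (LINT x:{x. s < norm x \<and> norm x \<le> t}|lebesgue. L x)" if "a \<le> s" "s \<le> t" "t \<le> b" for s t
          using flux[of s t] that ab by (simp add: \<sigma>_def)
        show "set_integrable lebesgue (annulus a b) (\<lambda>x. \<bar>L x * (H (w (norm x)) / h (w (norm x)))\<bar> powr (p / 2) * h (w (norm x)))"
          using ji(1)[OF ab(1-3)] by (simp add: j_def[abs_def])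
        show "p * c \<le> \<tau> * (real CARD('n) - p)" using \<tau>1 by (simp add: n_def)
        show "D' = (real CARD('n) - 1) * (p - 2) * \<tau>" by (simp add: D'_def n_def)
      qed (fact h_cont hp dH Hp P inc c0 \<tau>0 D'1 | rule Geq)+
      have "(LINT x:annulus a0 b0|lebesgue. f x) \<le> (LINT x:annulus a b|lebesgue. f x)"
        unfolding set_lebesgue_integral_def
      proof (rule integral_mono)
        show "integrable lebesgue (\<lambda>x. indicator (annulus a0 b0) x *\<^sub>R f x)" "integrable lebesgue (\<lambda>x. indicator (annulus a b) x *\<^sub>R f x)"
          using fi[OF ab0(1-3)] fi[OF ab(1-3)] unfolding set_integrable_def by auto
        show "indicator (annulus a0 b0) x *\<^sub>R f x \<le> indicator (annulus a b) x *\<^sub>R f x" for x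
          using f0[of x] ab by (auto simp: indicator_def annulus_def)
      qed
      also note main
      also have "A' * (LINT x:annulus a b|lebesgue. j x) \<le> A' * Jr" using ji(2)[OF ab(1-3)] by (intro mult_left_mono) (simp_all add: A'_def)
      also have "q * (\<sigma> * b ^ (CARD('n) - 1) * (\<bar>w1 b\<bar> powr (p - 2) * w1 b) * H (w b)
          - \<sigma> * a ^ (CARD('n) - 1) * (\<bar>w1 a\<bar> powr (p - 2) * w1 a) * H (w a)
          + (n - 1) * (p - 2) * \<tau> powr (1 - p) * (\<sigma> * (G_fun h C p (w b) powr p * b powr (n - p)) / (n - p))) \<le> \<delta>"
      proof -
        have wb: "w b \<in> {0<..<B}" using wB[of b] ab by auto
        have Gb: "0 < G_fun h C p (w b)" "G_fun h C p (w b) \<le> g0"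
          using G_pos wb d(2)[OF wb] b1(3)[of b] b by auto
        have z1: "\<sigma> * b ^ (CARD('n) - 1) * (\<bar>w1 b\<bar> powr (p - 2) * w1 b) * H (w b) \<le> 0"
        proof -
          have "\<bar>w1 b\<bar> powr (p - 2) * w1 b \<le> 0" using w1b by (intro mult_nonneg_nonpos) auto
          then have "\<sigma> * b ^ (CARD('n) - 1) * (\<bar>w1 b\<bar> powr (p - 2) * w1 b) \<le> 0"
            using \<sigma> ab by (intro mult_nonneg_nonpos[of "\<sigma> * b ^ (CARD('n) - 1)"]) auto
          from mult_nonpos_nonneg[OF this less_imp_le[OF Hp[OF wb]]] show ?thesis .
        qed
        have z3: "(n - 1) * (p - 2) * \<tau> powr (1 - p) * (\<sigma> * (G_fun h C p (w b) powr p * b powr (n - p)) / (n - p)) \<le>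
           (n - 1) * (p - 2) * \<tau> powr (1 - p) * (\<sigma> * (g0 powr p * r powr (n - p)) / (n - p))"
        proof (intro mult_left_mono divide_right_mono mult_mono)
          show "G_fun h C p (w b) powr p \<le> g0 powr p" using Gb p2 by (intro powr_mono2) auto
          show "b powr (n - p) \<le> r powr (n - p)" using ab pn' by (intro powr_mono2) auto
        qed (use \<sigma> p2 pn' in auto)
        have "q * (\<sigma> * b ^ (CARD('n) - 1) * (\<bar>w1 b\<bar> powr (p - 2) * w1 b) * H (w b)
          - \<sigma> * a ^ (CARD('n) - 1) * (\<bar>w1 a\<bar> powr (p - 2) * w1 a) * H (w a)
          + (n - 1) * (p - 2) * \<tau> powr (1 - p) * (\<sigma> * (G_fun h C p (w b) powr p * b powr (n - p)) / (n - p)))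
          \<le> q * (0 + \<delta> / (2 * q) + (n - 1) * (p - 2) * \<tau> powr (1 - p) * (\<sigma> * (g0 powr p * r powr (n - p)) / (n - p)))"
          using z1 a(2) z3 q by (intro mult_left_mono) auto
        also have "\<dots> = \<delta> / 2 + M * g0 powr p" using q by (simp add: M_def distrib_left)
        also have "\<dots> \<le> \<delta>" using g0p by simp
        finally show ?thesis .
      qed
      finally show ?thesis by simp
    qed
    have "(\<integral>\<^sup>+x\<in>ball 0 r. ennreal (f x) \<partial>lebesgue) \<le> ennreal (A' * Jr)"
    proof (rule nn_integral_ball_le_annuli[OF r fi f0])
      fix a b :: real assume ab: "0 < a" "a \<le> b" "b < r"
      have "(LINT x:annulus a b|lebesgue. f x) \<le> A' * Jr"
        by (rule field_le_epsilon) (rule bound[OF ab])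
      then show "ennreal (LINT x:annulus a b|lebesgue. f x) \<le> ennreal (A' * Jr)" by (rule ennreal_leI)
    qed
    also have "\<dots> \<le> ennreal (A * Jr)" using A'A Jr0 by (intro ennreal_leI mult_right_mono) auto
    also have "\<dots> = ennreal A * Jn" using A0 Jr0 by (simp add: Jr ennreal_mult)
    finally show ?thesis unfolding lhs Jn_def .
  qed
qed

end
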